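(* Let $A$ be a symmetrizable generalized Cartan matrix, $\mathfrak g$ the derived subalgebra of its Kac–Moody Lie algebra, $\ell\in\mathbb C$, and let $X=V$ or $X=L$ (with $\ell\in\mathbb Z_+$ if $X=L$). Let $\tau\in\mathfrak T$ be given by $$\tau_{ij}^{0,0}(z)=q_i^{-a_{ij}\partial_z}[r\ell]_{q^{\partial_z}}^2\partial_z^2f_0(z),\quad \tau_{ij}^{\bullet,0}(z)=\tau_{ij}^{0,\bullet}(z)=-q_i^{-a_{ij}\partial_z}[r\ell]_{q^{\partial_z}}\partial_zf_0(z),\quad\tau_{ij}^{\bullet,\bullet}(z)=\exp\big(f_0(z-r_ia_{ij}\hbar)\big),$$ where $f_0(z)=\log\big((e^{z/2}-e^{-z/2})/z\big)$. Then there is an isomorphism of $\hbar$-adic quantum vertex algebras from $X_{\hbar,\tau}^\ell(\mathfrak g)$ to $X_{\hat{\mathfrak g},\hbar}(\ell,0)$ determined by $$h_i\mapsto h_{i,\hbar},\qquad x_i^+\mapsto\frac{q_i-q_i^{-1}}{2r_i\hbar}x_{i,\hbar}^+,\qquad x_i^-\mapsto x_{i,\hbar}^-\qquad(i\in I).$$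
   Context: Basic notions. $\mathbb N=\{0,1,\dots\}$, $\mathbb Z_+=\{1,2,\dots\}$. A $\mathbb C[[\hbar]]$-module is topologically free if it has the form $V_0[[\hbar]]$ with $V_0$ a $\mathbb C$-vector space; $U_0[[\hbar]]\hat\otimes V_0[[\hbar]]=(U_0\otimes V_0)[[\hbar]]$. For a submodule $K$ of a topologically free $V$, $\overline K$ is its closure in the $\hbar$-adic topology and $[K]=\{v\in V: \hbar^nv\in K\text{ for some }n\in\mathbb N\}$. For $W=W_0[[\hbar]]$ let $\mathcal E_\hbar(W)=\mathrm{Hom}_{\mathbb C[[\hbar]]}(W,W_0((z))[[\hbar]])$ (its elements are called fields). A pair $(a(z),b(z))$ in $\mathcal E_\hbar(W)$ is $\hbar$-adically compatible if for every $n\ge1$ there is $p\in\mathbb N$ such that $(z_1-z_2)^pa(z_1)b(z_2)$ induces a map $W/\hbar^nW\to (W/\hbar^nW)((z_1,z_2))$; then $Y_{\mathcal E}(a(z),z_0)b(z)=\sum_n a(z)_nb(z)z_0^{-n-1}$ is the inverse limit over $n$ of $z_0^{-p}\big((z_1-z)^pa(z_1)b(z)\big)|_{z_1=z+z_0}$ computed modulo $\hbar^n$. An $\hbar$-adic nonlocal vertex algebra is a topologically free $V$ with a $\mathbb C[[\hbar]]$-linear map $Y(\cdot,z):V\to\mathcal E_\hbar(V)$, $Y(v,z)=\sum_n v_nz^{-n-1}$, and a vector $\mathbf 1$ such that $Y(\mathbf 1,z)v=v$, $Y(v,z)\mathbf 1\in V[[z]]$ has constant term $v$, and for all $u,v$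 the pair $(Y(u,z),Y(v,z))$ is $\hbar$-adically compatible with $Y_{\mathcal E}(Y(u,z),z_0)Y(v,z)=Y(Y(u,z_0)v,z)$. Its canonical derivation is $\partial u=\lim_{z\to0}\frac{d}{dz}Y(u,z)\mathbf 1$. Homomorphisms preserve $\mathbf 1$ and all products $u_nv$; ideals are two-sided. Quantum structure. For $A,B\in \mathrm{Hom}_{\mathbb C[[\hbar]]}(W,W_0((z_1))((z_2))[[\hbar]])$ write $A(z_1,z_2)\sim B(z_2,z_1)$ if for each $n\ge1$ there is $k$ with $(z_1-z_2)^kA(z_1,z_2)\equiv(z_1-z_2)^kB(z_2,z_1)$ as maps on $W/\hbar^nW$. An $\hbar$-adic quantum vertex algebra is an $\hbar$-adic nonlocal vertex algebra with a $\mathbb C[[\hbar]]$-linear map (quantum Yang–Baxter operator) $S(z)=\sum_nS_nz^{-n-1}:V\hat\otimes V\to V\hat\otimes V\hat\otimes\mathbb C((z))[[\hbar]]$ with $[\partial\otimes1,S(z)]=-\frac{d}{dz}S(z)$, $S^{12}(z_1)S^{13}(z_1+z_2)S^{23}(z_2)=S^{23}(z_2)S^{13}(z_1+z_2)S^{12}(z_1)$, $S^{21}(z)S(-z)=1$, $S(z)(\mathbf 1\otimes v)=\mathbf 1\otimes v$, $Y(u,z_1)Y(v,z_2)\sim Y(z_2)(1\otimes Y(z_1))S(z_2-z_1)(v\otimes u)$, and $S(z_1)(Y(z_2)\otimes1)=(Y(z_2)\otimes1)S^{23}(z_1)S^{13}(z_1+z_2)$, where $Y(z)(u\otimes v)=Y(u,z)v$.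 Data. $A=(a_{ij})_{i,j\in I}$, $r_i$ ($i\in I$) the unique relatively prime positive integers with $(r_ia_{ij})$ symmetric, $r=\mathrm{lcm}(r_i)$, $\mathfrak g=[\mathfrak g(A),\mathfrak g(A)]$, $q=e^\hbar$, $q_i=q^{r_i}$, $m_{ij}=1-a_{ij}$. $[c]_{q^{D}}=\frac{q^{cD}-q^{-cD}}{q^{D}-q^{-D}}$ ($c\in\mathbb C$) is a power series in $\hbar D$ for a derivation $D$; $q^{c\partial_z}$ is the shift $z\mapsto z+c\hbar$. $F(z)=(q^z-q^{-z})/z$. $\iota_{z_1,z_2}$ denotes expansion in nonnegative powers of $z_2$. $\mathfrak T$ is the set of tuples $\tau=(\tau_{ij}^{a,b}(z))_{i,j\in I}^{a,b\in\{0,\bullet\}}$ in $\mathbb C[[z,\hbar]]$ with $\lim_{z\to0}\lim_{\hbar\to0}\tau_{ij}^{\bullet,\bullet}(z)=1$, $F(\partial_z)\tau_{ij}^{0,0}(z)=\tau_{ij}^{0,\bullet}(z-r\ell\hbar)-\tau_{ij}^{0,\bullet}(z+r\ell\hbar)=\tau_{ij}^{\bullet,0}(z-r\ell\hbar)-\tau_{ij}^{\bullet,0}(z+r\ell\hbar)$, and $\tau_{ij}^{\bullet,\bullet}(z-r\ell\hbar)\tau_{ij}^{\bullet,\bullet}(z+r\ell\hbar)^{-1}=\exp(F(\partial_z)\tau_{ij}^{\bullet,0}(z))=\exp(F(\partial_z)\tau_{ij}^{0,\bullet}(z))$. Universal algebras. For a category $\mathcal M$ of topologically free modules with specified fields indexed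 by symbols and subject to given relations, the universal $\hbar$-adic nonlocal vertex algebra of $\mathcal M$ is the one generated by elements named by these symbols whose vertex operators make it an object of $\mathcal M$, and such that any $\hbar$-adic nonlocal vertex algebra with elements whose vertex operators make it an object of $\mathcal M$ receives a unique homomorphism matching these elements. The algebras $X_{\hbar,\tau}^\ell(\mathfrak g)$. $\mathcal M_{\hbar,\tau}^\ell(\mathfrak g)$ is the category of topologically free $W$ with fields $h_i(z),x_i^\pm(z)\in\mathcal E_\hbar(W)$ ($i\in I$) satisfying ($\tau1$) $[h_i(z_1),h_j(z_2)]=[r_ia_{ij}]_{q^{\partial_{z_2}}}[r\ell]_{q^{\partial_{z_2}}}(q^{-r\ell\partial_{z_2}}\iota_{z_1,z_2}-q^{r\ell\partial_{z_2}}\iota_{z_2,z_1})(z_1-z_2)^{-2}+\tau_{ij}^{0,0}(z_1-z_2)-\tau_{ji}^{0,0}(z_2-z_1)$; ($\tau2$) $[h_i(z_1),x_j^\pm(z_2)]=\pm x_j^\pm(z_2)[r_ia_{ij}]_{q^{\partial_{z_2}}}(q^{-r\ell\partial_{z_2}}\iota_{z_1,z_2}-q^{r\ell\partial_{z_2}}\iota_{z_2,z_1})(z_1-z_2)^{-1}\pm x_j^\pm(z_2)(\tau_{ij}^{0,\bullet}(z_1-z_2)+\tau_{ji}^{\bullet,0}(z_2-z_1))$; ($\tau3.5$) $(z_1-z_2)^{\delta_{ij}}(z_1-z_2+2r\ell\hbar)^{\delta_{ij}}\Big(x_i^+(z_1)x_j^-(z_2)-\iota_{z_2,z_1}\frac{(z_2-z_1+r_ia_{ij}\hbar)\tau_{ij}^{\bullet,\bullet}(z_1-z_2)}{(z_2-z_1-r_ia_{ij}\hbar)\tau_{ji}^{\bullet,\bullet}(z_2-z_1)}x_j^-(z_2)x_i^+(z_1)\Big)=0$;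 ($\tau4$) $(z_1-z_2-r_ia_{ij}\hbar)\tau_{ij}^{\bullet,\bullet}(z_1-z_2)x_i^\pm(z_1)x_j^\pm(z_2)=(z_1-z_2+r_ia_{ij}\hbar)\tau_{ji}^{\bullet,\bullet}(z_2-z_1)x_j^\pm(z_2)x_i^\pm(z_1)$. $V(\mathcal M_{\hbar,\tau}^\ell(\mathfrak g))$ is its universal algebra, $E_\tau(h_i)=\frac{\tau_{ii}^{\bullet,\bullet}(-2r\ell\hbar)^{1/2}}{\tau_{ii}^{\bullet,\bullet}(2r\ell\hbar)^{1/2}}\exp\big((-q^{-r\ell\partial}F(\partial)h_i)_{-1}\big)\mathbf 1$, and $V_{\hbar,\tau}^\ell(\mathfrak g)=V(\mathcal M_{\hbar,\tau}^\ell(\mathfrak g))/\overline{[R_1]}$, $R_1$ the ideal generated by $(x_i^+)_0x_i^--\frac1{2r_i\hbar}(\mathbf 1-E_\tau(h_i))$, $(x_i^+)_1x_i^--\frac{r\ell}{r_i}E_\tau(h_i)$ ($i\in I$), and $((x_i^\pm)_0)^{m_{ij}}x_j^\pm$ ($a_{ij}\le0$). If $\ell\in\mathbb Z_+$, $L_{\hbar,\tau}^\ell(\mathfrak g)=V_{\hbar,\tau}^\ell(\mathfrak g)/\overline{[R_2]}$, $R_2$ the ideal generated by $((x_i^\pm)_{-1})^{r\ell/r_i}x_i^\pm$ ($i\in I$). Their quantum Yang–Baxter operator $S_\tau(z)$ is determined by $S_\tau(z)(h_j\otimes h_i)=h_j\otimes h_i+\mathbf 1\otimes\mathbf 1\otimes\big([r_ia_{ij}]_{q^{\partial_z}}[r\ell]_{q^{\partial_z}}(q^{-r\ell\partial_z}-q^{r\ell\partial_z})z^{-2}+\tau_{ij}^{0,0}(-z)-\tau_{ji}^{0,0}(z)\big)$,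 $S_\tau(z)(h_j\otimes x_i^\pm)=h_j\otimes x_i^\pm\mp\mathbf 1\otimes x_i^\pm\otimes\big([r_ja_{ji}]_{q^{\partial_z}}(q^{r\ell\partial_z}-q^{-r\ell\partial_z})z^{-1}+\tau_{ij}^{\bullet,0}(-z)+\tau_{ji}^{0,\bullet}(z)\big)$, $S_\tau(z)(x_j^\pm\otimes h_i)=x_j^\pm\otimes h_i\pm x_j^\pm\otimes\mathbf 1\otimes\big([r_ia_{ij}]_{q^{\partial_z}}(q^{r\ell\partial_z}-q^{-r\ell\partial_z})z^{-1}+\tau_{ij}^{0,\bullet}(-z)+\tau_{ji}^{\bullet,0}(z)\big)$, $S_\tau(z)(x_j^{\epsilon_1}\otimes x_i^{\epsilon_2})=x_j^{\epsilon_1}\otimes x_i^{\epsilon_2}\otimes\Big(\frac{\tau_{ji}^{\bullet,\bullet}(z)}{\tau_{ij}^{\bullet,\bullet}(-z)}\Big)^{\epsilon_1\epsilon_2}\frac{z-\epsilon_1\epsilon_2r_ia_{ij}\hbar}{z+\epsilon_1\epsilon_2r_ia_{ij}\hbar}$. The algebras $X_{\hat{\mathfrak g},\hbar}(\ell,0)$. Let $\mathcal M$ be the category of topologically free $W$ with fields $h_{i,\hbar}(z),x_{i,\hbar}^\pm(z)\in\mathcal E_\hbar(W)$ ($i\in I$) satisfying $[h_{i,\hbar}(z_1),h_{j,\hbar}(z_2)]=[r_ia_{ij}]_{q^{\partial_{z_2}}}[r\ell]_{q^{\partial_{z_2}}}(\iota_{z_1,z_2}q^{-r\ell\partial_{z_2}}-\iota_{z_2,z_1}q^{r\ell\partial_{z_2}})\frac{e^{-z_1+z_2}}{(1-e^{-z_1+z_2})^2}$,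 $[h_{i,\hbar}(z_1),x_{j,\hbar}^\pm(z_2)]=\pm x_{j,\hbar}^\pm(z_2)[r_ia_{ij}]_{q^{\partial_{z_2}}}(\iota_{z_1,z_2}q^{-r\ell\partial_{z_2}}-\iota_{z_2,z_1}q^{r\ell\partial_{z_2}})\frac{1+e^{-z_1+z_2}}{2-2e^{-z_1+z_2}}$, $\iota_{z_1,z_2}\frac{1-q_i^{a_{ij}}e^{-z_1+z_2}}{(1-e^{-z_1+z_2})^{\delta_{ij}}}x_{i,\hbar}^\pm(z_1)x_{j,\hbar}^\pm(z_2)=\iota_{z_2,z_1}\frac{q_i^{a_{ij}}-e^{-z_1+z_2}}{(1-e^{-z_1+z_2})^{\delta_{ij}}}x_{j,\hbar}^\pm(z_2)x_{i,\hbar}^\pm(z_1)$, $(z_1-z_2)^{\delta_{ij}}(z_1-z_2+2r\ell\hbar)^{\delta_{ij}}\Big(x_{i,\hbar}^+(z_1)x_{j,\hbar}^-(z_2)-\iota_{z_2,z_1}\frac{1-q_i^{a_{ij}}e^{z_2-z_1}}{q_i^{a_{ij}}-e^{z_2-z_1}}x_{j,\hbar}^-(z_2)x_{i,\hbar}^+(z_1)\Big)=0$. $F_\tau(A,\ell)$ is the universal algebra of $\mathcal M$, with generators $h_{i,\hbar},x_{i,\hbar}^\pm$. $V_{\hat{\mathfrak g},\hbar}(\ell,0)$ is the quotient of $F_\tau(A,\ell)$ by the minimal closed ideal $K$ with $[K]=K$ containing $(x_{i,\hbar}^+)_0x_{i,\hbar}^--(q_i-q_i^{-1})^{-1}(\mathbf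 1-E(h_{i,\hbar}))$, $(x_{i,\hbar}^+)_1x_{i,\hbar}^--2r\ell\hbar(q_i-q_i^{-1})^{-1}E(h_{i,\hbar})$ ($i\in I$), and $((x_{i,\hbar}^\pm)_0)^{m_{ij}}x_{j,\hbar}^\pm$ ($a_{ij}\le0$), where $E(h_{i,\hbar})=\big(\frac{F(r_i+r\ell)}{F(r_i-r\ell)}\big)^{1/2}\exp\big((-q^{-r\ell\partial}F(\partial)h_{i,\hbar})_{-1}\big)\mathbf 1$. If $\ell\in\mathbb Z_+$, $L_{\hat{\mathfrak g},\hbar}(\ell,0)$ is the quotient of $V_{\hat{\mathfrak g},\hbar}(\ell,0)$ by the minimal closed ideal $K$ with $[K]=K$ containing $((x_{i,\hbar}^\pm)_{-1})^{r\ell/r_i}x_{i,\hbar}^\pm$ ($i\in I$). Their quantum Yang–Baxter operator is the one determined by the same formulas as $S_\tau(z)$ on the generators $h_{i,\hbar},x_{i,\hbar}^\pm$. *)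

theory Defs
  imports "HOL-Algebra.Algebraic_Closure_Type"
begin

unbundle fps_syntax

section \<open>Topologically free modules over the power series in \<open>h\<close>\<close>

abbreviation CR :: "complex ring" where "CR \<equiv> ring_of_type_algebra"
abbreviation HR :: "complex fps ring" where "HR \<equiv> ring_of_type_algebra"

definition linear_maps ::
  "('k, 'v, 'm) module_scheme \<Rightarrow> ('k, 'w, 'n) module_scheme \<Rightarrow> ('v \<Rightarrow> 'w) set" where
  "linear_maps M N = {f \<in> carrier M \<rightarrow> carrier N.
     (\<forall>u\<in>carrier M. \<forall>v\<in>carrier M. f (u \<oplus>\<^bsub>M\<^esub> v) = f u \<oplus>\<^bsub>N\<^esub> f v) \<and>
     (\<forall>c. \<forall>v\<in>carrier M. f (c \<odot>\<^bsub>M\<^esub> v) = c \<odot>\<^bsub>N\<^esub> f v)}"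

text \<open>The module \<open>V0[[h]]\<close>; the fields \<open>mult\<close> and \<open>one\<close> of a module record carry no meaning.\<close>
definition pseries :: "(complex, 'v) module \<Rightarrow> (complex fps, nat \<Rightarrow> 'v) module" where
  "pseries V0 = \<lparr>carrier = {f. \<forall>n. f n \<in> carrier V0},
     monoid.mult = (\<lambda>_ _. undefined), monoid.one = undefined,
     ring.zero = (\<lambda>_. \<zero>\<^bsub>V0\<^esub>), ring.add = (\<lambda>f g n. f n \<oplus>\<^bsub>V0\<^esub> g n),
     module.smult = (\<lambda>c f n. finsum V0 (\<lambda>k. (c $ k) \<odot>\<^bsub>V0\<^esub> f (n - k)) {..n})\<rparr>"

definition topologically_free :: "(complex fps, 'v, 'm) module_scheme \<Rightarrow> bool" where
  "topologically_free M \<longleftrightarrow> module HR M \<and>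
     (\<exists>V0 :: (complex, 'v) module. module CR V0 \<and>
       (\<exists>f \<in> linear_maps (pseries V0) M. bij_betw f (carrier (pseries V0)) (carrier M)))"

definition hpow :: "(complex fps, 'v, 'm) module_scheme \<Rightarrow> nat \<Rightarrow> 'v set" where
  "hpow M n = {fps_X ^ n \<odot>\<^bsub>M\<^esub> v | v. v \<in> carrier M}"

definition hcong :: "(complex fps, 'v, 'm) module_scheme \<Rightarrow> nat \<Rightarrow> 'v \<Rightarrow> 'v \<Rightarrow> bool" where
  "hcong M n u v \<longleftrightarrow> u \<ominus>\<^bsub>M\<^esub> v \<in> hpow M n"

definition hclosure :: "(complex fps, 'v, 'm) module_scheme \<Rightarrow> 'v set \<Rightarrow> 'v set" where
  "hclosure M K = {v \<in> carrier M. \<forall>n. \<exists>k\<in>K. hcong M n v k}"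

text \<open>The operation \<open>[K]\<close>.\<close>
definition saturate :: "(complex fps, 'v, 'm) module_scheme \<Rightarrow> 'v set \<Rightarrow> 'v set" where
  "saturate M K = {v \<in> carrier M. \<exists>n. fps_X ^ n \<odot>\<^bsub>M\<^esub> v \<in> K}"

text \<open>Unconditional \<open>h\<close>-adic summation. Every product of formal series below is
  such a sum; modulo each \<open>h ^ n\<close> only finitely many terms are nonzero.\<close>
definition hsums :: "(complex fps, 'v, 'm) module_scheme \<Rightarrow> ('j \<Rightarrow> 'v) \<Rightarrow> 'v \<Rightarrow> bool" where
  "hsums M f v \<longleftrightarrow> v \<in> carrier M \<and>
     (\<forall>n. \<exists>F. finite F \<and> (\<forall>F'. finite F' \<and> F \<subseteq> F' \<longrightarrow> hcong M n (finsum M f F') v))"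

definition hsum :: "(complex fps, 'v, 'm) module_scheme \<Rightarrow> ('j \<Rightarrow> 'v) \<Rightarrow> 'v" where
  "hsum M f = (THE v. hsums M f v)"

text \<open>Division by a nonzero element of a torsion-free module, for a divisible \<open>v\<close>.\<close>
definition hdiv :: "(complex fps, 'v, 'm) module_scheme \<Rightarrow> complex fps \<Rightarrow> 'v \<Rightarrow> 'v" where
  "hdiv M d v = (THE u. u \<in> carrier M \<and> d \<odot>\<^bsub>M\<^esub> u = v)"


section \<open>Scalar series\<close>

text \<open>\<open>\<complex>[[h]]\<close> is \<open>complex fps\<close>, \<open>\<complex>[[z,h]]\<close> is \<open>complex fps fps\<close> and \<open>\<complex>((z))[[h]]\<close> is
  \<open>complex fls fps\<close>, with \<open>h\<close> always the outer variable. A series in \<open>z1, z2\<close> infinite in both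
  directions is the function \<open>int \<Rightarrow> int \<Rightarrow> _\<close> whose value at \<open>a, b\<close> is the coefficient
  of \<open>z1^a z2^b\<close>.\<close>

abbreviation zv :: "complex fls fps" where "zv \<equiv> fps_const fls_X"

definition hmon :: "complex \<Rightarrow> complex fls fps" where
  "hmon c = fps_const (fls_const c) * fps_X"

definition hemb :: "complex fps \<Rightarrow> complex fls fps" where
  "hemb f = Abs_fps (\<lambda>n. fls_const (f $ n))"

definition temb :: "complex fps fps \<Rightarrow> complex fls fps" where
  "temb f = Abs_fps (\<lambda>n. fps_to_fls (f $ n))"

text \<open>\<open>z \<mapsto> - z\<close>\<close>
definition reflect :: "complex fps fps \<Rightarrow> complex fps fps" where
  "reflect f = Abs_fps (\<lambda>n. fps_compose (f $ n) (- fps_X))"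

definition zcoef :: "complex fls fps \<Rightarrow> int \<Rightarrow> complex fps" where
  "zcoef f c = Abs_fps (\<lambda>n. (f $ n) $$ c)"

text \<open>\<open>f(z1 - z2)\<close> expanded in nonnegative powers of \<open>z2\<close>, respectively of \<open>z1\<close>: the coefficient
  of \<open>z1^a z2^b\<close> only involves the coefficient of \<open>z^(a+b)\<close> in \<open>f\<close>.\<close>
definition iota12 :: "complex fls fps \<Rightarrow> int \<Rightarrow> int \<Rightarrow> complex fps" where
  "iota12 f a b = (if 0 \<le> b then
     fps_const ((- 1) powi b * (of_int (a + b) gchoose nat b)) * zcoef f (a + b) else 0)"

definition iota21 :: "complex fls fps \<Rightarrow> int \<Rightarrow> int \<Rightarrow> complex fps" where
  "iota21 f a b = (if 0 \<le> a then
     fps_const ((- 1) powi b * (of_int (a + b) gchoose nat a)) * zcoef f (a + b) else 0)"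

text \<open>The operators \<open>P(h D)\<close> for a one-variable power series \<open>P\<close>: \<open>D = d/dz\<close> on \<open>\<complex>[[z,h]]\<close> and
  on \<open>\<complex>((z))[[h]]\<close>, and \<open>D = d/dz2\<close> on two-variable series. For \<open>P = fps_exp c\<close> this is
  \<open>q^(c D)\<close>, the shift by \<open>c h\<close>.\<close>
definition hD_fps :: "complex fps \<Rightarrow> complex fps fps \<Rightarrow> complex fps fps" where
  "hD_fps P f = Abs_fps (\<lambda>n. \<Sum>k\<le>n. fps_const (P $ k) * (fps_deriv ^^ k) (f $ (n - k)))"

definition hD_fls :: "complex fps \<Rightarrow> complex fls fps \<Rightarrow> complex fls fps" where
  "hD_fls P f = Abs_fps (\<lambda>n. \<Sum>k\<le>n. fls_const (P $ k) * (fls_deriv ^^ k) (f $ (n - k)))"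

definition deriv2 :: "(int \<Rightarrow> int \<Rightarrow> complex fps) \<Rightarrow> int \<Rightarrow> int \<Rightarrow> complex fps" where
  "deriv2 G a b = of_int (b + 1) * G a (b + 1)"

definition hD_two ::
  "complex fps \<Rightarrow> (int \<Rightarrow> int \<Rightarrow> complex fps) \<Rightarrow> int \<Rightarrow> int \<Rightarrow> complex fps" where
  "hD_two P G a b = Abs_fps (\<lambda>n. \<Sum>k\<le>n. P $ k * (deriv2 ^^ k) G a b $ (n - k))"

text \<open>\<open>[c]\<close> at \<open>q^D\<close> is \<open>qnum c\<close> at \<open>h D\<close>. Since \<open>F(D) = (q^D - q^(-D)) / D\<close>, one has \<open>F(D) = h P(h D)\<close>
  with \<open>P = Fser\<close>.\<close>
definition qnum :: "complex \<Rightarrow> complex fps" where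
  "qnum c = (fps_exp c - fps_exp (- c)) / (fps_exp 1 - fps_exp (- 1))"

definition Fser :: "complex fps" where
  "Fser = (fps_exp 1 - fps_exp (- 1)) / fps_X"

definition F_fps :: "complex fps fps \<Rightarrow> complex fps fps" where
  "F_fps f = fps_X * hD_fps Fser f"

text \<open>\<open>F(c)\<close> for a complex number \<open>c\<close>; at \<open>c = 0\<close> its value is \<open>2 h\<close>.\<close>
definition Fval :: "complex \<Rightarrow> complex fps" where
  "Fval c = fps_X * fps_compose Fser (fps_const c * fps_X)"

text \<open>Exponential of a series in \<open>\<complex>[[z,h]]\<close> without constant term: the \<open>k\<close>-th power has total
  order at least \<open>k\<close>.\<close>
definition exp_zh :: "complex fps fps \<Rightarrow> complex fps fps" where
  "exp_zh f = Abs_fps (\<lambda>n. Abs_fps (\<lambda>m. \<Sum>k\<le>n + m. (f ^ k) $ n $ m / fact k))"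

text \<open>\<open>f(c h, h)\<close> for \<open>f(z, h)\<close>\<close>
definition eval_zh :: "complex fps fps \<Rightarrow> complex \<Rightarrow> complex fps" where
  "eval_zh f c = Abs_fps (\<lambda>m. \<Sum>n\<le>m. c ^ (m - n) * (f $ n) $ (m - n))"

text \<open>Square root of a series with constant term \<open>1\<close>, normalised to constant term \<open>1\<close>.\<close>
abbreviation fps_sqrt :: "complex fps \<Rightarrow> complex fps" where
  "fps_sqrt \<equiv> fps_radical (\<lambda>_. csqrt) 2"


section \<open>Fields and nonlocal vertex algebras\<close>

text \<open>A field is the family of its coefficients: \<open>a c\<close> is the coefficient of \<open>z^c\<close> in \<open>a(z)\<close>.
  The truncation condition modulo every \<open>h ^ n\<close> describes \<open>W0((z))[[h]]\<close>.\<close>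
definition is_field :: "(complex fps, 'v, 'm) module_scheme \<Rightarrow> (int \<Rightarrow> 'v \<Rightarrow> 'v) \<Rightarrow> bool" where
  "is_field W a \<longleftrightarrow> (\<forall>c. a c \<in> linear_maps W W) \<and>
     (\<forall>w\<in>carrier W. \<forall>n. \<exists>N. \<forall>c<N. a c w \<in> hpow W n)"

text \<open>Product of a scalar with a vector-valued two-variable series.\<close>
definition smul2 :: "(complex fps, 'v, 'm) module_scheme \<Rightarrow> (int \<Rightarrow> int \<Rightarrow> complex fps) \<Rightarrow>
    (int \<Rightarrow> int \<Rightarrow> 'v) \<Rightarrow> int \<Rightarrow> int \<Rightarrow> 'v" where
  "smul2 W G f a b = hsum W (\<lambda>(p, q). G p q \<odot>\<^bsub>W\<^esub> f (a - p) (b - q))"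

definition locprod :: "(complex fps, 'v, 'm) module_scheme \<Rightarrow> (int \<Rightarrow> 'v \<Rightarrow> 'v) \<Rightarrow>
    (int \<Rightarrow> 'v \<Rightarrow> 'v) \<Rightarrow> nat \<Rightarrow> 'v \<Rightarrow> int \<Rightarrow> int \<Rightarrow> 'v" where
  "locprod W a b p w = smul2 W (iota12 (zv ^ p)) (\<lambda>i j. a i (b j w))"

definition compatible_mod :: "(complex fps, 'v, 'm) module_scheme \<Rightarrow> (int \<Rightarrow> 'v \<Rightarrow> 'v) \<Rightarrow>
    (int \<Rightarrow> 'v \<Rightarrow> 'v) \<Rightarrow> nat \<Rightarrow> nat \<Rightarrow> bool" where
  "compatible_mod W a b n p \<longleftrightarrow> (\<forall>w\<in>carrier W. \<exists>N. \<forall>i j. i < N \<or> j < N \<longrightarrow>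
     locprod W a b p w i j \<in> hpow W n)"

definition compatible :: "(complex fps, 'v, 'm) module_scheme \<Rightarrow> (int \<Rightarrow> 'v \<Rightarrow> 'v) \<Rightarrow>
    (int \<Rightarrow> 'v \<Rightarrow> 'v) \<Rightarrow> bool" where
  "compatible W a b \<longleftrightarrow> (\<forall>n\<ge>1. \<exists>p. compatible_mod W a b n p)"

text \<open>\<open>c(z)\<close> is the product \<open>a(z)_m b(z)\<close>, the coefficient of \<open>z0^(-m-1)\<close> in \<open>Y_E(a(z), z0) b(z)\<close>.
  Substituting \<open>z1 = z + z0\<close> into \<open>G(z1, z)\<close> and dividing by \<open>z0^p\<close>, the coefficient of
  \<open>z^s z0^(-m-1)\<close> is the sum over \<open>i\<close> of \<open>(i choose j)\<close> times the coefficient of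
  \<open>z1^i z^(s-i+j)\<close> in \<open>G\<close>, where \<open>j = p - m - 1\<close>; modulo \<open>h ^ n\<close> this sum is finite.\<close>
definition is_YE_prod :: "(complex fps, 'v, 'm) module_scheme \<Rightarrow> (int \<Rightarrow> 'v \<Rightarrow> 'v) \<Rightarrow>
    (int \<Rightarrow> 'v \<Rightarrow> 'v) \<Rightarrow> int \<Rightarrow> (int \<Rightarrow> 'v \<Rightarrow> 'v) \<Rightarrow> bool" where
  "is_YE_prod W a b m c \<longleftrightarrow>
     (\<forall>n\<ge>1. \<forall>p. compatible_mod W a b n p \<longrightarrow> (\<forall>w\<in>carrier W. \<forall>s. \<exists>N0. \<forall>N\<ge>N0.
        let j = int p - m - 1 in
        hcong W n (c s w)
          (if 0 \<le> j then finsum W (\<lambda>i. fps_const (of_int i gchoose nat j) \<odot>\<^bsub>W\<^esub>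
              locprod W a b p w i (s - i + j)) {- N..N}
           else \<zero>\<^bsub>W\<^esub>)))"

record 'v hva = "(complex fps, 'v) module" +
  vac :: 'v
  nprod :: "int \<Rightarrow> 'v \<Rightarrow> 'v \<Rightarrow> 'v"

text \<open>\<open>nprod V n u v\<close> is \<open>u_n v\<close>, whence the coefficient of \<open>z^c\<close> in \<open>Y(u,z)\<close>:\<close>
definition Yc :: "'v hva \<Rightarrow> 'v \<Rightarrow> int \<Rightarrow> 'v \<Rightarrow> 'v" where
  "Yc V u c = nprod V (- c - 1) u"

definition nonlocal_va :: "'v hva \<Rightarrow> bool" where
  "nonlocal_va V \<longleftrightarrow> topologically_free V \<and> vac V \<in> carrier V \<and>
     (\<forall>u\<in>carrier V. is_field V (Yc V u)) \<and>
     (\<forall>n. \<forall>v\<in>carrier V. (\<lambda>u. nprod V n u v) \<in> linear_maps V V) \<and>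
     (\<forall>n. \<forall>v\<in>carrier V. nprod V n (vac V) v = (if n = - 1 then v else \<zero>\<^bsub>V\<^esub>)) \<and>
     (\<forall>v\<in>carrier V. (\<forall>n\<ge>0. nprod V n v (vac V) = \<zero>\<^bsub>V\<^esub>) \<and> nprod V (- 1) v (vac V) = v) \<and>
     (\<forall>u\<in>carrier V. \<forall>v\<in>carrier V. compatible V (Yc V u) (Yc V v) \<and>
        (\<forall>m. is_YE_prod V (Yc V u) (Yc V v) m (Yc V (nprod V m u v))))"

text \<open>The limit of \<open>d/dz Y(u,z) 1\<close> at \<open>z = 0\<close> is the coefficient of \<open>z\<close> in \<open>Y(u,z) 1\<close>.\<close>
definition der :: "'v hva \<Rightarrow> 'v \<Rightarrow> 'v" where
  "der V u = nprod V (- 2) u (vac V)"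

text \<open>\<open>P(h D)\<close> for the canonical derivation \<open>D\<close>\<close>
definition hD_va :: "'v hva \<Rightarrow> complex fps \<Rightarrow> 'v \<Rightarrow> 'v" where
  "hD_va V P v = hsum V (\<lambda>k. (fps_const (P $ k) * fps_X ^ k) \<odot>\<^bsub>V\<^esub> (der V ^^ k) v)"

definition va_hom :: "'v hva \<Rightarrow> 'w hva \<Rightarrow> ('v \<Rightarrow> 'w) set" where
  "va_hom V V' = {f \<in> linear_maps V V'. f (vac V) = vac V' \<and>
     (\<forall>n. \<forall>u\<in>carrier V. \<forall>v\<in>carrier V. f (nprod V n u v) = nprod V' n (f u) (f v))}"

definition va_iso :: "'v hva \<Rightarrow> 'w hva \<Rightarrow> ('v \<Rightarrow> 'w) set" where
  "va_iso V V' = {f \<in> va_hom V V'. bij_betw f (carrier V) (carrier V')}"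

definition va_ideal :: "'v hva \<Rightarrow> 'v set \<Rightarrow> bool" where
  "va_ideal V K \<longleftrightarrow> submodule K HR V \<and>
     (\<forall>n. \<forall>u\<in>carrier V. \<forall>k\<in>K. nprod V n u k \<in> K \<and> nprod V n k u \<in> K)"

definition ideal_gen :: "'v hva \<Rightarrow> 'v set \<Rightarrow> 'v set" where
  "ideal_gen V G = \<Inter> {K. va_ideal V K \<and> G \<subseteq> K}"

definition closed_ideal_gen :: "'v hva \<Rightarrow> 'v set \<Rightarrow> 'v set" where
  "closed_ideal_gen V G =
     \<Inter> {K. va_ideal V K \<and> hclosure V K = K \<and> saturate V K = K \<and> G \<subseteq> K}"

definition va_quot :: "'v hva \<Rightarrow> 'v set \<Rightarrow> 'v set hva" where
  "va_quot V K = \<lparr>carrier = a_rcosets\<^bsub>V\<^esub> K,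
     monoid.mult = (\<lambda>_ _. undefined), monoid.one = undefined,
     ring.zero = K, ring.add = (<+>\<^bsub>V\<^esub>),
     module.smult = (\<lambda>c A. K <+>\<^bsub>V\<^esub> {c \<odot>\<^bsub>V\<^esub> u | u. u \<in> A}),
     vac = K +>\<^bsub>V\<^esub> vac V,
     nprod = (\<lambda>n A B. K <+>\<^bsub>V\<^esub> {nprod V n u v | u v. u \<in> A \<and> v \<in> B})\<rparr>"

text \<open>Generation is understood in the topological sense: the smallest closed subalgebra \<open>K\<close>
  with \<open>[K] = K\<close> containing the generators is everything.\<close>
definition va_subalgebra :: "'v hva \<Rightarrow> 'v set \<Rightarrow> bool" where
  "va_subalgebra V K \<longleftrightarrow> submodule K HR V \<and> vac V \<in> K \<and>
     (\<forall>n. \<forall>u\<in>K. \<forall>v\<in>K. nprod V n u v \<in> K)"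

definition va_generated :: "'v hva \<Rightarrow> 'v set \<Rightarrow> bool" where
  "va_generated V G \<longleftrightarrow> (\<forall>K. va_subalgebra V K \<and> hclosure V K = K \<and> saturate V K = K \<and> G \<subseteq> K
     \<longrightarrow> K = carrier V)"

text \<open>\<open>V\<close> with generators \<open>g s\<close> is the universal algebra of the category whose objects are the
  modules with fields satisfying \<open>Cat\<close>. The competing algebras range over all algebras whose
  underlying set is a subset of the same (arbitrary) type.\<close>
definition universal_va ::
  "('v hva \<Rightarrow> ('s \<Rightarrow> int \<Rightarrow> 'v \<Rightarrow> 'v) \<Rightarrow> bool) \<Rightarrow> 'v hva \<Rightarrow> ('s \<Rightarrow> 'v) \<Rightarrow> bool" where
  "universal_va Cat V g \<longleftrightarrow>
     nonlocal_va V \<and> range g \<subseteq> carrier V \<and> Cat V (\<lambda>s. Yc V (g s)) \<and> va_generated V (range g) \<and>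
     (\<forall>V' g'. nonlocal_va V' \<and> range g' \<subseteq> carrier V' \<and> Cat V' (\<lambda>s. Yc V' (g' s)) \<longrightarrow>
        (\<exists>!f. f \<in> va_hom V V' \<inter> extensional (carrier V) \<and> (\<forall>s. f (g s) = g' s)))"


section \<open>Completed tensor powers\<close>

text \<open>The completed tensor power \<open>(V0 \<otimes> ... \<otimes> V0)[[h]]\<close> of \<open>V = V0[[h]]\<close> is realised inside the dual
  of the module of \<open>n\<close>-linear forms on \<open>V\<close>: the tensor of \<open>v1, ..., vn\<close> is evaluation at
  \<open>[v1, ..., vn]\<close>, and the completed tensor power consists of the \<open>h\<close>-adic limits of finite sums of
  such tensors. Multilinear forms over a field separate the elements of a tensor power, so the
  canonical map from \<open>(V0 \<otimes> ... \<otimes> V0)[[h]]\<close> is an isomorphism. The linear map induced by a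
  multilinear map \<open>T\<close> into tensors sends \<open>t\<close> to the functional with value \<open>t (\<lambda>xs. T xs B)\<close> at \<open>B\<close>.\<close>

type_synonym 'v tens = "('v list \<Rightarrow> complex fps) \<Rightarrow> complex fps"

definition mlin :: "(complex fps, 'v, 'm) module_scheme \<Rightarrow> nat \<Rightarrow> ('v list \<Rightarrow> complex fps) \<Rightarrow> bool" where
  "mlin V n B \<longleftrightarrow> (\<forall>xs. length xs = n \<and> set xs \<subseteq> carrier V \<longrightarrow> (\<forall>i<n.
     (\<forall>u\<in>carrier V. \<forall>v\<in>carrier V. B (xs[i := u \<oplus>\<^bsub>V\<^esub> v]) = B (xs[i := u]) + B (xs[i := v])) \<and>
     (\<forall>c. \<forall>u\<in>carrier V. B (xs[i := c \<odot>\<^bsub>V\<^esub> u]) = c * B (xs[i := u]))))"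

definition pure :: "(complex fps, 'v, 'm) module_scheme \<Rightarrow> 'v list \<Rightarrow> 'v tens" where
  "pure V xs = (\<lambda>B. if mlin V (length xs) B then B xs else 0)"

definition ctens :: "(complex fps, 'v, 'm) module_scheme \<Rightarrow> nat \<Rightarrow> (complex fps, 'v tens) module" where
  "ctens V n = \<lparr>carrier = {t. (\<forall>B. \<not> mlin V n B \<longrightarrow> t B = 0) \<and>
       (\<forall>N. \<exists>xss. (\<forall>xs\<in>set xss. length xs = n \<and> set xs \<subseteq> carrier V) \<and>
          (\<forall>B. mlin V n B \<longrightarrow> fps_X ^ N dvd t B - (\<Sum>xs\<leftarrow>xss. pure V xs B)))},
     monoid.mult = (\<lambda>_ _. undefined), monoid.one = undefined,
     ring.zero = (\<lambda>_. 0), ring.add = (\<lambda>s t B. s B + t B), module.smult = (\<lambda>c t B. c * t B)\<rparr>"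

definition lift_tens :: "(complex fps, 'v, 'm) module_scheme \<Rightarrow> nat \<Rightarrow> ('u list \<Rightarrow> 'v tens) \<Rightarrow>
    'u tens \<Rightarrow> 'v tens" where
  "lift_tens V n T t = (\<lambda>B. if mlin V n B then t (\<lambda>xs. T xs B) else 0)"

text \<open>Families of coefficients of elements of \<open>(V \<otimes> ... \<otimes> V) \<otimes> \<complex>((z))[[h]]\<close>, completed: modulo
  every power of \<open>h\<close> a finite sum of \<open>t \<otimes> f(z)\<close>.\<close>
definition laurent_tens :: "(complex fps, 'v, 'm) module_scheme \<Rightarrow> nat \<Rightarrow> (int \<Rightarrow> 'v tens) \<Rightarrow> bool" where
  "laurent_tens V n T \<longleftrightarrow> (\<forall>c. T c \<in> carrier (ctens V n)) \<and>
     (\<forall>N. \<exists>ts :: ('v tens \<times> complex fls) list. fst ` set ts \<subseteq> carrier (ctens V n) \<and>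
        (\<forall>c B. fps_X ^ N dvd T c B - (\<Sum>(t, f)\<leftarrow>ts. fps_const (f $$ c) * t B)))"

text \<open>\<open>op_at V n T i j\<close> is \<open>T\<close> acting on the factors \<open>i\<close> and \<open>j\<close> (counted from \<open>0\<close>, in this order) of
  the \<open>n\<close>-th tensor power.\<close>
definition op_at :: "(complex fps, 'v, 'm) module_scheme \<Rightarrow> nat \<Rightarrow> ('v tens \<Rightarrow> 'v tens) \<Rightarrow> nat \<Rightarrow> nat \<Rightarrow>
    'v tens \<Rightarrow> 'v tens" where
  "op_at V n T i j = lift_tens V n
     (\<lambda>xs B. T (pure V [xs ! i, xs ! j]) (\<lambda>ys. B (xs[i := ys ! 0, j := ys ! 1])))"

definition der_first :: "'v hva \<Rightarrow> 'v tens \<Rightarrow> 'v tens" where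
  "der_first V = lift_tens V 2 (\<lambda>xs. pure V (xs[0 := der V (xs ! 0)]))"

text \<open>The coefficient of \<open>z^c\<close> in \<open>Y(z)\<close> acting on the factors \<open>i\<close> and \<open>i + 1\<close>; the result lies in
  the \<open>n\<close>-th tensor power.\<close>
definition Y_at :: "'v hva \<Rightarrow> nat \<Rightarrow> nat \<Rightarrow> int \<Rightarrow> 'v tens \<Rightarrow> 'v tens" where
  "Y_at V n i c = lift_tens V n
     (\<lambda>xs. pure V (take i xs @ Yc V (xs ! i) c (xs ! Suc i) # drop (i + 2) xs))"

definition map_tens :: "(complex fps, 'w, 'm) module_scheme \<Rightarrow> nat \<Rightarrow> ('v \<Rightarrow> 'w) \<Rightarrow> 'v tens \<Rightarrow> 'w tens" where
  "map_tens V' n f = lift_tens V' n (\<lambda>xs. pure V' (map f xs))"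

text \<open>Operator series in \<open>z1, z2\<close>: \<open>P(z1)\<close>, \<open>P(z2)\<close>, \<open>P(z1 + z2)\<close> in nonnegative powers of \<open>z2\<close>,
  \<open>P(z2 - z1)\<close> in nonnegative powers of \<open>z1\<close>, and products.\<close>
definition in_z1 :: "(int \<Rightarrow> 'u tens \<Rightarrow> 'v tens) \<Rightarrow> int \<Rightarrow> int \<Rightarrow> 'u tens \<Rightarrow> 'v tens" where
  "in_z1 P a b t = (if b = 0 then P a t else (\<lambda>_. 0))"

definition in_z2 :: "(int \<Rightarrow> 'u tens \<Rightarrow> 'v tens) \<Rightarrow> int \<Rightarrow> int \<Rightarrow> 'u tens \<Rightarrow> 'v tens" where
  "in_z2 P a b t = (if a = 0 then P b t else (\<lambda>_. 0))"

definition in_sum :: "(int \<Rightarrow> 'u tens \<Rightarrow> 'v tens) \<Rightarrow> int \<Rightarrow> int \<Rightarrow> 'u tens \<Rightarrow> 'v tens" where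
  "in_sum P a b t = (if 0 \<le> b then
     (\<lambda>B. fps_const (of_int (a + b) gchoose nat b) * P (a + b) t B) else (\<lambda>_. 0))"

definition in_diff :: "(int \<Rightarrow> 'u tens \<Rightarrow> 'v tens) \<Rightarrow> int \<Rightarrow> int \<Rightarrow> 'u tens \<Rightarrow> 'v tens" where
  "in_diff P a b t = (if 0 \<le> a then
     (\<lambda>B. fps_const ((- 1) ^ nat a * (of_int (a + b) gchoose nat a)) * P (a + b) t B) else (\<lambda>_. 0))"

definition comp2 :: "(complex fps, 'w tens) module \<Rightarrow> (int \<Rightarrow> int \<Rightarrow> 'v tens \<Rightarrow> 'w tens) \<Rightarrow>
    (int \<Rightarrow> int \<Rightarrow> 'u tens \<Rightarrow> 'v tens) \<Rightarrow> int \<Rightarrow> int \<Rightarrow> 'u tens \<Rightarrow> 'w tens" where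
  "comp2 T P Q a b t = hsum T (\<lambda>(p, q). P p q (Q (a - p) (b - q) t))"


section \<open>Quantum vertex algebras\<close>

text \<open>\<open>S c\<close> is the coefficient of \<open>z^c\<close> in \<open>S(z)\<close>.\<close>

definition S_local :: "'v hva \<Rightarrow> (int \<Rightarrow> 'v tens \<Rightarrow> 'v tens) \<Rightarrow> bool" where
  "S_local V S \<longleftrightarrow> (\<forall>u\<in>carrier V. \<forall>v\<in>carrier V. \<forall>n\<ge>1. \<exists>k. \<forall>w\<in>carrier V. \<forall>a b.
     hcong (ctens V 1) n
       (smul2 (ctens V 1) (iota12 (zv ^ k)) (\<lambda>a b. pure V [Yc V u a (Yc V v b w)]) a b)
       (smul2 (ctens V 1) (iota12 (zv ^ k))
          (\<lambda>a b. comp2 (ctens V 1) (\<lambda>a b t. Y_at V 1 0 b (Y_at V 2 1 a t))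
             (in_diff (\<lambda>c. op_at V 3 (S c) 0 1)) a b (pure V [v, u, w])) a b))"

definition quantum_va :: "'v hva \<Rightarrow> (int \<Rightarrow> 'v tens \<Rightarrow> 'v tens) \<Rightarrow> bool" where
  "quantum_va V S \<longleftrightarrow> nonlocal_va V \<and>
     (\<forall>c. S c \<in> linear_maps (ctens V 2) (ctens V 2)) \<and>
     (\<forall>t\<in>carrier (ctens V 2). laurent_tens V 2 (\<lambda>c. S c t)) \<and>
     (\<forall>t\<in>carrier (ctens V 2). \<forall>c.
        der_first V (S c t) \<ominus>\<^bsub>ctens V 2\<^esub> S c (der_first V t) = - of_int (c + 1) \<odot>\<^bsub>ctens V 2\<^esub> S (c + 1) t) \<and>
     (\<forall>t\<in>carrier (ctens V 3). \<forall>a b.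
        comp2 (ctens V 3) (in_z1 (\<lambda>c. op_at V 3 (S c) 0 1))
          (comp2 (ctens V 3) (in_sum (\<lambda>c. op_at V 3 (S c) 0 2)) (in_z2 (\<lambda>c. op_at V 3 (S c) 1 2))) a b t =
        comp2 (ctens V 3) (in_z2 (\<lambda>c. op_at V 3 (S c) 1 2))
          (comp2 (ctens V 3) (in_sum (\<lambda>c. op_at V 3 (S c) 0 2)) (in_z1 (\<lambda>c. op_at V 3 (S c) 0 1))) a b t) \<and>
     (\<forall>t\<in>carrier (ctens V 2). \<forall>a.
        hsum (ctens V 2) (\<lambda>p. op_at V 2 (S p) 1 0 (fps_const ((- 1) powi (a - p)) \<odot>\<^bsub>ctens V 2\<^esub> S (a - p) t)) =
        (if a = 0 then t else \<zero>\<^bsub>ctens V 2\<^esub>)) \<and>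
     (\<forall>v\<in>carrier V. \<forall>c. S c (pure V [vac V, v]) = (if c = 0 then pure V [vac V, v] else \<zero>\<^bsub>ctens V 2\<^esub>)) \<and>
     S_local V S \<and>
     (\<forall>t\<in>carrier (ctens V 3). \<forall>a b.
        S a (Y_at V 2 0 b t) =
        comp2 (ctens V 2) (in_z2 (Y_at V 2 0))
          (comp2 (ctens V 3) (in_z1 (\<lambda>c. op_at V 3 (S c) 1 2)) (in_sum (\<lambda>c. op_at V 3 (S c) 0 2))) a b t)"

definition quantum_va_iso :: "'v hva \<Rightarrow> (int \<Rightarrow> 'v tens \<Rightarrow> 'v tens) \<Rightarrow>
    'w hva \<Rightarrow> (int \<Rightarrow> 'w tens \<Rightarrow> 'w tens) \<Rightarrow> ('v \<Rightarrow> 'w) set" where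
  "quantum_va_iso V S V' S' = {f \<in> va_iso V V'.
     (\<forall>t\<in>carrier (ctens V 2). \<forall>c. map_tens V' 2 f (S c t) = S' c (map_tens V' 2 f t))}"


section \<open>Cartan data and the series \<open>\<tau>\<close>\<close>

text \<open>A generalized Cartan matrix together with relatively prime positive integers \<open>r i\<close> such that
  \<open>r i * a i j\<close> is symmetric. (They are unique if the matrix is indecomposable.)\<close>
definition symmetrizable_gcm :: "('i::finite \<Rightarrow> 'i \<Rightarrow> int) \<Rightarrow> ('i \<Rightarrow> nat) \<Rightarrow> bool" where
  "symmetrizable_gcm a r \<longleftrightarrow> (\<forall>i. a i i = 2) \<and> (\<forall>i j. i \<noteq> j \<longrightarrow> a i j \<le> 0) \<and>
     (\<forall>i j. a i j = 0 \<longleftrightarrow> a j i = 0) \<and>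
     (\<forall>i. 0 < r i) \<and> Gcd (range r) = 1 \<and> (\<forall>i j. int (r i) * a i j = int (r j) * a j i)"

definition ra :: "('i \<Rightarrow> 'i \<Rightarrow> int) \<Rightarrow> ('i \<Rightarrow> nat) \<Rightarrow> 'i \<Rightarrow> 'i \<Rightarrow> complex" where
  "ra a r i j = of_nat (r i) * of_int (a i j)"

definition rl :: "('i \<Rightarrow> nat) \<Rightarrow> complex \<Rightarrow> complex" where
  "rl r l = of_nat (Lcm (range r)) * l"

datatype slot = Nought | Bullet

type_synonym 'i tau = "slot \<Rightarrow> slot \<Rightarrow> 'i \<Rightarrow> 'i \<Rightarrow> complex fps fps"

definition tau_set :: "('i \<Rightarrow> nat) \<Rightarrow> complex \<Rightarrow> 'i tau set" where
  "tau_set r l = {t. \<forall>i j.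
     t Bullet Bullet i j $ 0 $ 0 = 1 \<and>
     F_fps (t Nought Nought i j) = hD_fps (fps_exp (- rl r l)) (t Nought Bullet i j) -
                                   hD_fps (fps_exp (rl r l)) (t Nought Bullet i j) \<and>
     F_fps (t Nought Nought i j) = hD_fps (fps_exp (- rl r l)) (t Bullet Nought i j) -
                                   hD_fps (fps_exp (rl r l)) (t Bullet Nought i j) \<and>
     hD_fps (fps_exp (- rl r l)) (t Bullet Bullet i j) *
       inverse (hD_fps (fps_exp (rl r l)) (t Bullet Bullet i j)) =
       exp_zh (F_fps (t Bullet Nought i j)) \<and>
     hD_fps (fps_exp (- rl r l)) (t Bullet Bullet i j) *
       inverse (hD_fps (fps_exp (rl r l)) (t Bullet Bullet i j)) =
       exp_zh (F_fps (t Nought Bullet i j))}"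

definition f0 :: "complex fps" where
  "f0 = fps_compose (fps_ln 1) ((fps_exp (1 / 2) - fps_exp (- (1 / 2))) / fps_X - 1)"

fun tau_trig :: "('i \<Rightarrow> 'i \<Rightarrow> int) \<Rightarrow> ('i \<Rightarrow> nat) \<Rightarrow> complex \<Rightarrow> 'i tau" where
  "tau_trig a r l Nought Nought i j =
     hD_fps (fps_exp (- ra a r i j) * qnum (rl r l) ^ 2) (fps_const (fps_deriv (fps_deriv f0)))"
| "tau_trig a r l Bullet Nought i j =
     - hD_fps (fps_exp (- ra a r i j) * qnum (rl r l)) (fps_const (fps_deriv f0))"
| "tau_trig a r l Nought Bullet i j =
     - hD_fps (fps_exp (- ra a r i j) * qnum (rl r l)) (fps_const (fps_deriv f0))"
| "tau_trig a r l Bullet Bullet i j = exp_zh (hD_fps (fps_exp (- ra a r i j)) (fps_const f0))"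


section \<open>The two categories of modules\<close>

datatype sign = Pos | Neg

fun sg :: "sign \<Rightarrow> int" where "sg Pos = 1" | "sg Neg = - 1"

datatype 'i gen = Hg 'i | Xg sign 'i

text \<open>\<open>[c] (q^(-d D) iota12 - q^(d D) iota21) f(z1 - z2)\<close> with \<open>D = d/dz2\<close>\<close>
definition comm_series :: "complex \<Rightarrow> complex \<Rightarrow> complex fls fps \<Rightarrow> int \<Rightarrow> int \<Rightarrow> complex fps" where
  "comm_series c d f = hD_two (qnum c)
     (\<lambda>a b. hD_two (fps_exp (- d)) (iota12 f) a b - hD_two (fps_exp d) (iota21 f) a b)"

definition rel_hh :: "(complex fps, 'v, 'm) module_scheme \<Rightarrow> (int \<Rightarrow> 'v \<Rightarrow> 'v) \<Rightarrow> (int \<Rightarrow> 'v \<Rightarrow> 'v) \<Rightarrow>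
    (int \<Rightarrow> int \<Rightarrow> complex fps) \<Rightarrow> bool" where
  "rel_hh W h h' G \<longleftrightarrow> (\<forall>w\<in>carrier W. \<forall>a b.
     h a (h' b w) \<ominus>\<^bsub>W\<^esub> h' b (h a w) = G a b \<odot>\<^bsub>W\<^esub> w)"

text \<open>\<open>[h(z1), x(z2)] = x(z2) G(z1, z2)\<close>\<close>
definition rel_hx :: "(complex fps, 'v, 'm) module_scheme \<Rightarrow> (int \<Rightarrow> 'v \<Rightarrow> 'v) \<Rightarrow> (int \<Rightarrow> 'v \<Rightarrow> 'v) \<Rightarrow>
    (int \<Rightarrow> int \<Rightarrow> complex fps) \<Rightarrow> bool" where
  "rel_hx W h x G \<longleftrightarrow> (\<forall>w\<in>carrier W. \<forall>a b.
     h a (x b w) \<ominus>\<^bsub>W\<^esub> x b (h a w) =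
     smul2 W G (\<lambda>a b. if a = 0 then x b w else \<zero>\<^bsub>W\<^esub>) a b)"

text \<open>\<open>G x(z1) y(z2) = G' y(z2) x(z1)\<close>\<close>
definition rel_xx :: "(complex fps, 'v, 'm) module_scheme \<Rightarrow> (int \<Rightarrow> 'v \<Rightarrow> 'v) \<Rightarrow> (int \<Rightarrow> 'v \<Rightarrow> 'v) \<Rightarrow>
    (int \<Rightarrow> int \<Rightarrow> complex fps) \<Rightarrow> (int \<Rightarrow> int \<Rightarrow> complex fps) \<Rightarrow> bool" where
  "rel_xx W x y G G' \<longleftrightarrow> (\<forall>w\<in>carrier W. \<forall>a b.
     smul2 W G (\<lambda>a b. x a (y b w)) a b = smul2 W G' (\<lambda>a b. y b (x a w)) a b)"

text \<open>\<open>P(z1 - z2) (x(z1) y(z2) - G y(z2) x(z1)) = 0\<close> for a polynomial \<open>P\<close>\<close>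
definition rel_xy :: "(complex fps, 'v, 'm) module_scheme \<Rightarrow> (int \<Rightarrow> 'v \<Rightarrow> 'v) \<Rightarrow> (int \<Rightarrow> 'v \<Rightarrow> 'v) \<Rightarrow>
    complex fls fps \<Rightarrow> (int \<Rightarrow> int \<Rightarrow> complex fps) \<Rightarrow> bool" where
  "rel_xy W x y P G \<longleftrightarrow> (\<forall>w\<in>carrier W. \<forall>a b.
     smul2 W (iota12 P) (\<lambda>a b. x a (y b w) \<ominus>\<^bsub>W\<^esub> smul2 W G (\<lambda>a b. y b (x a w)) a b) a b = \<zero>\<^bsub>W\<^esub>)"

definition delta_poly :: "('i \<Rightarrow> nat) \<Rightarrow> complex \<Rightarrow> 'i \<Rightarrow> 'i \<Rightarrow> complex fls fps" where
  "delta_poly r l i j = (if i = j then zv * (zv + hmon (2 * rl r l)) else 1)"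

definition M_tau :: "('i \<Rightarrow> 'i \<Rightarrow> int) \<Rightarrow> ('i \<Rightarrow> nat) \<Rightarrow> complex \<Rightarrow> 'i tau \<Rightarrow>
    (complex fps, 'v, 'm) module_scheme \<Rightarrow> ('i gen \<Rightarrow> int \<Rightarrow> 'v \<Rightarrow> 'v) \<Rightarrow> bool" where
  "M_tau a r l t W x \<longleftrightarrow> topologically_free W \<and> (\<forall>s. is_field W (x s)) \<and>
     (\<forall>i j. rel_hh W (x (Hg i)) (x (Hg j))
        (\<lambda>m n. hD_two (qnum (ra a r i j)) (comm_series (rl r l) (rl r l) (inverse zv ^ 2)) m n
           + iota12 (temb (t Nought Nought i j) - temb (reflect (t Nought Nought j i))) m n)) \<and>
     (\<forall>i j e. rel_hx W (x (Hg i)) (x (Xg e j))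
        (\<lambda>m n. of_int (sg e) * (comm_series (ra a r i j) (rl r l) (inverse zv) m n
           + iota12 (temb (t Nought Bullet i j) + temb (reflect (t Bullet Nought j i))) m n))) \<and>
     (\<forall>i j. rel_xy W (x (Xg Pos i)) (x (Xg Neg j)) (delta_poly r l i j)
        (iota21 ((- zv + hmon (ra a r i j)) * temb (t Bullet Bullet i j) /
                 ((- zv - hmon (ra a r i j)) * temb (reflect (t Bullet Bullet j i)))))) \<and>
     (\<forall>i j e. rel_xx W (x (Xg e i)) (x (Xg e j))
        (iota12 ((zv - hmon (ra a r i j)) * temb (t Bullet Bullet i j)))
        (iota12 ((zv + hmon (ra a r i j)) * temb (reflect (t Bullet Bullet j i)))))"

text \<open>\<open>e^(-z1+z2)\<close> as a series in \<open>z = z1 - z2\<close>\<close>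
abbreviation expm :: "complex fls fps" where
  "expm \<equiv> fps_const (fps_to_fls (fps_exp (- 1)))"

text \<open>\<open>q_i^(a_ij)\<close>\<close>
definition qa :: "('i \<Rightarrow> 'i \<Rightarrow> int) \<Rightarrow> ('i \<Rightarrow> nat) \<Rightarrow> 'i \<Rightarrow> 'i \<Rightarrow> complex fls fps" where
  "qa a r i j = hemb (fps_exp (ra a r i j))"

definition M_hat :: "('i \<Rightarrow> 'i \<Rightarrow> int) \<Rightarrow> ('i \<Rightarrow> nat) \<Rightarrow> complex \<Rightarrow>
    (complex fps, 'v, 'm) module_scheme \<Rightarrow> ('i gen \<Rightarrow> int \<Rightarrow> 'v \<Rightarrow> 'v) \<Rightarrow> bool" where
  "M_hat a r l W x \<longleftrightarrow> topologically_free W \<and> (\<forall>s. is_field W (x s)) \<and>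
     (\<forall>i j. rel_hh W (x (Hg i)) (x (Hg j))
        (hD_two (qnum (ra a r i j)) (comm_series (rl r l) (rl r l) (expm / (1 - expm) ^ 2)))) \<and>
     (\<forall>i j e. rel_hx W (x (Hg i)) (x (Xg e j))
        (\<lambda>m n. of_int (sg e) * comm_series (ra a r i j) (rl r l) ((1 + expm) / (2 - 2 * expm)) m n)) \<and>
     (\<forall>i j e. rel_xx W (x (Xg e i)) (x (Xg e j))
        (iota12 ((1 - qa a r i j * expm) / (if i = j then 1 - expm else 1)))
        (iota21 ((qa a r i j - expm) / (if i = j then 1 - expm else 1)))) \<and>
     (\<forall>i j. rel_xy W (x (Xg Pos i)) (x (Xg Neg j)) (delta_poly r l i j)
        (iota21 ((1 - qa a r i j * expm) / (qa a r i j - expm))))"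


section \<open>The quotients\<close>

text \<open>\<open>exp((-q^(-d D) F(D) h)_(-1)) 1\<close>\<close>
definition exp_vec :: "'v hva \<Rightarrow> complex \<Rightarrow> 'v \<Rightarrow> 'v" where
  "exp_vec V d h =
     (let y = \<ominus>\<^bsub>V\<^esub> hD_va V (fps_exp (- d)) (fps_X \<odot>\<^bsub>V\<^esub> hD_va V Fser h)
      in hsum V (\<lambda>k. fps_const (1 / fact k) \<odot>\<^bsub>V\<^esub> (nprod V (- 1) y ^^ k) (vac V)))"

definition E_tau :: "('i \<Rightarrow> nat) \<Rightarrow> complex \<Rightarrow> 'i tau \<Rightarrow> 'v hva \<Rightarrow> ('i gen \<Rightarrow> 'v) \<Rightarrow> 'i \<Rightarrow> 'v" where
  "E_tau r l t V g i =
     (fps_sqrt (eval_zh (t Bullet Bullet i i) (- 2 * rl r l)) /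
      fps_sqrt (eval_zh (t Bullet Bullet i i) (2 * rl r l))) \<odot>\<^bsub>V\<^esub> exp_vec V (rl r l) (g (Hg i))"

definition E_hat :: "('i \<Rightarrow> nat) \<Rightarrow> complex \<Rightarrow> 'v hva \<Rightarrow> ('i gen \<Rightarrow> 'v) \<Rightarrow> 'i \<Rightarrow> 'v" where
  "E_hat r l V g i =
     fps_sqrt (Fval (of_nat (r i) + rl r l) / Fval (of_nat (r i) - rl r l))
       \<odot>\<^bsub>V\<^esub> exp_vec V (rl r l) (g (Hg i))"

definition serre :: "('i \<Rightarrow> 'i \<Rightarrow> int) \<Rightarrow> 'v hva \<Rightarrow> ('i gen \<Rightarrow> 'v) \<Rightarrow> 'v set" where
  "serre a V g = {(nprod V 0 (g (Xg e i)) ^^ nat (1 - a i j)) (g (Xg e j)) | e i j. a i j \<le> 0}"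

definition R1_tau :: "('i \<Rightarrow> 'i \<Rightarrow> int) \<Rightarrow> ('i \<Rightarrow> nat) \<Rightarrow> complex \<Rightarrow> 'i tau \<Rightarrow>
    'v hva \<Rightarrow> ('i gen \<Rightarrow> 'v) \<Rightarrow> 'v set" where
  "R1_tau a r l t V g =
     {nprod V 0 (g (Xg Pos i)) (g (Xg Neg i)) \<ominus>\<^bsub>V\<^esub>
        hdiv V (of_nat (2 * r i) * fps_X) (vac V \<ominus>\<^bsub>V\<^esub> E_tau r l t V g i) | i. True} \<union>
     {nprod V 1 (g (Xg Pos i)) (g (Xg Neg i)) \<ominus>\<^bsub>V\<^esub>
        fps_const (rl r l / of_nat (r i)) \<odot>\<^bsub>V\<^esub> E_tau r l t V g i | i. True} \<union>
     serre a V g"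

text \<open>\<open>q_i - q_i^(-1)\<close>\<close>
definition qdiff :: "('i \<Rightarrow> nat) \<Rightarrow> 'i \<Rightarrow> complex fps" where
  "qdiff r i = fps_exp (of_nat (r i)) - fps_exp (- of_nat (r i))"

definition R1_hat :: "('i \<Rightarrow> 'i \<Rightarrow> int) \<Rightarrow> ('i \<Rightarrow> nat) \<Rightarrow> complex \<Rightarrow>
    'v hva \<Rightarrow> ('i gen \<Rightarrow> 'v) \<Rightarrow> 'v set" where
  "R1_hat a r l V g =
     {nprod V 0 (g (Xg Pos i)) (g (Xg Neg i)) \<ominus>\<^bsub>V\<^esub>
        hdiv V (qdiff r i) (vac V \<ominus>\<^bsub>V\<^esub> E_hat r l V g i) | i. True} \<union>
     {nprod V 1 (g (Xg Pos i)) (g (Xg Neg i)) \<ominus>\<^bsub>V\<^esub>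
        (fps_const (2 * rl r l) * fps_X / qdiff r i) \<odot>\<^bsub>V\<^esub> E_hat r l V g i | i. True} \<union>
     serre a V g"

definition R2 :: "('i \<Rightarrow> nat) \<Rightarrow> nat \<Rightarrow> 'v hva \<Rightarrow> ('i gen \<Rightarrow> 'v) \<Rightarrow> 'v set" where
  "R2 r k V g = {(nprod V (- 1) (g (Xg e i)) ^^ (Lcm (range r) * k div r i)) (g (Xg e i)) | e i. True}"

text \<open>Below \<open>U\<close> with generators \<open>g\<close> stands for the universal algebra of the respective category;
  \<open>K1_\<close>, \<open>K2_\<close> are the ideals that are factored out, and \<open>gV_\<close>, \<open>gL_\<close> the images of the generators.
  The natural number \<open>k\<close> is the level \<open>l\<close> in the case of the algebras \<open>L\<close>.\<close>

definition "K1_tau a r l t U g = hclosure U (saturate U (ideal_gen U (R1_tau a r l t U g)))"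
definition "V_tau a r l t U g = va_quot U (K1_tau a r l t U g)"
definition "gV_tau a r l t U g s = K1_tau a r l t U g +>\<^bsub>U\<^esub> g s"

definition "K2_tau a r k t U g =
  (let V = V_tau a r (of_nat k) t U g
   in hclosure V (saturate V (ideal_gen V (R2 r k V (gV_tau a r (of_nat k) t U g)))))"
definition "L_tau a r k t U g = va_quot (V_tau a r (of_nat k) t U g) (K2_tau a r k t U g)"
definition "gL_tau a r k t U g s =
  K2_tau a r k t U g +>\<^bsub>V_tau a r (of_nat k) t U g\<^esub> gV_tau a r (of_nat k) t U g s"

definition "K1_hat a r l U g = closed_ideal_gen U (R1_hat a r l U g)"
definition "V_hat a r l U g = va_quot U (K1_hat a r l U g)"
definition "gV_hat a r l U g s = K1_hat a r l U g +>\<^bsub>U\<^esub> g s"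

definition "K2_hat a r k U g =
  (let V = V_hat a r (of_nat k) U g
   in closed_ideal_gen V (R2 r k V (gV_hat a r (of_nat k) U g)))"
definition "L_hat a r k U g = va_quot (V_hat a r (of_nat k) U g) (K2_hat a r k U g)"
definition "gL_hat a r k U g s =
  K2_hat a r k U g +>\<^bsub>V_hat a r (of_nat k) U g\<^esub> gV_hat a r (of_nat k) U g s"

text \<open>\<open>[c] (q^(d D) - q^(-d D)) f\<close> with \<open>D = d/dz\<close>\<close>
definition qdiff_fls :: "complex \<Rightarrow> complex \<Rightarrow> complex fls fps \<Rightarrow> complex fls fps" where
  "qdiff_fls c d f = hD_fls (qnum c) (hD_fls (fps_exp d - fps_exp (- d)) f)"

text \<open>The values of the quantum Yang--Baxter operator on the generators.\<close>
definition S_on_gens :: "('i \<Rightarrow> 'i \<Rightarrow> int) \<Rightarrow> ('i \<Rightarrow> nat) \<Rightarrow> complex \<Rightarrow> 'i tau \<Rightarrow>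
    'v hva \<Rightarrow> ('i gen \<Rightarrow> 'v) \<Rightarrow> (int \<Rightarrow> 'v tens \<Rightarrow> 'v tens) \<Rightarrow> bool" where
  "S_on_gens a r l t V g S \<longleftrightarrow>
     (let T = ctens V 2; one_at = (\<lambda>c. if c = 0 then 1 else 0 :: complex fps) in
     (\<forall>i j c. S c (pure V [g (Hg j), g (Hg i)]) =
        one_at c \<odot>\<^bsub>T\<^esub> pure V [g (Hg j), g (Hg i)] \<oplus>\<^bsub>T\<^esub>
        zcoef (hD_fls (qnum (ra a r i j)) (qdiff_fls (rl r l) (- rl r l) (inverse zv ^ 2))
               + temb (reflect (t Nought Nought i j)) - temb (t Nought Nought j i)) c
          \<odot>\<^bsub>T\<^esub> pure V [vac V, vac V]) \<and>
     (\<forall>i j e c. S c (pure V [g (Hg j), g (Xg e i)]) =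
        one_at c \<odot>\<^bsub>T\<^esub> pure V [g (Hg j), g (Xg e i)] \<oplus>\<^bsub>T\<^esub>
        (- of_int (sg e) * zcoef (qdiff_fls (ra a r j i) (rl r l) (inverse zv)
               + temb (reflect (t Bullet Nought i j)) + temb (t Nought Bullet j i)) c)
          \<odot>\<^bsub>T\<^esub> pure V [vac V, g (Xg e i)]) \<and>
     (\<forall>i j e c. S c (pure V [g (Xg e j), g (Hg i)]) =
        one_at c \<odot>\<^bsub>T\<^esub> pure V [g (Xg e j), g (Hg i)] \<oplus>\<^bsub>T\<^esub>
        (of_int (sg e) * zcoef (qdiff_fls (ra a r i j) (rl r l) (inverse zv)
               + temb (reflect (t Nought Bullet i j)) + temb (t Bullet Nought j i)) c)
          \<odot>\<^bsub>T\<^esub> pure V [g (Xg e j), vac V]) \<and>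
     (\<forall>i j e1 e2 c. S c (pure V [g (Xg e1 j), g (Xg e2 i)]) =
        zcoef ((temb (t Bullet Bullet j i) / temb (reflect (t Bullet Bullet i j))) powi (sg e1 * sg e2) *
               ((zv - of_int (sg e1 * sg e2) * hmon (ra a r i j)) /
                (zv + of_int (sg e1 * sg e2) * hmon (ra a r i j)))) c
          \<odot>\<^bsub>T\<^esub> pure V [g (Xg e1 j), g (Xg e2 i)]))"

definition maps_gens :: "('i \<Rightarrow> nat) \<Rightarrow> ('i gen \<Rightarrow> 'v) \<Rightarrow> 'w hva \<Rightarrow> ('i gen \<Rightarrow> 'w) \<Rightarrow> ('v \<Rightarrow> 'w) \<Rightarrow> bool" where
  "maps_gens r g V' g' f \<longleftrightarrow> (\<forall>i. f (g (Hg i)) = g' (Hg i) \<and>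
     f (g (Xg Pos i)) = (qdiff r i / (of_nat (2 * r i) * fps_X)) \<odot>\<^bsub>V'\<^esub> g' (Xg Pos i) \<and>
     f (g (Xg Neg i)) = g' (Xg Neg i))"

end

theory Submission
 imports Defs
begin

text \<open>
For the trigonometric \<open>\<tau>\<close> the rational coefficient of each relation, together with its \<open>\<tau>\<close>-term, is up to
multiplication by an invertible series the trigonometric coefficient. Hence rescaling \<open>x\<^sub>i\<^sup>+\<close> by a unit identifies
the two categories of modules, and with them their universal algebras; under this identification the
generators of the ideals correspond up to units. The hexagon identity and unitarity determine a quantum
Yang-Baxter operator from its values on pairs of generators, so the isomorphism intertwines any two
operators given by the same values.
\<close>

section \<open>Modules over the power series ring\<close>

text \<open>Four obstacles shape the proof. For \<open>i = j\<close> the trigonometric relation has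
  the extra denominator \<open>1 - e^(-z1+z2)\<close>, and cancelling \<open>z1 - z2\<close> from an
  identity of formal distributions loses a delta-function term; only the equality of the two fields
  rules that term out. The two kinds of quotients are formed by different closure recipes, which
  agree because the closure of a saturated ideal is again saturated. Tensors are functionals on
  multilinear forms, so dividing a tensor by \<open>h\<close> has to produce another limit of finite
  sums; this rests on separating vectors by functionals modulo \<open>h\<close>. Finally, the
  hexagon identity opens only the first argument of \<open>S\<close>. Unitarity makes the flipped
  operator the inverse of \<open>S(-z)\<close>, and the inverse satisfies a hexagon identity of its
  own, which opens the second argument. Composites of operators are computed on bilinear forms with
  values in Laurent series, modulo each \<open>h ^ N\<close>, where the infinite sums become
  finite.\<close>

lemma ring_of_type_algebra_simps [simp]:
 "carrier (ring_of_type_algebra :: 'a::comm_ring_1 ring) = UNIV"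
 "x \<oplus>\<^bsub>(ring_of_type_algebra :: 'a::comm_ring_1 ring)\<^esub> y = x + y"
 "x \<otimes>\<^bsub>(ring_of_type_algebra :: 'a::comm_ring_1 ring)\<^esub> y = x * y"
 "\<zero>\<^bsub>(ring_of_type_algebra :: 'a::comm_ring_1 ring)\<^esub> = 0"
 "\<one>\<^bsub>(ring_of_type_algebra :: 'a::comm_ring_1 ring)\<^esub> = 1"
 by (simp_all add: ring_of_type_algebra_def)

lemma ring_of_type_algebra_uminus [simp]:
 "\<ominus>\<^bsub>(ring_of_type_algebra :: 'a::comm_ring_1 ring)\<^esub> x = - x"
proof -
 interpret R: ring "ring_of_type_algebra :: 'a ring" by (rule ring_from_type_algebra)
 show ?thesis using R.minus_equality[of "- x" x] by simp
qed

text \<open>The record operations of the scalar ring are traded for type-class operations once, so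
  that scalar identities can be settled by ordinary algebra. Arbitrary commutative scalars are
  allowed because both the complex numbers and the power series in \<open>h\<close> occur.\<close>

locale tmod = module "ring_of_type_algebra :: 'k::comm_ring_1 ring" M
 for M :: "('k::comm_ring_1, 'v, 'm) module_scheme" (structure)
begin

lemma sm_closed [simp]: "x \<in> carrier M ==> c \<odot> x \<in> carrier M"
 by simp

lemma sm_assoc: "x \<in> carrier M ==> a \<odot> (b \<odot> x) = (a * b) \<odot> x"
 using smult_assoc1[of a b x] by simp

lemma sm_add_l: "x \<in> carrier M ==> (a + b) \<odot> x = a \<odot> x \<oplus> b \<odot> x"
 using smult_l_distr[of a b x] by simp

lemma sm_add_r: "x \<in> carrier M ==> y \<in> carrier M ==> a \<odot> (x \<oplus> y) = a \<odot> x \<oplus> a \<odot> y"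
 using smult_r_distr[of a x y] by simp

lemma sm_one [simp]: "x \<in> carrier M ==> 1 \<odot> x = x"
 using smult_one[of x] by simp

lemma sm_0 [simp]: "x \<in> carrier M ==> 0 \<odot> x = \<zero>"
 using smult_l_null[of x] by simp

lemma sm_0_r [simp]: "a \<odot> \<zero> = \<zero>"
 using smult_r_null[of a] by simp

lemma sm_neg: "x \<in> carrier M ==> (- a) \<odot> x = \<ominus> (a \<odot> x)"
 using smult_l_minus[of a x] by simp

lemma sm_neg_r: "x \<in> carrier M ==> a \<odot> (\<ominus> x) = \<ominus> (a \<odot> x)"
 using smult_r_minus[of a x] by simp

lemma sm_minus_r: "x \<in> carrier M ==> y \<in> carrier M ==> a \<odot> (x \<ominus> y) = a \<odot> x \<ominus> a \<odot> y"
 by (simp add: minus_eq sm_add_r sm_neg_r)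

lemma sm_minus_l: "x \<in> carrier M ==> (a - b) \<odot> x = a \<odot> x \<ominus> b \<odot> x"
 using sm_add_l[of x a "- b"] by (simp add: minus_eq sm_neg)

lemma neg_as_smult: "x \<in> carrier M ==> \<ominus> x = (- 1) \<odot> x"
 by (simp add: sm_neg)

lemma minus_zero_iff: "x \<in> carrier M ==> y \<in> carrier M ==> x \<ominus> y = \<zero> \<longleftrightarrow> x = y"
 by (metis M.minus_eq M.r_neg M.minus_unique M.minus_minus a_inv_closed)

lemma minus_zero_r [simp]: "x \<in> carrier M ==> x \<ominus> \<zero> = x"
 by (simp add: minus_eq)

lemma minus_self [simp]: "x \<in> carrier M ==> x \<ominus> x = \<zero>"
 by (simp add: minus_eq r_neg)

lemma add_minus_cancel: "x \<in> carrier M ==> y \<in> carrier M ==> (x \<ominus> y) \<oplus> y = x"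
 by (simp add: minus_eq a_assoc l_neg)

lemma minus_add_eq:
 "a \<in> carrier M ==> b \<in> carrier M ==> c \<in> carrier M ==> d \<in> carrier M ==>
  (a \<oplus> b) \<ominus> (c \<oplus> d) = (a \<ominus> c) \<oplus> (b \<ominus> d)"
 by (simp add: minus_eq minus_add a_ac)

lemma minus_trans_eq:
 "a \<in> carrier M ==> b \<in> carrier M ==> c \<in> carrier M ==> (a \<ominus> b) \<oplus> (b \<ominus> c) = a \<ominus> c"
proof -
 assume a: "a \<in> carrier M" "b \<in> carrier M" "c \<in> carrier M"
 have "(a \<ominus> b) \<oplus> (b \<ominus> c) = a \<oplus> ((\<ominus> b \<oplus> b) \<oplus> \<ominus> c)"
  using a by (simp add: minus_eq a_assoc del: l_neg)
 then show ?thesis using a by (simp add: minus_eq l_neg)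
qed

lemma minus_minus_eq: "a \<in> carrier M ==> b \<in> carrier M ==> \<ominus> (a \<ominus> b) = b \<ominus> a"
 by (simp add: minus_eq minus_add a_comm)

end


locale tlin = A: tmod A + B: tmod B
 for A :: "('k::comm_ring_1, 'v, 'm) module_scheme" (structure)
  and B :: "('k::comm_ring_1, 'w, 'n) module_scheme" (structure)
  and f :: "'v => 'w" +
 assumes lin: "f \<in> linear_maps A B"
begin

lemma closed [simp]: "x \<in> carrier A ==> f x \<in> carrier B"
 using lin by (auto simp: linear_maps_def)

lemma add: "x \<in> carrier A ==> y \<in> carrier A ==> f (x \<oplus>\<^bsub>A\<^esub> y) = f x \<oplus>\<^bsub>B\<^esub> f y"
 using lin by (auto simp: linear_maps_def)

lemma smult: "x \<in> carrier A ==> f (c \<odot>\<^bsub>A\<^esub> x) = c \<odot>\<^bsub>B\<^esub> f x"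
 using lin by (auto simp: linear_maps_def)

lemma zero [simp]: "f \<zero>\<^bsub>A\<^esub> = \<zero>\<^bsub>B\<^esub>"
 using smult[of "\<zero>\<^bsub>A\<^esub>" 0] by simp

lemma neg: "x \<in> carrier A ==> f (\<ominus>\<^bsub>A\<^esub> x) = \<ominus>\<^bsub>B\<^esub> f x"
 by (simp add: A.neg_as_smult B.neg_as_smult smult)

lemma minus: "x \<in> carrier A ==> y \<in> carrier A ==> f (x \<ominus>\<^bsub>A\<^esub> y) = f x \<ominus>\<^bsub>B\<^esub> f y"
 by (simp add: A.minus_eq B.minus_eq add neg)

lemma finsum: "g \<in> F \<rightarrow> carrier A ==> f (finsum A g F) = finsum B (%i. f (g i)) F"
proof (induction F rule: infinite_finite_induct)
 case (insert x F)
 then have "g \<in> F \<rightarrow> carrier A" "g x \<in> carrier A" by auto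
 with insert show ?case by (simp add: Pi_def add)
qed (simp_all add: A.finsum_infinite B.finsum_infinite)

end

lemma tlinI: "tmod M ==> tmod N ==> f \<in> linear_maps M N ==> tlin M N f"
 by (simp add: tlin_def tlin_axioms_def)

lemma linear_mapsI:
 assumes "!!x. x \<in> carrier M ==> f x \<in> carrier N"
  and "!!x y. x \<in> carrier M ==> y \<in> carrier M ==> f (x \<oplus>\<^bsub>M\<^esub> y) = f x \<oplus>\<^bsub>N\<^esub> f y"
  and "!!c x. x \<in> carrier M ==> f (c \<odot>\<^bsub>M\<^esub> x) = c \<odot>\<^bsub>N\<^esub> f x"
 shows "f \<in> linear_maps M N"
 using assms by (auto simp: linear_maps_def)

locale hmod = tmod M for M :: "(complex fps, 'v, 'm) module_scheme" (structure)
begin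

lemma hpow_closed: "v \<in> hpow M n ==> v \<in> carrier M"
 by (auto simp: hpow_def)

lemma hpow_0 [simp]: "hpow M 0 = carrier M"
 by (force simp: hpow_def)

lemma hpow_zero [simp]: "\<zero> \<in> hpow M n"
 unfolding hpow_def by (rule CollectI, rule exI[of _ "\<zero>"]) simp

lemma hpow_smult: "v \<in> hpow M n ==> c \<odot> v \<in> hpow M n"
 unfolding hpow_def by (clarsimp simp: sm_assoc) (metis mult.commute sm_assoc sm_closed)

lemma hpow_add: "u \<in> hpow M n ==> v \<in> hpow M n ==> u \<oplus> v \<in> hpow M n"
 unfolding hpow_def by (clarsimp) (metis sm_add_r add.m_closed)

lemma hpow_neg: "u \<in> hpow M n ==> \<ominus> u \<in> hpow M n"
 using hpow_smult[of u n "- 1"] hpow_closed[of u n] by (simp add: neg_as_smult)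

lemma hpow_mono: "m <= n ==> v \<in> hpow M n ==> v \<in> hpow M m"
 unfolding hpow_def
proof clarsimp
 fix w assume "m <= n" "w \<in> carrier M"
 then show "EX va. fps_X ^ n \<odot> w = fps_X ^ m \<odot> va & va \<in> carrier M"
  by (intro exI[of _ "fps_X ^ (n - m) \<odot> w"]) (simp add: sm_assoc flip: power_add)
qed

lemma hpow_dvd: "v \<in> carrier M ==> fps_X ^ n dvd c ==> c \<odot> v \<in> hpow M n"
 unfolding hpow_def by (auto elim!: dvdE simp flip: sm_assoc)

lemma hpow_X: "v \<in> hpow M n ==> fps_X ^ k \<odot> v \<in> hpow M (k + n)"
 unfolding hpow_def by (auto simp: sm_assoc power_add)

lemma hpow_finsum: "(!!i. i \<in> F ==> g i \<in> hpow M n) ==> finsum M g F \<in> hpow M n"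
proof (induction F rule: infinite_finite_induct)
 case (insert x F)
 then have "g \<in> F \<rightarrow> carrier M" "g x \<in> carrier M" by (auto intro!: hpow_closed)
 with insert show ?case by (simp add: finsum_insert hpow_add)
qed (simp_all add: finsum_infinite)

lemma hcong_refl [simp]: "u \<in> carrier M ==> hcong M n u u"
 by (simp add: hcong_def)

lemma hcong_sym: "u \<in> carrier M ==> v \<in> carrier M ==> hcong M n u v ==> hcong M n v u"
 unfolding hcong_def using hpow_neg[of "u \<ominus> v" n] by (simp add: minus_minus_eq)

lemma hcong_trans:
 "u \<in> carrier M ==> v \<in> carrier M ==> w \<in> carrier M ==> hcong M n u v ==> hcong M n v w ==> hcong M n u w"
 unfolding hcong_def using hpow_add[of "u \<ominus> v" n "v \<ominus> w"] by (simp add: minus_trans_eq)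

lemma hcong_add:
 "[|a \<in> carrier M; b \<in> carrier M; c \<in> carrier M; d \<in> carrier M; hcong M n a c; hcong M n b d|]
  ==> hcong M n (a \<oplus> b) (c \<oplus> d)"
 unfolding hcong_def by (simp add: minus_add_eq hpow_add)

lemma hcong_hpow: "u \<in> carrier M ==> v \<in> hpow M n ==> hcong M n u v ==> u \<in> hpow M n"
 unfolding hcong_def using hpow_add[of "u \<ominus> v" n v] by (simp add: add_minus_cancel hpow_closed)

lemma hcong_finsum_superset:
 assumes "finite F'" "F \<subseteq> F'" "!!j. j \<in> F' ==> g j \<in> carrier M" "!!j. j \<in> F' - F ==> g j \<in> hpow M n"
 shows "hcong M n (finsum M g F') (finsum M g F)"
proof -
 have "finite F" using assms finite_subset by auto
 moreover have "F' = F \<union> (F' - F)" using assms by auto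
 ultimately have "finsum M g F' = finsum M g F \<oplus> finsum M g (F' - F)"
  using assms finsum_Un_disjoint[of F "F' - F" g] by (auto simp: Pi_def)
 moreover have "finsum M g (F' - F) \<in> hpow M n" using assms by (intro hpow_finsum) auto
 moreover have "finsum M g F \<in> carrier M" using assms by (intro finsum_closed) auto
 ultimately show ?thesis
  unfolding hcong_def using hpow_closed[of "finsum M g (F' - F)" n]
  by (metis a_assoc a_comm add.inv_closed minus_eq r_neg r_zero)
qed

end

lemma linear_maps_hpow:
 assumes "hmod M" "hmod N" "f \<in> linear_maps M N" "v \<in> hpow M n"
 shows "f v \<in> hpow N n"
proof -
 interpret tlin M N f using assms by (intro tlinI) (auto simp: hmod_def)
 show ?thesis using assms(4) unfolding hpow_def by (auto simp: smult)
qed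

text \<open>Families tending to zero \<open>h\<close>-adically. In a complete separated module the
  description that defines \<open>hsum\<close> is met, for such a family, by one and only one
  vector.\<close>

definition hnull :: "(complex fps, 'v, 'm) module_scheme => ('j => 'v) => bool" where
 "hnull M f \<longleftrightarrow> (ALL j. f j \<in> carrier M) & (ALL n. finite {j. f j \<notin> hpow M n})"

text \<open>Separated, torsion-free and complete: all that summation and division use of topological
  freeness. Completed tensor powers are shown to have these properties without exhibiting a space of
  constants for them.\<close>

locale hfree = hmod +
 assumes sep: "[|v \<in> carrier M; !!n. v \<in> hpow M n|] ==> v = \<zero>"
  and torsion_free: "[|v \<in> carrier M; fps_X \<odot> v = \<zero>|] ==> v = \<zero>"
  and cauchy: "[|!!n. s n \<in> carrier M; !!n. s (Suc n) \<ominus> s n \<in> hpow M n|] ==>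
   EX v:carrier M. ALL n. v \<ominus> s n \<in> hpow M n"
begin

lemma sep_eq: "[|u \<in> carrier M; v \<in> carrier M; !!n. hcong M n u v|] ==> u = v"
 using sep[of "u \<ominus> v"] by (auto simp: hcong_def minus_zero_iff)

lemma X_pow_torsion_free: "v \<in> carrier M ==> fps_X ^ n \<odot> v = \<zero> ==> v = \<zero>"
proof (induction n)
 case (Suc n)
 then show ?case using torsion_free[of "fps_X ^ n \<odot> v"] by (simp add: sm_assoc)
qed simp

text \<open>A nonzero power series is a power of \<open>h\<close> times a unit, so the absence of
  \<open>h\<close>-torsion excludes all torsion.\<close>

lemma smult_cancel:
 assumes "u \<in> carrier M" "v \<in> carrier M" "d \<odot> u = d \<odot> v" "d ~= 0"
 shows "u = v"
proof -
 have d: "d = fps_X ^ subdegree d * unit_factor d"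
  by (metis fps_unit_factor_decompose mult.commute fps_normalize_def normalize_mult_unit_factor assms(4))
 have u: "unit_factor d * inverse (unit_factor d) = 1"
  using assms(4) by (intro inverse_mult_eq_1') (simp add: fps_unit_factor_def)
 define w where "w = u \<ominus> v"
 have w: "w \<in> carrier M" using assms by (simp add: w_def)
 have "d \<odot> w = \<zero>" using assms by (simp add: w_def sm_minus_r)
 then have "fps_X ^ subdegree d \<odot> (unit_factor d \<odot> w) = \<zero>"
  using w d by (metis sm_assoc)
 then have "unit_factor d \<odot> w = \<zero>" using w X_pow_torsion_free[of "unit_factor d \<odot> w" "subdegree d"] by simp
 then have "inverse (unit_factor d) \<odot> (unit_factor d \<odot> w) = \<zero>" by simp
 then have "w = \<zero>" using w u by (simp add: sm_assoc mult.commute)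
 then show ?thesis using assms by (simp add: w_def minus_zero_iff)
qed

lemma hsums_unique: "hsums M f u ==> hsums M f v ==> (!!j. f j \<in> carrier M) ==> u = v"
proof (rule sep_eq)
 fix n assume u: "hsums M f u" and v: "hsums M f v" and f: "!!j. f j \<in> carrier M"
 obtain F G where "finite F" "finite G"
  "!!F'. finite F' ==> F \<subseteq> F' ==> hcong M n (finsum M f F') u"
  "!!F'. finite F' ==> G \<subseteq> F' ==> hcong M n (finsum M f F') v"
  using u v unfolding hsums_def by metis
 then have "hcong M n (finsum M f (F \<union> G)) u" "hcong M n (finsum M f (F \<union> G)) v" by auto
 moreover have "finsum M f (F \<union> G) \<in> carrier M" using f by (intro finsum_closed) auto
 ultimately show "hcong M n u v" using u v by (meson hcong_sym hcong_trans hsums_def)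
qed (auto simp: hsums_def)

lemma hsum_eqI: "hsums M f v ==> (!!j. f j \<in> carrier M) ==> hsum M f = v"
 unfolding hsum_def by (rule the_equality) (auto intro: hsums_unique)

text \<open>The sums over the finite sets of terms outside \<open>hpow M n\<close> form a Cauchy
  sequence, and its limit is the sum of the family.\<close>

lemma hnull_hsums_ex:
 assumes "hnull M f"
 shows "EX v. hsums M f v"
proof -
 let ?F = "%n. {j. f j \<notin> hpow M n}"
 let ?s = "%n. finsum M f (?F n)"
 have f: "!!j. f j \<in> carrier M" and fin: "!!n. finite (?F n)" using assms by (auto simp: hnull_def)
 have mono: "?F m \<subseteq> ?F n" if "m <= n" for m n using hpow_mono[OF that] by auto
 have s: "?s n \<in> carrier M" for n using f by (intro finsum_closed) auto
 have cg: "hcong M n (finsum M f F') (?s n)" if "finite F'" "?F n \<subseteq> F'" for F' n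
  using that f by (intro hcong_finsum_superset) auto
 have "EX v:carrier M. ALL n. v \<ominus> ?s n \<in> hpow M n"
 proof (rule cauchy)
  show "?s (Suc n) \<ominus> ?s n \<in> hpow M n" for n
   using cg[OF fin mono[of n "Suc n"]] by (simp add: hcong_def)
 qed (rule s)
 then obtain v where v: "v \<in> carrier M" "!!n. hcong M n v (?s n)" by (auto simp: hcong_def)
 have "hsums M f v"
  unfolding hsums_def
 proof (intro conjI allI exI[of _ "?F _"] impI fin v(1))
  fix n F' assume *: "finite F' & ?F n \<subseteq> F'"
  have c: "finsum M f F' \<in> carrier M" using f by (intro finsum_closed) auto
  show "hcong M n (finsum M f F') v"
   by (rule hcong_trans[OF c s[of n] v(1) cg hcong_sym[OF v(1) s v(2)]]) (use * in auto)
 qed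
 then show ?thesis ..
qed

lemma hsums_hsum: "hnull M f ==> hsums M f (hsum M f)"
 using hnull_hsums_ex[of f] hsum_eqI[of f] by (auto simp: hnull_def)

lemma hsum_closed [simp]: "hnull M f ==> hsum M f \<in> carrier M"
 using hsums_hsum by (auto simp: hsums_def)

lemma hsum_hcong:
 assumes "hnull M f" "finite F" "!!j. j \<notin> F ==> f j \<in> hpow M n"
 shows "hcong M n (finsum M f F) (hsum M f)"
proof -
 have f: "!!j. f j \<in> carrier M" using assms by (auto simp: hnull_def)
 obtain G where G: "finite G" "!!F'. finite F' ==> G \<subseteq> F' ==> hcong M n (finsum M f F') (hsum M f)"
  using hsums_hsum[OF assms(1)] unfolding hsums_def by metis
 have "hcong M n (finsum M f (F \<union> G)) (finsum M f F)"
  using assms f G by (intro hcong_finsum_superset) auto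
 moreover have "hcong M n (finsum M f (F \<union> G)) (hsum M f)" using G assms by auto
 moreover have "finsum M f F' \<in> carrier M" for F' using f by (intro finsum_closed) auto
 ultimately show ?thesis using assms by (meson hcong_sym hcong_trans hsum_closed)
qed

lemma hsum_hpow: "hnull M f ==> (!!j. f j \<in> hpow M n) ==> hsum M f \<in> hpow M n"
 using hsum_hcong[of f "{}" n] hcong_hpow[of "hsum M f" "\<zero>" n] hcong_sym[of "\<zero>" "hsum M f" n] by simp

lemma hsumsI:
 assumes "v \<in> carrier M" "!!j. f j \<in> carrier M"
  and "!!n. EX F. finite F & (ALL j. j \<notin> F --> f j \<in> hpow M n) & hcong M n (finsum M f F) v"
 shows "hsums M f v"
 unfolding hsums_def
proof (intro conjI allI assms(1))
 fix n
 obtain F where F: "finite F" "ALL j. j \<notin> F --> f j \<in> hpow M n" "hcong M n (finsum M f F) v"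
  using assms(3) by blast
 have c: "finsum M f F' \<in> carrier M" for F' using assms(2) by (intro finsum_closed) auto
 show "EX F. finite F & (ALL F'. finite F' & F \<subseteq> F' --> hcong M n (finsum M f F') v)"
 proof (intro exI[of _ F] conjI allI impI F(1))
  fix F' assume "finite F' & F \<subseteq> F'"
  then have "hcong M n (finsum M f F') (finsum M f F)"
   using F assms(2) by (intro hcong_finsum_superset) auto
  then show "hcong M n (finsum M f F') v" using F(3) c assms(1) hcong_trans by blast
 qed
qed

lemma hsum_finite:
 assumes "finite F" "!!j. f j \<in> carrier M" "!!j. j \<notin> F ==> f j = \<zero>"
 shows "hsum M f = finsum M f F"
 using assms by (intro hsum_eqI hsumsI finsum_closed) (auto intro!: exI[of _ F] finsum_closed)

lemma hnull_reindex:
 assumes "hnull M f" "inj \<pi>"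
 shows "hnull M (%j. f (\<pi> j))"
 unfolding hnull_def
proof (intro conjI allI)
 fix n
 have "{j. f (\<pi> j) \<notin> hpow M n} = \<pi> -` {j. f j \<notin> hpow M n}" by auto
 moreover have "finite {j. f j \<notin> hpow M n}" using assms by (auto simp: hnull_def)
 ultimately show "finite {j. f (\<pi> j) \<notin> hpow M n}"
  using finite_vimageI[OF _ assms(2)] by metis
qed (use assms in \<open>auto simp: hnull_def\<close>)

lemma hsum_reindex:
 assumes "hnull M f" "bij \<pi>"
 shows "hsum M (%j. f (\<pi> j)) = hsum M f"
proof (rule hsum_eqI)
 have f: "!!j. f j \<in> carrier M" using assms by (auto simp: hnull_def)
 then show "f (\<pi> j) \<in> carrier M" for j by simp
 show "hsums M (%j. f (\<pi> j)) (hsum M f)"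
 proof (rule hsumsI)
  fix n
  let ?F = "{j. f j \<notin> hpow M n}"
  have fin: "finite ?F" using assms by (auto simp: hnull_def)
  have inj: "inj \<pi>" and surj: "surj \<pi>" using assms by (auto simp: bij_def)
  have "finsum M f (\<pi> ` (\<pi> -` ?F)) = finsum M (%j. f (\<pi> j)) (\<pi> -` ?F)"
   using f inj by (intro finsum_reindex) (auto intro: inj_on_subset)
  then have "finsum M (%j. f (\<pi> j)) (\<pi> -` ?F) = finsum M f ?F"
   using surj_image_vimage_eq[OF surj, of ?F] by simp
  moreover have "hcong M n (finsum M f ?F) (hsum M f)" using assms fin by (intro hsum_hcong) auto
  ultimately show "EX F. finite F & (ALL j. j \<notin> F --> f (\<pi> j) \<in> hpow M n) &
    hcong M n (finsum M (%j. f (\<pi> j)) F) (hsum M f)"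
   using finite_vimageI[OF fin inj] by (intro exI[of _ "\<pi> -` ?F"]) auto
 qed (use assms f in auto)
qed

lemma hnull_inner:
 assumes "hnull M f"
 shows "hnull M (%k. f (j, k))"
 by (rule hnull_reindex[OF assms]) (simp add: inj_def)

lemma hnull_fst:
 assumes "hnull M f"
 shows "hnull M (%j. hsum M (%k. f (j, k)))"
 unfolding hnull_def
proof (intro conjI allI)
 fix n
 have "{j. hsum M (%k. f (j, k)) \<notin> hpow M n} \<subseteq> fst ` {p. f p \<notin> hpow M n}"
  using hsum_hpow[OF hnull_inner[OF assms]] by (force simp: image_iff)
 then show "finite {j. hsum M (%k. f (j, k)) \<notin> hpow M n}"
  using assms by (auto simp: hnull_def elim: finite_subset)
qed (use hnull_inner[OF assms] in auto)

lemma hcong_finsum: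
 "[|!!j. j \<in> F ==> f j \<in> carrier M; !!j. j \<in> F ==> g j \<in> carrier M; !!j. j \<in> F ==> hcong M n (f j) (g j)|]
  ==> hcong M n (finsum M f F) (finsum M g F)"
proof (induction F rule: infinite_finite_induct)
 case (insert x F)
 then show ?case by (simp add: Pi_def hcong_add finsum_closed)
qed (simp_all add: finsum_infinite)

lemma finsum_Sigma':
 assumes "finite F" "!!x. x \<in> F ==> finite (G x)" "!!x y. f (x, y) \<in> carrier M"
 shows "finsum M f (Sigma F G) = finsum M (%x. finsum M (%y. f (x, y)) (G x)) F"
 using assms(1,2)
proof (induction F)
 case (insert x F)
 have e: "Sigma (insert x F) G = Pair x ` G x \<union> Sigma F G" by auto
 have "finsum M f (Sigma (insert x F) G) = finsum M f (Pair x ` G x) \<oplus> finsum M f (Sigma F G)"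
  unfolding e using insert assms(3) by (intro finsum_Un_disjoint) auto
 moreover have "finsum M f (Pair x ` G x) = finsum M (%y. f (x, y)) (G x)"
  using assms(3) by (intro finsum_reindex) (auto simp: inj_on_def)
 ultimately show ?case using insert assms(3) by (simp add: Pi_def finsum_closed)
qed simp

text \<open>Modulo \<open>h ^ n\<close> only finitely many pairs matter, and the rectangle spanned
  by their projections reduces the claim to a finite double sum.\<close>

lemma hsum_Sigma:
 assumes "hnull M f"
 shows "hsum M (%j. hsum M (%k. f (j, k))) = hsum M f"
proof (rule hsum_eqI)
 have f: "!!j. f j \<in> carrier M" using assms by (auto simp: hnull_def)
 note in1 = hnull_inner[OF assms]
 show "hsum M (%k. f (j, k)) \<in> carrier M" for j using in1 by simp
 show "hsums M (%j. hsum M (%k. f (j, k))) (hsum M f)"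
 proof (rule hsumsI)
  fix n
  let ?P = "{p. f p \<notin> hpow M n}"
  have P: "finite ?P" using assms by (auto simp: hnull_def)
  let ?F = "fst ` ?P" let ?G = "snd ` ?P"
  have fin: "finite ?F" "finite ?G" using P by auto
  have 1: "hcong M n (finsum M f (?F \<times> ?G)) (hsum M f)"
   using assms fin by (intro hsum_hcong) (auto simp: image_iff)
  have 2: "finsum M f (?F \<times> ?G) = finsum M (%j. finsum M (%k. f (j, k)) ?G) ?F"
   using fin f by (intro finsum_Sigma') auto
  have 3: "hcong M n (finsum M (%j. finsum M (%k. f (j, k)) ?G) ?F) (finsum M (%j. hsum M (%k. f (j, k))) ?F)"
  proof (intro hcong_finsum)
   fix j
   show "finsum M (%k. f (j, k)) ?G \<in> carrier M" using f by (intro finsum_closed) auto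
   show "hsum M (%k. f (j, k)) \<in> carrier M" using in1 by simp
   show "hcong M n (finsum M (%k. f (j, k)) ?G) (hsum M (%k. f (j, k)))"
    using fin in1 by (intro hsum_hcong) (auto simp: image_iff)
  qed
  have "finsum M g F \<in> carrier M" if "!!j. g j \<in> carrier M" for g :: "'x => 'a" and F
   using that by (intro finsum_closed) auto
  then have "hcong M n (finsum M (%j. hsum M (%k. f (j, k))) ?F) (hsum M f)"
   using hcong_trans[OF _ _ _ hcong_sym[OF _ _ 3] 1[unfolded 2]] in1 f assms
   by (simp add: finsum_closed Pi_def)
  moreover have "hsum M (%k. f (j, k)) \<in> hpow M n" if "j \<notin> ?F" for j
   using that by (intro hsum_hpow in1) (auto simp: image_iff)
  ultimately show "EX F. finite F & (ALL j. j \<notin> F --> hsum M (%k. f (j, k)) \<in> hpow M n) &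
    hcong M n (finsum M (%j. hsum M (%k. f (j, k))) F) (hsum M f)"
   using fin by blast
 qed (use in1 assms in auto)
qed

end

text \<open>Linearity over the power series already forces continuity: \<open>h ^ n M\<close> is
  mapped into \<open>h ^ n N\<close>.\<close>

lemma hsum_linear:
 assumes "hfree M" "hfree N" "f \<in> linear_maps M N" "hnull M g"
 shows "f (hsum M g) = hsum N (%j. f (g j))"
proof -
 interpret M: hfree M by fact
 interpret N: hfree N by fact
 interpret tlin M N f using assms(3) by unfold_locales
 have g: "!!j. g j \<in> carrier M" using assms(4) by (auto simp: hnull_def)
 have "hsums N (%j. f (g j)) (f (hsum M g))"
 proof (rule N.hsumsI)
  fix n
  let ?F = "{j. g j \<notin> hpow M n}"
  have fin: "finite ?F" using assms by (auto simp: hnull_def)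
  have "hcong M n (finsum M g ?F) (hsum M g)" using assms fin by (intro M.hsum_hcong) auto
  then have "f (finsum M g ?F \<ominus>\<^bsub>M\<^esub> hsum M g) \<in> hpow N n"
   unfolding hcong_def by (intro linear_maps_hpow[OF _ _ assms(3)]) unfold_locales
  then have "hcong N n (finsum N (%j. f (g j)) ?F) (f (hsum M g))"
   using g assms by (simp add: hcong_def minus finsum Pi_def M.finsum_closed)
  then show "EX F. finite F & (ALL j. j \<notin> F --> f (g j) \<in> hpow N n) & hcong N n (finsum N (%j. f (g j)) F) (f (hsum M g))"
   using fin linear_maps_hpow[OF _ _ assms(3)] M.hmod_axioms N.hmod_axioms
   by (intro exI[of _ ?F]) auto
 qed (use g assms in auto)
 then show ?thesis using g by (intro N.hsum_eqI[symmetric]) auto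
qed

subsection \<open>Topologically free modules\<close>

text \<open>The isomorphism with \<open>V0[[h]]\<close> is passed on as coordinates, that is,
  through its inverse; bijectivity becomes the last two clauses.\<close>

lemma topologically_freeE:
 assumes "topologically_free M"
 obtains V0 :: "(complex, 'v) module" and co :: "'v => nat => 'v"
 where "tmod V0" "!!v n. v \<in> carrier M ==> co v n \<in> carrier V0"
  "!!u v n. u \<in> carrier M ==> v \<in> carrier M ==> co (u \<oplus>\<^bsub>M\<^esub> v) n = co u n \<oplus>\<^bsub>V0\<^esub> co v n"
  "!!c v n. v \<in> carrier M ==> co (c \<odot>\<^bsub>M\<^esub> v) n = finsum V0 (%k. (c $ k) \<odot>\<^bsub>V0\<^esub> co v (n - k)) {..n}"
  "!!u v. u \<in> carrier M ==> v \<in> carrier M ==> (!!n. co u n = co v n) ==> u = v"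
  "!!p. (!!n. p n \<in> carrier V0) ==> EX v:carrier M. ALL n. co v n = p n"
proof -
 obtain V0 :: "(complex, 'v) module" and f where V0: "module CR V0"
  and f: "f \<in> linear_maps (pseries V0) M" and b: "bij_betw f (carrier (pseries V0)) (carrier M)"
  using assms unfolding topologically_free_def by blast
 interpret V0: tmod V0 using V0 by (simp add: tmod_def)
 let ?P = "carrier (pseries V0)"
 define co where "co = inv_into ?P f"
 have coP: "co v \<in> ?P" if "v \<in> carrier M" for v
  using that b unfolding co_def by (metis bij_betw_imp_surj_on inv_into_into)
 have fco: "f (co v) = v" if "v \<in> carrier M" for v
  using that b unfolding co_def by (metis bij_betw_inv_into_right)
 have cof: "co (f p) = p" if "p \<in> ?P" for p
  using that b unfolding co_def by (simp add: bij_betw_inv_into_left)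
 have fM: "f p \<in> carrier M" if "p \<in> ?P" for p using that f by (auto simp: linear_maps_def)
 have Pa: "p \<oplus>\<^bsub>pseries V0\<^esub> q \<in> ?P" if "p \<in> ?P" "q \<in> ?P" for p q
  using that by (auto simp: pseries_def)
 have Ps: "c \<odot>\<^bsub>pseries V0\<^esub> q \<in> ?P" if "q \<in> ?P" for c q
  using that by (auto simp: pseries_def intro!: V0.finsum_closed)
 show ?thesis
 proof (rule that)
  show "tmod V0" by (fact V0.tmod_axioms)
  show "co v n \<in> carrier V0" if "v \<in> carrier M" for v n
   using coP[OF that] by (simp add: pseries_def)
  show "co (u \<oplus>\<^bsub>M\<^esub> v) n = co u n \<oplus>\<^bsub>V0\<^esub> co v n" if "u \<in> carrier M" "v \<in> carrier M" for u v n
  proof -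
   have "f (co u \<oplus>\<^bsub>pseries V0\<^esub> co v) = u \<oplus>\<^bsub>M\<^esub> v"
    using that f coP fco by (auto simp: linear_maps_def)
   then have "co (u \<oplus>\<^bsub>M\<^esub> v) = co u \<oplus>\<^bsub>pseries V0\<^esub> co v" using cof[OF Pa[OF coP coP]] that by metis
   then show ?thesis by (simp add: pseries_def)
  qed
  show "co (c \<odot>\<^bsub>M\<^esub> v) n = finsum V0 (%k. (c $ k) \<odot>\<^bsub>V0\<^esub> co v (n - k)) {..n}" if "v \<in> carrier M" for c v n
  proof -
   have "f (c \<odot>\<^bsub>pseries V0\<^esub> co v) = c \<odot>\<^bsub>M\<^esub> v"
    using that f coP fco by (auto simp: linear_maps_def)
   then have "co (c \<odot>\<^bsub>M\<^esub> v) = c \<odot>\<^bsub>pseries V0\<^esub> co v" using cof[OF Ps[OF coP]] that by metis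
   then show ?thesis by (simp add: pseries_def)
  qed
  show "u = v" if "u \<in> carrier M" "v \<in> carrier M" "!!n. co u n = co v n" for u v
   using that fco by (metis ext)
  show "EX v:carrier M. ALL n. co v n = p n" if "!!n. p n \<in> carrier V0" for p
  proof -
   have "p \<in> ?P" using that by (simp add: pseries_def)
   then show ?thesis using cof fM by (intro bexI[of _ "f p"]) auto
  qed
 qed
qed

lemma topologically_free_hfree:
 assumes "topologically_free M"
 shows "hfree M"
proof (rule topologically_freeE[OF assms])
 fix V0 :: "(complex, 'a) module" and co :: "'a => nat => 'a"
 assume "tmod V0" and coc: "!!v n. v \<in> carrier M ==> co v n \<in> carrier V0"
  and coa: "!!u v n. u \<in> carrier M ==> v \<in> carrier M ==> co (u \<oplus>\<^bsub>M\<^esub> v) n = co u n \<oplus>\<^bsub>V0\<^esub> co v n"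
  and cos: "!!c v n. v \<in> carrier M ==> co (c \<odot>\<^bsub>M\<^esub> v) n = finsum V0 (%k. (c $ k) \<odot>\<^bsub>V0\<^esub> co v (n - k)) {..n}"
  and coi: "!!u v. u \<in> carrier M ==> v \<in> carrier M ==> (!!n. co u n = co v n) ==> u = v"
  and cou: "!!p. (!!n. p n \<in> carrier V0) ==> EX v:carrier M. ALL n. co v n = p n"
 interpret hmod M using assms by (simp add: topologically_free_def tmod_def hmod_def)
 interpret V0: tmod V0 by fact
 \<comment> \<open>Multiplication by \<open>h ^ n\<close> shifts coordinates by \<open>n\<close>,
   which turns divisibility by \<open>h ^ n\<close> into the vanishing of the first \<open>n\<close>
   coordinates.\<close>
 have coX: "co (fps_X ^ n \<odot>\<^bsub>M\<^esub> v) m = (if m < n then \<zero>\<^bsub>V0\<^esub> else co v (m - n))" if v: "v \<in> carrier M" for n m v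
 proof (cases "m < n")
  case True
  have "finsum V0 (%k. (fps_X ^ n $ k) \<odot>\<^bsub>V0\<^esub> co v (m - k)) {..m} = finsum V0 (%k. \<zero>\<^bsub>V0\<^esub>) {..m}"
   using True coc[OF v] by (intro V0.finsum_cong') (auto simp: fps_X_power_nth)
  then show ?thesis using True v by (simp add: cos)
 next
  case False
  have "finsum V0 (%k. (fps_X ^ n $ k) \<odot>\<^bsub>V0\<^esub> co v (m - k)) {..m} =
   finsum V0 (%k. if n = k then co v (m - k) else \<zero>\<^bsub>V0\<^esub>) {..m}"
   using False coc[OF v] by (intro V0.finsum_cong') (auto simp: fps_X_power_nth)
  also have "... = co v (m - n)"
   using False coc[OF v] by (intro V0.finsum_singleton) auto
  finally show ?thesis using False v by (simp add: cos)
 qed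
 have co0: "co \<zero>\<^bsub>M\<^esub> n = \<zero>\<^bsub>V0\<^esub>" for n
  using coX[of "\<zero>\<^bsub>M\<^esub>" "Suc n" n] by simp
 have hp: "v \<in> hpow M n \<longleftrightarrow> (ALL m<n. co v m = \<zero>\<^bsub>V0\<^esub>)" if v: "v \<in> carrier M" for v n
 proof
  show "v \<in> hpow M n ==> ALL m<n. co v m = \<zero>\<^bsub>V0\<^esub>" unfolding hpow_def using coX by auto
  assume z: "ALL m<n. co v m = \<zero>\<^bsub>V0\<^esub>"
  obtain w where w: "w \<in> carrier M" "!!m. co w m = co v (m + n)"
   using cou[of "%m. co v (m + n)"] coc[OF v] by blast
  have "v = fps_X ^ n \<odot>\<^bsub>M\<^esub> w" by (rule coi) (use v w z coX in auto)
  then show "v \<in> hpow M n" using w unfolding hpow_def by auto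
 qed
 have com: "co (u \<ominus>\<^bsub>M\<^esub> v) n = co u n \<ominus>\<^bsub>V0\<^esub> co v n" if "u \<in> carrier M" "v \<in> carrier M" for u v n
 proof -
  have "co u n = co (u \<ominus>\<^bsub>M\<^esub> v) n \<oplus>\<^bsub>V0\<^esub> co v n"
   using that coa[of "u \<ominus>\<^bsub>M\<^esub> v" v n] by (simp add: add_minus_cancel)
  then show ?thesis using that coc by (simp add: V0.minus_eq V0.a_assoc V0.r_neg)
 qed
 show "hfree M"
 proof
  fix v assume v: "v \<in> carrier M"
  show "v = \<zero>\<^bsub>M\<^esub>" if "!!n. v \<in> hpow M n"
   by (rule coi) (use v that hp[OF v] co0 in \<open>auto\<close>)
  show "v = \<zero>\<^bsub>M\<^esub>" if "fps_X \<odot>\<^bsub>M\<^esub> v = \<zero>\<^bsub>M\<^esub>"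
  proof (rule coi)
   show "co v n = co \<zero>\<^bsub>M\<^esub> n" for n
    using coX[OF v, of 1 "Suc n"] that by (simp add: co0)
  qed (use v in auto)
 next
  fix s :: "nat => 'a"
  assume s: "!!n. s n \<in> carrier M" and d: "!!n. s (Suc n) \<ominus>\<^bsub>M\<^esub> s n \<in> hpow M n"
  have step: "co (s (Suc n)) m = co (s n) m" if "m < n" for n m
   using d[of n] that s[of n] s[of "Suc n"] coc hp by (simp add: com V0.minus_zero_iff)
  have st: "co (s n) m = co (s (Suc m)) m" if "Suc m <= n" for n m
   using that by (induction n rule: dec_induct) (auto simp: step)
  \<comment> \<open>Step \<open>n\<close> of the sequence only changes coordinates from
    \<open>n\<close> upwards, so coordinate \<open>m\<close> is constant from term
    \<open>m + 1\<close> on.\<close>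
  obtain v where v: "v \<in> carrier M" "!!m. co v m = co (s (Suc m)) m"
   using cou[of "%m. co (s (Suc m)) m"] coc[OF s] by blast
  show "EX v:carrier M. ALL n. v \<ominus>\<^bsub>M\<^esub> s n \<in> hpow M n"
  proof (intro bexI[of _ v] allI v(1))
   fix n
   have "co v m = co (s n) m" if "m < n" for m using v(2)[of m] st[of m n] that by simp
   then show "v \<ominus>\<^bsub>M\<^esub> s n \<in> hpow M n"
    using v(1) s[of n] coc by (simp add: hp com V0.minus_zero_iff)
  qed
 qed
qed

text \<open>The scalars as a module over themselves: convolutions of coefficients become instances
  of \<open>hsum\<close>, and evaluating a tensor at a form becomes a linear map between complete
  modules.\<close>

definition HM :: "(complex fps, complex fps) module" where
 "HM = \<lparr>carrier = UNIV, monoid.mult = (*), monoid.one = 1, ring.zero = 0, ring.add = (+), module.smult = (*)\<rparr>"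

lemma HM_simps [simp]: "carrier HM = UNIV" "\<zero>\<^bsub>HM\<^esub> = 0" "x \<oplus>\<^bsub>HM\<^esub> y = x + y" "x \<odot>\<^bsub>HM\<^esub> y = x * y"
 by (simp_all add: HM_def)

lemma hmod_HM: "hmod HM"
 unfolding hmod_def tmod_def
proof (rule moduleI)
 show "cring (ring_of_type_algebra :: complex fps ring)" by (rule cring_from_type_algebra)
 have "EX y. y + x = 0" for x :: "complex fps" by (rule exI[of _ "- x"]) simp
 then show "abelian_group HM"
  by (intro abelian_groupI) (auto simp: ac_simps)
qed (auto simp: algebra_simps)

lemma HM_minus [simp]: "x \<ominus>\<^bsub>HM\<^esub> y = x - y"
proof -
 interpret hmod HM by (rule hmod_HM)
 show ?thesis using sm_neg[of 1 y] neg_as_smult[of y] by (simp add: minus_eq)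
qed

lemma HM_finsum [simp]: "finsum HM f F = sum f F"
proof -
 interpret hmod HM by (rule hmod_HM)
 show ?thesis by (induction F rule: infinite_finite_induct) (auto simp: finsum_infinite)
qed

lemma HM_hpow [simp]: "x \<in> hpow HM n \<longleftrightarrow> fps_X ^ n dvd x"
 by (auto simp: hpow_def dvd_def)

lemma fps_X_power_dvd_iff: "(fps_X ^ n :: 'a::field fps) dvd x \<longleftrightarrow> (ALL m<n. x $ m = 0)"
proof
 assume "fps_X ^ n dvd x"
 then show "ALL m<n. x $ m = 0" by (auto elim!: dvdE simp: fps_X_power_mult_nth)
next
 assume z: "ALL m<n. x $ m = 0"
 have "x = fps_X ^ n * fps_shift n x"
  by (rule fps_ext) (auto simp: fps_X_power_mult_nth z)
 then show "fps_X ^ n dvd x" by (metis dvd_triv_left)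
qed

lemma hfree_HM: "hfree HM"
proof -
 interpret hmod HM by (rule hmod_HM)
 show ?thesis
 proof
  show "v = \<zero>\<^bsub>HM\<^esub>" if "!!n. v \<in> hpow HM n" for v
  proof -
   have "v $ n = 0" for n using that[of "Suc n"] unfolding HM_hpow fps_X_power_dvd_iff by auto
   then show ?thesis by (auto intro: fps_ext)
  qed
  show "v = \<zero>\<^bsub>HM\<^esub>" if "fps_X \<odot>\<^bsub>HM\<^esub> v = \<zero>\<^bsub>HM\<^esub>" for v using that by simp
 next
  fix s :: "nat => complex fps"
  assume "!!n. s (Suc n) \<ominus>\<^bsub>HM\<^esub> s n \<in> hpow HM n"
  then have step: "s (Suc n) $ m = s n $ m" if "m < n" for n m
   using that by (simp add: fps_X_power_dvd_iff)
  have st: "s n $ m = s (Suc m) $ m" if "Suc m <= n" for n m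
   using that by (induction n rule: dec_induct) (auto simp: step)
  show "EX v:carrier HM. ALL n. v \<ominus>\<^bsub>HM\<^esub> s n \<in> hpow HM n"
  proof (intro bexI[of _ "Abs_fps (%m. s (Suc m) $ m)"] allI)
   show "Abs_fps (%m. s (Suc m) $ m) \<ominus>\<^bsub>HM\<^esub> s n \<in> hpow HM n" for n
    using st[of _ n] by (auto simp: fps_X_power_dvd_iff simp del: fps_nth_Abs_fps) (auto)
  qed simp
 qed
qed

section \<open>Scalar series\<close>

subsection \<open>Operators \<open>P(h D)\<close> on power series\<close>

text \<open>The derivative in \<open>z\<close>. Since \<open>h\<close> is the outer variable,
  \<open>fps_deriv\<close> on \<open>complex fps fps\<close> is the derivative in
  \<open>h\<close>.\<close>

definition zderiv :: "complex fps fps => complex fps fps" where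
 "zderiv f = Abs_fps (%n. fps_deriv (f $ n))"

lemma zderiv_nth [simp]: "zderiv f $ n = fps_deriv (f $ n)"
 by (simp add: zderiv_def)

lemma fps_deriv_sum': "fps_deriv (sum f S) = (\<Sum>i\<in>S. fps_deriv (f i))"
 by (induction S rule: infinite_finite_induct) auto

lemma zderiv_add [simp]: "zderiv (f + g) = zderiv f + zderiv g"
 by (rule fps_ext) simp

lemma zderiv_mult: "zderiv (f * g) = zderiv f * g + f * zderiv g"
 by (rule fps_ext) (simp add: fps_mult_nth fps_deriv_sum' sum.distrib add.commute)

lemma hD_fps_nth:
 "hD_fps P f $ n = (\<Sum>k\<le>n. fps_const (P $ k) * (fps_deriv ^^ k) (f $ (n - k)))"
 by (simp add: hD_fps_def)

lemma fps_deriv_iter_add: "(fps_deriv ^^ k) (f + g) = (fps_deriv ^^ k) f + (fps_deriv ^^ k) (g :: complex fps)"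
 by (induction k) auto

lemma fps_deriv_iter_uminus: "(fps_deriv ^^ k) (- f) = - (fps_deriv ^^ k) (f :: complex fps)"
 by (induction k) auto

lemma fps_deriv_iter_const_mult:
 "(fps_deriv ^^ k) (fps_const c * f) = fps_const c * (fps_deriv ^^ k) (f :: complex fps)"
 by (induction k) auto

lemma fps_deriv_iter_0 [simp]: "(fps_deriv ^^ k) (0 :: complex fps) = 0"
 by (induction k) auto

lemma fps_deriv_iter_sum: "(fps_deriv ^^ k) (sum f S) = (\<Sum>i\<in>S. (fps_deriv ^^ k) (f i :: complex fps))"
 by (induction S rule: infinite_finite_induct) (auto simp: fps_deriv_iter_add)

lemma hD_fps_add: "hD_fps P (f + g) = hD_fps P f + hD_fps P g"
 by (rule fps_ext) (simp add: hD_fps_nth fps_deriv_iter_add sum.distrib algebra_simps)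

lemma hD_fps_uminus: "hD_fps P (- f) = - hD_fps P f"
 by (rule fps_ext) (simp add: hD_fps_nth fps_deriv_iter_uminus sum_negf)

lemma hD_fps_diff: "hD_fps P (f - g) = hD_fps P f - hD_fps P g"
 using hD_fps_add[of P f "- g"] by (simp add: hD_fps_uminus)

lemma hD_fps_add_l: "hD_fps (P + Q) f = hD_fps P f + hD_fps Q f"
 by (rule fps_ext) (simp add: hD_fps_nth sum.distrib algebra_simps flip: fps_const_add)

lemma hD_fps_uminus_l: "hD_fps (- P) f = - hD_fps P f"
 by (rule fps_ext) (simp add: hD_fps_nth sum_negf flip: fps_const_neg)

lemma hD_fps_diff_l: "hD_fps (P - Q) f = hD_fps P f - hD_fps Q f"
 using hD_fps_add_l[of P "- Q" f] by (simp add: hD_fps_uminus_l)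

lemma sum_triangle_nested:
 fixes n :: nat
 shows "(\<Sum>i\<le>n. \<Sum>j\<le>n - i. f i j) = (\<Sum>k\<le>n. \<Sum>i\<le>k. f i (k - i))"
proof -
 have "(\<Sum>i\<le>n. \<Sum>j\<le>n - i. f i j) = (\<Sum>(i, j)\<in>Sigma {..n} (%i. {..n - i}). f i j)"
  by (simp add: sum.Sigma)
 also have "Sigma {..n} (%i. {..n - i}) = {(i, j). i + j <= n}" by auto
 finally show ?thesis by (simp add: sum.triangle_reindex_eq)
qed

text \<open>All these operators are series in the single operator \<open>h d/dz\<close>, so
  composing them multiplies their symbols; regrouping by total order is a triangle sum.\<close>

lemma hD_fps_mult: "hD_fps P (hD_fps Q f) = hD_fps (P * Q) f"
proof (rule fps_ext)
 fix n
 have "hD_fps P (hD_fps Q f) $ n = (\<Sum>i\<le>n. \<Sum>j\<le>n - i. fps_const (P $ i * Q $ j) * (fps_deriv ^^ (i + j)) (f $ (n - (i + j))))"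
  by (simp add: hD_fps_nth fps_deriv_iter_sum fps_deriv_iter_const_mult sum_distrib_left mult.assoc
    funpow_add flip: fps_const_mult)
 also have "... = (\<Sum>k\<le>n. \<Sum>i\<le>k. fps_const (P $ i * Q $ (k - i)) * (fps_deriv ^^ k) (f $ (n - k)))"
  by (subst sum_triangle_nested) simp
 also have "... = (\<Sum>k\<le>n. fps_const ((P * Q) $ k) * (fps_deriv ^^ k) (f $ (n - k)))"
 proof (rule sum.cong[OF refl])
  fix k
  have "fps_const ((P * Q) $ k) = (\<Sum>i\<le>k. fps_const (P $ i * Q $ (k - i)))"
   by (rule fps_ext) (simp add: fps_mult_nth fps_sum_nth atLeast0AtMost)
  then show "(\<Sum>i\<le>k. fps_const (P $ i * Q $ (k - i)) * (fps_deriv ^^ k) (f $ (n - k))) =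
    fps_const ((P * Q) $ k) * (fps_deriv ^^ k) (f $ (n - k))"
   by (simp add: sum_distrib_right)
 qed
 finally show "hD_fps P (hD_fps Q f) $ n = hD_fps (P * Q) f $ n" by (simp add: hD_fps_nth)
qed

lemma hD_fps_nth_0: "hD_fps P f $ 0 = fps_const (P $ 0) * f $ 0"
 by (simp add: hD_fps_nth)

lemma hD_fps_X: "hD_fps fps_X f = fps_X * zderiv f"
proof (rule fps_ext)
 fix n
 have "hD_fps fps_X f $ n = (\<Sum>k\<in>{..n} \<inter> {1}. fps_const (fps_X $ k) * (fps_deriv ^^ k) (f $ (n - k)))"
  unfolding hD_fps_nth by (rule sum.mono_neutral_right) (auto simp: fps_X_nth)
 also have "... = (fps_X * zderiv f) $ n"
  by (cases n) auto
 finally show "hD_fps fps_X f $ n = (fps_X * zderiv f) $ n" .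
qed

lemma zderiv_hD: "zderiv (hD_fps P f) = hD_fps P (zderiv f)"
 by (rule fps_ext) (simp add: hD_fps_nth fps_deriv_sum' flip: funpow_swap1)

text \<open>The derivative in \<open>h\<close> hits the coefficients of \<open>f\<close> and, by the
  chain rule, the symbol, where it produces \<open>P'(h D) D f\<close>. For exponential symbols this
  is the evolution equation of the shift.\<close>

lemma fps_deriv_hD: "fps_deriv (hD_fps P f) = hD_fps P (fps_deriv f) + hD_fps (fps_deriv P) (zderiv f)"
proof (rule fps_ext)
 fix n
 let ?t = "%k. fps_const (P $ k) * (fps_deriv ^^ k) (f $ (Suc n - k))"
 have "fps_deriv (hD_fps P f) $ n = (\<Sum>k\<le>Suc n. of_nat (Suc n) * ?t k)"
  by (simp add: hD_fps_nth sum_distrib_left algebra_simps)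
 also have "... = (\<Sum>k\<le>Suc n. of_nat (Suc n - k) * ?t k + of_nat k * ?t k)"
  by (intro sum.cong refl) (auto simp: of_nat_diff algebra_simps)
 also have "... = (\<Sum>k\<le>Suc n. of_nat (Suc n - k) * ?t k) + (\<Sum>k\<le>Suc n. of_nat k * ?t k)"
  by (simp add: sum.distrib)
 also have "(\<Sum>k\<le>Suc n. of_nat (Suc n - k) * ?t k) = (\<Sum>k\<le>n. of_nat (Suc n - k) * ?t k)"
  by simp
 also have "... = hD_fps P (fps_deriv f) $ n"
  unfolding hD_fps_nth
 proof (rule sum.cong[OF refl])
  fix k assume k: "k \<in> {..n}"
  have "fps_deriv f $ (n - k) = fps_const (of_nat (Suc n - k)) * f $ (Suc n - k)"
   using k by (simp only: fps_deriv_nth fps_of_nat) (simp add: Suc_diff_le)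
  then have "(fps_deriv ^^ k) (fps_deriv f $ (n - k)) = of_nat (Suc n - k) * (fps_deriv ^^ k) (f $ (Suc n - k))"
   by (metis fps_deriv_iter_const_mult fps_of_nat)
  then show "of_nat (Suc n - k) * ?t k = fps_const (P $ k) * (fps_deriv ^^ k) (fps_deriv f $ (n - k))"
   by (simp only: mult.left_commute)
 qed
 also have "(\<Sum>k\<le>Suc n. of_nat k * ?t k) = (\<Sum>k\<le>n. of_nat (Suc k) * ?t (Suc k))"
  by (subst sum.atMost_Suc_shift) simp
 also have "... = hD_fps (fps_deriv P) (zderiv f) $ n"
  unfolding hD_fps_nth
 proof (rule sum.cong[OF refl])
  fix k
  have "fps_const (fps_deriv P $ k) = of_nat (Suc k) * fps_const (P $ Suc k)"
   by (simp add: fps_of_nat[symmetric] del: of_nat_Suc)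
  then show "of_nat (Suc k) * ?t (Suc k) = fps_const (fps_deriv P $ k) * (fps_deriv ^^ k) (zderiv f $ (n - k))"
   by (simp add: funpow_swap1 mult.assoc)
 qed
 finally show "fps_deriv (hD_fps P f) $ n = (hD_fps P (fps_deriv f) + hD_fps (fps_deriv P) (zderiv f)) $ n"
  by simp
qed

lemma hD_fps_const_mult_l: "hD_fps (fps_const c * P) f = fps_const (fps_const c) * hD_fps P f"
 by (rule fps_ext) (simp add: hD_fps_nth sum_distrib_left mult.assoc flip: fps_const_mult)

lemma fps_deriv_hD_exp:
 "fps_deriv (hD_fps (fps_exp c) f) = hD_fps (fps_exp c) (fps_deriv f) + fps_const (fps_const c) * hD_fps (fps_exp c) (zderiv f)"
 by (simp add: fps_deriv_hD hD_fps_const_mult_l)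

lemma of_nat_Suc_fps_cancel: "of_nat (Suc n) * a = of_nat (Suc n) * b ==> a = (b :: complex fps)"
 by (metis mult_cancel_left of_nat_neq_0)

text \<open>The shift is multiplicative because both sides obey the same first-order equation in
  \<open>h\<close> and agree at \<open>h = 0\<close>. The induction on the order in \<open>h\<close>
  keeps \<open>f\<close> and \<open>g\<close> arbitrary, as their derivatives appear on the
  right.\<close>

lemma hD_exp_mult: "hD_fps (fps_exp c) (f * g) = hD_fps (fps_exp c) f * hD_fps (fps_exp c) g"
proof (rule fps_ext)
 let ?T = "hD_fps (fps_exp c)"
 fix n show "?T (f * g) $ n = (?T f * ?T g) $ n"
 proof (induction n arbitrary: f g)
  case 0
  show ?case by (simp add: hD_fps_nth_0)
 next
  case (Suc n)
  have "fps_deriv (?T (f * g)) = ?T (f * fps_deriv g) + ?T (fps_deriv f * g) +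
    fps_const (fps_const c) * (?T (zderiv f * g) + ?T (f * zderiv g))"
   by (simp add: fps_deriv_hD_exp zderiv_mult hD_fps_add)
  then have "fps_deriv (?T (f * g)) $ n = (?T f * ?T (fps_deriv g) + ?T (fps_deriv f) * ?T g +
    fps_const (fps_const c) * (?T (zderiv f) * ?T g + ?T f * ?T (zderiv g))) $ n"
   by (simp add: Suc)
  also have "... = fps_deriv (?T f * ?T g) $ n"
   by (simp add: fps_deriv_hD_exp algebra_simps)
  finally have "of_nat (Suc n) * ?T (f * g) $ Suc n = of_nat (Suc n) * (?T f * ?T g) $ Suc n"
   by (simp only: fps_deriv_nth Suc_eq_plus1)
  then show ?case by (rule of_nat_Suc_fps_cancel)
 qed
qed

subsection \<open>The exponential\<close>

lemma power_nth_nth_eq_0: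
 assumes "f $ 0 $ 0 = (0::complex)" "n + m < k"
 shows "(f ^ k) $ n $ m = 0"
 using assms(2)
proof (induction k arbitrary: n m)
 case (Suc k)
 have "f $ i $ j * (f ^ k) $ (n - i) $ (m - j) = 0" if "i <= n" "j <= m" for i j
 proof (cases "i = 0 & j = 0")
  case False
  then show ?thesis using that Suc.prems by (subst Suc.IH) auto
 qed (use assms in auto)
 then show ?case unfolding power_Suc fps_mult_nth fps_sum_nth by (intro sum.neutral ballI) auto
qed simp

text \<open>Since \<open>f ^ k\<close> has total order at least \<open>k\<close>, each double
  coefficient of \<open>exp_zh f\<close> is that of every sufficiently long partial sum; derivatives
  are computed on these polynomials in \<open>f\<close>.\<close>

definition exp_trunc :: "complex fps fps => nat => complex fps fps" where
 "exp_trunc f M = (\<Sum>k\<le>M. fps_const (fps_const (1 / fact k)) * f ^ k)"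

lemma exp_zh_eq_trunc:
 assumes "f $ 0 $ 0 = 0" "n + m <= M"
 shows "exp_zh f $ n $ m = exp_trunc f M $ n $ m"
proof -
 have "exp_trunc f M $ n $ m = (\<Sum>k\<le>M. (f ^ k) $ n $ m / fact k)"
  by (simp add: exp_trunc_def fps_sum_nth)
 also have "... = (\<Sum>k\<le>n + m. (f ^ k) $ n $ m / fact k)"
  using assms by (intro sum.mono_neutral_right) (auto simp: power_nth_nth_eq_0)
 finally show ?thesis by (simp add: exp_zh_def)
qed

text \<open>Stated for an abstract derivation so that it serves both \<open>d/dh\<close> and
  \<open>d/dz\<close>. Differentiation shortens the partial sum by one term.\<close>

lemma exp_trunc_deriv:
 assumes d1: "!!a b. d (a * b) = d a * b + a * d b" and d2: "!!a b. d (a + b) = d a + d b"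
  and d3: "!!c. d (fps_const (fps_const c)) = 0"
 shows "d (exp_trunc f (Suc M)) = d f * exp_trunc f M"
proof -
 have d0: "d 0 = 0" using d3[of 0] by simp
 have d1': "d 1 = 0" using d3[of 1] by simp
 have dp: "d (f ^ Suc k) = of_nat (Suc k) * d f * f ^ k" for k
  by (induction k) (simp_all add: d1 d1' algebra_simps)
 have ds: "d (sum g S) = (\<Sum>i\<in>S. d (g i))" if "finite S" for g :: "nat => _" and S
  using that by (induction S rule: finite_induct) (simp_all add: d0 d2)
 have "d (exp_trunc f (Suc M)) = (\<Sum>k\<le>Suc M. fps_const (fps_const (1 / fact k)) * d (f ^ k))"
  unfolding exp_trunc_def by (simp only: ds finite_atMost d1 d3 mult_zero_left add_0)
 also have "... = (\<Sum>k\<le>M. fps_const (fps_const (1 / fact (Suc k))) * d (f ^ Suc k))"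
  by (subst sum.atMost_Suc_shift) (simp add: d1')
 also have "... = (\<Sum>k\<le>M. d f * (fps_const (fps_const (1 / fact k)) * f ^ k))"
 proof (rule sum.cong[OF refl])
  fix k
  have "(1 / fact (Suc k)) * of_nat (Suc k) = (1 / fact k :: complex)"
   by (simp add: field_simps del: of_nat_Suc)
  moreover have "fps_const (fps_const (1 / fact (Suc k))) * of_nat (Suc k) = fps_const (fps_const ((1 / fact (Suc k)) * of_nat (Suc k) :: complex))"
   by (simp only: fps_of_nat[symmetric] fps_const_mult[symmetric])
  ultimately have "fps_const (fps_const (1 / fact (Suc k))) * of_nat (Suc k) = fps_const (fps_const (1 / fact k :: complex))"
   by simp
  then show "fps_const (fps_const (1 / fact (Suc k))) * d (f ^ Suc k) = d f * (fps_const (fps_const (1 / fact k)) * f ^ k)"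
   unfolding dp by (metis (no_types, opaque_lifting) mult.assoc mult.commute)
 qed
 finally show ?thesis by (simp add: exp_trunc_def sum_distrib_left)
qed

lemma fps_deriv_exp_zh:
 assumes "f $ 0 $ 0 = 0"
 shows "fps_deriv (exp_zh f) = fps_deriv f * exp_zh f"
proof (rule fps_ext, rule fps_ext)
 fix n m
 have c: "fps_deriv F $ n $ m = of_nat (Suc n) * F $ Suc n $ m" for F :: "complex fps fps"
  by (simp add: fps_of_nat[symmetric] del: of_nat_Suc)
 have "fps_deriv (exp_zh f) $ n $ m = fps_deriv (exp_trunc f (Suc (n + m))) $ n $ m"
  unfolding c using exp_zh_eq_trunc[OF assms, of "Suc n" m "Suc (n + m)"] by simp
 also have "... = (fps_deriv f * exp_trunc f (n + m)) $ n $ m"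
  by (subst exp_trunc_deriv) auto
 also have "... = (fps_deriv f * exp_zh f) $ n $ m"
  unfolding fps_mult_nth fps_sum_nth
  by (intro sum.cong refl) (simp add: exp_zh_eq_trunc[OF assms, of _ _ "n + m"])
 finally show "fps_deriv (exp_zh f) $ n $ m = (fps_deriv f * exp_zh f) $ n $ m" .
qed

lemma zderiv_exp_zh:
 assumes "f $ 0 $ 0 = 0"
 shows "zderiv (exp_zh f) = zderiv f * exp_zh f"
proof (rule fps_ext, rule fps_ext)
 fix n m
 have "zderiv (exp_zh f) $ n $ m = zderiv (exp_trunc f (Suc (n + m))) $ n $ m"
  using exp_zh_eq_trunc[OF assms, of n "Suc m" "Suc (n + m)"] by simp
 also have "... = (zderiv f * exp_trunc f (n + m)) $ n $ m"
  by (subst exp_trunc_deriv) (auto simp: zderiv_mult intro: fps_ext)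
 also have "... = (zderiv f * exp_zh f) $ n $ m"
  unfolding fps_mult_nth fps_sum_nth
  by (intro sum.cong refl) (simp add: exp_zh_eq_trunc[OF assms, of _ _ "n + m"])
 finally show "zderiv (exp_zh f) $ n $ m = (zderiv f * exp_zh f) $ n $ m" .
qed

lemma fps_ode_unique:
 fixes y z a :: "'a::idom fps"
 assumes "!!n::nat. of_nat (Suc n) ~= (0::'a)"
  and "fps_deriv y = a * y" "fps_deriv z = a * z" "y $ 0 = z $ 0"
 shows "y = z"
proof (rule fps_ext)
 fix n show "y $ n = z $ n"
 proof (induction n rule: less_induct)
  case (less n)
  show ?case
  proof (cases n)
   case (Suc m)
   have "fps_deriv y $ m = fps_deriv z $ m"
    unfolding assms(2,3) fps_mult_nth using less Suc by (intro sum.cong refl) auto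
   then show ?thesis using assms(1)[of m] Suc by (simp del: of_nat_Suc)
  qed (use assms in simp)
 qed
qed

lemma exp_zh_nth_0_0 [simp]: "exp_zh f $ 0 $ 0 = 1"
 by (simp add: exp_zh_def)

text \<open>A linear equation in \<open>h\<close> determines the series from its value at
  \<open>h = 0\<close>, and that value is in turn determined by a linear equation in
  \<open>z\<close>. The laws of the exponential follow by checking these two equations.\<close>

lemma exp_zh_unique:
 assumes "f $ 0 $ 0 = 0" "F $ 0 $ 0 = 1" "fps_deriv F = fps_deriv f * F"
  "fps_deriv (F $ 0) = fps_deriv (f $ 0) * F $ 0"
 shows "F = exp_zh f"
proof (rule fps_ode_unique)
 show "of_nat (Suc n) ~= (0 :: complex fps)" for n by (rule of_nat_neq_0)
 show "fps_deriv F = fps_deriv f * F" by fact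
 show "fps_deriv (exp_zh f) = fps_deriv f * exp_zh f" by (rule fps_deriv_exp_zh) fact
 show "F $ 0 = exp_zh f $ 0"
 proof (rule fps_ode_unique)
  show "of_nat (Suc n) ~= (0 :: complex)" for n by (rule of_nat_neq_0)
  show "fps_deriv (exp_zh f $ 0) = fps_deriv (f $ 0) * exp_zh f $ 0"
   using arg_cong[OF zderiv_exp_zh[OF assms(1)], of "%u. u $ 0"] by simp
 qed (use assms in auto)
qed

lemma fps_deriv_exp_zh_0:
 assumes "f $ 0 $ 0 = 0"
 shows "fps_deriv (exp_zh f $ 0) = fps_deriv (f $ 0) * exp_zh f $ 0"
 using arg_cong[OF zderiv_exp_zh[OF assms(1)], of "%u. u $ 0"] by simp

lemma exp_zh_add:
 assumes "f $ 0 $ 0 = 0" "g $ 0 $ 0 = 0"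
 shows "exp_zh (f + g) = exp_zh f * exp_zh g"
 by (rule exp_zh_unique[symmetric])
  (use assms in \<open>simp_all add: fps_deriv_exp_zh fps_deriv_exp_zh_0 algebra_simps\<close>)

lemma exp_zh_0: "exp_zh 0 = 1"
 by (rule exp_zh_unique[symmetric]) auto

text \<open>The coefficients are power series rather than field elements, so invertibility has to be
  traced down to the constant term of the leading coefficient before \<open>inverse\<close> is known
  to invert.\<close>

lemma inverse_fps_fps_unique:
 fixes f g :: "complex fps fps"
 assumes "f * g = 1"
 shows "inverse f = g"
proof -
 have "f $ 0 * g $ 0 = 1" using arg_cong[OF assms, of "%u. u $ 0"] by simp
 then have 1: "f $ 0 $ 0 * g $ 0 $ 0 = 1" by (metis fps_mult_nth_0 fps_one_nth)
 then have "f $ 0 * inverse (f $ 0) = 1" by (intro inverse_mult_eq_1') auto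
 then have "f * fps_right_inverse f (inverse (f $ 0)) = 1" by (rule fps_right_inverse)
 then have "f * inverse f = 1" by (simp add: fps_inverse_def)
 then show ?thesis using assms by (metis mult.commute mult.left_commute mult_1_right)
qed

lemma exp_zh_diff:
 assumes "f $ 0 $ 0 = 0" "g $ 0 $ 0 = 0"
 shows "exp_zh (f - g) = exp_zh f * inverse (exp_zh g)"
proof -
 have "exp_zh g * exp_zh (- g) = 1" using exp_zh_add[of g "- g"] assms by (simp add: exp_zh_0)
 then have "inverse (exp_zh g) = exp_zh (- g)" by (rule inverse_fps_fps_unique)
 then show ?thesis using exp_zh_add[of f "- g"] assms by simp
qed

lemma hD_exp_exp_zh:
 assumes "f $ 0 $ 0 = 0"
 shows "hD_fps (fps_exp c) (exp_zh f) = exp_zh (hD_fps (fps_exp c) f)"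
 by (rule exp_zh_unique)
  (use assms in \<open>simp_all add: hD_fps_nth_0 fps_deriv_hD_exp fps_deriv_exp_zh zderiv_exp_zh hD_exp_mult
   fps_deriv_exp_zh_0 algebra_simps\<close>)

lemma exp_zh_const:
 assumes "f $ 0 = 0"
 shows "exp_zh (fps_const f) = fps_const (fps_exp 1 oo f)"
 by (rule exp_zh_unique[symmetric])
  (use assms in \<open>simp_all add: fps_compose_deriv[OF assms] mult.commute\<close>)

subsection \<open>The logarithm of \<open>(e\<^bsup>z/2\<^esup> - e\<^bsup>-z/2\<^esup>) / z\<close>\<close>

text \<open>The exponential of \<open>f0\<close>, that is, \<open>2 sinh(z/2) / z\<close>.\<close>

definition sinhc :: "complex fps" where
 "sinhc = (fps_exp (1 / 2) - fps_exp (- (1 / 2))) / fps_X"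

lemma X_mult_divide_X: "f $ 0 = 0 ==> fps_X * (f / fps_X) = (f :: complex fps)"
 by (metis dvd_mult_div_cancel fps_X_power_dvd_iff less_one power_one_right)

lemma X_sinhc: "fps_X * sinhc = fps_exp (1 / 2) - fps_exp (- (1 / 2))"
 unfolding sinhc_def by (rule X_mult_divide_X) simp

lemma sinhc_nth: "sinhc $ n = ((1/2) ^ Suc n - (- (1/2)) ^ Suc n) / fact (Suc n)"
proof -
 have "sinhc $ n = (fps_X * sinhc) $ Suc n" by simp
 then show ?thesis by (simp add: X_sinhc diff_divide_distrib del: power_Suc fact_Suc)
qed

lemma sinhc_nth_0 [simp]: "sinhc $ 0 = 1"
 by (simp add: sinhc_nth)

lemma sinhc_even: "sinhc oo - fps_X = sinhc"
 by (rule fps_ext) (simp add: fps_compose_uminus' sinhc_nth power_minus' field_simps)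

lemma f0_nth_0 [simp]: "f0 $ 0 = 0"
 by (simp add: f0_def fps_ln_def)

lemma exp_f0: "fps_exp 1 oo f0 = sinhc"
proof -
 let ?u = "sinhc - 1"
 have 1: "(fps_exp 1 - 1) oo fps_ln 1 = (fps_X :: complex fps)"
  unfolding fps_ln_fps_exp_inv[OF one_neq_zero] by (rule fps_inv_right) auto
 have l0: "fps_ln 1 $ 0 = (0::complex)" by (simp add: fps_ln_def)
 have u0: "?u $ 0 = 0" by simp
 have "(fps_exp 1 - 1) oo f0 = ((fps_exp 1 - 1) oo fps_ln 1) oo ?u"
  unfolding f0_def sinhc_def[symmetric] using fps_compose_assoc[OF u0 l0] by simp
 also have "... = ?u" by (simp add: 1 fps_X_fps_compose_startby0)
 finally show ?thesis by (simp add: fps_compose_sub_distrib)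
qed

lemma f0_even: "f0 oo - fps_X = f0"
proof -
 have u0: "(sinhc - 1) $ 0 = 0" by simp
 show ?thesis
  unfolding f0_def sinhc_def[symmetric]
  by (subst fps_compose_assoc[symmetric])
   (auto simp: fps_compose_sub_distrib sinhc_even)
qed

lemma f0_deriv: "fps_deriv f0 * sinhc = fps_deriv sinhc"
 using fps_compose_deriv[of f0 "fps_exp 1"] by (simp add: exp_f0 mult.commute)

abbreviation shD :: "complex fls" where
 "shD \<equiv> fps_to_fls (fps_exp (1 / 2)) - fps_to_fls (fps_exp (- (1 / 2)))"
abbreviation chD :: "complex fls" where
 "chD \<equiv> fps_to_fls (fps_exp (1 / 2)) + fps_to_fls (fps_exp (- (1 / 2)))"

lemma shD_eq: "shD = fls_X * fps_to_fls sinhc"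
 using arg_cong[OF X_sinhc, of fps_to_fls] by (simp add: fls_times_fps_to_fls)

lemma sinhc_nz: "sinhc ~= 0"
 using sinhc_nth_0 by (metis fps_zero_nth zero_neq_one)

lemma shD_nz: "shD ~= 0"
 unfolding shD_eq using sinhc_nz by simp

abbreviation f0' :: "complex fls" where "f0' \<equiv> fps_to_fls (fps_deriv f0)"
abbreviation f0'' :: "complex fls" where "f0'' \<equiv> fps_to_fls (fps_deriv (fps_deriv f0))"

lemma exp_half_mult: "fps_to_fls (fps_exp (1 / 2)) * fps_to_fls (fps_exp (- (1 / 2))) = (1 :: complex fls)"
 using fps_exp_add_mult[of "1 / 2 :: complex" "- (1 / 2)"] by (simp flip: fls_times_fps_to_fls)

lemma exp_neg_one_eq: "fps_to_fls (fps_exp (- 1)) = (fps_to_fls (fps_exp (- (1 / 2))) ^ 2 :: complex fls)"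
 using fps_exp_add_mult[of "- (1 / 2) :: complex" "- (1 / 2)"] by (simp add: power2_eq_square flip: fls_times_fps_to_fls)

text \<open>\<open>2 sinh(z/2) = z exp(f0)\<close> has logarithmic derivative
  \<open>1/z + f0'\<close>, while its derivative is \<open>cosh(z/2)\<close>. Hence
  \<open>1/z + f0'\<close> is half the hyperbolic cotangent of \<open>z/2\<close>.\<close>

lemma chD_eq: "2 * shD * (inverse fls_X + f0') = chD"
proof -
 have 0: "fls_deriv shD = fls_const (1 / 2) * chD"
  by (simp add: fls_deriv_fps_to_fls fls_times_fps_to_fls algebra_simps)
 have "fls_deriv shD = fps_to_fls sinhc + fls_X * fps_to_fls (fps_deriv sinhc)"
  by (simp add: shD_eq fls_deriv_fps_to_fls)
 also have "... = fps_to_fls sinhc + fls_X * (f0' * fps_to_fls sinhc)"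
  by (simp flip: f0_deriv add: fls_times_fps_to_fls)
 also have "... = shD * (inverse fls_X + f0')"
 proof -
  have X: "fls_X * inverse fls_X = (1 :: complex fls)" by (rule right_inverse) simp
  have "fls_X * fps_to_fls sinhc * (inverse fls_X + f0') =
    (fls_X * inverse fls_X) * fps_to_fls sinhc + fls_X * (f0' * fps_to_fls sinhc)"
   by (simp only: distrib_left mult_ac)
  then show ?thesis unfolding shD_eq X by simp
 qed
 finally have "2 * (shD * (inverse fls_X + f0')) = 2 * (fls_const (1 / 2) * chD)" using 0 by simp
 also have "... = chD"
  by (simp add: fls_const_mult_const[symmetric] flip: mult.assoc fls_const_numeral)
 finally show ?thesis by (simp only: mult.assoc)
qed

lemma coth_f0: "(1 + fps_to_fls (fps_exp (- 1))) / (2 - 2 * fps_to_fls (fps_exp (- 1))) = inverse fls_X + f0'"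
proof -
 define a b where "a = (fps_to_fls (fps_exp (1 / 2)) :: complex fls)" and "b = (fps_to_fls (fps_exp (- (1 / 2))) :: complex fls)"
 have ab: "a * b = 1" unfolding a_def b_def by (rule exp_half_mult)
 have nz: "a - b ~= 0" using shD_nz by (simp add: a_def b_def)
 have b0: "b ~= 0" using ab by auto
 have e: "2 - 2 * b ^ 2 = 2 * (a - b) * b" "1 + b ^ 2 = (a + b) * b"
  using ab by (simp_all add: algebra_simps power2_eq_square)
 have "(1 + b ^ 2) / (2 - 2 * b ^ 2) = (a + b) / (2 * (a - b))"
  unfolding e using b0 nz by simp
 also have "... = inverse fls_X + f0'"
  using chD_eq nz unfolding a_def[symmetric] b_def[symmetric] by (simp add: field_simps)
 finally show ?thesis by (simp add: exp_neg_one_eq b_def)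
qed

text \<open>Obtained by differentiating the hyperbolic cotangent: the derivative of
  \<open>coth(z/2) / 2\<close> is \<open>- 1 / (2 sinh(z/2))^2\<close>, and the left-hand side
  equals \<open>1 / (2 sinh(z/2))^2\<close>.\<close>

lemma csch_f0: "fps_to_fls (fps_exp (- 1)) / (1 - fps_to_fls (fps_exp (- 1))) ^ 2 = inverse fls_X ^ 2 - f0''"
proof -
 define a b where "a = (fps_to_fls (fps_exp (1 / 2)) :: complex fls)" and "b = (fps_to_fls (fps_exp (- (1 / 2))) :: complex fls)"
 have ab: "a * b = 1" unfolding a_def b_def by (rule exp_half_mult)
 have nz: "a - b ~= 0" using shD_nz by (simp add: a_def b_def)
 have b0: "b ~= 0" using ab by auto
 have h2: "2 * (fls_const (1 / 2) * x) = (x :: complex fls)" for x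
  by (simp add: fls_const_mult_const[symmetric] flip: mult.assoc fls_const_numeral)
 have da: "2 * fls_deriv a = a" and db: "2 * fls_deriv b = - b"
  using h2[of a] h2[of b] by (simp_all add: a_def b_def fls_deriv_fps_to_fls fls_times_fps_to_fls flip: fps_const_neg)
 let ?c = "inverse fls_X + f0'"
 let ?d = "f0'' - inverse fls_X ^ 2"
 have dc: "fls_deriv ?c = ?d"
  by (simp add: fls_deriv_fps_to_fls fls_inverse_X)
 have c: "2 * (a - b) * ?c = a + b" using chD_eq by (simp add: a_def b_def)
 have "fls_deriv (2 * (a - b) * ?c) = 2 * (a - b) * ?d + (2 * fls_deriv a - 2 * fls_deriv b) * ?c"
  by (simp only: fls_deriv_mult dc fls_deriv_sub fls_deriv_numeral) (simp add: algebra_simps)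
 then have "fls_deriv a + fls_deriv b = 2 * (a - b) * ?d + (a + b) * ?c"
  unfolding c da db fls_deriv_add diff_minus_eq_add .
 moreover have "2 * (fls_deriv a + fls_deriv b) = a - b" by (simp only: distrib_left da db) simp
 ultimately have "a - b = 2 * (2 * (a - b) * ?d + (a + b) * ?c)" by simp
 then have "(a - b) * (a - b) = (a - b) * (2 * (2 * (a - b) * ?d + (a + b) * ?c))"
  by (rule arg_cong)
 also have "(a - b) * (2 * (2 * (a - b) * d + (a + b) * c)) = 4 * (a - b) ^ 2 * d + (a + b) * (2 * (a - b) * c)"
  for c d by (simp add: algebra_simps power2_eq_square)
 finally have "(a - b) ^ 2 = 4 * (a - b) ^ 2 * ?d + (a + b) ^ 2" unfolding c by (simp add: power2_eq_square)
 \<comment> \<open>The relation between hyperbolic cosine and sine, in the form given by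
   \<open>a * b = 1\<close>.\<close>
 moreover have "(a + b) ^ 2 = (a - b) ^ 2 + 4" using ab by (simp add: power2_eq_square algebra_simps)
 ultimately have "4 * ((a - b) ^ 2 * ?d + 1) = 0" by (simp add: algebra_simps)
 then have d: "(a - b) ^ 2 * ?d = - 1" by (simp add: add_eq_0_iff2)
 have e: "1 - b ^ 2 = (a - b) * b" using ab by (simp add: algebra_simps power2_eq_square)
 have "b ^ 2 / (1 - b ^ 2) ^ 2 = 1 / (a - b) ^ 2"
  unfolding e using b0 nz by (simp add: power_mult_distrib)
 also have "... = - ?d" using d nz by (simp add: field_simps)
 finally show ?thesis by (simp add: exp_neg_one_eq b_def)
qed

subsection \<open>Embeddings into Laurent series\<close>

lemma temb_nth [simp]: "temb f $ n = fps_to_fls (f $ n)"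
 by (simp add: temb_def)

lemma fps_to_fls_sum': "fps_to_fls (sum f S) = (\<Sum>i\<in>S. fps_to_fls (f i :: complex fps))"
 by (induction S rule: infinite_finite_induct) auto

lemma temb_add: "temb (f + g) = temb f + temb g"
 by (rule fps_ext) simp

lemma temb_diff: "temb (f - g) = temb f - temb g"
 by (rule fps_ext) simp

lemma temb_uminus: "temb (- f) = - temb f"
 by (rule fps_ext) simp

lemma temb_mult: "temb (f * g) = temb f * temb g"
 by (rule fps_ext) (simp add: fps_mult_nth fps_to_fls_sum' fls_times_fps_to_fls)

lemma temb_const: "temb (fps_const a) = fps_const (fps_to_fls a)"
 by (rule fps_ext) simp

lemma temb_1 [simp]: "temb 1 = 1"
 by (rule fps_ext) simp

lemma temb_0 [simp]: "temb 0 = 0"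
 by (rule fps_ext) simp

lemma temb_inj: "temb f = temb g ==> f = g"
 by (metis fps_ext fps_to_fls_eq_iff temb_nth)

lemma zv_eq_temb: "zv = temb (fps_const fps_X)"
 by (simp add: temb_const)

lemma hmon_eq_temb: "hmon c = temb (fps_const (fps_const c) * fps_X)"
 by (rule fps_ext) (simp add: hmon_def)

definition emb :: "complex fps => complex fps fps" where
 "emb P = Abs_fps (%n. fps_const (P $ n))"

lemma emb_nth [simp]: "emb P $ n = fps_const (P $ n)"
 by (simp add: emb_def)

lemma fps_const_sum': "fps_const (sum f S) = (\<Sum>i\<in>S. fps_const (f i :: complex))"
 by (induction S rule: infinite_finite_induct) (auto simp flip: fps_const_add)

lemma emb_mult: "emb (P * Q) = emb P * emb Q"
 by (rule fps_ext) (simp add: fps_mult_nth fps_const_sum')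

lemma emb_1 [simp]: "emb 1 = 1"
 by (rule fps_ext) simp

lemma hemb_eq_temb: "hemb P = temb (emb P)"
 by (rule fps_ext) (simp add: hemb_def)

text \<open>Serves both as reflection of a series in \<open>z\<close> and as sign change in the
  symbol of an operator: on functions of \<open>z1 - z2\<close> the derivative in \<open>z2\<close>
  is \<open>- d/dz\<close>, and reflection turns \<open>d/dz\<close> into
  \<open>- d/dz\<close>.\<close>

definition pneg :: "complex fps => complex fps" where
 "pneg P = P oo - fps_X"

lemma pneg_nth: "pneg P $ n = (- 1) ^ n * P $ n"
 by (simp add: pneg_def fps_compose_uminus')

lemma pneg_mult: "pneg (P * Q) = pneg P * pneg Q"
 by (simp add: pneg_def fps_compose_mult_distrib)

lemma pneg_diff: "pneg (P - Q) = pneg P - pneg Q"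
 by (simp add: pneg_def fps_compose_sub_distrib)

lemma pneg_power: "pneg (P ^ n) = pneg P ^ n"
 by (simp add: pneg_def fps_compose_power)

lemma pneg_exp [simp]: "pneg (fps_exp c) = fps_exp (- c)"
 by (rule fps_ext) (simp add: pneg_nth power_minus')

lemma reflect_nth: "reflect f $ n = pneg (f $ n)"
 by (simp add: reflect_def pneg_def)

lemma fps_deriv_pneg: "fps_deriv (pneg f) = - pneg (fps_deriv f)"
 by (rule fps_ext) (simp add: pneg_nth)

lemma pneg_uminus: "pneg (- f) = - pneg f"
 by (rule fps_ext) (simp add: pneg_nth)

lemma pneg_sum: "pneg (sum f S) = (\<Sum>i\<in>S. pneg (f i))"
 by (induction S rule: infinite_finite_induct) (auto simp: pneg_def fps_compose_add_distrib)

lemma pneg_const [simp]: "pneg (fps_const c) = fps_const c"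
 by (simp add: pneg_def)

lemma pneg_deriv_iter: "pneg ((fps_deriv ^^ k) f) = fps_const ((- 1) ^ k) * (fps_deriv ^^ k) (pneg f)"
proof (induction k)
 case (Suc k)
 have "pneg ((fps_deriv ^^ Suc k) f) = - fps_deriv (pneg ((fps_deriv ^^ k) f))"
  by (simp add: fps_deriv_pneg)
 then show ?case unfolding Suc by (simp flip: fps_const_neg)
qed simp

lemma reflect_hD: "reflect (hD_fps P f) = hD_fps (pneg P) (reflect f)"
proof (rule fps_ext)
 fix n
 have "reflect (hD_fps P f) $ n = (\<Sum>k\<le>n. fps_const (P $ k) * pneg ((fps_deriv ^^ k) (f $ (n - k))))"
  by (simp add: reflect_nth hD_fps_nth pneg_sum pneg_mult)
 also have "... = hD_fps (pneg P) (reflect f) $ n"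
  unfolding hD_fps_nth pneg_deriv_iter reflect_nth pneg_nth
  by (intro sum.cong refl) (simp add: mult.assoc[symmetric] mult.commute)
 finally show "reflect (hD_fps P f) $ n = hD_fps (pneg P) (reflect f) $ n" .
qed

lemma reflect_const: "reflect (fps_const f) = fps_const (pneg f)"
 by (rule fps_ext) (simp add: reflect_nth pneg_def)

lemma reflect_uminus: "reflect (- f) = - reflect f"
 by (rule fps_ext) (simp add: reflect_nth pneg_uminus)

lemma pneg_f0: "pneg f0 = f0"
 by (simp add: pneg_def f0_even)

lemma pneg_f0': "pneg (fps_deriv f0) = - fps_deriv f0"
 by (metis fps_deriv_pneg minus_minus pneg_f0)

lemma pneg_f0'': "pneg (fps_deriv (fps_deriv f0)) = fps_deriv (fps_deriv f0)"
 using fps_deriv_pneg[of "fps_deriv f0"] by (simp add: pneg_f0')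

lemma pneg_sinhc: "pneg sinhc = sinhc"
 by (simp add: pneg_def sinhc_even)

subsection \<open>Quantum integers\<close>

abbreviation q1 :: "complex fps" where "q1 \<equiv> fps_exp 1 - fps_exp (- 1)"

lemma X_Fser: "fps_X * Fser = q1"
 unfolding Fser_def by (rule X_mult_divide_X) simp

lemma Fser_nth_0: "Fser $ 0 = 2"
proof -
 have "Fser $ 0 = (fps_X * Fser) $ 1" by simp
 then show ?thesis by (simp add: X_Fser)
qed

lemma q1_nz: "q1 ~= 0"
 using X_Fser Fser_nth_0 by (metis fps_X_neq_zero fps_zero_nth mult_eq_0_iff zero_neq_numeral)

text \<open>\<open>q1\<close> is \<open>fps_X\<close> times the unit \<open>Fser\<close>, so the
  quotient that defines \<open>qnum\<close> leaves no remainder.\<close>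

lemma q1_dvd: "q1 dvd f" if "f $ 0 = 0"
proof -
 have "inverse Fser * Fser = 1" using Fser_nth_0 by (intro inverse_mult_eq_1) auto
 then have "f = q1 * (inverse Fser * (f / fps_X))"
  using X_mult_divide_X[OF that] unfolding X_Fser[symmetric]
  by (metis (no_types, lifting) mult.assoc mult.commute mult_1)
 then show ?thesis by (metis dvd_triv_left)
qed

lemma qnum_q1: "q1 * qnum c = fps_exp c - fps_exp (- c)"
 unfolding qnum_def by (rule dvd_mult_div_cancel) (rule q1_dvd, simp)

lemma pneg_qnum [simp]: "pneg (qnum c) = qnum c"
proof -
 have "pneg (q1 * qnum c) = pneg (fps_exp c - fps_exp (- c))" by (simp only: qnum_q1)
 then have "q1 * pneg (qnum c) = fps_exp c - fps_exp (- c)"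
  unfolding pneg_mult pneg_diff by (simp add: algebra_simps)
 then have "q1 * pneg (qnum c) = q1 * qnum c" by (simp only: qnum_q1)
 then show ?thesis using q1_nz by (metis mult_cancel_left)
qed

subsection \<open>Expansions in two variables\<close>

definition dz :: "complex fls fps => complex fls fps" where
 "dz f = Abs_fps (%n. fls_deriv (f $ n))"

lemma zcoef_nth [simp]: "zcoef f c $ n = f $ n $$ c"
 by (simp add: zcoef_def)

lemma iota12_nth: "iota12 f a b $ n = (if 0 <= b then ((- 1) powi b * (of_int (a + b) gchoose nat b)) * f $ n $$ (a + b) else 0)"
 by (simp add: iota12_def)

lemma iota21_nth: "iota21 f a b $ n = (if 0 <= a then ((- 1) powi b * (of_int (a + b) gchoose nat a)) * f $ n $$ (a + b) else 0)"
 by (simp add: iota21_def)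

lemma iota12_add: "iota12 (f + g) a b = iota12 f a b + iota12 g a b"
 by (rule fps_ext) (simp add: iota12_nth algebra_simps)

lemma iota12_diff: "iota12 (f - g) a b = iota12 f a b - iota12 g a b"
 by (rule fps_ext) (simp add: iota12_nth algebra_simps)

lemma iota21_add: "iota21 (f + g) a b = iota21 f a b + iota21 g a b"
 by (rule fps_ext) (simp add: iota21_nth algebra_simps)

text \<open>Without poles the binomial coefficients are symmetric and vanish as soon as one of the
  exponents is negative. Such series can therefore multiply identities that mix the two
  expansions.\<close>

lemma iota12_temb_eq_iota21: "iota12 (temb g) a b = iota21 (temb g) a b"
proof (rule fps_ext)
 fix n
 show "iota12 (temb g) a b $ n = iota21 (temb g) a b $ n"
 proof (cases "0 <= a + b")
  case True
  then obtain m where m: "a + b = int m" by (metis nonneg_int_cases)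
  consider "0 <= a" "0 <= b" | "a < 0" "0 <= b" | "b < 0" "0 <= a" using True by linarith
  then show ?thesis
  proof cases
   case 1
   have g: "of_int (a + b) gchoose k = (of_nat (m choose k) :: complex)" for k
    using m binomial_gbinomial[of m k, where 'a = complex] by simp
   have "nat a = m - nat b" "nat b <= m" using 1 m by auto
   then show ?thesis using 1 by (simp add: iota12_nth iota21_nth g binomial_symmetric[of "nat b" m] del: of_int_add)
  next
   case 2
   then have "m < nat b" using m by linarith
   then have "(of_int (a + b) gchoose nat b :: complex) = 0"
    using m binomial_gbinomial[of m "nat b", where 'a = complex] binomial_eq_0[of m "nat b"] by simp
   then show ?thesis using 2 by (simp add: iota12_nth iota21_nth del: of_int_add)
  next
   case 3
   then have "m < nat a" using m by linarith
   then have "(of_int (a + b) gchoose nat a :: complex) = 0"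
    using m binomial_gbinomial[of m "nat a", where 'a = complex] binomial_eq_0[of m "nat a"] by simp
   then show ?thesis using 3 by (simp add: iota12_nth iota21_nth del: of_int_add)
  qed
 qed (simp add: iota12_nth iota21_nth)
qed

lemma deriv2_iota12: "deriv2 (iota12 f) = iota12 (- dz f)"
proof (intro ext, rule fps_ext)
 fix a b n
 show "deriv2 (iota12 f) a b $ n = iota12 (- dz f) a b $ n"
 proof (cases "0 <= b")
  case True
  then obtain k where k: "b = int k" by (metis nonneg_int_cases)
  have "of_int (b + 1) * (of_int (a + b + 1) gchoose Suc k) = (of_int (a + b + 1) :: complex) * (of_int (a + b) gchoose k)"
   using gbinomial_absorption[of k "of_int (a + b + 1) :: complex"] k by (simp add: add_ac)
  moreover have "nat (1 + int k) = Suc k" by simp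
  ultimately show ?thesis
   using k by (simp add: deriv2_def iota12_nth dz_def fps_mult_of_int_nth power_int_add algebra_simps
    fps_of_int[symmetric] del: of_int_add of_int_of_nat_eq)
 next
  case False
  then show ?thesis by (cases "b = -1") (auto simp: deriv2_def iota12_nth fps_of_int[symmetric])
 qed
qed

lemma deriv2_iota21: "deriv2 (iota21 f) = iota21 (- dz f)"
proof (intro ext, rule fps_ext)
 fix a b n
 show "deriv2 (iota21 f) a b $ n = iota21 (- dz f) a b $ n"
 proof (cases "0 <= a")
  case True
  then obtain k where k: "a = int k" by (metis nonneg_int_cases)
  have "(of_int (a + b + 1) - of_nat k) * (of_int (a + b + 1) gchoose k) = (of_int (a + b + 1) :: complex) * (of_int (a + b) gchoose k)"
   using gbinomial_absorb_comp[of "of_int (a + b + 1) :: complex" k] by simp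
  then have "(of_int (b + 1)) * (of_int (a + b + 1) gchoose k) = (of_int (a + b + 1) :: complex) * (of_int (a + b) gchoose k)"
   using k by simp
  then show ?thesis
   using k by (simp add: deriv2_def iota21_nth dz_def power_int_add algebra_simps
    fps_of_int[symmetric] del: of_int_add of_int_of_nat_eq)
 qed (simp add: deriv2_def iota21_def)
qed

lemma dz_iter_nth: "((%f. - dz f) ^^ k) f $ n = fls_const ((- 1) ^ k) * (fls_deriv ^^ k) (f $ n)"
proof (induction k)
 case (Suc k)
 have "fls_deriv (fls_const ((- 1) ^ k) * g) = fls_const ((- 1) ^ k) * fls_deriv g" for g :: "complex fls"
  by (simp add: fls_deriv_mult_const_left)
 then show ?case using Suc by (simp add: dz_def)
qed simp

lemma deriv2_iter_iota12: "(deriv2 ^^ k) (iota12 f) = iota12 (((%f. - dz f) ^^ k) f)"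
 by (induction k) (simp_all add: deriv2_iota12)

lemma deriv2_iter_iota21: "(deriv2 ^^ k) (iota21 f) = iota21 (((%f. - dz f) ^^ k) f)"
 by (induction k) (simp_all add: deriv2_iota21)

lemma hD_fls_nth_nth:
 "hD_fls P f $ n $$ c = (\<Sum>k\<le>n. P $ k * (fls_deriv ^^ k) (f $ (n - k)) $$ c)"
 by (simp add: hD_fls_def fls_nth_sum)

text \<open>\<open>d/dz2\<close> acts on an expansion of \<open>f(z1 - z2)\<close> through
  \<open>- d/dz\<close>, whence the reflected symbol. The two-variable kernels are thereby reduced
  to one variable.\<close>

lemma hD_two_iota12: "hD_two P (iota12 f) = iota12 (hD_fls (pneg P) f)"
 by (intro ext fps_ext)
  (simp add: hD_two_def deriv2_iter_iota12 iota12_nth dz_iter_nth hD_fls_nth_nth pneg_nth sum_distrib_left mult_ac)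

lemma hD_two_iota21: "hD_two P (iota21 f) = iota21 (hD_fls (pneg P) f)"
 by (intro ext fps_ext)
  (simp add: hD_two_def deriv2_iter_iota21 iota21_nth dz_iter_nth hD_fls_nth_nth pneg_nth sum_distrib_left mult_ac)

lemma deriv2_iter_add:
 "(deriv2 ^^ k) (%a b. G a b + H a b) = (%a b. (deriv2 ^^ k) G a b + (deriv2 ^^ k) H a b)"
 by (induction k) (simp_all add: deriv2_def fun_eq_iff algebra_simps)

lemma hD_two_add: "hD_two P (%a b. G a b + H a b) = (%a b. hD_two P G a b + hD_two P H a b)"
 by (intro ext fps_ext) (simp add: hD_two_def deriv2_iter_add sum.distrib algebra_simps)

lemma hD_fls_temb: "hD_fls P (temb g) = temb (hD_fps P g)"
proof (rule fps_ext)
 fix n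
 have "(fls_deriv ^^ k) (fps_to_fls f) = fps_to_fls ((fps_deriv ^^ k) f)" for k and f :: "complex fps"
  by (induction k) (simp_all add: fls_deriv_fps_to_fls)
 then show "hD_fls P (temb g) $ n = temb (hD_fps P g) $ n"
  by (simp add: hD_fls_def hD_fps_nth fps_to_fls_sum' fls_times_fps_to_fls)
qed

lemma hD_fls_add: "hD_fls P (f + g) = hD_fls P f + hD_fls P g"
proof (rule fps_ext)
 fix n
 have "(fls_deriv ^^ k) (f + g) = (fls_deriv ^^ k) f + (fls_deriv ^^ k) g" for k and f g :: "complex fls"
  by (induction k) simp_all
 then show "hD_fls P (f + g) $ n = (hD_fls P f + hD_fls P g) $ n"
  by (simp add: hD_fls_def sum.distrib algebra_simps)
qed

lemma comm_series_add: "comm_series c d (f + g) a b = comm_series c d f a b + comm_series c d g a b"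
proof -
 have "(%a b. hD_two (fps_exp (- d)) (iota12 (f + g)) a b - hD_two (fps_exp d) (iota21 (f + g)) a b) =
  (%a b. (hD_two (fps_exp (- d)) (iota12 f) a b - hD_two (fps_exp d) (iota21 f) a b) +
   (hD_two (fps_exp (- d)) (iota12 g) a b - hD_two (fps_exp d) (iota21 g) a b))"
  by (simp add: hD_two_iota12 hD_two_iota21 hD_fls_add iota12_add iota21_add fun_eq_iff)
 then show ?thesis unfolding comm_series_def by (simp only: hD_two_add)
qed

text \<open>For a regular series the two expansions agree, so the difference collapses to a single
  operator; its sign is reversed by the passage from \<open>d/dz2\<close> to
  \<open>d/dz\<close>.\<close>

lemma comm_series_temb:
 "comm_series c d (temb g) = iota12 (temb (hD_fps (qnum c * (fps_exp d - fps_exp (- d))) g))"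
proof -
 have "(%a b. hD_two (fps_exp (- d)) (iota12 (temb g)) a b - hD_two (fps_exp d) (iota21 (temb g)) a b)
  = iota12 (temb (hD_fps (fps_exp d - fps_exp (- d)) g))"
  by (intro ext) (simp add: hD_two_iota12 hD_two_iota21 hD_fls_temb hD_fps_diff_l temb_diff iota12_diff
    flip: iota12_temb_eq_iota21)
 then show ?thesis
  by (simp add: comm_series_def hD_two_iota12 hD_fls_temb hD_fps_mult)
qed

subsection \<open>Comparison of the defining relations\<close>

text \<open>The trigonometric kernel differs from the rational one by a regular series. Here and in
  the next lemma derivatives of \<open>f0\<close> are the whole difference, and
  \<open>tau_trig\<close> is made to absorb it.\<close>

lemma expm_csch: "expm / (1 - expm) ^ 2 = inverse zv ^ 2 + temb (fps_const (- fps_deriv (fps_deriv f0)))"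
proof -
 have "expm / (1 - expm) ^ 2 = fps_const (fps_to_fls (fps_exp (- 1)) / (1 - fps_to_fls (fps_exp (- 1))) ^ 2)"
  by (simp flip: fps_const_1_eq_1 fps_const_sub fps_const_power fps_const_divide)
 then show ?thesis
  by (simp only: csch_f0 temb_const fps_const_inverse fps_const_power fps_const_add fps_to_fls_uminus add_uminus_conv_diff)
qed

lemma expm_coth: "(1 + expm) / (2 - 2 * expm) = inverse zv + temb (fps_const (fps_deriv f0))"
proof -
 have "(1 + expm) / (2 - 2 * expm) = fps_const ((1 + fps_to_fls (fps_exp (- 1))) / (2 - 2 * fps_to_fls (fps_exp (- 1))))"
  by (simp only: fps_const_1_eq_1 [symmetric] numeral_fps_const fps_const_sub fps_const_mult fps_const_add fps_const_divide)
 then show ?thesis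
  by (simp only: coth_f0 temb_const fps_const_inverse fps_const_add)
qed

lemma qnum_exp_diff: "qnum d * q1 = fps_exp d - fps_exp (- d)"
 using qnum_q1[of d] by (simp only: mult.commute)

text \<open>The correction \<open>- f0''\<close> of the kernel is acted on by
  \<open>qnum c * qnum d * (q^d - q^(-d))\<close>. As \<open>f0''\<close> is even, the two
  \<open>\<tau>\<close>-terms contribute \<open>f0''\<close> acted on by the symbol
  \<open>fps_exp (- c) * qnum d ^ 2\<close> minus its reflection. The two agree because
  \<open>q^c - q^(-c) = q1 * qnum c\<close>, and likewise for \<open>d\<close>.\<close>

lemma hh_scalar:
 "hD_two (qnum c) (comm_series d d (inverse zv ^ 2)) m n +
   iota12 (temb (hD_fps (fps_exp (- c) * qnum d ^ 2) (fps_const (fps_deriv (fps_deriv f0))))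
    - temb (reflect (hD_fps (fps_exp (- c) * qnum d ^ 2) (fps_const (fps_deriv (fps_deriv f0)))))) m n =
  hD_two (qnum c) (comm_series d d (expm / (1 - expm) ^ 2)) m n"
proof -
 let ?g = "fps_const (fps_deriv (fps_deriv f0)) :: complex fps fps"
 have *: "(%a b. comm_series d d (inverse zv ^ 2 + temb (- ?g)) a b) =
  (%a b. comm_series d d (inverse zv ^ 2) a b + comm_series d d (temb (- ?g)) a b)"
  by (simp add: comm_series_add)
 have "fps_exp (- c) * qnum d ^ 2 - pneg (fps_exp (- c) * qnum d ^ 2) = - (fps_exp c - fps_exp (- c)) * qnum d ^ 2"
  by (simp add: pneg_mult pneg_power algebra_simps)
 also have "... = - (qnum c * (qnum d * (fps_exp d - fps_exp (- d))))"
  unfolding qnum_exp_diff[of c, symmetric] qnum_exp_diff[of d, symmetric] by (simp only: power2_eq_square mult_ac mult_minus_left mult_minus_right)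
 finally have Q: "fps_exp (- c) * qnum d ^ 2 - pneg (fps_exp (- c) * qnum d ^ 2) = - (qnum c * (qnum d * (fps_exp d - fps_exp (- d))))" .
 have "temb (hD_fps (fps_exp (- c) * qnum d ^ 2) ?g) - temb (reflect (hD_fps (fps_exp (- c) * qnum d ^ 2) ?g))
  = temb (hD_fps (fps_exp (- c) * qnum d ^ 2 - pneg (fps_exp (- c) * qnum d ^ 2)) ?g)"
  by (simp only: reflect_hD reflect_const pneg_f0'' hD_fps_diff_l temb_diff)
 also have "... = temb (hD_fps (qnum c * (qnum d * (fps_exp d - fps_exp (- d)))) (- ?g))"
  unfolding Q by (simp add: hD_fps_uminus_l hD_fps_uminus del: fps_const_neg)
 also have "iota12 ... = hD_two (qnum c) (comm_series d d (temb (- ?g)))"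
  by (simp add: comm_series_temb hD_two_iota12 hD_fls_temb hD_fps_mult)
 finally show ?thesis
  unfolding expm_csch fps_const_neg[symmetric] * hD_two_add by simp
qed

text \<open>The same comparison with the odd series \<open>f0'\<close>: oddness turns the sum of the
  two \<open>\<tau>\<close>-terms into a difference of a reflected symbol and the symbol.\<close>

lemma hx_scalar:
 "comm_series c d (inverse zv) m n +
   iota12 (temb (- hD_fps (fps_exp (- c) * qnum d) (fps_const (fps_deriv f0)))
    + temb (reflect (- hD_fps (fps_exp (- c) * qnum d) (fps_const (fps_deriv f0))))) m n =
  comm_series c d ((1 + expm) / (2 - 2 * expm)) m n"
proof -
 let ?g = "fps_const (fps_deriv f0) :: complex fps fps"
 have "pneg (fps_exp (- c) * qnum d) - fps_exp (- c) * qnum d = (fps_exp c - fps_exp (- c)) * qnum d"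
  by (simp add: pneg_mult algebra_simps)
 also have "... = qnum c * (fps_exp d - fps_exp (- d))"
  unfolding qnum_exp_diff[of c, symmetric] qnum_exp_diff[of d, symmetric] by (simp only: mult_ac)
 finally have Q: "pneg (fps_exp (- c) * qnum d) - fps_exp (- c) * qnum d = qnum c * (fps_exp d - fps_exp (- d))" .
 have "temb (- hD_fps (fps_exp (- c) * qnum d) ?g) + temb (reflect (- hD_fps (fps_exp (- c) * qnum d) ?g))
  = temb (hD_fps (pneg (fps_exp (- c) * qnum d) - fps_exp (- c) * qnum d) ?g)"
  by (simp add: reflect_uminus reflect_hD reflect_const pneg_f0' hD_fps_diff_l temb_diff hD_fps_uminus temb_uminus
    flip: fps_const_neg)
 then show ?thesis unfolding expm_coth comm_series_add Q comm_series_temb by simp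
qed

lemma hD_exp_const_exp: "hD_fps (fps_exp c) (fps_const (fps_exp a)) = fps_const (fps_exp a) * emb (fps_exp (a * c))"
proof (rule fps_ext)
 fix n
 have d: "(fps_deriv ^^ k) (fps_exp a) = fps_const (a ^ k) * fps_exp a" for k
  by (induction k) (simp_all add: mult_ac flip: fps_const_mult)
 have "hD_fps (fps_exp c) (fps_const (fps_exp a)) $ n =
   (\<Sum>k\<in>{n}. fps_const (fps_exp c $ k) * (fps_deriv ^^ k) (fps_const (fps_exp a) $ (n - k)))"
  unfolding hD_fps_nth by (rule sum.mono_neutral_right) auto
 also have "... = (fps_const (c ^ n / fact n) * fps_const (a ^ n)) * fps_exp a" by (simp add: d mult.assoc del: fps_const_mult)
 also have "fps_const (c ^ n / fact n) * fps_const (a ^ n) = fps_const ((a * c) ^ n / fact n)"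
  by (simp add: power_mult_distrib field_simps)
 finally show "hD_fps (fps_exp c) (fps_const (fps_exp a)) $ n = (fps_const (fps_exp a) * emb (fps_exp (a * c))) $ n"
  by (simp add: mult.commute)
qed

lemma hD_exp_const_X: "hD_fps (fps_exp c) (fps_const fps_X) = fps_const fps_X + fps_const (fps_const c) * fps_X"
proof (rule fps_ext)
 fix n
 have "hD_fps (fps_exp c) (fps_const fps_X) $ n =
   (\<Sum>k\<in>{n}. fps_const (fps_exp c $ k) * (fps_deriv ^^ k) (fps_const fps_X $ (n - k)))"
  unfolding hD_fps_nth by (rule sum.mono_neutral_right) auto
 moreover have "(fps_deriv ^^ n) (fps_X :: complex fps) = (if n = 0 then fps_X else if n = 1 then 1 else 0)"
 proof (cases n)
  case (Suc m)
  have "(fps_deriv ^^ m) (1 :: complex fps) = (if m = 0 then 1 else 0)"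
   by (cases m) (simp_all add: funpow_Suc_right del: funpow.simps)
  then show ?thesis using Suc by (simp add: funpow_Suc_right del: funpow.simps)
 qed simp
 ultimately show "hD_fps (fps_exp c) (fps_const fps_X) $ n = (fps_const fps_X + fps_const (fps_const c) * fps_X) $ n"
  by (cases "n = 0"; cases "n = 1") (auto simp: fps_X_nth)
qed

text \<open>\<open>exp (f0 (z - c h))\<close>; the pair \<open>i, j\<close> enters only through the
  number \<open>c = r_i a_ij\<close>.\<close>

definition tau_shift :: "complex => complex fps fps" where
 "tau_shift c = hD_fps (fps_exp (- c)) (fps_const sinhc)"

lemma tau_trig_bullet: "tau_trig a r l Bullet Bullet i j = tau_shift (ra a r i j)"
 by (simp add: tau_shift_def hD_exp_exp_zh[symmetric] exp_zh_const exp_f0)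

lemma reflect_tau_shift: "reflect (tau_shift c) = tau_shift (- c)"
 by (simp add: tau_shift_def reflect_hD reflect_const pneg_sinhc)

text \<open>The linear factor is the shift of \<open>z\<close> by the same amount, so the product is
  the shift of \<open>z sinhc(z) = 2 sinh(z/2)\<close>. This is why the rational factor and
  \<open>\<tau>\<close> together become trigonometric.\<close>

lemma X_mult_tau_shift:
 "(fps_const fps_X - fps_const (fps_const c) * fps_X) * tau_shift c =
  fps_const (fps_exp (1 / 2)) * emb (fps_exp (- c / 2)) - fps_const (fps_exp (- (1 / 2))) * emb (fps_exp (c / 2))"
proof -
 have "(fps_const fps_X - fps_const (fps_const c) * fps_X) * tau_shift c =
  hD_fps (fps_exp (- c)) (fps_const fps_X * fps_const sinhc)"
  by (simp add: tau_shift_def hD_exp_mult hD_exp_const_X del: fps_const_mult flip: fps_const_neg)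
 also have "fps_const fps_X * fps_const sinhc = fps_const (fps_exp (1 / 2)) - fps_const (fps_exp (- (1 / 2)))"
  by (simp add: X_sinhc)
 finally show ?thesis by (simp only: hD_fps_diff hD_exp_const_exp) simp
qed

text \<open>\<open>exp (- (z - c h) / 2)\<close>, the factor between
  \<open>2 sinh((z - c h) / 2)\<close> and \<open>1 - q^c e^(-z)\<close>. The same factor serves the
  opposite side of the relation, where the hyperbolic sine is shifted the other way.\<close>

definition hat_unit :: "complex => complex fps fps" where
 "hat_unit c = fps_const (fps_exp (- (1 / 2))) * emb (fps_exp (c / 2))"

lemma emb_exp_mult: "emb (fps_exp x) * emb (fps_exp y) = emb (fps_exp (x + y))"
 by (simp add: fps_exp_add_mult flip: emb_mult)

lemma hat_unit_mult:
 "temb (hat_unit c) * ((zv - hmon c) * temb (tau_shift c)) = 1 - hemb (fps_exp c) * expm"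
 "temb (hat_unit c) * ((zv + hmon c) * temb (tau_shift (- c))) = hemb (fps_exp c) - expm"
proof -
 define A B where "A = (fps_const (fps_exp (1 / 2)) :: complex fps fps)" and "B = (fps_const (fps_exp (- (1 / 2))) :: complex fps fps)"
 define E F where "E = emb (fps_exp (c / 2))" and "F = emb (fps_exp (- c / 2))"
 have AB: "A * B = 1" "E * F = 1"
  using fps_exp_add_mult[of "1 / 2 :: complex" "- (1 / 2)"] by (simp_all add: A_def B_def E_def F_def emb_exp_mult)
 have BB: "B * B = fps_const (fps_exp (- 1))" "E * E = emb (fps_exp c)"
  using fps_exp_add_mult[of "- (1 / 2) :: complex" "- (1 / 2)"] by (simp_all add: B_def E_def emb_exp_mult)
 have "hat_unit c * ((fps_const fps_X - fps_const (fps_const c) * fps_X) * tau_shift c) = (B * E) * (A * F - B * E)"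
  unfolding X_mult_tau_shift by (simp add: hat_unit_def A_def B_def E_def F_def)
 also have "... = (A * B) * (E * F) - (B * B) * (E * E)" by (simp only: right_diff_distrib mult_ac)
 also have "... = 1 - emb (fps_exp c) * fps_const (fps_exp (- 1))" by (simp add: AB BB mult.commute)
 finally show "temb (hat_unit c) * ((zv - hmon c) * temb (tau_shift c)) = 1 - hemb (fps_exp c) * expm"
  by (simp only: zv_eq_temb hmon_eq_temb temb_mult[symmetric] temb_diff[symmetric] temb_1[symmetric]
    hemb_eq_temb temb_const[symmetric])
 have "hat_unit c * ((fps_const fps_X + fps_const (fps_const c) * fps_X) * tau_shift (- c)) = (B * E) * (A * E - B * F)"
  using X_mult_tau_shift[of "- c"] by (simp add: hat_unit_def A_def B_def E_def F_def flip: fps_const_neg)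
 also have "... = (A * B) * (E * E) - (B * B) * (E * F)" by (simp only: right_diff_distrib mult_ac)
 also have "... = emb (fps_exp c) - fps_const (fps_exp (- 1))" by (simp add: AB BB mult.commute)
 finally show "temb (hat_unit c) * ((zv + hmon c) * temb (tau_shift (- c))) = hemb (fps_exp c) - expm"
  by (simp only: zv_eq_temb hmon_eq_temb temb_mult[symmetric] temb_diff[symmetric] temb_add[symmetric]
    hemb_eq_temb temb_const[symmetric])
qed

lemma hat_unit_inverse: "hat_unit c * (fps_const (fps_exp (1 / 2)) * emb (fps_exp (- c / 2))) = 1"
proof -
 have "fps_const (fps_exp (- (1 / 2))) * fps_const (fps_exp (1 / 2)) = (1 :: complex fps fps)"
  using fps_exp_add_mult[of "- (1 / 2) :: complex" "1 / 2"] by simp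
 moreover have "emb (fps_exp (c / 2)) * emb (fps_exp (- c / 2)) = 1" by (simp add: emb_exp_mult)
 ultimately show ?thesis unfolding hat_unit_def by (metis (no_types, opaque_lifting) mult.assoc mult.commute mult_1)
qed

lemma xy_scalar:
 "(- zv + hmon c) * temb (tau_shift c) / ((- zv - hmon c) * temb (tau_shift (- c))) =
  (1 - hemb (fps_exp c) * expm) / (hemb (fps_exp c) - expm)"
proof -
 have u: "- temb (hat_unit c) ~= 0"
  using hat_unit_inverse[of c] temb_inj[of "hat_unit c" 0] by auto
 have "(- zv + hmon c) * temb (tau_shift c) / ((- zv - hmon c) * temb (tau_shift (- c))) =
  (- temb (hat_unit c) * ((- zv + hmon c) * temb (tau_shift c))) / (- temb (hat_unit c) * ((- zv - hmon c) * temb (tau_shift (- c))))"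
  by (rule div_mult_mult1[OF u, symmetric])
 also have "- T * ((- z + h) * t) = T * ((z - h) * t)" for T z h t :: "complex fls fps"
  by (simp add: algebra_simps)
 also have "- T * ((- z - h) * t) = T * ((z + h) * t)" for T z h t :: "complex fls fps"
  by (simp add: algebra_simps)
 also note hat_unit_mult(1)
 also note hat_unit_mult(2)
 finally show ?thesis .
qed

subsection \<open>The series \<open>\<tau>\<close>\<close>

lemma hD_zderiv: "fps_X * hD_fps P (fps_const (fps_deriv g)) = hD_fps (fps_X * P) (fps_const g)"
proof -
 have "zderiv (fps_const g) = fps_const (fps_deriv g)" by (rule fps_ext) simp
 then have "fps_X * hD_fps P (fps_const (fps_deriv g)) = fps_X * zderiv (hD_fps P (fps_const g))"
  by (simp add: zderiv_hD)
 then show ?thesis by (simp add: hD_fps_mult flip: hD_fps_X)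
qed

text \<open>Applied to a derivative, \<open>F(D)\<close> loses its denominator \<open>D\<close> and
  leaves \<open>q^D - q^(-D)\<close>, whose symbol is \<open>q1\<close>.\<close>

lemma F_fps_hD: "F_fps (hD_fps P (fps_const (fps_deriv g))) = hD_fps (q1 * P) (fps_const g)"
 unfolding F_fps_def hD_fps_mult hD_zderiv by (simp add: X_Fser flip: mult.assoc)

lemma F_fps_uminus: "F_fps (- f) = - F_fps f"
 by (simp add: F_fps_def hD_fps_uminus)

text \<open>Apart from the normalisation, the conditions reduce to
  \<open>q^d - q^(-d) = q1 * qnum d\<close>: neighbouring members of the tuple differ by a factor
  \<open>qnum d\<close>, and \<open>F\<close> supplies the factor \<open>q1\<close>.\<close>

lemma tau_trig_in_tau_set: "tau_trig a r l \<in> tau_set r l"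
proof -
 let ?d = "rl r l"
 have e: "fps_exp ?d - fps_exp (- ?d) = q1 * qnum ?d" by (simp only: qnum_q1)
 have 1: "F_fps (hD_fps (fps_exp (- c) * qnum ?d ^ 2) (fps_const (fps_deriv (fps_deriv f0)))) =
  hD_fps (fps_exp (- ?d)) (- hD_fps (fps_exp (- c) * qnum ?d) (fps_const (fps_deriv f0))) -
  hD_fps (fps_exp ?d) (- hD_fps (fps_exp (- c) * qnum ?d) (fps_const (fps_deriv f0)))" for c
 proof -
  have "hD_fps (fps_exp (- ?d)) (- hD_fps (fps_exp (- c) * qnum ?d) (fps_const (fps_deriv f0))) -
   hD_fps (fps_exp ?d) (- hD_fps (fps_exp (- c) * qnum ?d) (fps_const (fps_deriv f0))) =
   hD_fps ((fps_exp ?d - fps_exp (- ?d)) * (fps_exp (- c) * qnum ?d)) (fps_const (fps_deriv f0))"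
   by (simp add: hD_fps_uminus hD_fps_mult hD_fps_diff_l left_diff_distrib)
  then show ?thesis unfolding e F_fps_hD by (simp add: power2_eq_square mult_ac)
 qed
 have 2: "hD_fps (fps_exp (- ?d)) (exp_zh (hD_fps (fps_exp (- c)) (fps_const f0))) *
   inverse (hD_fps (fps_exp ?d) (exp_zh (hD_fps (fps_exp (- c)) (fps_const f0)))) =
   exp_zh (F_fps (- hD_fps (fps_exp (- c) * qnum ?d) (fps_const (fps_deriv f0))))" for c
 proof -
  let ?g = "hD_fps (fps_exp (- c)) (fps_const f0)"
  have g: "?g $ 0 $ 0 = 0" by (simp add: hD_fps_nth_0)
  have z: "hD_fps (fps_exp x) ?g $ 0 $ 0 = 0" for x by (simp add: hD_fps_nth_0)
  have "F_fps (- hD_fps (fps_exp (- c) * qnum ?d) (fps_const (fps_deriv f0))) =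
   - hD_fps ((q1 * qnum ?d) * fps_exp (- c)) (fps_const f0)"
   by (simp add: F_fps_uminus F_fps_hD mult_ac)
  also have "... = hD_fps (fps_exp (- ?d)) ?g - hD_fps (fps_exp ?d) ?g"
   unfolding e[symmetric] by (simp add: hD_fps_mult left_diff_distrib hD_fps_diff_l)
  finally show ?thesis
   by (simp add: hD_exp_exp_zh[OF g] exp_zh_diff[OF z z])
 qed
 show ?thesis unfolding tau_set_def using 1 2 by simp
qed

subsection \<open>The scalars of the vectors \<open>E\<close>\<close>

lemma eval_zh_hD_exp_const:
 "eval_zh (hD_fps (fps_exp c) (fps_const g)) d = g oo (fps_const (c + d) * fps_X)"
proof (rule fps_ext)
 fix m
 have h: "hD_fps (fps_exp c) (fps_const g) $ n = fps_const (c ^ n / fact n) * (fps_deriv ^^ n) g" for n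
 proof -
  have "hD_fps (fps_exp c) (fps_const g) $ n =
    (\<Sum>k\<in>{n}. fps_const (fps_exp c $ k) * (fps_deriv ^^ k) (fps_const g $ (n - k)))"
   unfolding hD_fps_nth by (rule sum.mono_neutral_right) auto
  then show ?thesis by simp
 qed
 have dn: "(fps_deriv ^^ n) g $ k = g $ (n + k) * fact (n + k) / fact k" for n k
 proof (induction n arbitrary: k)
  case (Suc n)
  have "(fps_deriv ^^ Suc n) g $ k = of_nat (k + 1) * ((fps_deriv ^^ n) g $ (k + 1))" by simp
  also have "... = g $ (Suc n + k) * fact (Suc n + k) / fact k"
   unfolding Suc by (simp add: field_simps del: of_nat_Suc)
  finally show ?case .
 qed simp
 have "eval_zh (hD_fps (fps_exp c) (fps_const g)) d $ m =
   (\<Sum>n\<le>m. of_nat (m choose n) * c ^ n * d ^ (m - n) * g $ m)"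
  unfolding eval_zh_def fps_nth_Abs_fps h
  by (intro sum.cong refl) (simp add: dn binomial_fact field_simps)
 \<comment> \<open>The binomial theorem: Taylor's formula for the shift by \<open>c h\<close>,
   evaluated at \<open>z = d h\<close>.\<close>
 also have "... = (c + d) ^ m * g $ m"
  by (simp add: binomial_ring sum_distrib_right)
 finally show "eval_zh (hD_fps (fps_exp c) (fps_const g)) d $ m = (g oo (fps_const (c + d) * fps_X)) $ m" by simp
qed

lemma Fser_eq_sinhc: "Fser = fps_const 2 * (sinhc oo (fps_const 2 * fps_X))"
proof -
 have "fps_X * (fps_const 2 * (sinhc oo (fps_const 2 * fps_X))) = (fps_X * sinhc) oo (fps_const 2 * fps_X)"
  by (simp add: fps_compose_mult_distrib mult_ac)
 also have "... = q1" unfolding X_sinhc by (simp add: fps_compose_sub_distrib)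
 finally show ?thesis by (metis X_Fser fps_X_neq_zero mult_cancel_left)
qed

lemma sinhc_compose_neg: "sinhc oo (fps_const (- c) * fps_X) = sinhc oo (fps_const c * fps_X)"
proof (rule fps_ext)
 fix n
 have "(- 1) ^ n * sinhc $ n = sinhc $ n" using arg_cong[OF pneg_sinhc, of "%f. f $ n"] by (simp add: pneg_nth)
 then show "(sinhc oo (fps_const (- c) * fps_X)) $ n = (sinhc oo (fps_const c * fps_X)) $ n"
  unfolding fps_nth_compose_linear power_minus[of c n] by (metis mult.assoc mult.commute)
qed

lemma Fval_eq: "Fval c = fps_const 2 * fps_X * (sinhc oo (fps_const (2 * c) * fps_X))"
 unfolding Fval_def Fser_eq_sinhc
 by (simp add: fps_compose_mult_distrib fps_compose_assoc[symmetric] mult_ac)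

lemma fps_sqrt_divide:
 fixes u v :: "complex fps"
 assumes "u $ 0 = 1" "v $ 0 = 1"
 shows "fps_sqrt (u / v) = fps_sqrt u / fps_sqrt v"
 by (rule iffD1[OF radical_divide]) (use assms in auto)

text \<open>With \<open>Fval c = 2 h sinhc(2 c h)\<close> the factor \<open>2 h\<close> cancels, and
  evenness of \<open>sinhc\<close> matches the values at \<open>- 2 d h\<close> and
  \<open>2 d h\<close> with numerator and denominator. The parameter \<open>2 * s\<close> is
  \<open>r_i a_ii\<close> for \<open>s = r_i\<close>. Constant terms 1 make the square root
  multiplicative.\<close>

lemma E_scalar:
 assumes "tau = tau_shift (2 * s)"
 shows "fps_sqrt (eval_zh tau (- 2 * d)) / fps_sqrt (eval_zh tau (2 * d)) = fps_sqrt (Fval (s + d) / Fval (s - d))"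
  and "fps_sqrt (Fval (s + d) / Fval (s - d)) $ 0 = 1"
proof -
 let ?S = "%c. sinhc oo (fps_const c * fps_X)"
 have S0: "?S c $ 0 = 1" for c by simp
 have 1: "eval_zh tau (- 2 * d) = ?S (2 * (s + d))"
  using sinhc_compose_neg[of "2 * (s + d)"] by (simp add: assms tau_shift_def eval_zh_hD_exp_const algebra_simps)
 have 2: "eval_zh tau (2 * d) = ?S (2 * (s - d))"
  using sinhc_compose_neg[of "2 * (s - d)"] by (simp add: assms tau_shift_def eval_zh_hD_exp_const algebra_simps)
 have "fps_const 2 * fps_X ~= (0 :: complex fps)" by simp
 then have 3: "Fval (s + d) / Fval (s - d) = ?S (2 * (s + d)) / ?S (2 * (s - d))"
  unfolding Fval_eq by (rule div_mult_mult1)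
 show "fps_sqrt (eval_zh tau (- 2 * d)) / fps_sqrt (eval_zh tau (2 * d)) = fps_sqrt (Fval (s + d) / Fval (s - d))"
  unfolding 1 2 3 by (rule fps_sqrt_divide[symmetric]) (rule S0)+
 have "(?S (2 * (s + d)) / ?S (2 * (s - d))) $ 0 = 1"
  by (subst fps_divide_unit) (simp_all add: S0)
 then show "fps_sqrt (Fval (s + d) / Fval (s - d)) $ 0 = 1"
  unfolding 3 by simp
qed

section \<open>Products of scalar series and vector-valued series\<close>

text \<open>Arbitrary lower bounds replace the subdegrees, so that one summation range serves all
  the finitely many coefficients of \<open>h\<close> that matter modulo
  \<open>h ^ N\<close>.\<close>

lemma fls_times_nth_range:
 fixes f g :: "complex fls"
 assumes "!!m. m < A ==> f $$ m = 0" "!!m. m < B ==> g $$ m = 0"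
 shows "(f * g) $$ n = (\<Sum>m = A..n - B. f $$ m * g $$ (n - m))"
proof (cases "f = 0 | g = 0")
 case False
 then have "A <= fls_subdegree f" "B <= fls_subdegree g"
  using assms by (auto intro!: fls_subdegree_geI)
 then have "(\<Sum>m = A..n - B. f $$ m * g $$ (n - m)) = (\<Sum>m = fls_subdegree f..n - fls_subdegree g. f $$ m * g $$ (n - m))"
 proof (intro sum.mono_neutral_right ballI)
  fix i assume "i \<in> {A..n - B} - {fls_subdegree f..n - fls_subdegree g}"
  then have "i < fls_subdegree f | n - i < fls_subdegree g" by auto
  then show "f $$ i * g $$ (n - i) = 0" by auto
 qed auto
 then show ?thesis by (simp add: fls_times_nth(2))
qed auto

lemma fls_fps_lower: "EX C::int. ALL n<N. ALL c<C. (F :: complex fls fps) $ n $$ c = 0"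
proof (induction N)
 case (Suc N)
 then obtain C where C: "ALL n<N. ALL c<C. F $ n $$ c = 0" by blast
 show ?case
  by (rule exI[of _ "min C (fls_subdegree (F $ N))"])
   (use C in \<open>auto simp: less_Suc_eq intro: fls_eq0_below_subdegree\<close>)
qed auto

section \<open>The substitution of -z for z in Laurent series\<close>

definition flneg :: "complex fls => complex fls" where
 "flneg f = Abs_fls (%c. (- 1) powi c * f $$ c)"

lemma flneg_nth [simp]: "flneg f $$ c = (- 1) powi c * f $$ c"
 unfolding flneg_def
 by (rule nth_Abs_fls_lower_bound[of "fls_subdegree f"]) (auto simp: fls_eq0_below_subdegree)

lemma flneg_mult: "flneg (f * g) = flneg f * flneg g"
proof (rule fls_eqI)
 fix n
 let ?A = "fls_subdegree f" and ?B = "fls_subdegree g"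
 have "flneg (f * g) $$ n = (\<Sum>m = ?A..n - ?B. (- 1) powi n * (f $$ m * g $$ (n - m)))"
  by (simp add: fls_times_nth(2) sum_distrib_left)
 also have "... = (\<Sum>m = ?A..n - ?B. flneg f $$ m * flneg g $$ (n - m))"
 proof (rule sum.cong[OF refl])
  fix m
  have "(- 1 :: complex) powi n = (- 1) powi m * (- 1) powi (n - m)"
   by (simp flip: power_int_add)
  then show "(- 1) powi n * (f $$ m * g $$ (n - m)) = flneg f $$ m * flneg g $$ (n - m)" by simp
 qed
 also have "... = (flneg f * flneg g) $$ n"
  by (rule fls_times_nth_range[symmetric]) (auto simp: fls_eq0_below_subdegree)
 finally show "flneg (f * g) $$ n = (flneg f * flneg g) $$ n" .
qed

lemma flneg_add: "flneg (f + g) = flneg f + flneg g"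
 by (rule fls_eqI) (simp add: algebra_simps)

lemma flneg_sum: "flneg (sum f S) = (\<Sum>i\<in>S. flneg (f i))"
 by (induction S rule: infinite_finite_induct) (auto simp: flneg_add intro: fls_eqI)

lemma flneg_const [simp]: "flneg (fls_const c) = fls_const c"
 by (rule fls_eqI) auto

lemma flneg_flneg [simp]: "flneg (flneg f) = f"
 by (rule fls_eqI) (simp add: mult.assoc[symmetric] flip: power_int_mult_distrib)

definition fneg :: "complex fls fps => complex fls fps" where
 "fneg F = Abs_fps (%n. flneg (F $ n))"

lemma fneg_nth [simp]: "fneg F $ n = flneg (F $ n)"
 by (simp add: fneg_def)

lemma fneg_mult: "fneg (F * G) = fneg F * fneg G"
 by (rule fps_ext) (simp add: fps_mult_nth flneg_sum flneg_mult)

lemma fneg_diff: "fneg (F - G) = fneg F - fneg G"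
 by (rule fps_ext, rule fls_eqI) (simp add: algebra_simps)

lemma fneg_1 [simp]: "fneg 1 = 1"
proof (rule fps_ext)
 fix n show "fneg 1 $ n = 1 $ n"
  using flneg_const[of 1] flneg_const[of 0] by (cases "n = 0") simp_all
qed

lemma fneg_hemb [simp]: "fneg (hemb P) = hemb P"
 by (rule fps_ext) (simp add: hemb_def)

lemma fneg_temb: "fneg (temb f) = temb (reflect f)"
proof (rule fps_ext, rule fls_eqI)
 fix n c
 show "fneg (temb f) $ n $$ c = temb (reflect f) $ n $$ c"
 proof (cases "0 <= c")
  case True
  then obtain k where "c = int k" by (metis nonneg_int_cases)
  then show ?thesis by (simp add: reflect_nth pneg_nth)
 qed simp
qed

lemma fneg_fneg [simp]: "fneg (fneg F) = F"
 by (rule fps_ext) simp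

text \<open>\<open>f(z1 - z2) = f(-(z2 - z1))\<close>: the other expansion is the same one for the
  reflected series with the variables exchanged. What is proved for \<open>iota12\<close> thus
  carries over.\<close>

lemma iota21_eq: "iota21 F a b = iota12 (fneg F) b a"
proof (rule fps_ext)
 fix n
 have "(- 1 :: complex) powi b = (- 1) powi a * (- 1) powi (a + b)" if "0 <= a"
  by (simp add: power_int_add flip: power_int_mult_distrib mult.assoc)
 then show "iota21 F a b $ n = iota12 (fneg F) b a $ n"
  by (simp add: iota21_nth iota12_nth mult_ac add.commute)
qed

lemma iota12_dvd:
 assumes "ALL n<N. ALL c<C. F $ n $$ c = 0" "q < 0 | p + q < C"
 shows "fps_X ^ N dvd iota12 F p q"
 using assms by (auto simp: fps_X_power_dvd_iff iota12_nth)

text \<open>Expansion is multiplicative: Vandermonde's identity sums the products of binomial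
  coefficients over \<open>q\<close>, and what remains is the Laurent convolution in the total
  exponent.\<close>

lemma iota12_conv:
 "hsum HM (%(p, q). iota12 F p q * iota12 G (P - p) (Q - q)) = iota12 (F * G) P Q"
proof -
 interpret HM: hfree HM by (rule hfree_HM)
 let ?f = "%(p, q). iota12 F p q * iota12 G (P - p) (Q - q)"
 have "hsums HM ?f (iota12 (F * G) P Q)"
 proof (rule HM.hsumsI)
  fix N
  obtain C where C: "ALL n<N. ALL c<C. F $ n $$ c = 0" using fls_fps_lower by blast
  obtain D where D: "ALL n<N. ALL c<D. G $ n $$ c = 0" using fls_fps_lower by blast
  \<comment> \<open>Coordinates are the total exponent \<open>m = p + q\<close> and the exponent
    \<open>q\<close> of \<open>z2\<close>; modulo \<open>h ^ N\<close> both are bounded.\<close>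
  let ?M = "{C..P + Q - D} \<times> {0..Q}"
  let ?h = "%(m::int, q::int). (m - q, q)"
  let ?S = "?h ` ?M"
  have inj: "inj_on ?h ?M" by (auto simp: inj_on_def)
  have out: "fps_X ^ N dvd ?f j" if "j \<notin> ?S" for j
  proof -
   obtain p q where j: "j = (p, q)" by fastforce
   have "(p + q, q) \<notin> ?M" using that j by force
   then have "q < 0 | p + q < C | Q - q < 0 | (P - p) + (Q - q) < D" by auto
   then show ?thesis using iota12_dvd[OF C, of q p] iota12_dvd[OF D, of "Q - q" "P - p"]
    unfolding j by (auto intro: dvd_mult dvd_mult2)
  qed
  have eq: "sum ?f ?S $ n = iota12 (F * G) P Q $ n" if n: "n < N" for n
  proof (cases "0 <= Q")
   case True
   have V: "(\<Sum>q = 0..Q. (of_int m gchoose nat q) * (of_int (P + Q - m) gchoose nat (Q - q))) = (of_int (P + Q) gchoose nat Q :: complex)" for m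
   proof -
    have "(\<Sum>q = 0..Q. (of_int m gchoose nat q) * (of_int (P + Q - m) gchoose nat (Q - q))) =
     (\<Sum>k\<le>nat Q. (of_int m gchoose k) * (of_int (P + Q - m) gchoose (nat Q - k)) :: complex)"
     by (rule sum.reindex_bij_witness[of _ int nat]) (use True in \<open>auto simp: nat_diff_distrib\<close>)
    then show ?thesis using gbinomial_Vandermonde[of "of_int m :: complex" "of_int (P + Q - m)" "nat Q"] by (simp add: atLeast0AtMost)
   qed
   have "sum ?f ?S $ n = (\<Sum>(m, q)\<in>?M. (iota12 F (m - q) q * iota12 G (P - (m - q)) (Q - q)) $ n)"
    using sum.reindex[OF inj, of ?f] by (simp add: fps_sum_nth case_prod_unfold)
   also have "... = (\<Sum>m = C..P + Q - D. \<Sum>q = 0..Q. (iota12 F (m - q) q * iota12 G (P - (m - q)) (Q - q)) $ n)"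
    by (simp add: sum.cartesian_product)
   also have "... = (\<Sum>m = C..P + Q - D. \<Sum>q = 0..Q. \<Sum>i = 0..n. (- 1) powi Q *
     ((of_int m gchoose nat q) * (of_int (P + Q - m) gchoose nat (Q - q))) *
     (F $ i $$ m * G $ (n - i) $$ (P + Q - m)))"
   proof (intro sum.cong refl)
    fix m q :: int assume q: "q \<in> {0..Q}"
    have "(- 1 :: complex) powi Q = (- 1) powi q * (- 1) powi (Q - q)"
     by (simp flip: power_int_add)
    moreover have e: "P - (m - q) + (Q - q) = P + Q - m" by simp
    moreover have "iota12 F (m - q) q $ i = (- 1) powi q * (of_int m gchoose nat q) * F $ i $$ m" for i
     using q by (simp add: iota12_nth)
    moreover have "iota12 G (P - (m - q)) (Q - q) $ i =
      (- 1) powi (Q - q) * (of_int (P + Q - m) gchoose nat (Q - q)) * G $ i $$ (P + Q - m)" for i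
     unfolding iota12_nth e using q by simp
    ultimately show "(iota12 F (m - q) q * iota12 G (P - (m - q)) (Q - q)) $ n =
     (\<Sum>i = 0..n. (- 1) powi Q *
     ((of_int m gchoose nat q) * (of_int (P + Q - m) gchoose nat (Q - q))) *
     (F $ i $$ m * G $ (n - i) $$ (P + Q - m)))"
     by (simp only: fps_mult_nth mult_ac)
   qed
   also have "... = (\<Sum>m = C..P + Q - D. \<Sum>i = 0..n. (- 1) powi Q *
     (\<Sum>q = 0..Q. (of_int m gchoose nat q) * (of_int (P + Q - m) gchoose nat (Q - q))) *
     (F $ i $$ m * G $ (n - i) $$ (P + Q - m)))"
    by (subst sum.swap) (simp add: sum_distrib_left sum_distrib_right mult_ac)
   also have "... = (\<Sum>i = 0..n. (- 1) powi Q * (of_int (P + Q) gchoose nat Q) *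
     (\<Sum>m = C..P + Q - D. F $ i $$ m * G $ (n - i) $$ (P + Q - m)))"
    unfolding V by (subst sum.swap) (simp add: sum_distrib_left)
   also have "... = (\<Sum>i = 0..n. (- 1) powi Q * (of_int (P + Q) gchoose nat Q) * (F $ i * G $ (n - i)) $$ (P + Q))"
    using C D n by (intro sum.cong refl arg_cong2[of _ _ _ _ "(*)"] fls_times_nth_range[symmetric]) auto
   also have "... = iota12 (F * G) P Q $ n"
    using True by (simp add: iota12_nth fps_mult_nth fls_nth_sum sum_distrib_left)
   finally show ?thesis .
  qed (simp add: iota12_nth)
  show "EX F'. finite F' & (ALL j. j \<notin> F' --> ?f j \<in> hpow HM N) & hcong HM N (finsum HM ?f F') (iota12 (F * G) P Q)"
   by (intro exI[of _ ?S] conjI allI impI finite_imageI)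
    (use out eq in \<open>auto simp: hcong_def fps_X_power_dvd_iff simp del: fps_sum_nth\<close>)
 qed auto
 then show ?thesis by (rule HM.hsum_eqI) auto
qed

text \<open>Vector series in \<open>W((z1))((z2))\<close> modulo every \<open>h ^ N\<close>, such as
  \<open>x(z1) y(z2) w\<close>; the bound for \<open>z1\<close> may depend on the exponent of
  \<open>z2\<close>. These are the series that can be multiplied by expansions in nonnegative powers
  of \<open>z2\<close>.\<close>

definition left_truncated :: "(complex fps, 'v, 'm) module_scheme => (int => int => 'v) => bool" where
 "left_truncated W Z \<longleftrightarrow> (ALL a b. Z a b \<in> carrier W) & (ALL N. EX b0. ALL a b. b < b0 --> Z a b \<in> hpow W N) &
   (ALL N b. EX a0. ALL a<a0. Z a b \<in> hpow W N)"

context hfree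
begin

lemma left_truncated_fields:
 assumes "is_field M x" "is_field M y" "w \<in> carrier M"
 shows "left_truncated M (%a b. x a (y b w))"
proof -
 have x: "x a \<in> linear_maps M M" and y: "y a \<in> linear_maps M M" for a using assms by (auto simp: is_field_def)
 have yw: "y b w \<in> carrier M" for b using y[of b] assms by (auto simp: linear_maps_def)
 have hp: "v \<in> hpow M N ==> x a v \<in> hpow M N" for a v N
  using linear_maps_hpow[OF hmod_axioms hmod_axioms x] .
 have xt: "ALL w:carrier M. ALL n. EX N. ALL c<N. x c w \<in> hpow M n"
  and yt: "ALL w:carrier M. ALL n. EX N. ALL c<N. y c w \<in> hpow M n" using assms by (auto simp: is_field_def)
 show ?thesis
  unfolding left_truncated_def
 proof (intro conjI allI)
  show "x a (y b w) \<in> carrier M" for a b using x[of a] yw[of b] by (auto simp: linear_maps_def)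
  show "EX b0. ALL a b. b < b0 --> x a (y b w) \<in> hpow M N" for N
   using yt[rule_format, OF assms(3), of N] hp by blast
  show "EX a0. ALL a<a0. x a (y b w) \<in> hpow M N" for N b
   using xt[rule_format, OF yw] by blast
 qed
qed

lemma hpow_mult:
 assumes "x \<in> carrier M" "fps_X ^ N dvd u | fps_X ^ N dvd v | x \<in> hpow M N"
 shows "(u * v) \<odot> x \<in> hpow M N"
 using assms hpow_dvd[of x N "u * v"] hpow_smult[of x N "u * v"] dvd_mult2 dvd_mult by blast

text \<open>Summability is established for two scalar factors at once; products with one factor are
  the special case \<open>G = 1\<close>, restricted to the term where it contributes 1.\<close>

lemma iota12_null:
 assumes Z: "left_truncated M Z"
 shows "hnull M (%((p, q), (p', q')). (iota12 F p q * iota12 G p' q') \<odot> Z (a - p - p') (b - q - q'))"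
  (is "hnull M ?K")
proof -
 have Xc: "Z a b \<in> carrier M" for a b using Z by (auto simp: left_truncated_def)
 have "?K j \<in> carrier M" for j
  using Xc by (auto split: prod.split)
 moreover have "finite {j. ?K j \<notin> hpow M N}" for N
 proof -
 obtain C where C: "ALL n<N. ALL c<C. F $ n $$ c = 0" using fls_fps_lower by blast
 obtain D where D: "ALL n<N. ALL c<D. G $ n $$ c = 0" using fls_fps_lower by blast
 obtain b0 where b0: "!!a b. b < b0 ==> Z a b \<in> hpow M N" using Z unfolding left_truncated_def by blast
 obtain al where al: "!!b a. a < al b ==> Z a b \<in> hpow M N" using Z unfolding left_truncated_def by metis
 \<comment> \<open>Only the exponents of \<open>z2\<close> from \<open>b0\<close> to
   \<open>b\<close> can matter, so the finitely many bounds \<open>al\<close> have a common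
   minimum.\<close>
 define m where "m = Min (insert 0 (al ` {b0..b}))"
 have m: "Z a' b' \<in> hpow M N" if "a' < m" "b' <= b" for a' b'
 proof (cases "b' < b0")
  case False
  then have "m <= al b'" using that unfolding m_def by (intro Min_le) auto
  then show ?thesis using al that by auto
 qed (use b0 in auto)
 define L where "L = max 0 (b - b0)"
 let ?S = "({C - L..a - m - (D - L)} \<times> {0..L}) \<times> ({D - L..a - m - (C - L)} \<times> {0..L})"
 have "{j. ?K j \<notin> hpow M N} \<subseteq> ?S"
 proof
  fix j assume j': "j \<in> {j. ?K j \<notin> hpow M N}"
  obtain p q p' q' where j: "j = ((p, q), (p', q'))" by (metis surj_pair)
  have n: "(iota12 F p q * iota12 G p' q') \<odot> Z (a - p - p') (b - q - q') \<notin> hpow M N"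
   using j' by (simp add: j)
  then have "~  fps_X ^ N dvd iota12 F p q" "~  fps_X ^ N dvd iota12 G p' q'" "Z (a - p - p') (b - q - q') \<notin> hpow M N"
   using hpow_mult[OF Xc] by blast+
  then have 1: "0 <= q" "C <= p + q" "0 <= q'" "D <= p' + q'" "b0 <= b - q - q'"
   and n': "Z (a - p - p') (b - q - q') \<notin> hpow M N"
   using iota12_dvd[OF C, of q p] iota12_dvd[OF D, of q' p'] b0 by (force simp: not_less[symmetric])+
  have "m <= a - p - p'"
   using m[of "a - p - p'" "b - q - q'"] n' 1 by linarith
  with 1 have "(C - L <= p & p <= a - m - (D - L) & 0 <= q & q <= L) & D - L <= p' & p' <= a - m - (C - L) & 0 <= q' & q' <= L"
   unfolding L_def by linarith
  then show "j \<in> ?S" by (simp add: j)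
 qed
 then show ?thesis by (rule finite_subset) auto
 qed
 ultimately show ?thesis by (auto simp: hnull_def)
qed

lemma iota12_1: "iota12 1 0 0 = 1"
 by (rule fps_ext) (auto simp: iota12_nth)

lemma iota12_null1:
 assumes Z: "left_truncated M Z"
 shows "hnull M (%(p, q). iota12 F p q \<odot> Z (a - p) (b - q))"
proof -
 have "hnull M (%j. (%((p, q), (p', q')). (iota12 F p q * iota12 1 p' q') \<odot> Z (a - p - p') (b - q - q')) (j, (0, 0)))"
  by (rule hnull_reindex[OF iota12_null[OF Z]]) (simp add: inj_def)
 then show ?thesis by (simp add: iota12_1 case_prod_unfold)
qed

lemma smult_linear: "(\<odot>) c \<in> linear_maps M M"
 by (rule linear_mapsI) (auto simp: sm_add_r sm_assoc mult.commute)

lemma smult_linear_HM: "x \<in> carrier M ==> (%c. c \<odot> x) \<in> linear_maps HM M"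
 by (rule linear_mapsI) (auto simp: sm_add_l sm_assoc)

lemma smul2_closed: "left_truncated M Z ==> smul2 M (iota12 F) Z a b \<in> carrier M"
 unfolding smul2_def by (rule hsum_closed) (rule iota12_null1)

text \<open>Both sides rearrange one summable family: grouped by the exponents of the first factor,
  or by the total exponents of both scalar factors, where the inner sums are those of
  \<open>iota12_conv\<close>.\<close>

lemma smul2_assoc:
 assumes Z: "left_truncated M Z"
 shows "smul2 M (iota12 F) (smul2 M (iota12 G) Z) a b = smul2 M (iota12 (F * G)) Z a b"
proof -
 have Xc: "Z a b \<in> carrier M" for a b using Z by (auto simp: left_truncated_def)
 let ?K = "%((p, q), (p', q')). (iota12 F p q * iota12 G p' q') \<odot> Z (a - p - p') (b - q - q')"
 let ?\<pi> = "%((P, Q), (p, q)). ((p :: int, q :: int), (P - p, Q - q :: int))"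
 note K = iota12_null[OF Z, of F G a b]
 have bij: "bij ?\<pi>"
  by (rule o_bij[of "%((p, q), (p', q')). ((p + p', q + q'), (p, q))"]) (auto simp: fun_eq_iff)
 have "smul2 M (iota12 F) (smul2 M (iota12 G) Z) a b = hsum M (%j. hsum M (%k. ?K (j, k)))"
  unfolding smul2_def
 proof (rule arg_cong[of _ _ "hsum M"], rule ext)
  fix j :: "int \<times> int"
  obtain p q where j: "j = (p, q)" by fastforce
  have "iota12 F p q \<odot> hsum M (%(p', q'). iota12 G p' q' \<odot> Z (a - p - p') (b - q - q')) =
   hsum M (%k. iota12 F p q \<odot> (%(p', q'). iota12 G p' q' \<odot> Z (a - p - p') (b - q - q')) k)"
   by (rule hsum_linear[OF hfree_axioms hfree_axioms smult_linear iota12_null1[OF Z]])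
  then show "(case j of (p, q) => iota12 F p q \<odot> hsum M (%(p', q'). iota12 G p' q' \<odot> Z (a - p - p') (b - q - q')))
   = hsum M (%k. ?K (j, k))"
   using Xc by (simp add: j case_prod_unfold sm_assoc)
 qed
 also have "... = hsum M ?K" by (rule hsum_Sigma[OF K])
 also have "... = hsum M (%j. ?K (?\<pi> j))" by (rule hsum_reindex[OF K bij, symmetric])
 also have "... = hsum M (%j. hsum M (%k. ?K (?\<pi> (j, k))))"
  by (rule hsum_Sigma[symmetric]) (rule hnull_reindex[OF K bij_is_inj[OF bij]])
 also have "... = smul2 M (iota12 (F * G)) Z a b"
  unfolding smul2_def
 proof (rule arg_cong[of _ _ "hsum M"], rule ext)
  fix j :: "int \<times> int"
  obtain P Q where j: "j = (P, Q)" by fastforce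
  let ?c = "%(p, q). iota12 F p q * iota12 G (P - p) (Q - q)"
  have "finite {j. ?c j \<notin> hpow HM N}" for N
  proof -
   obtain C where C: "ALL n<N. ALL c<C. F $ n $$ c = 0" using fls_fps_lower by blast
   obtain D where D: "ALL n<N. ALL c<D. G $ n $$ c = 0" using fls_fps_lower by blast
   have "{j. ?c j \<notin> hpow HM N} \<subseteq> {C - Q..P + Q - D} \<times> {0..Q}"
   proof
    fix i assume i': "i \<in> {j. ?c j \<notin> hpow HM N}"
    obtain p q where i: "i = (p, q)" by fastforce
    have "~  fps_X ^ N dvd iota12 F p q * iota12 G (P - p) (Q - q)" using i' by (simp add: i)
    then have "~  fps_X ^ N dvd iota12 F p q" "~  fps_X ^ N dvd iota12 G (P - p) (Q - q)"
     by (auto intro: dvd_mult dvd_mult2)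
    then have "0 <= q" "C <= p + q" "0 <= Q - q" "D <= P - p + (Q - q)"
     using iota12_dvd[OF C, of q p] iota12_dvd[OF D, of "Q - q" "P - p"] by (force simp: not_less[symmetric])+
    then show "i \<in> {C - Q..P + Q - D} \<times> {0..Q}" by (auto simp: i)
   qed
   then show ?thesis by (rule finite_subset) auto
  qed
  then have nc: "hnull HM ?c" by (auto simp: hnull_def)
  have "hsum M (%k. ?K (?\<pi> (j, k))) = hsum M (%k. ?c k \<odot> Z (a - P) (b - Q))"
   by (simp add: j case_prod_unfold algebra_simps)
  also have "... = hsum HM ?c \<odot> Z (a - P) (b - Q)"
   by (rule hsum_linear[OF hfree_HM hfree_axioms smult_linear_HM[OF Xc] nc, symmetric])
  also have "... = iota12 (F * G) P Q \<odot> Z (a - P) (b - Q)" by (simp only: iota12_conv)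
  finally show "hsum M (%k. ?K (?\<pi> (j, k))) = (case j of (P, Q) => iota12 (F * G) P Q \<odot> Z (a - P) (b - Q))"
   by (simp only: j prod.case)
 qed
 finally show ?thesis .
qed

lemma smul2_iota21:
 assumes Z: "left_truncated M (%a b. Z b a)"
 shows "smul2 M (iota21 F) Z a b = smul2 M (iota12 (fneg F)) (%a b. Z b a) b a"
proof -
 have b: "bij (prod.swap :: int \<times> int => _)" by (rule bij_swap)
 show ?thesis
  unfolding smul2_def
  using hsum_reindex[OF iota12_null1[OF Z] b, of "fneg F" a b]
  by (simp add: iota21_eq case_prod_unfold prod.swap_def)
qed


text \<open>The common value can be multiplied by expansions in \<open>z2\<close> when read from the
  left and by expansions in \<open>z1\<close> when read from the right. For a regular factor both
  expansions coincide, so the two products agree.\<close>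

lemma smul2_transfer:
 assumes Z: "left_truncated M Z" and Z': "left_truncated M (%a b. Z' b a)"
  and eq: "!!a b. smul2 M (iota12 A) Z a b = smul2 M (iota21 B) Z' a b"
 shows "smul2 M (iota12 (temb V * A)) Z a b = smul2 M (iota21 (temb V * B)) Z' a b"
proof -
 let ?Q = "smul2 M (iota12 (fneg B)) (%a b. Z' b a)"
 have Q: "smul2 M (iota21 B) Z' a b = ?Q b a" for a b by (rule smul2_iota21[OF Z'])
 have P: "smul2 M (iota12 A) Z = (%a b. ?Q b a)" using eq Q by (intro ext) simp
 have Qc: "?Q a b \<in> carrier M" for a b by (rule smul2_closed[OF Z'])
 have lt: "hnull M (%(p, q). iota12 (fneg (temb V)) p q \<odot> ?Q (b - p) (a - q))"
 proof -
  have "hnull M (%j. hsum M (%k. (%((p, q), (p', q')). (iota12 (fneg (temb V)) p q * iota12 (fneg B) p' q') \<odot> Z' (a - q - q') (b - p - p')) (j, k)))"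
   by (rule hnull_fst) (rule iota12_null[OF Z'])
  moreover have "hsum M (%k. (%((p, q), (p', q')). (iota12 (fneg (temb V)) p q * iota12 (fneg B) p' q') \<odot> Z' (a - q - q') (b - p - p')) (j, k)) =
   (%(p, q). iota12 (fneg (temb V)) p q \<odot> ?Q (b - p) (a - q)) j" for j
  proof -
   obtain p q where j: "j = (p, q)" by fastforce
   have Z'c: "Z' a b \<in> carrier M" for a b using Z' by (auto simp: left_truncated_def)
   have "iota12 (fneg (temb V)) p q \<odot> ?Q (b - p) (a - q) =
    hsum M (%k. iota12 (fneg (temb V)) p q \<odot> (%(p', q'). iota12 (fneg B) p' q' \<odot> Z' (a - q - q') (b - p - p')) k)"
    unfolding smul2_def
    by (rule hsum_linear[OF hfree_axioms hfree_axioms smult_linear iota12_null1[OF Z']])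
   then show ?thesis using Z'c by (simp add: j case_prod_unfold sm_assoc)
  qed
  ultimately show ?thesis by simp
 qed
 have "smul2 M (iota12 (temb V * A)) Z a b = smul2 M (iota12 (temb V)) (%a b. ?Q b a) a b"
  using smul2_assoc[OF Z, of "temb V" A] by (simp add: P)
 also have "... = hsum M (%j. (%(p, q). iota12 (fneg (temb V)) p q \<odot> ?Q (b - p) (a - q)) (prod.swap j))"
 proof -
  have "iota12 (temb V) p q = iota12 (fneg (temb V)) q p" for p q
   using iota12_temb_eq_iota21[of V p q] by (simp add: iota21_eq)
  then show ?thesis by (simp add: smul2_def case_prod_unfold)
 qed
 also have "... = smul2 M (iota12 (fneg (temb V))) ?Q b a"
  unfolding smul2_def[of M "iota12 (fneg (temb V))"] by (rule hsum_reindex[OF lt bij_swap])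
 also have "... = smul2 M (iota21 (temb V * B)) Z' a b"
  by (simp add: smul2_assoc[OF Z'] smul2_iota21[OF Z'] fneg_mult)
 finally show ?thesis .
qed

lemma iota12_zv: "iota12 zv p q = (if (p, q) = (1, 0) then 1 else if (p, q) = (0, 1) then - 1 else 0)"
proof (rule fps_ext)
 fix n
 have *: "(1 gchoose nat q :: complex) = 0" if "q ~= 0" "q ~= 1" "0 <= q"
 proof -
  have "1 < nat q" using that by linarith
  then have "(1 choose nat q) = 0" by (rule binomial_eq_0)
  then show ?thesis using binomial_gbinomial[of 1 "nat q", where 'a = complex] by (metis of_nat_0 of_nat_1)
 qed
 show "iota12 zv p q $ n = (if (p, q) = (1, 0) then 1 else if (p, q) = (0, 1) then - 1 else 0) $ n"
  using * by (cases "p + q = 1"; cases "n = 0") (auto simp: iota12_nth)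
qed

lemma smul2_zv:
 assumes "!!a b. P a b \<in> carrier M"
 shows "smul2 M (iota12 zv) P a b = P (a - 1) b \<ominus> P a (b - 1)"
proof -
 have "smul2 M (iota12 zv) P a b = finsum M (%(p, q). iota12 zv p q \<odot> P (a - p) (b - q)) {(1, 0), (0, 1)}"
  unfolding smul2_def using assms by (intro hsum_finite) (auto simp: iota12_zv split: if_split_asm)
 then show ?thesis using assms by (simp add: iota12_zv minus_eq sm_neg)
qed

lemma two_torsion: "v \<in> carrier M ==> v = \<ominus> v ==> v = \<zero>"
proof -
 assume v: "v \<in> carrier M" "v = \<ominus> v"
 have "v \<oplus> v = \<zero>" using M.r_neg[OF v(1)] by (simp only: v(2)[symmetric])
 then have "(1 + 1) \<odot> v = \<zero>" using v by (simp only: sm_add_l sm_one)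
 then show "v = \<zero>" using smult_cancel[of v "\<zero>" "1 + 1"] v by simp
qed

text \<open>Multiplication by \<open>z1 - z2\<close> has the kernel \<open>c(z2) \<delta>(z1 - z2)\<close>. For equal fields the difference of both
 sides is antisymmetric in \<open>z1, z2\<close>, while the series of this form are symmetric.\<close>

lemma smul2_cancel_zv:
 assumes x: "is_field M x" and w: "w \<in> carrier M"
  and f: "fneg g = f"
  and eq: "!!a b. smul2 M (iota12 (zv * f)) (%a b. x a (x b w)) a b = smul2 M (iota21 (zv * g)) (%a b. x b (x a w)) a b"
 shows "smul2 M (iota12 f) (%a b. x a (x b w)) a b = smul2 M (iota21 g) (%a b. x b (x a w)) a b"
proof -
 let ?Z = "%a b. x a (x b w)"
 let ?P = "smul2 M (iota12 f) ?Z"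
 have Z: "left_truncated M ?Z" by (rule left_truncated_fields[OF x x w])
 have Z': "left_truncated M (%a b. (%a b. x b (x a w)) b a)" using Z by simp
 have Pc: "?P a b \<in> carrier M" for a b by (rule smul2_closed[OF Z])
 have 1: "smul2 M (iota12 (zv * f)) ?Z a b = ?P (a - 1) b \<ominus> ?P a (b - 1)" for a b
  using smul2_assoc[OF Z, of zv f a b] smul2_zv[OF Pc] by simp
 have nz: "fneg zv = - zv"
  by (rule fps_ext, rule fls_eqI) simp
 have "iota12 (- F) = (%a b. - iota12 F a b)" for F
  by (intro ext fps_ext) (simp add: iota12_nth)
 then have 2: "smul2 M (iota12 (- F)) ?Z a b = \<ominus> smul2 M (iota12 F) ?Z a b" for F a b
 proof -
  have Xc: "x a (x b w) \<in> carrier M" for a b using Z by (auto simp: left_truncated_def)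
  have "(- 1) \<odot> smul2 M (iota12 F) ?Z a b = hsum M (%k. (- 1) \<odot> (%(p, q). iota12 F p q \<odot> ?Z (a - p) (b - q)) k)"
   unfolding smul2_def by (rule hsum_linear[OF hfree_axioms hfree_axioms smult_linear iota12_null1[OF Z]])
  moreover have "iota12 (- F) p q = (- 1) * iota12 F p q" for p q
   by (rule fps_ext) (simp add: iota12_nth)
  ultimately show ?thesis
   using Xc smul2_closed[OF Z] by (simp add: smul2_def[of M "iota12 (- F)"] case_prod_unfold sm_assoc neg_as_smult)
 qed
 have Q: "smul2 M (iota21 g) (%a b. x b (x a w)) a b = ?P b a" for a b
  using smul2_iota21[OF Z', of g a b] by (simp add: f)
 have "smul2 M (iota21 (zv * g)) (%a b. x b (x a w)) a b = smul2 M (iota12 (- (zv * f))) ?Z b a" for a b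
 proof -
  have "fneg (zv * g) = - (zv * f)" by (simp only: fneg_mult f nz mult_minus_left)
  then show ?thesis using smul2_iota21[OF Z', of "zv * g" a b] by simp
 qed
 then have "?P (a - 1) b \<ominus> ?P a (b - 1) = \<ominus> (?P (b - 1) a \<ominus> ?P b (a - 1))" for a b
  using eq[of a b] 1[of a b] 1[of b a] by (simp add: 2)
 then have e: "?P (a - 1) b \<ominus> ?P a (b - 1) = ?P b (a - 1) \<ominus> ?P (b - 1) a" for a b
  using Pc by (simp add: minus_minus_eq)
 define S where "S a b = ?P a b \<ominus> ?P b a" for a b
 have Sc: "S a b \<in> carrier M" for a b using Pc by (simp add: S_def)
 have sw: "u1 \<ominus> v1 = u2 \<ominus> v2" if "u1 \<ominus> u2 = v1 \<ominus> v2" "u1 \<in> carrier M" "u2 \<in> carrier M" "v1 \<in> carrier M" "v2 \<in> carrier M"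
  for u1 u2 v1 v2
 proof -
  have "u1 \<ominus> v1 = (u1 \<ominus> u2) \<oplus> (u2 \<ominus> v1)" using minus_trans_eq[of u1 u2 v1] that(2-) by simp
  also have "... = (u2 \<ominus> v1) \<oplus> (v1 \<ominus> v2)" unfolding that(1) using that by (intro M.a_comm) auto
  finally show ?thesis using that by (simp only: minus_trans_eq)
 qed
 have step: "S (a - 1) b = S a (b - 1)" for a b
  unfolding S_def by (rule sw[OF e]) (use Pc in auto)
 have shift: "S (a + int k) (b - int k) = S a b" for a b k
 proof (induction k)
  case (Suc k)
  show ?case using step[of "a + int (Suc k)" "b - int k"] Suc by (simp add: algebra_simps)
 qed simp
 have *: "S a b = S b a" if "a <= b" for a b
 proof -
  have e: "a + int (nat (b - a)) = b" "b - int (nat (b - a)) = a" using that by auto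
  have "S b a = S a b" using shift[of a "nat (b - a)" b] by (simp only: e)
  then show ?thesis by (rule HOL.sym)
 qed
 have sym: "S a b = S b a" by (cases "a <= b") (use *[of a b] *[of b a] in auto)
 have "S b a = \<ominus> S a b" unfolding S_def using Pc by (simp add: minus_minus_eq)
 then have "S a b = \<zero>" using sym Sc two_torsion[of "S a b"] by simp
 then have "?P a b = ?P b a" unfolding S_def using Pc by (simp add: minus_zero_iff)
 then show ?thesis by (simp only: Q)
qed

lemma rel_xx_transfer:
 assumes x: "is_field M x" and y: "is_field M y" and "rel_xx M x y (iota12 A) (iota21 B)"
 shows "rel_xx M x y (iota12 (temb V * A)) (iota21 (temb V * B))"
 unfolding rel_xx_def
proof (intro ballI allI)
 fix w a b assume w: "w \<in> carrier M"
 show "smul2 M (iota12 (temb V * A)) (%a b. x a (y b w)) a b = smul2 M (iota21 (temb V * B)) (%a b. y b (x a w)) a b"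
 proof (rule smul2_transfer)
  show "left_truncated M (%a b. x a (y b w))" by (rule left_truncated_fields[OF x y w])
  show "left_truncated M (%a b. y a (x b w))" by (rule left_truncated_fields[OF y x w])
 qed (use assms(3) w in \<open>auto simp: rel_xx_def\<close>)
qed

text \<open>Multiplication by the unit leads one way and by its inverse back; the right-hand side
  may be read in either expansion by the assumption on \<open>B\<close>.\<close>

lemma rel_xx_unit:
 assumes x: "is_field M x" and y: "is_field M y" and U: "temb U * temb U' = 1" and B: "iota12 B = iota21 B"
 shows "rel_xx M x y (iota12 A) (iota12 B) \<longleftrightarrow> rel_xx M x y (iota12 (temb U * A)) (iota21 (temb U * B))"
proof
 assume "rel_xx M x y (iota12 A) (iota12 B)"
 then show "rel_xx M x y (iota12 (temb U * A)) (iota21 (temb U * B))"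
  unfolding B by (rule rel_xx_transfer[OF x y])
next
 assume "rel_xx M x y (iota12 (temb U * A)) (iota21 (temb U * B))"
 then have "rel_xx M x y (iota12 (temb U' * (temb U * A))) (iota21 (temb U' * (temb U * B)))"
  by (rule rel_xx_transfer[OF x y])
 moreover have "temb U' * (temb U * C) = C" for C
  using U by (metis mult.assoc mult.commute mult_1)
 ultimately show "rel_xx M x y (iota12 A) (iota12 B)" by (simp add: B)
qed

lemma rel_xx_zv:
 assumes x: "is_field M x" and "fneg g = f" and "rel_xx M x x (iota12 (zv * f)) (iota21 (zv * g))"
 shows "rel_xx M x x (iota12 f) (iota21 g)"
 unfolding rel_xx_def
proof (intro ballI allI)
 fix w a b assume w: "w \<in> carrier M"
 show "smul2 M (iota12 f) (%a b. x a (x b w)) a b = smul2 M (iota21 g) (%a b. x b (x a w)) a b"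
  by (rule smul2_cancel_zv[OF x w assms(2)]) (use assms(3) w in \<open>unfold rel_xx_def, blast\<close>)
qed

end

text \<open>\<open>(1 - e^(-z)) / z\<close>, a unit: removing the factor \<open>1 - e^(-z)\<close>
  amounts to removing \<open>z\<close>.\<close>

definition expc :: "complex fps" where "expc = (1 - fps_exp (- 1)) / fps_X"

lemma X_expc: "fps_X * expc = 1 - fps_exp (- 1)"
 unfolding expc_def by (rule X_mult_divide_X) simp

lemma expc_inverse: "expc * inverse expc = 1"
proof -
 have "expc $ 0 = (fps_X * expc) $ 1" by simp
 then have "expc $ 0 = 1" by (simp add: X_expc)
 then show ?thesis by (intro inverse_mult_eq_1') simp
qed

lemma one_minus_expm: "1 - expm = zv * temb (fps_const expc)" "1 - expm = temb (fps_const (1 - fps_exp (- 1)))"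
proof -
 show 2: "1 - expm = temb (fps_const (1 - fps_exp (- 1)))"
  by (simp only: fps_const_sub[symmetric] temb_diff temb_const fps_const_1_eq_1 temb_1)
 show "1 - expm = zv * temb (fps_const expc)"
  unfolding 2 zv_eq_temb by (simp flip: temb_mult X_expc)
qed

lemma one_minus_expm_nth_0: "(1 - expm) $ 0 ~= 0"
proof
 assume "(1 - expm) $ 0 = 0"
 then have "fps_to_fls (1 - fps_exp (- 1)) = (0 :: complex fls)" by simp
 then have "fps_X * expc = 0" by (simp only: X_expc fps_to_fls_eq_0_iff)
 then show False using expc_inverse by auto
qed

lemma divide_one_minus_expm: "(F / (1 - expm)) * (1 - expm) = F"
 using inverse_mult_eq_1[OF one_minus_expm_nth_0] fps_divide_unit[OF one_minus_expm_nth_0, of F]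
 by (simp add: mult.assoc)

lemma fneg_expm: "fneg expm * expm = 1"
proof -
 have "fneg expm = fps_const (fps_to_fls (fps_exp 1))"
  using fneg_temb[of "fps_const (fps_exp (- 1))"] by (simp add: temb_const reflect_const)
 moreover have "fps_exp 1 * fps_exp (- 1) = (1 :: complex fps)"
  using fps_exp_add_mult[of "1::complex" "- 1"] by simp
 ultimately show ?thesis by (simp flip: fls_times_fps_to_fls)
qed

text \<open>After the reflection, numerator and denominator are multiplied by \<open>e^(-z)\<close>.
  This symmetry is what the cancellation of \<open>z1 - z2\<close> between equal fields
  requires.\<close>

lemma fneg_hat_quotient:
 "fneg ((hemb P - expm) / (1 - expm)) = (1 - hemb P * expm) / (1 - expm)" (is "fneg ?g = ?f")
proof -
 have "fneg ?g * fneg (1 - expm) = fneg (hemb P - expm)"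
  using divide_one_minus_expm[of "hemb P - expm"] by (metis fneg_mult)
 then have "fneg ?g * (1 - fneg expm) = hemb P - fneg expm" by (simp add: fneg_diff)
 then have "fneg ?g * ((1 - fneg expm) * expm) = (hemb P - fneg expm) * expm" by (simp only: mult.assoc[symmetric])
 then have "fneg ?g * (expm - 1) = hemb P * expm - 1"
  by (simp only: left_diff_distrib fneg_expm mult_1)
 then have "fneg ?g * (1 - expm) = ?f * (1 - expm)"
  unfolding divide_one_minus_expm by (simp add: right_diff_distrib algebra_simps)
 moreover have "1 - expm ~= 0" using one_minus_expm_nth_0 by auto
 ultimately show ?thesis by (metis mult_cancel_right)
qed

text \<open>The unit \<open>hat_unit c\<close> turns the rational relation with
  \<open>\<tau>\<close> into the trigonometric one with cleared denominator. For
  \<open>i = j\<close> the denominator is restored by cancelling \<open>z1 - z2\<close>, which is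
  legitimate because the two fields are then equal.\<close>

lemma rel_xx_hat:
 assumes W: "topologically_free W" and x: "is_field W x" and y: "is_field W y"
  and e: "i = j ==> x = y"
 shows "rel_xx W x y (iota12 ((zv - hmon c) * temb (tau_shift c))) (iota12 ((zv + hmon c) * temb (tau_shift (- c)))) \<longleftrightarrow>
  rel_xx W x y (iota12 ((1 - hemb (fps_exp c) * expm) / (if i = j then 1 - expm else 1)))
    (iota21 ((hemb (fps_exp c) - expm) / (if i = j then 1 - expm else 1)))"
proof -
 interpret hfree W using W by (rule topologically_free_hfree)
 let ?A = "(zv - hmon c) * temb (tau_shift c)" and ?B = "(zv + hmon c) * temb (tau_shift (- c))"
 define U where "U = hat_unit c"
 define U' where "U' = fps_const (fps_exp (1 / 2)) * emb (fps_exp (- c / 2))"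
 have U: "temb U * temb U' = 1" unfolding U_def U'_def using hat_unit_inverse[of c] by (simp flip: temb_mult)
 have "?B = temb ((fps_const fps_X + fps_const (fps_const c) * fps_X) * tau_shift (- c))"
  by (simp only: zv_eq_temb hmon_eq_temb temb_mult temb_add)
 then have B: "iota12 ?B = iota21 ?B" by (intro ext) (simp only: iota12_temb_eq_iota21)
 have u: "temb U * ?A = 1 - hemb (fps_exp c) * expm" "temb U * ?B = hemb (fps_exp c) - expm"
  unfolding U_def by (rule hat_unit_mult)+
 have *: "rel_xx W x y (iota12 ?A) (iota12 ?B) \<longleftrightarrow>
   rel_xx W x y (iota12 (1 - hemb (fps_exp c) * expm)) (iota21 (hemb (fps_exp c) - expm))"
  unfolding u[symmetric] by (rule rel_xx_unit[OF x y U B])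
 show ?thesis
 proof (cases "i = j")
  case False
  then show ?thesis by (simp add: *)
 next
  case True
  let ?f = "(1 - hemb (fps_exp c) * expm) / (1 - expm)" and ?g = "(hemb (fps_exp c) - expm) / (1 - expm)"
  have yx: "y = x" using e True by simp
  let ?D = "fps_const (1 - fps_exp (- 1)) :: complex fps fps"
  have d: "temb ?D * ?f = 1 - hemb (fps_exp c) * expm" "temb ?D * ?g = hemb (fps_exp c) - expm"
   unfolding one_minus_expm(2)[symmetric] by (simp_all only: mult.commute[of "1 - expm"] divide_one_minus_expm)
  have z: "temb (fps_const (inverse expc)) * ((1 - expm) * F) = zv * F" for F
  proof -
   have "temb (fps_const (inverse expc)) * temb (fps_const expc) = 1"
    using expc_inverse by (simp add: mult.commute flip: temb_mult)
   then show ?thesis unfolding one_minus_expm(1) by (metis (no_types, opaque_lifting) mult.assoc mult.commute mult_1)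
  qed
  have "rel_xx W x x (iota12 (1 - hemb (fps_exp c) * expm)) (iota21 (hemb (fps_exp c) - expm)) \<longleftrightarrow>
   rel_xx W x x (iota12 ?f) (iota21 ?g)"
  proof
   assume "rel_xx W x x (iota12 (1 - hemb (fps_exp c) * expm)) (iota21 (hemb (fps_exp c) - expm))"
   then have "rel_xx W x x (iota12 ((1 - expm) * ?f)) (iota21 ((1 - expm) * ?g))"
    by (simp only: mult.commute[of "1 - expm"] divide_one_minus_expm)
   then have "rel_xx W x x (iota12 (zv * ?f)) (iota21 (zv * ?g))"
    using rel_xx_transfer[OF x x, of _ _ "fps_const (inverse expc)"] unfolding z[symmetric] by blast
   then show "rel_xx W x x (iota12 ?f) (iota21 ?g)"
    by (rule rel_xx_zv[OF x fneg_hat_quotient])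
  next
   assume "rel_xx W x x (iota12 ?f) (iota21 ?g)"
   then have "rel_xx W x x (iota12 (temb ?D * ?f)) (iota21 (temb ?D * ?g))"
    by (rule rel_xx_transfer[OF x x])
   then show "rel_xx W x x (iota12 (1 - hemb (fps_exp c) * expm)) (iota21 (hemb (fps_exp c) - expm))"
    by (simp only: d)
  qed
  then show ?thesis using True * yx by simp
 qed
qed

text \<open>Symmetry of \<open>r_i a_ij\<close> expresses the \<open>\<tau>\<close>-terms with
  indices \<open>j, i\<close> through the number attached to \<open>i, j\<close>. Only the relations
  between fields \<open>x\<close> of equal sign then need more than an identity of scalar
  series.\<close>

theorem M_tau_iff_M_hat:
 assumes sym: "!!i j. ra a r i j = ra a r j i"
 shows "M_tau a r l (tau_trig a r l) W x \<longleftrightarrow> M_hat a r l W x"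
proof (cases "topologically_free W & (ALL s. is_field W (x s))")
 case True
 then have W: "topologically_free W" and f: "!!s. is_field W (x s)" by auto
 let ?t = "tau_trig a r l"
 have hh: "(%m n. hD_two (qnum (ra a r i j)) (comm_series (rl r l) (rl r l) (inverse zv ^ 2)) m n
   + iota12 (temb (?t Nought Nought i j) - temb (reflect (?t Nought Nought j i))) m n) =
  hD_two (qnum (ra a r i j)) (comm_series (rl r l) (rl r l) (expm / (1 - expm) ^ 2))" for i j
  by (intro ext) (simp only: tau_trig.simps sym[of j i] hh_scalar)
 have hx: "(%m n. of_int (sg e) * (comm_series (ra a r i j) (rl r l) (inverse zv) m n
   + iota12 (temb (?t Nought Bullet i j) + temb (reflect (?t Bullet Nought j i))) m n)) =
  (%m n. of_int (sg e) * comm_series (ra a r i j) (rl r l) ((1 + expm) / (2 - 2 * expm)) m n)" for i j e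
  by (intro ext) (simp only: tau_trig.simps sym[of j i] hx_scalar)
 have b: "?t Bullet Bullet i j = tau_shift (ra a r i j)" "reflect (tau_shift (ra a r j i)) = tau_shift (- ra a r i j)" for i j
  by (simp_all only: tau_trig_bullet reflect_tau_shift sym[of j i])
 have xx: "rel_xx W (x (Xg e i)) (x (Xg e j))
    (iota12 ((zv - hmon (ra a r i j)) * temb (tau_shift (ra a r i j))))
    (iota12 ((zv + hmon (ra a r i j)) * temb (tau_shift (- ra a r i j)))) \<longleftrightarrow>
   rel_xx W (x (Xg e i)) (x (Xg e j))
    (iota12 ((1 - hemb (fps_exp (ra a r i j)) * expm) / (if i = j then 1 - expm else 1)))
    (iota21 ((hemb (fps_exp (ra a r i j)) - expm) / (if i = j then 1 - expm else 1)))" for e i j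
  by (rule rel_xx_hat[OF W f f]) simp
 show ?thesis
  unfolding M_tau_def M_hat_def hh hx b xy_scalar xx qa_def by blast
next
 case False
 then show ?thesis unfolding M_tau_def M_hat_def by blast
qed

text \<open>The relation between two fields \<open>h\<close> has an inhomogeneous right-hand side,
  so these fields must keep their scale. The other relations are homogeneous in each field
  \<open>x\<close>, and the factors are moved into the vector \<open>w\<close>.\<close>

lemma M_hat_scale:
 assumes M: "M_hat a r l W x" and c: "!!i. c (Hg i) = 1"
  and x': "!!s m v. v \<in> carrier W ==> x' s m v = c s \<odot>\<^bsub>W\<^esub> x s m v"
 shows "M_hat a r l W x'"
proof -
 have W: "topologically_free W" and f: "!!s. is_field W (x s)" using M by (auto simp: M_hat_def)
 interpret hfree W using W by (rule topologically_free_hfree)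
 have lin: "x s m \<in> linear_maps W W" for s m using f by (auto simp: is_field_def)
 have cl [simp]: "v \<in> carrier W ==> x s m v \<in> carrier W" for s m v using lin[of s m] by (auto simp: linear_maps_def)
 have sm: "v \<in> carrier W ==> x s m (d \<odot>\<^bsub>W\<^esub> v) = d \<odot>\<^bsub>W\<^esub> x s m v" for s m d v using lin[of s m] by (auto simp: linear_maps_def)
 have ad: "u \<in> carrier W ==> v \<in> carrier W ==> x s m (u \<oplus>\<^bsub>W\<^esub> v) = x s m u \<oplus>\<^bsub>W\<^esub> x s m v" for s m u v using lin[of s m] by (auto simp: linear_maps_def)
 have 2: "x' s m (x' s' n w) = x s m (x s' n ((c s * c s') \<odot>\<^bsub>W\<^esub> w))" if "w \<in> carrier W" for s m s' n w
  using that by (simp add: x' sm sm_assoc mult.commute)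
 have h: "x' (Hg i) m w = x (Hg i) m w" if "w \<in> carrier W" for i m w using that by (simp add: x' c)
 have f': "is_field W (x' s)" for s
  unfolding is_field_def
 proof (intro conjI allI ballI)
  show "x' s m \<in> linear_maps W W" for m
   by (rule linear_mapsI) (auto simp: x' sm ad sm_assoc sm_add_r mult.commute)
  fix w n assume w: "w \<in> carrier W"
  then obtain N where "ALL m<N. x s m w \<in> hpow W n" using f[of s] unfolding is_field_def by meson
  then show "EX N. ALL m<N. x' s m w \<in> hpow W n" using w by (auto simp: x' intro!: exI[of _ N] hpow_smult)
 qed
 have hh: "rel_hh W (x' (Hg i)) (x' (Hg j)) G" if "rel_hh W (x (Hg i)) (x (Hg j)) G" for i j G
  using that by (simp add: rel_hh_def h)
 have hx: "rel_hx W (x' (Hg i)) (x' s) G" if "rel_hx W (x (Hg i)) (x s) G" for i s G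
  unfolding rel_hx_def
 proof (intro ballI allI)
  fix w m n assume w: "w \<in> carrier W"
  then have "c s \<odot>\<^bsub>W\<^esub> w \<in> carrier W" by simp
  then have *: "x (Hg i) m (x s n (c s \<odot>\<^bsub>W\<^esub> w)) \<ominus>\<^bsub>W\<^esub> x s n (x (Hg i) m (c s \<odot>\<^bsub>W\<^esub> w)) =
   smul2 W G (%a b. if a = 0 then x s b (c s \<odot>\<^bsub>W\<^esub> w) else \<zero>\<^bsub>W\<^esub>) m n"
   using that unfolding rel_hx_def by blast
  show "x' (Hg i) m (x' s n w) \<ominus>\<^bsub>W\<^esub> x' s n (x' (Hg i) m w) =
   smul2 W G (%a b. if a = 0 then x' s b w else \<zero>\<^bsub>W\<^esub>) m n"
  proof -
   have "(%a b. if a = 0 then x s b (c s \<odot>\<^bsub>W\<^esub> w) else \<zero>\<^bsub>W\<^esub>) = (%a b. if a = (0::int) then x' s b w else \<zero>\<^bsub>W\<^esub>)"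
    using w by (auto simp: x' sm fun_eq_iff)
   then show ?thesis using * w by (simp add: c x' sm)
  qed
 qed
 have xx: "rel_xx W (x' s) (x' s') G G'" if "rel_xx W (x s) (x s') G G'" for s s' G G'
  unfolding rel_xx_def
 proof (intro ballI allI)
  fix w m n assume w: "w \<in> carrier W"
  then have "(c s * c s') \<odot>\<^bsub>W\<^esub> w \<in> carrier W" by simp
  then have "smul2 W G (%a b. x s a (x s' b ((c s * c s') \<odot>\<^bsub>W\<^esub> w))) m n = smul2 W G' (%a b. x s' b (x s a ((c s * c s') \<odot>\<^bsub>W\<^esub> w))) m n"
   using that unfolding rel_xx_def by blast
  then show "smul2 W G (%a b. x' s a (x' s' b w)) m n = smul2 W G' (%a b. x' s' b (x' s a w)) m n"
   using w by (simp add: 2 mult.commute[of "c s'" "c s"])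
 qed
 have xy: "rel_xy W (x' s) (x' s') P G" if "rel_xy W (x s) (x s') P G" for s s' P G
  unfolding rel_xy_def
 proof (intro ballI allI)
  fix w m n assume w: "w \<in> carrier W"
  then have "(c s * c s') \<odot>\<^bsub>W\<^esub> w \<in> carrier W" by simp
  then have "smul2 W (iota12 P) (%a b. x s a (x s' b ((c s * c s') \<odot>\<^bsub>W\<^esub> w)) \<ominus>\<^bsub>W\<^esub>
    smul2 W G (%a b. x s' b (x s a ((c s * c s') \<odot>\<^bsub>W\<^esub> w))) a b) m n = \<zero>\<^bsub>W\<^esub>"
   using that unfolding rel_xy_def by blast
  then show "smul2 W (iota12 P) (%a b. x' s a (x' s' b w) \<ominus>\<^bsub>W\<^esub> smul2 W G (%a b. x' s' b (x' s a w)) a b) m n = \<zero>\<^bsub>W\<^esub>"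
   using w by (simp add: 2 mult.commute[of "c s'" "c s"])
 qed
 show ?thesis using M f' hh hx xx xy unfolding M_hat_def by meson
qed

section \<open>Ideals, quotients and homomorphisms\<close>

text \<open>Vacuum and bilinear products without any locality axiom. This much passes to every
  quotient by an ideal, so the arguments on ideals and homomorphisms apply to the quotient algebras
  as well.\<close>

locale pva = hmod V for V :: "'v hva" (structure) +
 assumes vac_closed [simp]: "vac V \<in> carrier V"
  and nprod_closed [simp]: "u \<in> carrier V ==> v \<in> carrier V ==> nprod V n u v \<in> carrier V"
  and nprod_add_l: "u \<in> carrier V ==> u' \<in> carrier V ==> v \<in> carrier V ==> nprod V n (u \<oplus> u') v = nprod V n u v \<oplus> nprod V n u' v"
  and nprod_add_r: "u \<in> carrier V ==> v \<in> carrier V ==> v' \<in> carrier V ==> nprod V n u (v \<oplus> v') = nprod V n u v \<oplus> nprod V n u v'"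
  and nprod_smult_l: "u \<in> carrier V ==> v \<in> carrier V ==> nprod V n (c \<odot> u) v = c \<odot> nprod V n u v"
  and nprod_smult_r: "u \<in> carrier V ==> v \<in> carrier V ==> nprod V n u (c \<odot> v) = c \<odot> nprod V n u v"
begin

lemma nprod_minus_l: "u \<in> carrier V ==> u' \<in> carrier V ==> v \<in> carrier V ==> nprod V n (u \<ominus> u') v = nprod V n u v \<ominus> nprod V n u' v"
 by (simp add: minus_eq nprod_add_l neg_as_smult nprod_smult_l)

lemma nprod_minus_r: "u \<in> carrier V ==> v \<in> carrier V ==> v' \<in> carrier V ==> nprod V n u (v \<ominus> v') = nprod V n u v \<ominus> nprod V n u v'"
 by (simp add: minus_eq nprod_add_r neg_as_smult nprod_smult_r)

lemma nprod_hpow_l: "u \<in> hpow V k ==> v \<in> carrier V ==> nprod V n u v \<in> hpow V k"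
 unfolding hpow_def by (auto simp: nprod_smult_l)

lemma nprod_hpow_r: "u \<in> carrier V ==> v \<in> hpow V k ==> nprod V n u v \<in> hpow V k"
 unfolding hpow_def by (auto simp: nprod_smult_r)

lemma va_idealI:
 assumes "K \<subseteq> carrier V" "\<zero> \<in> K" "!!x y. x \<in> K ==> y \<in> K ==> x \<oplus> y \<in> K" "!!c x. x \<in> K ==> c \<odot> x \<in> K"
  and "!!n u k. u \<in> carrier V ==> k \<in> K ==> nprod V n u k \<in> K"
  and "!!n u k. u \<in> carrier V ==> k \<in> K ==> nprod V n k u \<in> K"
 shows "va_ideal V K"
proof -
 have "submodule K (ring_of_type_algebra :: complex fps ring) V"
 proof (rule submoduleI)
  show "\<ominus> x \<in> K" if "x \<in> K" for x using assms(4)[OF that, of "-1"] assms(1) that by (auto simp: neg_as_smult)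
 qed (use assms in auto)
 then show ?thesis using assms by (auto simp: va_ideal_def)
qed

lemma submodule_facts:
 assumes "submodule K (ring_of_type_algebra :: complex fps ring) V"
 shows "K \<subseteq> carrier V" "\<zero> \<in> K" "!!x y. x \<in> K ==> y \<in> K ==> x \<oplus> y \<in> K" "!!c x. x \<in> K ==> c \<odot> x \<in> K"
  "!!x y. x \<in> K ==> y \<in> K ==> x \<ominus> y \<in> K"
proof -
 note E = submoduleE[OF assms]
 show "K \<subseteq> carrier V" "!!x y. x \<in> K ==> y \<in> K ==> x \<oplus> y \<in> K" "!!c x. x \<in> K ==> c \<odot> x \<in> K"
  using E by auto
 show "\<zero> \<in> K" using E(1,2,4) by (metis UNIV_I ex_in_conv ring_of_type_algebra_simps(1) sm_0 subsetD)
 show "x \<ominus> y \<in> K" if "x \<in> K" "y \<in> K" for x y using E(3)[OF that(2)] E(5)[OF that(1)] by (simp add: minus_eq)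
qed

lemma va_idealD:
 assumes "va_ideal V K"
 shows "K \<subseteq> carrier V" "\<zero> \<in> K" "!!x y. x \<in> K ==> y \<in> K ==> x \<oplus> y \<in> K" "!!c x. x \<in> K ==> c \<odot> x \<in> K"
  "!!x y. x \<in> K ==> y \<in> K ==> x \<ominus> y \<in> K"
  "!!n u k. u \<in> carrier V ==> k \<in> K ==> nprod V n u k \<in> K"
  "!!n u k. u \<in> carrier V ==> k \<in> K ==> nprod V n k u \<in> K"
 using assms submodule_facts[of K] unfolding va_ideal_def by auto

lemma va_ideal_carrier: "va_ideal V (carrier V)"
 by (rule va_idealI) auto

lemma va_ideal_Inter:
 assumes F: "!!K. K \<in> F ==> va_ideal V K" and ne: "F ~= {}"
 shows "va_ideal V (\<Inter> F)"
proof (rule va_idealI)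
 note D = va_idealD[OF F]
 show "\<Inter> F \<subseteq> carrier V" using D(1) ne by auto
 show "\<zero> \<in> \<Inter> F" using D(2) by auto
 show "x \<oplus> y \<in> \<Inter> F" if "x \<in> \<Inter> F" "y \<in> \<Inter> F" for x y using D(3) that by auto
 show "c \<odot> x \<in> \<Inter> F" if "x \<in> \<Inter> F" for c x using D(4) that by auto
 show "nprod V n u k \<in> \<Inter> F" if "u \<in> carrier V" "k \<in> \<Inter> F" for n u k using D(6) that by auto
 show "nprod V n k u \<in> \<Inter> F" if "u \<in> carrier V" "k \<in> \<Inter> F" for n u k using D(7) that by auto
qed

lemma hclosure_mono: "K \<subseteq> L ==> hclosure V K \<subseteq> hclosure V L"
 unfolding hclosure_def by fast

lemma saturate_mono: "K \<subseteq> L ==> saturate V K \<subseteq> saturate V L"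
 unfolding saturate_def by fast

lemma subset_hclosure: "K \<subseteq> carrier V ==> K \<subseteq> hclosure V K"
 unfolding hclosure_def by (auto intro!: bexI)

lemma subset_saturate: "K \<subseteq> carrier V ==> K \<subseteq> saturate V K"
 unfolding saturate_def by (auto intro!: exI[of _ 0])

lemma hclosure_carrier [simp]: "hclosure V (carrier V) = carrier V"
 using subset_hclosure[of "carrier V"] by (auto simp: hclosure_def)

lemma saturate_carrier [simp]: "saturate V (carrier V) = carrier V"
 using subset_saturate[of "carrier V"] by (auto simp: saturate_def)

lemma va_ideal_saturate:
 assumes "va_ideal V K"
 shows "va_ideal V (saturate V K)"
proof (rule va_idealI)
 note K = va_idealD[OF assms]
 show "\<zero> \<in> saturate V K" using K(1,2) subset_saturate by blast
 show "x \<oplus> y \<in> saturate V K" if x: "x \<in> saturate V K" and y: "y \<in> saturate V K" for x y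
 proof -
  obtain m n where m: "fps_X ^ m \<odot> x \<in> K" "fps_X ^ n \<odot> y \<in> K" and c: "x \<in> carrier V" "y \<in> carrier V"
   using x y unfolding saturate_def by auto
  have "fps_X ^ n \<odot> (fps_X ^ m \<odot> x) \<oplus> fps_X ^ m \<odot> (fps_X ^ n \<odot> y) \<in> K"
   by (intro K(3,4) m)
  then have "fps_X ^ (m + n) \<odot> (x \<oplus> y) \<in> K" using c by (simp add: sm_assoc sm_add_r power_add mult.commute)
  then show ?thesis using c unfolding saturate_def by auto
 qed
 show "c \<odot> x \<in> saturate V K" if xs: "x \<in> saturate V K" for c x
 proof -
  obtain m where m: "fps_X ^ m \<odot> x \<in> K" and x: "x \<in> carrier V"
   using xs unfolding saturate_def by auto
  have "c \<odot> (fps_X ^ m \<odot> x) \<in> K" by (rule K(4)[OF m])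
  then have "fps_X ^ m \<odot> (c \<odot> x) \<in> K" using x by (simp add: sm_assoc mult.commute)
  then show ?thesis using x unfolding saturate_def by auto
 qed
 fix n u k assume u: "u \<in> carrier V" and "k \<in> saturate V K"
 then obtain m where m: "fps_X ^ m \<odot> k \<in> K" and k: "k \<in> carrier V" unfolding saturate_def by auto
 show "nprod V n u k \<in> saturate V K"
  using K(6)[OF u m, of n] u k unfolding saturate_def by (auto simp: nprod_smult_r)
 show "nprod V n k u \<in> saturate V K"
  using K(7)[OF u m, of n] u k unfolding saturate_def by (auto simp: nprod_smult_l)
qed (auto simp: saturate_def)

lemma va_ideal_hclosure:
 assumes "va_ideal V K"
 shows "va_ideal V (hclosure V K)"
proof (rule va_idealI)
 note K = va_idealD[OF assms]
 show "\<zero> \<in> hclosure V K" using K(1,2) subset_hclosure by blast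
 show "x \<oplus> y \<in> hclosure V K" if x: "x \<in> hclosure V K" and y: "y \<in> hclosure V K" for x y
  unfolding hclosure_def
 proof (intro CollectI conjI allI)
  fix n
  obtain k k' where "k \<in> K" "k' \<in> K" "hcong V n x k" "hcong V n y k'" using x y unfolding hclosure_def by blast
  then show "EX k:K. hcong V n (x \<oplus> y) k"
   using x y K(1) by (intro bexI[of _ "k \<oplus> k'"] hcong_add K(3)) (auto simp: hclosure_def)
 qed (use x y in \<open>auto simp: hclosure_def\<close>)
 show "c \<odot> x \<in> hclosure V K" if x: "x \<in> hclosure V K" for c x
  unfolding hclosure_def
 proof (intro CollectI conjI allI)
  fix n
  obtain k where k: "k \<in> K" "hcong V n x k" using x unfolding hclosure_def by blast
  then have "hcong V n (c \<odot> x) (c \<odot> k)"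
   using x K(1) hpow_smult[of "x \<ominus> k" n c] by (auto simp: hcong_def hclosure_def sm_minus_r subset_iff)
  then show "EX k:K. hcong V n (c \<odot> x) k" using K(4) k by blast
 qed (use x in \<open>auto simp: hclosure_def\<close>)
 fix m u x assume u: "u \<in> carrier V" and x: "x \<in> hclosure V K"
 have xc: "x \<in> carrier V" using x by (auto simp: hclosure_def)
 show "nprod V m u x \<in> hclosure V K"
  unfolding hclosure_def
 proof (intro CollectI conjI allI)
  fix n
  obtain k where k: "k \<in> K" "hcong V n x k" using x unfolding hclosure_def by blast
  then have "hcong V n (nprod V m u x) (nprod V m u k)"
   using u xc K(1) nprod_hpow_r[of u "x \<ominus> k" n m] by (auto simp: hcong_def nprod_minus_r subset_iff)
  then show "EX k:K. hcong V n (nprod V m u x) k" using K(6) k u by blast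
 qed (use u xc in auto)
 show "nprod V m x u \<in> hclosure V K"
  unfolding hclosure_def
 proof (intro CollectI conjI allI)
  fix n
  obtain k where k: "k \<in> K" "hcong V n x k" using x unfolding hclosure_def by blast
  then have "hcong V n (nprod V m x u) (nprod V m k u)"
   using u xc K(1) nprod_hpow_l[of "x \<ominus> k" n u m] by (auto simp: hcong_def nprod_minus_l subset_iff)
  then show "EX k:K. hcong V n (nprod V m x u) k" using K(7) k u by blast
 qed (use u xc in auto)
qed (auto simp: hclosure_def)

lemma saturate_saturate: "saturate V (saturate V K) = saturate V K"
proof
 show "saturate V (saturate V K) \<subseteq> saturate V K"
  unfolding saturate_def by (auto simp: sm_assoc simp flip: power_add)
 show "saturate V K \<subseteq> saturate V (saturate V K)"
  by (rule subset_saturate) (auto simp: saturate_def)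
qed

lemma hclosure_hclosure:
 assumes "K \<subseteq> carrier V"
 shows "hclosure V (hclosure V K) = hclosure V K"
proof
 show "hclosure V (hclosure V K) \<subseteq> hclosure V K"
 proof
  fix x assume "x \<in> hclosure V (hclosure V K)"
  then have x: "x \<in> carrier V" "!!n. EX y:hclosure V K. hcong V n x y" by (auto simp: hclosure_def)
  have "EX k:K. hcong V n x k" for n
  proof -
   obtain y where y: "y \<in> hclosure V K" "hcong V n x y" using x by blast
   then obtain k where "k \<in> K" "hcong V n y k" by (auto simp: hclosure_def)
   then show ?thesis using y x assms hcong_trans[of x y k n] by (auto simp: hclosure_def)
  qed
  then show "x \<in> hclosure V K" using x by (auto simp: hclosure_def)
 qed
 show "hclosure V K \<subseteq> hclosure V (hclosure V K)"
  by (rule subset_hclosure) (auto simp: hclosure_def)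
qed

end

text \<open>What a target must satisfy for homomorphisms into it to be determined on topological
  generators; quotients by closed saturated ideals have it.\<close>

definition hsep :: "(complex fps, 'v, 'm) module_scheme => bool" where
 "hsep M \<longleftrightarrow> (ALL v:carrier M. (ALL n. v \<in> hpow M n) --> v = \<zero>\<^bsub>M\<^esub>) &
  (ALL v:carrier M. ALL n. fps_X ^ n \<odot>\<^bsub>M\<^esub> v = \<zero>\<^bsub>M\<^esub> --> v = \<zero>\<^bsub>M\<^esub>)"

context pva
begin

lemma minus_minus_cancel: "a \<in> carrier V ==> k \<in> carrier V ==> a \<ominus> (a \<ominus> k) = k"
proof -
 assume a: "a \<in> carrier V" and k: "k \<in> carrier V"
 have "a \<ominus> (a \<ominus> k) = a \<oplus> (k \<ominus> a)" using minus_minus_eq[OF a k] by (simp only: minus_eq)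
 also have "... = (k \<ominus> a) \<oplus> a" using a k by (intro M.a_comm) auto
 also have "... = k" by (rule add_minus_cancel[OF k a])
 finally show ?thesis .
qed

lemma saturate_hclosure:
 assumes K: "va_ideal V K" "saturate V K = K"
 shows "saturate V (hclosure V K) = hclosure V K"
proof
 note KD = va_idealD[OF K(1)]
 show "saturate V (hclosure V K) \<subseteq> hclosure V K"
 proof
  fix v assume "v \<in> saturate V (hclosure V K)"
  then obtain m where v: "v \<in> carrier V" and m: "fps_X ^ m \<odot> v \<in> hclosure V K" by (auto simp: saturate_def)
  have "EX k:K. hcong V n v k" for n
  proof -
   \<comment> \<open>To keep precision \<open>n\<close> after dividing by \<open>h ^ m\<close>, the
     approximation is taken to precision \<open>m + n\<close>; saturation of \<open>K\<close> then
     permits the division.\<close>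
   obtain k where k: "k \<in> K" "hcong V (m + n) (fps_X ^ m \<odot> v) k" using m unfolding hclosure_def by blast
   then obtain w where w: "w \<in> carrier V" "(fps_X ^ m \<odot> v) \<ominus> k = fps_X ^ (m + n) \<odot> w"
    unfolding hcong_def hpow_def by auto
   have kc: "k \<in> carrier V" using k KD by auto
   have "(fps_X ^ m \<odot> v) \<ominus> fps_X ^ (m + n) \<odot> w = k"
    using minus_minus_cancel[of "fps_X ^ m \<odot> v" k] w(2) kc v by simp
   then have "(fps_X ^ m \<odot> v) \<ominus> (fps_X ^ m \<odot> (fps_X ^ n \<odot> w)) = k"
    using w(1) by (simp add: sm_assoc power_add)
   then have "fps_X ^ m \<odot> (v \<ominus> fps_X ^ n \<odot> w) \<in> K" using w v k by (simp add: sm_minus_r)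
   then have "v \<ominus> fps_X ^ n \<odot> w \<in> saturate V K" using w v unfolding saturate_def by auto
   then have 1: "v \<ominus> fps_X ^ n \<odot> w \<in> K" by (simp only: K(2))
   have "hcong V n v (v \<ominus> fps_X ^ n \<odot> w)"
   proof -
    have "v \<ominus> (v \<ominus> fps_X ^ n \<odot> w) = fps_X ^ n \<odot> w"
     using v w by (simp add: minus_minus_cancel)
    then show ?thesis using w unfolding hcong_def hpow_def by auto
   qed
   then show ?thesis using 1 by blast
  qed
  then show "v \<in> hclosure V K" using v by (auto simp: hclosure_def)
 qed
 show "hclosure V K \<subseteq> saturate V (hclosure V K)" by (rule subset_saturate) (auto simp: hclosure_def)
qed

definition cs_ideal :: "'v set => bool" where
 "cs_ideal K \<longleftrightarrow> va_ideal V K & hclosure V K = K & saturate V K = K"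

lemma ideal_gen_ideal: "G \<subseteq> carrier V ==> va_ideal V (ideal_gen V G)"
 unfolding ideal_gen_def by (rule va_ideal_Inter) (use va_ideal_carrier in auto)

lemma closed_ideal_gen_cs:
 assumes "G \<subseteq> carrier V"
 shows "cs_ideal (closed_ideal_gen V G)"
proof -
 let ?F = "{K. va_ideal V K & hclosure V K = K & saturate V K = K & G \<subseteq> K}"
 have ne: "carrier V \<in> ?F" by (simp add: assms va_ideal_carrier)
 have I: "va_ideal V (\<Inter> ?F)"
 proof (rule va_ideal_Inter)
  show "va_ideal V K" if "K \<in> ?F" for K using that by simp
  show "?F ~= {}" using ne by (metis empty_iff)
 qed
 have "hclosure V (\<Inter> ?F) \<subseteq> \<Inter> ?F"
 proof (rule Inter_greatest)
  fix K assume K: "K \<in> ?F"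
  then have "hclosure V (\<Inter> ?F) \<subseteq> hclosure V K" by (intro hclosure_mono Inter_lower)
  then show "hclosure V (\<Inter> ?F) \<subseteq> K" using K by simp
 qed
 moreover have "saturate V (\<Inter> ?F) \<subseteq> \<Inter> ?F"
 proof (rule Inter_greatest)
  fix K assume K: "K \<in> ?F"
  then have "saturate V (\<Inter> ?F) \<subseteq> saturate V K" by (intro saturate_mono Inter_lower)
  then show "saturate V (\<Inter> ?F) \<subseteq> K" using K by simp
 qed
 moreover have sub: "\<Inter> ?F \<subseteq> carrier V" by (rule Inter_lower[OF ne])
 ultimately show ?thesis
  unfolding cs_ideal_def closed_ideal_gen_def
  by (intro conjI I equalityI subset_hclosure subset_saturate)
qed

lemma closed_ideal_gen_superset: "G \<subseteq> closed_ideal_gen V G"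
 unfolding closed_ideal_gen_def by (rule Inter_greatest) simp

lemma closed_ideal_gen_least: "cs_ideal K ==> G \<subseteq> K ==> closed_ideal_gen V G \<subseteq> K"
 unfolding closed_ideal_gen_def cs_ideal_def by (rule Inter_lower) simp

text \<open>Reconciles the two recipes: one family of quotients factors out the closure of a
  saturation, the other a minimal closed saturated ideal. Taking the closure last is harmless
  because it preserves saturation.\<close>

theorem hclosure_saturate_ideal_gen:
 assumes G: "G \<subseteq> carrier V"
 shows "hclosure V (saturate V (ideal_gen V G)) = closed_ideal_gen V G"
proof
 let ?S = "saturate V (ideal_gen V G)"
 have S: "va_ideal V ?S" by (intro va_ideal_saturate ideal_gen_ideal G)
 note sub = va_idealD(1)[OF ideal_gen_ideal[OF G]]
 have "cs_ideal (hclosure V ?S)"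
  unfolding cs_ideal_def
  using va_ideal_hclosure[OF S] hclosure_hclosure[OF va_idealD(1)[OF S]] saturate_hclosure[OF S saturate_saturate] by simp
 moreover have "G \<subseteq> hclosure V ?S"
 proof -
  have "G \<subseteq> ideal_gen V G" unfolding ideal_gen_def by (rule Inter_greatest) simp
  then show ?thesis using subset_saturate[OF sub] subset_hclosure[OF va_idealD(1)[OF S]] by (meson order_trans)
 qed
 ultimately show "closed_ideal_gen V G \<subseteq> hclosure V ?S" by (rule closed_ideal_gen_least)
 have C: "cs_ideal (closed_ideal_gen V G)" by (rule closed_ideal_gen_cs[OF G])
 then have "va_ideal V (closed_ideal_gen V G)" by (simp add: cs_ideal_def)
 then have "ideal_gen V G \<subseteq> closed_ideal_gen V G"
  unfolding ideal_gen_def by (intro Inter_lower CollectI conjI closed_ideal_gen_superset)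
 then have "?S \<subseteq> saturate V (closed_ideal_gen V G)" by (rule saturate_mono)
 then have "?S \<subseteq> closed_ideal_gen V G" using C by (simp add: cs_ideal_def)
 then have "hclosure V ?S \<subseteq> hclosure V (closed_ideal_gen V G)" by (rule hclosure_mono)
 then show "hclosure V ?S \<subseteq> closed_ideal_gen V G" using C by (simp add: cs_ideal_def)
qed

end

section \<open>Homomorphisms and preimages\<close>

locale pva_hom = A: pva A + B: pva B + tlin A B f
 for A :: "'v hva" and B :: "'w hva" and f +
 assumes hom: "f \<in> va_hom A B"
begin

lemma vac: "f (vac A) = vac B" and
 nprod: "u \<in> carrier A ==> v \<in> carrier A ==> f (nprod A n u v) = nprod B n (f u) (f v)"
 using hom by (auto simp: va_hom_def)

lemma hpow: "v \<in> hpow A n ==> f v \<in> hpow B n"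
 by (rule linear_maps_hpow[OF A.hmod_axioms B.hmod_axioms lin])

lemma hcong: "u \<in> carrier A ==> v \<in> carrier A ==> hcong A n u v ==> hcong B n (f u) (f v)"
 using hpow[of "u \<ominus>\<^bsub>A\<^esub> v" n] by (simp add: hcong_def minus)

lemma vimage_hclosure:
 assumes "hclosure B K = K" "K \<subseteq> carrier B"
 shows "hclosure A {u \<in> carrier A. f u \<in> K} = {u \<in> carrier A. f u \<in> K}"
proof
 show "hclosure A {u \<in> carrier A. f u \<in> K} \<subseteq> {u \<in> carrier A. f u \<in> K}"
 proof
  fix u assume "u \<in> hclosure A {u \<in> carrier A. f u \<in> K}"
  then have u: "u \<in> carrier A" "!!n. EX k:{u \<in> carrier A. f u \<in> K}. hcong A n u k" by (auto simp: hclosure_def)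
  then have "f u \<in> hclosure B K" unfolding hclosure_def using hcong by fastforce
  then show "u \<in> {u \<in> carrier A. f u \<in> K}" using u assms by simp
 qed
qed (rule A.subset_hclosure, auto)

lemma vimage_saturate:
 assumes "saturate B K = K"
 shows "saturate A {u \<in> carrier A. f u \<in> K} = {u \<in> carrier A. f u \<in> K}"
proof
 show "saturate A {u \<in> carrier A. f u \<in> K} \<subseteq> {u \<in> carrier A. f u \<in> K}"
 proof
  fix u assume "u \<in> saturate A {u \<in> carrier A. f u \<in> K}"
  then obtain n where "u \<in> carrier A" "f (fps_X ^ n \<odot>\<^bsub>A\<^esub> u) \<in> K" by (auto simp: saturate_def)
  then have "f u \<in> saturate B K" unfolding saturate_def by (auto simp: smult)
  then show "u \<in> {u \<in> carrier A. f u \<in> K}" using \<open>u \<in> carrier A\<close> assms by simp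
 qed
qed (rule A.subset_saturate, auto)

lemma vimage_cs_ideal:
 assumes "B.cs_ideal K"
 shows "A.cs_ideal {u \<in> carrier A. f u \<in> K}"
proof -
 note K = B.va_idealD[of K]
 have i: "va_ideal B K" using assms by (simp add: B.cs_ideal_def)
 have "va_ideal A {u \<in> carrier A. f u \<in> K}"
  by (rule A.va_idealI) (use K[OF i] in \<open>auto simp: add smult nprod\<close>)
 then show ?thesis
  using assms vimage_hclosure[of K] vimage_saturate[of K] K(1)[OF i] by (simp add: A.cs_ideal_def B.cs_ideal_def)
qed

lemma closed_ideal_gen_image:
 assumes G: "G \<subseteq> carrier A" "G' \<subseteq> carrier B" and GG: "!!x. x \<in> G ==> f x \<in> closed_ideal_gen B G'"
  and u: "u \<in> closed_ideal_gen A G"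
 shows "f u \<in> closed_ideal_gen B G'"
proof -
 have "closed_ideal_gen A G \<subseteq> {u \<in> carrier A. f u \<in> closed_ideal_gen B G'}"
  by (rule A.closed_ideal_gen_least[OF vimage_cs_ideal[OF B.closed_ideal_gen_cs[OF G(2)]]]) (use G GG in auto)
 then show ?thesis using u by auto
qed

lemma vimage_subalgebra:
 assumes "va_subalgebra B K"
 shows "va_subalgebra A {u \<in> carrier A. f u \<in> K}"
proof -
 have s: "submodule K (ring_of_type_algebra :: complex fps ring) B" using assms by (simp add: va_subalgebra_def)
 note K = B.submodule_facts[OF s]
 have "submodule {u \<in> carrier A. f u \<in> K} (ring_of_type_algebra :: complex fps ring) A"
 proof (rule A.submoduleI)
  show "\<ominus>\<^bsub>A\<^esub> x \<in> {u \<in> carrier A. f u \<in> K}" if "x \<in> {u \<in> carrier A. f u \<in> K}" for x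
   using that K(4)[of "f x" "- 1"] by (auto simp: A.neg_as_smult smult)
 qed (use K in \<open>auto simp: add smult\<close>)
 then show ?thesis using assms by (auto simp: va_subalgebra_def vac nprod)
qed

end

lemma pva_homI: "pva A ==> pva B ==> f \<in> va_hom A B ==> pva_hom A B f"
 unfolding pva_hom_def pva_hom_axioms_def tlin_def tlin_axioms_def
 by (auto simp: va_hom_def pva_def hmod_def)

lemma va_iso_inverse:
 assumes A: "pva A" and B: "pva B" and f: "f \<in> va_iso A B"
 obtains g where "g \<in> va_iso B A" "!!u. u \<in> carrier A ==> g (f u) = u" "!!v. v \<in> carrier B ==> f (g v) = v"
proof -
 interpret pva_hom A B f by (rule pva_homI) (use assms in \<open>auto simp: va_iso_def\<close>)
 have b: "bij_betw f (carrier A) (carrier B)" using f by (simp add: va_iso_def)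
 define g where "g = inv_into (carrier A) f"
 have gf: "g (f u) = u" if "u \<in> carrier A" for u using b that by (simp add: g_def bij_betw_inv_into_left)
 have fg: "f (g v) = v" if "v \<in> carrier B" for v using b that by (simp add: g_def bij_betw_inv_into_right)
 have gb: "bij_betw g (carrier B) (carrier A)" unfolding g_def by (rule bij_betw_inv_into[OF b])
 then have gc: "v \<in> carrier B ==> g v \<in> carrier A" for v by (auto simp: bij_betw_def)
 have "g \<in> va_hom B A"
  unfolding va_hom_def
 proof (intro CollectI conjI allI ballI linear_mapsI gc)
  show "g (x \<oplus>\<^bsub>B\<^esub> y) = g x \<oplus>\<^bsub>A\<^esub> g y" if "x \<in> carrier B" "y \<in> carrier B" for x y
   using gf[of "g x \<oplus>\<^bsub>A\<^esub> g y"] that gc by (simp add: add fg)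
  show "g (c \<odot>\<^bsub>B\<^esub> x) = c \<odot>\<^bsub>A\<^esub> g x" if "x \<in> carrier B" for c x
   using gf[of "c \<odot>\<^bsub>A\<^esub> g x"] that gc by (simp add: smult fg)
  show "g (vac B) = vac A" using gf[of "vac A"] by (simp add: vac)
  show "g (nprod B n x y) = nprod A n (g x) (g y)" if "x \<in> carrier B" "y \<in> carrier B" for n x y
   using gf[of "nprod A n (g x) (g y)"] that gc by (simp add: nprod fg)
 qed
 then show ?thesis using that[of g] gb gf fg by (simp add: va_iso_def)
qed

text \<open>Ideals are submodules, so a correspondence of generators up to scalars suffices; the
  inverse isomorphism gives the converse implication.\<close>

lemma closed_ideal_gen_iso:
 assumes A: "pva A" and B: "pva B" and f: "f \<in> va_iso A B"
  and G: "G \<subseteq> carrier A" "G' \<subseteq> carrier B"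
  and 1: "!!x. x \<in> G ==> EX c. EX y:G'. f x = c \<odot>\<^bsub>B\<^esub> y"
  and 2: "!!y. y \<in> G' ==> EX c. EX x:G. y = c \<odot>\<^bsub>B\<^esub> f x"
  and u: "u \<in> carrier A"
 shows "u \<in> closed_ideal_gen A G \<longleftrightarrow> f u \<in> closed_ideal_gen B G'"
proof -
 obtain g where g: "g \<in> va_iso B A" and gf: "!!u. u \<in> carrier A ==> g (f u) = u"
  and fg: "!!v. v \<in> carrier B ==> f (g v) = v"
  by (rule va_iso_inverse[OF A B f]) blast
 interpret F: pva_hom A B f by (rule pva_homI) (use A B f in \<open>auto simp: va_iso_def\<close>)
 interpret G: pva_hom B A g by (rule pva_homI) (use A B g in \<open>auto simp: va_iso_def\<close>)
 have cs: "F.A.cs_ideal (closed_ideal_gen A G)" "F.B.cs_ideal (closed_ideal_gen B G')"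
  using F.A.closed_ideal_gen_cs F.B.closed_ideal_gen_cs G by auto
 have s1: "c \<odot>\<^bsub>B\<^esub> y \<in> closed_ideal_gen B G'" if "y \<in> G'" for c y
  using F.B.va_idealD(4) cs(2) F.B.closed_ideal_gen_superset[of G'] that by (auto simp: F.B.cs_ideal_def)
 have s2: "c \<odot>\<^bsub>A\<^esub> x \<in> closed_ideal_gen A G" if "x \<in> G" for c x
  using F.A.va_idealD(4) cs(1) F.A.closed_ideal_gen_superset[of G] that by (auto simp: F.A.cs_ideal_def)
 have "f x \<in> closed_ideal_gen B G'" if "x \<in> G" for x using 1[OF that] s1 by auto
 moreover have "g y \<in> closed_ideal_gen A G" if y: "y \<in> G'" for y
 proof -
  obtain c x where x: "x \<in> G" "y = c \<odot>\<^bsub>B\<^esub> f x" using 2[OF y] by blast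
  then have "g y = c \<odot>\<^bsub>A\<^esub> x" using G gf by (auto simp: G.smult subset_iff)
  then show ?thesis using s2[OF x(1)] by simp
 qed
 ultimately show ?thesis
  using F.closed_ideal_gen_image[OF G] G.closed_ideal_gen_image[OF G(2,1)] gf[OF u] by metis
qed

subsection \<open>Quotients\<close>

context pva
begin

context
 fixes K assumes K: "va_ideal V K"
begin

lemmas KD = va_idealD[OF K]

lemma coset_mem: "u \<in> carrier V ==> z \<in> K +> u \<longleftrightarrow> z \<in> carrier V & z \<ominus> u \<in> K"
proof
 assume u: "u \<in> carrier V"
 show "z \<in> carrier V & z \<ominus> u \<in> K" if zu: "z \<in> K +> u"
 proof -
  obtain k where k: "k \<in> K" "z = k \<oplus> u" using zu by (auto simp: a_r_coset_def')
  then have "z \<ominus> u = k" using u KD(1) by (auto simp: minus_eq a_assoc M.r_neg subset_iff)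
  then show ?thesis using k u KD(1) by auto
 qed
 show "z \<in> K +> u" if "z \<in> carrier V & z \<ominus> u \<in> K"
  using that u add_minus_cancel[of z u] by (force simp: a_r_coset_def')
qed

lemma coset_self: "u \<in> carrier V ==> u \<in> K +> u"
 by (simp add: coset_mem KD)

lemma coset_eq_iff: "u \<in> carrier V ==> v \<in> carrier V ==> K +> u = K +> v \<longleftrightarrow> u \<ominus> v \<in> K"
proof
 assume u: "u \<in> carrier V" and v: "v \<in> carrier V"
 show "K +> u = K +> v ==> u \<ominus> v \<in> K" using coset_self[OF u] coset_mem[OF v] by auto
 assume uv: "u \<ominus> v \<in> K"
 have vu: "v \<ominus> u \<in> K" using KD(4)[OF uv, of "- 1"] u v minus_minus_eq[of u v] by (simp add: neg_as_smult)
 show "K +> u = K +> v"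
  using u v uv vu KD(3) minus_trans_eq[of _ u v] minus_trans_eq[of _ v u]
  by (intro Set.set_eqI) (auto simp: coset_mem; metis)
qed

text \<open>The operations of \<open>va_quot\<close> add \<open>K\<close> to a set formed from
  representatives, which need not fill a coset; the sum is a coset once that set lies in a single
  one.\<close>

lemma K_plus_set:
 assumes "x \<in> S" "x \<in> carrier V" "!!s. s \<in> S ==> s \<in> carrier V & s \<ominus> x \<in> K"
 shows "K <+>\<^bsub>V\<^esub> S = K +> x"
proof (intro Set.set_eqI iffI)
 fix z assume "z \<in> K <+>\<^bsub>V\<^esub> S"
 then obtain k s where k: "k \<in> K" "s \<in> S" "z = k \<oplus> s" by (auto simp: set_add_def')
 then have "k \<in> carrier V" "s \<in> carrier V" "s \<ominus> x \<in> K" using assms KD(1) by auto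
 moreover have "z \<ominus> x = k \<oplus> (s \<ominus> x)" using k calculation assms(2) by (simp add: minus_eq a_assoc)
 ultimately show "z \<in> K +> x" using k assms(2) KD(3) by (simp add: coset_mem)
next
 fix z assume "z \<in> K +> x"
 then show "z \<in> K <+>\<^bsub>V\<^esub> S" using assms(1) by (auto simp: set_add_def' a_r_coset_def')
qed

abbreviation "Q \<equiv> va_quot V K"

lemma quot_carrier: "carrier Q = (%u. K +> u) ` carrier V"
 by (auto simp: va_quot_def A_RCOSETS_def')

lemma quot_zero: "\<zero>\<^bsub>Q\<^esub> = K +> \<zero>"
proof -
 have "K +> \<zero> = K" using KD(1) by (auto simp: coset_mem)
 then show ?thesis by (simp add: va_quot_def)
qed

lemma quot_vac: "vac Q = K +> vac V"
 by (simp add: va_quot_def)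

lemma quot_add: "u \<in> carrier V ==> v \<in> carrier V ==> (K +> u) \<oplus>\<^bsub>Q\<^esub> (K +> v) = K +> (u \<oplus> v)"
proof -
 assume u: "u \<in> carrier V" and v: "v \<in> carrier V"
 have "(K +> u) <+>\<^bsub>V\<^esub> (K +> v) = K +> (u \<oplus> v)"
 proof (intro Set.set_eqI iffI)
  fix z assume "z \<in> (K +> u) <+>\<^bsub>V\<^esub> (K +> v)"
  then obtain x y where x: "x \<in> K +> u" "y \<in> K +> v" "z = x \<oplus> y" by (auto simp: set_add_def')
  then show "z \<in> K +> (u \<oplus> v)" using u v KD(3) by (auto simp: coset_mem minus_add_eq)
 next
  fix z assume z: "z \<in> K +> (u \<oplus> v)"
  then obtain k where k: "k \<in> K" "z = k \<oplus> (u \<oplus> v)" by (auto simp: a_r_coset_def')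
  then have "z = (k \<oplus> u) \<oplus> v" using u v KD(1) by (auto simp: a_assoc)
  moreover have "k \<oplus> u \<in> K +> u" using k by (auto simp: a_r_coset_def')
  ultimately show "z \<in> (K +> u) <+>\<^bsub>V\<^esub> (K +> v)" using coset_self[OF v] by (auto simp: set_add_def')
 qed
 then show ?thesis by (simp add: va_quot_def)
qed

lemma quot_smult: "u \<in> carrier V ==> c \<odot>\<^bsub>Q\<^esub> (K +> u) = K +> (c \<odot> u)"
proof -
 assume u: "u \<in> carrier V"
 have "K <+>\<^bsub>V\<^esub> {c \<odot> x |x. x \<in> K +> u} = K +> (c \<odot> u)"
 proof (rule K_plus_set)
  show "c \<odot> u \<in> {c \<odot> x |x. x \<in> K +> u}" using coset_self[OF u] by auto
  fix s assume "s \<in> {c \<odot> x |x. x \<in> K +> u}"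
  then obtain x where "s = c \<odot> x" "x \<in> carrier V" "x \<ominus> u \<in> K" using u by (auto simp: coset_mem)
  then show "s \<in> carrier V & s \<ominus> c \<odot> u \<in> K" using KD(4)[of "x \<ominus> u" c] u by (simp add: sm_minus_r)
 qed (use u in simp)
 then show ?thesis by (simp add: va_quot_def)
qed

lemma quot_nprod: "u \<in> carrier V ==> v \<in> carrier V ==> nprod Q n (K +> u) (K +> v) = K +> nprod V n u v"
proof -
 assume u: "u \<in> carrier V" and v: "v \<in> carrier V"
 have "K <+>\<^bsub>V\<^esub> {nprod V n x y |x y. x \<in> K +> u & y \<in> K +> v} = K +> nprod V n u v"
 proof (rule K_plus_set)
  show "nprod V n u v \<in> {nprod V n x y |x y. x \<in> K +> u & y \<in> K +> v}"
   using coset_self[OF u] coset_self[OF v] by auto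
  fix s assume "s \<in> {nprod V n x y |x y. x \<in> K +> u & y \<in> K +> v}"
  then obtain x y where s: "s = nprod V n x y" and x: "x \<in> carrier V" "x \<ominus> u \<in> K" and y: "y \<in> carrier V" "y \<ominus> v \<in> K"
   using u v by (auto simp: coset_mem)
  have "s \<ominus> nprod V n u v = (nprod V n x y \<ominus> nprod V n x v) \<oplus> (nprod V n x v \<ominus> nprod V n u v)"
   using x y u v unfolding s by (simp add: minus_trans_eq)
  also have "... = nprod V n x (y \<ominus> v) \<oplus> nprod V n (x \<ominus> u) v"
   using x y u v by (simp add: nprod_minus_l nprod_minus_r)
  finally show "s \<in> carrier V & s \<ominus> nprod V n u v \<in> K" using x y u v KD(3,6,7) by (simp add: s)
 qed (use u v in simp)
 then show ?thesis by (simp add: va_quot_def)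
qed

lemmas quot_simps = quot_carrier quot_zero quot_vac quot_add quot_smult quot_nprod

lemma quot_pva: "pva Q"
proof -
 have "module (ring_of_type_algebra :: complex fps ring) Q"
 proof (rule moduleI)
  show "cring (ring_of_type_algebra :: complex fps ring)" by (rule cring_from_type_algebra)
  show "abelian_group Q"
  proof (rule abelian_groupI)
   fix x assume "x \<in> carrier Q"
   then obtain u where u: "u \<in> carrier V" "x = K +> u" by (auto simp: quot_carrier)
   then have "(K +> (\<ominus> u)) \<oplus>\<^bsub>Q\<^esub> x = \<zero>\<^bsub>Q\<^esub>" by (simp add: quot_add quot_zero M.l_neg)
   moreover have "K +> (\<ominus> u) \<in> carrier Q" using u by (simp add: quot_carrier)
   ultimately show "EX y:carrier Q. y \<oplus>\<^bsub>Q\<^esub> x = \<zero>\<^bsub>Q\<^esub>" by blast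
  qed (auto simp: quot_simps a_ac)
 qed (auto simp: quot_simps sm_add_l sm_add_r sm_assoc)
 then interpret Q: hmod Q by (simp add: hmod_def tmod_def)
 show ?thesis
  by unfold_locales (auto simp: quot_simps nprod_add_l nprod_add_r nprod_smult_l nprod_smult_r)
qed

lemma quot_hom: "(%u. K +> u) \<in> va_hom V Q"
 unfolding va_hom_def by (auto intro!: linear_mapsI simp: quot_simps)

lemma quot_hsep:
 assumes cl: "hclosure V K = K" and sat: "saturate V K = K"
 shows "hsep Q"
 unfolding hsep_def
proof (intro conjI ballI allI impI)
 fix v assume "v \<in> carrier Q"
 then obtain u where u: "u \<in> carrier V" "v = K +> u" by (auto simp: quot_carrier)
 have zero_iff: "K +> x = \<zero>\<^bsub>Q\<^esub> \<longleftrightarrow> x \<in> K" if "x \<in> carrier V" for x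
  using that by (simp add: quot_zero coset_eq_iff)
 show "v = \<zero>\<^bsub>Q\<^esub>" if h: "ALL n. v \<in> hpow Q n"
 proof -
  have "EX k:K. hcong V n u k" for n
  proof -
   obtain x where x: "x \<in> carrier V" "v = fps_X ^ n \<odot>\<^bsub>Q\<^esub> (K +> x)"
    using h[rule_format, of n] by (auto simp: hpow_def quot_carrier)
   then have k: "u \<ominus> fps_X ^ n \<odot> x \<in> K" using u by (simp add: quot_smult coset_eq_iff)
   moreover have "u \<ominus> (u \<ominus> fps_X ^ n \<odot> x) \<in> hpow V n"
    using u x by (auto simp: minus_minus_cancel hpow_def)
   ultimately show ?thesis unfolding hcong_def by blast
  qed
  then have "u \<in> hclosure V K" using u by (simp add: hclosure_def)
  then show ?thesis using u cl by (simp add: zero_iff)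
 qed
 show "v = \<zero>\<^bsub>Q\<^esub>" if "fps_X ^ n \<odot>\<^bsub>Q\<^esub> v = \<zero>\<^bsub>Q\<^esub>" for n
 proof -
  have "fps_X ^ n \<odot> u \<in> K" using that u by (simp add: quot_smult zero_iff)
  then have "u \<in> saturate V K" using u by (auto simp: saturate_def)
  then show ?thesis using u sat by (simp add: zero_iff)
 qed
qed

lemma quot_generated:
 assumes "va_generated V (range g)" "range g \<subseteq> carrier V"
 shows "va_generated Q (range (%s. K +> g s))"
 unfolding va_generated_def
proof (intro allI impI)
 fix L assume L: "va_subalgebra Q L & hclosure Q L = L & saturate Q L = L & range (%s. K +> g s) \<subseteq> L"
 interpret pva_hom V Q "%u. K +> u" by (rule pva_homI[OF pva_axioms quot_pva quot_hom])
 have Lc: "L \<subseteq> carrier Q" using L B.submodule_facts(1) by (simp add: va_subalgebra_def)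
 let ?P = "{u \<in> carrier V. K +> u \<in> L}"
 have "va_subalgebra V ?P & hclosure V ?P = ?P & saturate V ?P = ?P & range g \<subseteq> ?P"
  using L Lc vimage_subalgebra[of L] vimage_hclosure[of L] vimage_saturate[of L] assms(2) by auto
 then have "?P = carrier V" using assms(1) unfolding va_generated_def by blast
 then show "L = carrier Q" using Lc by (auto simp: quot_carrier)
qed

end

end

lemma quot_iso:
 assumes A: "pva A" and B: "pva B" and f: "f \<in> va_iso A B" and K: "va_ideal A K" and L: "va_ideal B L"
  and KL: "!!u. u \<in> carrier A ==> u \<in> K \<longleftrightarrow> f u \<in> L"
 obtains F where "F \<in> va_iso (va_quot A K) (va_quot B L) \<inter> extensional (carrier (va_quot A K))"
  "!!u. u \<in> carrier A ==> F (K +>\<^bsub>A\<^esub> u) = L +>\<^bsub>B\<^esub> f u"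
proof -
 interpret pva_hom A B f by (rule pva_homI) (use assms in \<open>auto simp: va_iso_def\<close>)
 have fb: "f ` carrier A = carrier B" using f by (auto simp: va_iso_def bij_betw_def)
 \<comment> \<open>A chosen representative defines the map; it is restricted to the carrier because
   the uniqueness statement compares extensional maps.\<close>
 define F where "F = restrict (%c. L +>\<^bsub>B\<^esub> f (SOME u. u \<in> carrier A & K +>\<^bsub>A\<^esub> u = c)) (carrier (va_quot A K))"
 note qa = A.quot_simps[OF K] and qb = B.quot_simps[OF L]
 have F: "F (K +>\<^bsub>A\<^esub> u) = L +>\<^bsub>B\<^esub> f u" if u: "u \<in> carrier A" for u
 proof -
  let ?v = "SOME v. v \<in> carrier A & K +>\<^bsub>A\<^esub> v = K +>\<^bsub>A\<^esub> u"
  have v: "?v \<in> carrier A & K +>\<^bsub>A\<^esub> ?v = K +>\<^bsub>A\<^esub> u"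
   by (rule someI[of _ u]) (use u in simp)
  then have "?v \<ominus>\<^bsub>A\<^esub> u \<in> K" using u A.coset_eq_iff[OF K, of ?v u] by blast
  then have "f (?v \<ominus>\<^bsub>A\<^esub> u) \<in> L" using KL v u by simp
  then have "L +>\<^bsub>B\<^esub> f ?v = L +>\<^bsub>B\<^esub> f u" using u v B.coset_eq_iff[OF L, of "f ?v" "f u"] by (simp add: minus)
  then show ?thesis using u by (simp add: F_def qa)
 qed
 have inj: "inj_on F (carrier (va_quot A K))"
 proof (rule inj_onI)
  fix x y assume "x \<in> carrier (va_quot A K)" "y \<in> carrier (va_quot A K)" and e: "F x = F y"
  then obtain u v where u: "u \<in> carrier A" "x = K +>\<^bsub>A\<^esub> u" and v: "v \<in> carrier A" "y = K +>\<^bsub>A\<^esub> v" by (auto simp: qa)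
  then have "f u \<ominus>\<^bsub>B\<^esub> f v \<in> L" using e B.coset_eq_iff[OF L] by (simp add: F)
  then have "u \<ominus>\<^bsub>A\<^esub> v \<in> K" using u v KL[of "u \<ominus>\<^bsub>A\<^esub> v"] by (simp add: minus)
  then show "x = y" using u v A.coset_eq_iff[OF K] by simp
 qed
 have "F ` carrier (va_quot A K) = (%u. L +>\<^bsub>B\<^esub> f u) ` carrier A"
  unfolding qa(1) image_image by (intro image_cong refl F)
 also have "... = (%u. L +>\<^bsub>B\<^esub> u) ` f ` carrier A" by (simp add: image_image)
 also have "... = carrier (va_quot B L)" by (simp add: fb qb)
 finally have b: "bij_betw F (carrier (va_quot A K)) (carrier (va_quot B L))" using inj by (simp add: bij_betw_def)
 have "F \<in> va_hom (va_quot A K) (va_quot B L)"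
  unfolding va_hom_def
  by (auto intro!: linear_mapsI simp: qa qb F add smult nprod vac)
 then show ?thesis using that[of F] b F by (auto simp: va_iso_def F_def)
qed

text \<open>The equalizer of the two homomorphisms is a closed saturated subalgebra because the
  target is separated and torsion-free; topological generation does the rest.\<close>

lemma va_hom_eq:
 assumes A: "pva A" and B: "pva B" and gen: "va_generated A G" and sep: "hsep B"
  and f: "f \<in> va_hom A B" and h: "h \<in> va_hom A B" and eq: "!!x. x \<in> G ==> f x = h x" and G: "G \<subseteq> carrier A"
  and u: "u \<in> carrier A"
 shows "f u = h u"
proof -
 interpret F: pva_hom A B f by (rule pva_homI) (use assms in auto)
 interpret H: pva_hom A B h by (rule pva_homI) (use assms in auto)
 let ?E = "{u \<in> carrier A. f u = h u}"
 have sep1: "v = \<zero>\<^bsub>B\<^esub>" if "v \<in> carrier B" "!!n. v \<in> hpow B n" for v using sep that unfolding hsep_def by blast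
 have sep2: "v = \<zero>\<^bsub>B\<^esub>" if "v \<in> carrier B" "fps_X ^ n \<odot>\<^bsub>B\<^esub> v = \<zero>\<^bsub>B\<^esub>" for v n using sep that unfolding hsep_def by blast
 have "submodule ?E (ring_of_type_algebra :: complex fps ring) A"
  by (rule F.A.submoduleI) (auto simp: F.add H.add F.smult H.smult F.neg H.neg)
 then have "va_subalgebra A ?E"
  by (auto simp: va_subalgebra_def F.vac H.vac F.nprod H.nprod)
 moreover have "hclosure A ?E = ?E"
 proof
  show "hclosure A ?E \<subseteq> ?E"
  proof
   fix u assume "u \<in> hclosure A ?E"
   then have u: "u \<in> carrier A" "!!n. EX k:?E. hcong A n u k" by (auto simp: hclosure_def)
   have "f u \<ominus>\<^bsub>B\<^esub> h u \<in> hpow B n" for n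
   proof -
    obtain k where k: "k \<in> carrier A" "f k = h k" "hcong A n u k" using u by blast
    have "hcong B n (f u) (h u)"
     using F.hcong[OF u(1) k(1,3)] H.hcong[OF u(1) k(1,3)] k u F.B.hcong_trans[of "f u" "f k" "h u" n]
      F.B.hcong_sym[of "h u" "h k" n] by simp
    then show ?thesis by (simp add: hcong_def)
   qed
   then have "f u \<ominus>\<^bsub>B\<^esub> h u = \<zero>\<^bsub>B\<^esub>" using u by (intro sep1) auto
   then show "u \<in> ?E" using u by (simp add: F.B.minus_zero_iff)
  qed
 qed (rule F.A.subset_hclosure, auto)
 moreover have "saturate A ?E = ?E"
 proof
  show "saturate A ?E \<subseteq> ?E"
  proof
   fix u assume "u \<in> saturate A ?E"
   then obtain n where u: "u \<in> carrier A" "f (fps_X ^ n \<odot>\<^bsub>A\<^esub> u) = h (fps_X ^ n \<odot>\<^bsub>A\<^esub> u)" by (auto simp: saturate_def)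
   then have "fps_X ^ n \<odot>\<^bsub>B\<^esub> (f u \<ominus>\<^bsub>B\<^esub> h u) = \<zero>\<^bsub>B\<^esub>" by (simp add: F.smult H.smult F.B.sm_minus_r)
   then have "f u \<ominus>\<^bsub>B\<^esub> h u = \<zero>\<^bsub>B\<^esub>" by (rule sep2[rotated]) (use u(1) in simp)
   then show "u \<in> ?E" using u by (simp add: F.B.minus_zero_iff)
  qed
 qed (rule F.A.subset_saturate, auto)
 moreover have "G \<subseteq> ?E" using G eq by auto
 ultimately have "?E = carrier A" using gen unfolding va_generated_def by blast
 then show ?thesis using u by auto
qed

lemma nonlocal_va_pva:
 assumes "nonlocal_va V"
 shows "pva V"
proof -
 have tf: "topologically_free V" using assms by (simp add: nonlocal_va_def)
 interpret hfree V by (rule topologically_free_hfree[OF tf])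
 have l: "(%u. nprod V n u v) \<in> linear_maps V V" if "v \<in> carrier V" for n v using assms that by (auto simp: nonlocal_va_def)
 have r: "nprod V n u \<in> linear_maps V V" if "u \<in> carrier V" for n u
 proof -
  have "Yc V u (- n - 1) \<in> linear_maps V V" using assms that by (auto simp: nonlocal_va_def is_field_def)
  then show ?thesis by (simp add: Yc_def)
 qed
 show ?thesis
 proof unfold_locales
  show "vac V \<in> carrier V" using assms unfolding nonlocal_va_def by blast
  fix u u' v v' n c assume u: "u \<in> carrier V" and v: "v \<in> carrier V"
  show "nprod V n u v \<in> carrier V" using r[OF u, of n] v unfolding linear_maps_def by blast
  show "nprod V n (c \<odot>\<^bsub>V\<^esub> u) v = c \<odot>\<^bsub>V\<^esub> nprod V n u v" using l[OF v, of n] u unfolding linear_maps_def by blast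
  show "nprod V n u (c \<odot>\<^bsub>V\<^esub> v) = c \<odot>\<^bsub>V\<^esub> nprod V n u v" using r[OF u, of n] v unfolding linear_maps_def by blast
  show "nprod V n (u \<oplus>\<^bsub>V\<^esub> u') v = nprod V n u v \<oplus>\<^bsub>V\<^esub> nprod V n u' v" if "u' \<in> carrier V"
   using l[OF v, of n] u that unfolding linear_maps_def by blast
  show "nprod V n u (v \<oplus>\<^bsub>V\<^esub> v') = nprod V n u v \<oplus>\<^bsub>V\<^esub> nprod V n u v'" if "v' \<in> carrier V"
   using r[OF u, of n] v that unfolding linear_maps_def by blast
 qed
qed

section \<open>The isomorphism of the universal algebras\<close>

context pva
begin

lemma der_closed [simp]: "v \<in> carrier V ==> der V v \<in> carrier V"
 by (simp add: der_def)

lemma der_iter_closed [simp]: "v \<in> carrier V ==> (der V ^^ k) v \<in> carrier V"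
 by (induction k) auto

lemma der_iter_hpow: "v \<in> hpow V n ==> (der V ^^ k) v \<in> hpow V n"
 by (induction k) (auto simp: der_def nprod_hpow_l)

lemma hD_va_null:
 assumes "v \<in> carrier V"
 shows "hnull V (%k. (fps_const (P $ k) * fps_X ^ k) \<odot> (der V ^^ k) v)"
 unfolding hnull_def
proof (intro conjI allI)
 fix n
 have "{k. (fps_const (P $ k) * fps_X ^ k) \<odot> (der V ^^ k) v \<notin> hpow V n} \<subseteq> {..<n}"
 proof
  fix k assume k: "k \<in> {k. (fps_const (P $ k) * fps_X ^ k) \<odot> (der V ^^ k) v \<notin> hpow V n}"
  show "k \<in> {..<n}"
  proof (rule ccontr)
   assume "k \<notin> {..<n}"
   then have "fps_X ^ n dvd fps_const (P $ k) * fps_X ^ k" by (intro dvd_mult le_imp_power_dvd) auto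
   then show False using k hpow_dvd assms by auto
  qed
 qed
 then show "finite {k. (fps_const (P $ k) * fps_X ^ k) \<odot> (der V ^^ k) v \<notin> hpow V n}"
  by (rule finite_subset) auto
qed (use assms in auto)

text \<open>Each application of \<open>y\<close> gains a power of \<open>h\<close>; hence the
  exponential series of \<open>y\<close> converges.\<close>

lemma nprod_iter_hpow:
 assumes "y \<in> hpow V 1" "v \<in> carrier V"
 shows "(nprod V m y ^^ k) v \<in> hpow V k"
proof (induction k)
 case (Suc k)
 obtain y' where y': "y' \<in> carrier V" "y = fps_X \<odot> y'" using assms by (auto simp: hpow_def)
 then have "(nprod V m y ^^ Suc k) v = fps_X ^ 1 \<odot> nprod V m y' ((nprod V m y ^^ k) v)"
  using hpow_closed[OF Suc] by (simp add: nprod_smult_l)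
 moreover have "nprod V m y' ((nprod V m y ^^ k) v) \<in> hpow V k" using y' Suc by (intro nprod_hpow_r)
 ultimately show ?case using hpow_X[of "nprod V m y' ((nprod V m y ^^ k) v)" k 1] by simp
qed (use assms in simp)

lemma exp_null:
 assumes "y \<in> hpow V 1"
 shows "hnull V (%k. fps_const (1 / fact k) \<odot> (nprod V m y ^^ k) (vac V))"
 unfolding hnull_def
proof (intro conjI allI)
 have h: "fps_const (1 / fact k) \<odot> (nprod V m y ^^ k) (vac V) \<in> hpow V k" for k
  by (intro hpow_smult nprod_iter_hpow assms) simp
 then show "fps_const (1 / fact k) \<odot> (nprod V m y ^^ k) (vac V) \<in> carrier V" for k by (rule hpow_closed)
 fix n
 have "{k. fps_const (1 / fact k) \<odot> (nprod V m y ^^ k) (vac V) \<notin> hpow V n} \<subseteq> {..<n}"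
  using h hpow_mono by (force simp: not_less[symmetric])
 then show "finite {k. fps_const (1 / fact k) \<odot> (nprod V m y ^^ k) (vac V) \<notin> hpow V n}"
  by (rule finite_subset) auto
qed

end

locale va = pva + hfree V

lemma nonlocal_va_va: "nonlocal_va V ==> va V"
 unfolding va_def using nonlocal_va_pva topologically_free_hfree by (auto simp: nonlocal_va_def)

context va
begin

lemma hD_va_closed [simp]: "v \<in> carrier V ==> hD_va V P v \<in> carrier V"
 unfolding hD_va_def by (rule hsum_closed[OF hD_va_null])

lemma hD_va_hpow: "v \<in> hpow V n ==> hD_va V P v \<in> hpow V n"
 unfolding hD_va_def
 by (rule hsum_hpow[OF hD_va_null]) (auto intro!: hpow_smult der_iter_hpow hpow_closed)

lemma exp_arg_hpow: "h \<in> carrier V ==> \<ominus> hD_va V P (fps_X \<odot> hD_va V Fser h) \<in> hpow V 1"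
 by (intro hpow_neg hD_va_hpow) (auto intro: hpow_dvd)

lemma exp_vec_closed [simp]: "h \<in> carrier V ==> exp_vec V d h \<in> carrier V"
 unfolding exp_vec_def Let_def by (rule hsum_closed[OF exp_null[OF exp_arg_hpow]])

text \<open>Gives meaning to the division by \<open>2 r_i h\<close>, respectively
  \<open>q_i - q_i^(-1)\<close>, in the relators: the exponential starts with the vacuum, and the
  scalar in front has constant term 1.\<close>

lemma vac_minus_exp_vec:
 assumes h: "h \<in> carrier V" and s: "s $ 0 = 1"
 shows "vac V \<ominus> s \<odot> exp_vec V d h \<in> hpow V 1"
proof -
 let ?y = "\<ominus> hD_va V (fps_exp (- d)) (fps_X \<odot> hD_va V Fser h)"
 let ?f = "%k. fps_const (1 / fact k) \<odot> (nprod V (- 1) ?y ^^ k) (vac V)"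
 have y: "?y \<in> hpow V 1" by (rule exp_arg_hpow[OF h])
 have "hcong V 1 (finsum V ?f {0}) (hsum V ?f)"
 proof (rule hsum_hcong[OF exp_null[OF y]])
  fix k :: nat assume "k \<notin> {0}"
  then have "1 <= k" by simp
  moreover have "?f k \<in> hpow V k" by (intro hpow_smult nprod_iter_hpow y) simp
  ultimately show "?f k \<in> hpow V 1" by (rule hpow_mono)
 qed simp
 then have 1: "vac V \<ominus> exp_vec V d h \<in> hpow V 1"
  by (simp add: exp_vec_def Let_def hcong_def)
 have "fps_X ^ 1 dvd 1 - s" using s by (simp only: fps_X_power_dvd_iff) simp
 then have 2: "(1 - s) \<odot> exp_vec V d h \<in> hpow V 1" using h by (intro hpow_dvd) auto
 have "vac V \<ominus> s \<odot> exp_vec V d h = (vac V \<ominus> exp_vec V d h) \<oplus> (exp_vec V d h \<ominus> s \<odot> exp_vec V d h)"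
  using h by (simp add: minus_trans_eq)
 also have "exp_vec V d h \<ominus> s \<odot> exp_vec V d h = (1 - s) \<odot> exp_vec V d h"
  using h by (simp add: sm_minus_l)
 finally show ?thesis using 1 2 hpow_add by simp
qed

lemma hdiv_eqI:
 assumes "u \<in> carrier V" "d \<odot> u = v" "d ~= 0"
 shows "hdiv V d v = u"
 unfolding hdiv_def
proof (rule the_equality)
 show "u \<in> carrier V & d \<odot> u = v" using assms by blast
 show "w = u" if "w \<in> carrier V & d \<odot> w = v" for w
  using that assms smult_cancel[of w u d] by metis
qed

lemma hdiv_closed:
 assumes "v \<in> hpow V 1" "d = fps_X * e" "e * e' = 1"
 shows "hdiv V d v \<in> carrier V" "d \<odot> hdiv V d v = v"
proof -
 obtain w where w: "w \<in> carrier V" "v = fps_X \<odot> w" using assms by (auto simp: hpow_def)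
 have "d \<odot> (e' \<odot> w) = (fps_X * (e * e')) \<odot> w" using w assms(2) by (simp add: sm_assoc mult_ac)
 then have d: "d \<odot> (e' \<odot> w) = v" using w assms(3) by simp
 have "d ~= 0" using assms by auto
 then have "hdiv V d v = e' \<odot> w" using w d by (intro hdiv_eqI) auto
 then show "hdiv V d v \<in> carrier V" "d \<odot> hdiv V d v = v" using w d by auto
qed

end

locale va_hom_loc = A: va A + B: va B + pva_hom A B f
 for A :: "'v hva" and B :: "'w hva" and f
begin

lemma der_iter: "v \<in> carrier A ==> f ((der A ^^ k) v) = (der B ^^ k) (f v)"
 by (induction k) (simp_all add: der_def nprod vac)

lemma hD_va: "v \<in> carrier A ==> f (hD_va A P v) = hD_va B P (f v)"
proof -
 assume v: "v \<in> carrier A"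
 have "f (hD_va A P v) = hsum B (%k. f ((fps_const (P $ k) * fps_X ^ k) \<odot>\<^bsub>A\<^esub> (der A ^^ k) v))"
  unfolding hD_va_def by (rule hsum_linear[OF A.hfree_axioms B.hfree_axioms lin A.hD_va_null[OF v]])
 then show ?thesis using v by (simp add: hD_va_def smult der_iter)
qed

lemma nprod_iter: "u \<in> carrier A ==> v \<in> carrier A ==>
  (nprod A m u ^^ k) v \<in> carrier A & f ((nprod A m u ^^ k) v) = (nprod B m (f u) ^^ k) (f v)"
 by (induction k) (simp_all add: nprod)

lemma exp_vec: "h \<in> carrier A ==> f (exp_vec A d h) = exp_vec B d (f h)"
proof -
 assume h: "h \<in> carrier A"
 let ?y = "\<ominus>\<^bsub>A\<^esub> hD_va A (fps_exp (- d)) (fps_X \<odot>\<^bsub>A\<^esub> hD_va A Fser h)"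
 have y: "?y \<in> carrier A" using h by simp
 have fy: "f ?y = \<ominus>\<^bsub>B\<^esub> hD_va B (fps_exp (- d)) (fps_X \<odot>\<^bsub>B\<^esub> hD_va B Fser (f h))"
  using h by (simp add: neg hD_va smult)
 have "f (exp_vec A d h) = hsum B (%k. f (fps_const (1 / fact k) \<odot>\<^bsub>A\<^esub> (nprod A (- 1) ?y ^^ k) (vac A)))"
  unfolding exp_vec_def Let_def
  by (rule hsum_linear[OF A.hfree_axioms B.hfree_axioms lin A.exp_null[OF A.exp_arg_hpow[OF h]]])
 also have "... = hsum B (%k. fps_const (1 / fact k) \<odot>\<^bsub>B\<^esub> (nprod B (- 1) (f ?y) ^^ k) (vac B))"
  using nprod_iter[OF y A.vac_closed] by (simp add: smult vac)
 finally show ?thesis unfolding exp_vec_def Let_def fy .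
qed

end

lemma va_hom_locI: "va A ==> va B ==> f \<in> va_hom A B ==> va_hom_loc A B f"
 unfolding va_hom_loc_def using pva_homI by (auto simp: va_def)

section \<open>Rescaling the generators\<close>

definition gen_unit :: "('i => nat) => 'i gen => complex fps" where
 "gen_unit r s = (case s of Xg Pos i => qdiff r i / (of_nat (2 * r i) * fps_X) | _ => 1)"

lemma gen_unit_simps [simp]: "gen_unit r (Hg i) = 1" "gen_unit r (Xg Neg i) = 1"
 by (simp_all add: gen_unit_def)

lemma qdiff_eq:
 assumes "0 < r i"
 shows "qdiff r i = gen_unit r (Xg Pos i) * (of_nat (2 * r i) * fps_X)"
  and "gen_unit r (Xg Pos i) $ 0 = 1"
proof -
 define e where "e = qdiff r i / fps_X"
 have X: "fps_X * e = qdiff r i" unfolding e_def by (rule X_mult_divide_X) (simp add: qdiff_def)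
 have c: "(of_nat (2 * r i) :: complex fps) = fps_const (of_nat (2 * r i))" by (simp only: fps_of_nat)
 have n: "of_nat (2 * r i) ~= (0 :: complex)" using assms by simp
 have "qdiff r i = (fps_const (inverse (of_nat (2 * r i))) * e) * (of_nat (2 * r i) * fps_X)"
  unfolding X[symmetric] c using n
  by (metis (no_types, lifting) fps_const_1_eq_1 fps_const_mult left_inverse mult.assoc mult.commute mult_1)
 moreover have nz: "(of_nat (2 * r i) * fps_X :: complex fps) ~= 0" unfolding c using n by simp
 ultimately have g: "gen_unit r (Xg Pos i) = fps_const (inverse (of_nat (2 * r i))) * e"
  by (simp add: gen_unit_def)
 then show "qdiff r i = gen_unit r (Xg Pos i) * (of_nat (2 * r i) * fps_X)"
  using \<open>qdiff r i = (fps_const (inverse (of_nat (2 * r i))) * e) * (of_nat (2 * r i) * fps_X)\<close> by simp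
 have "e $ 0 = (fps_X * e) $ 1" by simp
 also have "... = of_nat (2 * r i)" unfolding X by (simp add: qdiff_def)
 finally show "gen_unit r (Xg Pos i) $ 0 = 1" unfolding g using n by simp
qed

lemma gen_unit_inverse:
 assumes "!!i. 0 < r i"
 shows "gen_unit r s * inverse (gen_unit r s) = 1"
proof (rule inverse_mult_eq_1')
 show "gen_unit r s $ 0 ~= 0"
 proof (cases s)
  case (Xg e i)
  then show ?thesis using qdiff_eq(2)[of r i] assms by (cases e) auto
 qed simp
qed

lemma Yc_smult:
 assumes "pva V" "u \<in> carrier V" "v \<in> carrier V"
 shows "Yc V (c \<odot>\<^bsub>V\<^esub> u) m v = c \<odot>\<^bsub>V\<^esub> Yc V u m v"
proof -
 interpret pva V by fact
 show ?thesis using assms by (simp add: Yc_def nprod_smult_l)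
qed

lemma va_hom_id: "(%x. x) \<in> va_hom V V"
 by (auto simp: va_hom_def linear_maps_def)

lemma va_hom_comp: "f \<in> va_hom A B ==> h \<in> va_hom B C ==> (%x. h (f x)) \<in> va_hom A C"
 by (simp add: va_hom_def linear_maps_def Pi_iff)

lemma va_hom_restrict:
 assumes "pva A" "f \<in> va_hom A B"
 shows "restrict f (carrier A) \<in> va_hom A B \<inter> extensional (carrier A)"
proof -
 interpret pva A by fact
 show ?thesis using assms(2) by (auto simp: va_hom_def linear_maps_def)
qed

text \<open>Uniqueness in the universal property concerns extensional maps, so the endomorphism and
  the identity are both restricted to the carrier before they are compared.\<close>

lemma universal_va_self:
 assumes u: "universal_va Cat V g" and f: "f \<in> va_hom V V" "!!s. f (g s) = g s" and x: "x \<in> carrier V"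
 shows "f x = x"
proof -
 have V: "nonlocal_va V" and g: "range g \<subseteq> carrier V" using u by (auto simp: universal_va_def)
 note p = nonlocal_va_pva[OF V]
 have "EX! f. f \<in> va_hom V V \<inter> extensional (carrier V) & (ALL s. f (g s) = g s)"
  using u unfolding universal_va_def by blast
 moreover have "restrict f (carrier V) \<in> va_hom V V \<inter> extensional (carrier V) & (ALL s. restrict f (carrier V) (g s) = g s)"
  using va_hom_restrict[OF p f(1)] f(2) g by auto
 moreover have "restrict (%x. x) (carrier V) \<in> va_hom V V \<inter> extensional (carrier V) & (ALL s. restrict (%x. x) (carrier V) (g s) = g s)"
  using va_hom_restrict[OF p va_hom_id] g by auto
 ultimately have "restrict f (carrier V) = restrict (%x. x) (carrier V)" by blast
 then show ?thesis using x by (metis restrict_apply')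
qed

text \<open>Both algebras have their underlying sets in the same type, so each competes in the
  universal property of the other: the rescaled generators of one satisfy the relations of the
  other. Both composites fix the generators and are therefore identities.\<close>

theorem universal_iso:
 fixes U U' :: "'v hva"
 assumes sym: "!!i j. ra a r i j = ra a r j i" and r: "!!i. 0 < r i"
  and U: "universal_va (M_tau a r l (tau_trig a r l)) U g" and U': "universal_va (M_hat a r l) U' g'"
 obtains f where "f \<in> va_iso U U'" "!!s. f (g s) = gen_unit r s \<odot>\<^bsub>U'\<^esub> g' s"
proof -
 let ?c = "gen_unit r"
 have V: "nonlocal_va U" "nonlocal_va U'" and g: "!!s. g s \<in> carrier U" "!!s. g' s \<in> carrier U'"
  and M: "M_tau a r l (tau_trig a r l) U (%s. Yc U (g s))" "M_hat a r l U' (%s. Yc U' (g' s))"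
  using U U' by (auto simp: universal_va_def)
 interpret A: va U by (rule nonlocal_va_va[OF V(1)])
 interpret B: va U' by (rule nonlocal_va_va[OF V(2)])
 have "M_hat a r l U' (%s. Yc U' (?c s \<odot>\<^bsub>U'\<^esub> g' s))"
  by (rule M_hat_scale[OF M(2), of ?c]) (simp_all add: Yc_smult[OF B.pva_axioms g(2)])
 then have "M_tau a r l (tau_trig a r l) U' (%s. Yc U' (?c s \<odot>\<^bsub>U'\<^esub> g' s))"
  by (simp only: M_tau_iff_M_hat[OF sym])
 moreover have "range (%s. ?c s \<odot>\<^bsub>U'\<^esub> g' s) \<subseteq> carrier U'" using g by auto
 ultimately have "EX! f. f \<in> va_hom U U' \<inter> extensional (carrier U) & (ALL s. f (g s) = ?c s \<odot>\<^bsub>U'\<^esub> g' s)"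
  using U V(2) unfolding universal_va_def by blast
 then obtain f where f: "f \<in> va_hom U U'" "!!s. f (g s) = ?c s \<odot>\<^bsub>U'\<^esub> g' s" by blast
 have "M_hat a r l U (%s. Yc U (g s))" using M(1) by (simp only: M_tau_iff_M_hat[OF sym])
 then have "M_hat a r l U (%s. Yc U (inverse (?c s) \<odot>\<^bsub>U\<^esub> g s))"
  by (rule M_hat_scale[where c = "%s. inverse (?c s)"]) (simp_all add: Yc_smult[OF A.pva_axioms g(1)])
 moreover have "range (%s. inverse (?c s) \<odot>\<^bsub>U\<^esub> g s) \<subseteq> carrier U" using g by auto
 ultimately have "EX! h. h \<in> va_hom U' U \<inter> extensional (carrier U') & (ALL s. h (g' s) = inverse (?c s) \<odot>\<^bsub>U\<^esub> g s)"
  using U' V(1) unfolding universal_va_def by blast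
 then obtain h where h: "h \<in> va_hom U' U" "!!s. h (g' s) = inverse (?c s) \<odot>\<^bsub>U\<^esub> g s" by blast
 interpret F: pva_hom U U' f by (rule pva_homI[OF A.pva_axioms B.pva_axioms f(1)])
 interpret H: pva_hom U' U h by (rule pva_homI[OF B.pva_axioms A.pva_axioms h(1)])
 have cc: "?c s * inverse (?c s) = 1" "inverse (?c s) * ?c s = 1" for s
  using gen_unit_inverse[of r s] r by (simp_all add: mult.commute)
 have hf: "h (f x) = x" if "x \<in> carrier U" for x
  by (rule universal_va_self[OF U va_hom_comp[OF f(1) h(1)] _ that])
   (simp add: f h g H.smult A.sm_assoc cc)
 have fh: "f (h x) = x" if "x \<in> carrier U'" for x
  by (rule universal_va_self[OF U' va_hom_comp[OF h(1) f(1)] _ that])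
   (simp add: f h g F.smult B.sm_assoc cc)
 have "bij_betw f (carrier U) (carrier U')"
  by (rule bij_betwI[of _ _ _ h]) (auto simp: hf fh)
 then show ?thesis using that[of f] f by (auto simp: va_iso_def)
qed

section \<open>Linear functionals on topologically free modules\<close>

definition flin :: "(complex fps, 'v, 'm) module_scheme => ('v => complex fps) => bool" where
 "flin M f \<longleftrightarrow> (ALL u:carrier M. ALL v:carrier M. f (u \<oplus>\<^bsub>M\<^esub> v) = f u + f v) &
   (ALL c. ALL u:carrier M. f (c \<odot>\<^bsub>M\<^esub> u) = c * f u)"

context hmod
begin

text \<open>Subspaces over the constants only: the separation takes place in the complex vector
  space \<open>V / h V\<close>, and the codimension argument divides by scalars.\<close>

definition csub :: "'v set => bool" where
 "csub S \<longleftrightarrow> S \<subseteq> carrier M & \<zero> \<in> S & (ALL u:S. ALL v:S. u \<oplus> v \<in> S) & (ALL c. ALL u:S. fps_const c \<odot> u \<in> S)"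

lemma csubD:
 assumes "csub S"
 shows "S \<subseteq> carrier M" "\<zero> \<in> S" "u \<in> S ==> v \<in> S ==> u \<oplus> v \<in> S" "u \<in> S ==> fps_const c \<odot> u \<in> S"
  "u \<in> S ==> v \<in> S ==> u \<ominus> v \<in> S"
proof -
 show *: "S \<subseteq> carrier M" "\<zero> \<in> S" "u \<in> S ==> v \<in> S ==> u \<oplus> v \<in> S" "u \<in> S ==> fps_const c \<odot> u \<in> S" for u v c
  using assms by (auto simp: csub_def)
 show "u \<in> S ==> v \<in> S ==> u \<ominus> v \<in> S"
 proof -
  assume u: "u \<in> S" and v: "v \<in> S"
  have "fps_const (- 1) = (- 1 :: complex fps)" by (simp flip: fps_const_neg)
  then have "\<ominus> v \<in> S" using *(4)[OF v, of "- 1"] *(1) v by (metis neg_as_smult subsetD)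
  then show ?thesis using u *(3) by (simp add: minus_eq)
 qed
qed

text \<open>A maximal subspace avoiding \<open>x\<close> has codimension one.\<close>

lemma separating_functional:
 assumes Z: "csub Z" and x: "x \<in> carrier M" "x \<notin> Z"
 obtains \<mu> :: "'v => complex" where "!!u v. u \<in> carrier M ==> v \<in> carrier M ==> \<mu> (u \<oplus> v) = \<mu> u + \<mu> v"
  "!!c u. u \<in> carrier M ==> \<mu> (fps_const c \<odot> u) = c * \<mu> u" "!!z. z \<in> Z ==> \<mu> z = 0" "\<mu> x = 1"
proof -
 let ?A = "{S. csub S & Z \<subseteq> S & x \<notin> S}"
 have "EX S:?A. ALL T:?A. S \<subseteq> T --> T = S"
 proof (rule subset_Zorn_nonempty)
  show "?A ~= {}" using Z x by blast
  fix C assume C: "C ~= {}" "subset.chain ?A C"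
  then have CA: "C \<subseteq> ?A" and ch: "!!S T. S \<in> C ==> T \<in> C ==> S \<subseteq> T | T \<subseteq> S"
   unfolding subset_chain_def by blast+
  have "csub (\<Union> C)"
   unfolding csub_def
  proof (intro conjI ballI allI)
   show "\<Union> C \<subseteq> carrier M" using CA csubD(1) by blast
   show "\<zero> \<in> \<Union> C" using CA C(1) csubD(2) by blast
   show "fps_const c \<odot> u \<in> \<Union> C" if "u \<in> \<Union> C" for c u using that CA csubD(4) by blast
   fix u v assume "u \<in> \<Union> C" "v \<in> \<Union> C"
   then obtain S T where ST: "S \<in> C" "u \<in> S" "T \<in> C" "v \<in> T" by blast
   then consider "u \<in> T" | "v \<in> S" using ch[of S T] by blast
   then show "u \<oplus> v \<in> \<Union> C" using ST CA csubD(3) by cases blast+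
  qed
  then show "\<Union> C \<in> ?A" using CA C(1) by blast
 qed
 then obtain S where SA: "S \<in> ?A" and mA: "ALL T:?A. S \<subseteq> T --> T = S" by (rule bexE)
 then have S: "csub S" "Z \<subseteq> S" "x \<notin> S" by auto
 have mx: "T = S" if "csub T" "S \<subseteq> T" "x \<notin> T" for T
 proof (rule mp[OF bspec[OF mA]])
  show "T \<in> ?A" using that S(2) by auto
 qed (rule that(2))
 note SD = csubD[OF S(1)]
 have ex: "EX c. v \<ominus> fps_const c \<odot> x \<in> S" if v: "v \<in> carrier M" for v
 proof (cases "v \<in> S")
  case True
  then show ?thesis using v x by (intro exI[of _ 0]) simp
 next
  case False
  let ?T = "{s \<oplus> fps_const c \<odot> v | s c. s \<in> S}"
  have "csub ?T"
   unfolding csub_def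
  proof (intro conjI ballI allI)
   show "?T \<subseteq> carrier M" using SD(1) v by auto
   show "\<zero> \<in> ?T" using SD(2) v by (auto intro!: exI[of _ "\<zero>"] exI[of _ 0])
   fix a assume "a \<in> ?T"
   then obtain s c where a: "a = s \<oplus> fps_const c \<odot> v" "s \<in> S" by auto
   have sc: "s \<in> carrier M" using a SD(1) by auto
   show "fps_const d \<odot> a \<in> ?T" for d
   proof -
    have "fps_const d \<odot> a = fps_const d \<odot> s \<oplus> fps_const (d * c) \<odot> v"
     using sc v by (simp add: a sm_add_r sm_assoc)
    then show ?thesis using SD(4)[OF a(2)] by blast
   qed
   fix b assume "b \<in> ?T"
   then obtain s' c' where b: "b = s' \<oplus> fps_const c' \<odot> v" "s' \<in> S" by auto
   have sc': "s' \<in> carrier M" using b SD(1) by auto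
   have "a \<oplus> b = (s \<oplus> s') \<oplus> (fps_const c \<odot> v \<oplus> fps_const c' \<odot> v)"
    using sc sc' v by (simp add: a b M.a_ac)
   also have "fps_const c \<odot> v \<oplus> fps_const c' \<odot> v = fps_const (c + c') \<odot> v"
    using v by (simp add: sm_add_l flip: fps_const_add)
   finally show "a \<oplus> b \<in> ?T" using SD(3)[OF a(2) b(2)] by blast
  qed
  moreover have "S \<subseteq> ?T"
  proof
   fix s assume s: "s \<in> S"
   then have "s = s \<oplus> fps_const 0 \<odot> v" using SD(1) v by auto
   then show "s \<in> ?T" using s by blast
  qed
  moreover have "v \<in> ?T"
  proof -
   have "v = \<zero> \<oplus> fps_const 1 \<odot> v" using v by simp
   then show ?thesis using SD(2) by blast
  qed
  ultimately have "x \<in> ?T" using mx[of ?T] False by blast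
  then obtain s c where s: "s \<in> S" "x = s \<oplus> fps_const c \<odot> v" by blast
  have sc: "s \<in> carrier M" using s SD(1) by auto
  have c: "c ~= 0"
  proof
   assume "c = 0"
   then have "x = s" using s(2) sc v by simp
   then show False using s S by simp
  qed
  have "fps_const (- inverse c) \<odot> s = v \<ominus> fps_const (inverse c) \<odot> x"
  proof -
   have "fps_const (inverse c) \<odot> x = fps_const (inverse c) \<odot> s \<oplus> v"
    unfolding s(2) using sc v c by (simp add: sm_add_r sm_assoc)
   moreover have "fps_const (- inverse c) \<odot> s = \<ominus> (fps_const (inverse c) \<odot> s)"
    using sc by (simp add: sm_neg flip: fps_const_neg)
   moreover have "v \<ominus> (w \<oplus> v) = \<ominus> w" if "w \<in> carrier M" for w
    using that v by (simp add: minus_eq M.minus_add M.a_ac M.r_neg1 M.r_neg2)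
   ultimately show ?thesis using sc by simp
  qed
  then show ?thesis using SD(4)[OF s(1)] by metis
 qed
 have uniq: "c = d" if "v \<in> carrier M" "v \<ominus> fps_const c \<odot> x \<in> S" "v \<ominus> fps_const d \<odot> x \<in> S" for v c d
 proof (rule ccontr)
  assume cd: "c ~= d"
  have "(v \<ominus> fps_const c \<odot> x) \<ominus> (v \<ominus> fps_const d \<odot> x) \<in> S" using that SD(5) by blast
  moreover have "(v \<ominus> fps_const c \<odot> x) \<ominus> (v \<ominus> fps_const d \<odot> x) = fps_const d \<odot> x \<ominus> fps_const c \<odot> x"
  proof -
   have "\<ominus> (v \<ominus> fps_const d \<odot> x) = fps_const d \<odot> x \<ominus> v" using that x by (simp add: minus_minus_eq)
   then have "(v \<ominus> fps_const c \<odot> x) \<ominus> (v \<ominus> fps_const d \<odot> x) = (fps_const d \<odot> x \<ominus> v) \<oplus> (v \<ominus> fps_const c \<odot> x)"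
    using that x by (simp add: minus_eq M.a_comm)
   then show ?thesis using that x by (simp add: minus_trans_eq)
  qed
  moreover have "... = fps_const (d - c) \<odot> x" using x by (simp add: sm_minus_l flip: fps_const_sub)
  ultimately have "fps_const (d - c) \<odot> x \<in> S" by simp
  then have "fps_const (inverse (d - c)) \<odot> (fps_const (d - c) \<odot> x) \<in> S" by (rule SD(4))
  then show False using S(3) cd x by (simp add: sm_assoc)
 qed
 define \<mu> where "\<mu> v = (THE c. v \<ominus> fps_const c \<odot> x \<in> S)" for v
 have mu: "\<mu> v = c" if "v \<in> carrier M" "v \<ominus> fps_const c \<odot> x \<in> S" for v c
  unfolding \<mu>_def by (rule the_equality) (use that uniq in blast)+
 have muS: "v \<ominus> fps_const (\<mu> v) \<odot> x \<in> S" if v: "v \<in> carrier M" for v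
  using ex[OF v] mu[OF v] by metis
 show ?thesis
 proof (rule that)
  fix u v assume u: "u \<in> carrier M" and v: "v \<in> carrier M"
  have "(u \<oplus> v) \<ominus> fps_const (\<mu> u + \<mu> v) \<odot> x = (u \<ominus> fps_const (\<mu> u) \<odot> x) \<oplus> (v \<ominus> fps_const (\<mu> v) \<odot> x)"
   using u v x by (simp add: minus_add_eq sm_add_l flip: fps_const_add)
  then show "\<mu> (u \<oplus> v) = \<mu> u + \<mu> v" using muS[OF u] muS[OF v] SD(3) u v by (intro mu) auto
 next
  fix c u assume u: "u \<in> carrier M"
  have "fps_const c \<odot> u \<ominus> fps_const (c * \<mu> u) \<odot> x = fps_const c \<odot> (u \<ominus> fps_const (\<mu> u) \<odot> x)"
   using u x by (simp add: sm_minus_r sm_assoc)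
  then show "\<mu> (fps_const c \<odot> u) = c * \<mu> u" using muS[OF u] SD(4) u by (intro mu) auto
 next
  fix z assume "z \<in> Z"
  then have "z \<in> S" "z \<in> carrier M" using S(2) SD(1) by auto
  then show "\<mu> z = 0" using x by (intro mu) simp_all
 next
  show "\<mu> x = 1" using SD(2) x by (intro mu) auto
 qed
qed

fun lcomb :: "complex list => 'v list => 'v" where
 "lcomb (c # cs) (x # xs) = fps_const c \<odot> x \<oplus> lcomb cs xs"
| "lcomb _ _ = \<zero>"

lemma lcomb_closed [simp]: "set xs \<subseteq> carrier M ==> lcomb cs xs \<in> carrier M"
 by (induction cs xs rule: lcomb.induct) auto

lemma lcomb_add:
 assumes "length cs = length xs" "length ds = length xs" "set xs \<subseteq> carrier M"
 shows "lcomb cs xs \<oplus> lcomb ds xs = lcomb (map2 (+) cs ds) xs"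
 using assms(1) assms(2)[symmetric] assms(3)
proof (induction cs xs ds rule: list_induct3)
 case (Cons c cs x xs d ds)
 then have "x \<in> carrier M" "lcomb cs xs \<in> carrier M" "lcomb ds xs \<in> carrier M" by auto
 then show ?case using Cons
  by (simp add: sm_add_l flip: fps_const_add Cons.IH) (simp add: M.a_ac)
qed auto

lemma lcomb_smult:
 assumes "set xs \<subseteq> carrier M"
 shows "fps_const c \<odot> lcomb cs xs = lcomb (map ((*) c) cs) xs"
 using assms by (induction cs xs rule: lcomb.induct) (auto simp: sm_add_r sm_assoc)

lemma lcomb_zero: "set xs \<subseteq> carrier M ==> lcomb (replicate n 0) xs = \<zero>"
proof (induction xs arbitrary: n)
 case (Cons x xs)
 then show ?case by (cases n) auto
qed simp

lemma lcomb_nth: "i < length xs ==> set xs \<subseteq> carrier M ==> lcomb ((replicate (length xs) 0)[i := 1]) xs = xs ! i"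
proof (induction xs arbitrary: i)
 case (Cons x xs)
 then have "i = Suc j ==> xs ! j \<in> carrier M" for j by (auto intro!: subsetD[OF _ nth_mem])
 then show ?case using Cons by (cases i) (auto simp: lcomb_zero)
qed simp

lemma csub_lcomb:
 assumes xs: "set xs \<subseteq> carrier M"
 shows "csub {lcomb cs xs \<oplus> fps_X \<odot> v | cs v. length cs = length xs & v \<in> carrier M}" (is "csub ?Z")
 unfolding csub_def
proof (intro conjI ballI allI)
 show "?Z \<subseteq> carrier M" using xs by auto
 show "\<zero> \<in> ?Z"
  using lcomb_zero[OF xs, of "length xs"] by (intro CollectI exI[of _ "replicate (length xs) 0"] exI[of _ "\<zero>"]) auto
 fix a assume "a \<in> ?Z"
 then obtain cs v where a: "a = lcomb cs xs \<oplus> fps_X \<odot> v" "length cs = length xs" "v \<in> carrier M" by auto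
 show "fps_const c \<odot> a \<in> ?Z" for c
  using a xs by (intro CollectI exI[of _ "map ((*) c) cs"] exI[of _ "fps_const c \<odot> v"])
   (auto simp: sm_add_r sm_assoc lcomb_smult mult.commute)
 fix b assume "b \<in> ?Z"
 then obtain ds w where b: "b = lcomb ds xs \<oplus> fps_X \<odot> w" "length ds = length xs" "w \<in> carrier M" by auto
 have l: "lcomb cs xs \<in> carrier M" "lcomb ds xs \<in> carrier M" using xs by auto
 have "a \<oplus> b = (lcomb cs xs \<oplus> lcomb ds xs) \<oplus> (fps_X \<odot> v \<oplus> fps_X \<odot> w)"
  using l a b by (simp add: M.a_ac)
 also have "... = lcomb (map2 (+) cs ds) xs \<oplus> fps_X \<odot> (v \<oplus> w)"
  using lcomb_add[OF a(2) b(2) xs] a b by (simp add: sm_add_r)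
 finally show "a \<oplus> b \<in> ?Z" using a b by (intro CollectI exI[of _ "map2 (+) cs ds"] exI[of _ "v \<oplus> w"]) auto
qed

end

text \<open>Either \<open>x\<close> lies in the span of the \<open>xs\<close> modulo
  \<open>h\<close>, or a complex functional on the constants vanishes on the \<open>xs\<close> but
  not on \<open>x\<close>. Applied to all coordinates it extends to a functional over the power
  series, whose values on the \<open>xs\<close> are divisible by \<open>h\<close>.\<close>

lemma functional_dichotomy:
 assumes tf: "topologically_free V" and x: "x \<in> carrier V" and xs: "set xs \<subseteq> carrier V"
 shows "(EX f. flin V f & f x = 1 & (ALL y:set xs. fps_X dvd f y)) |
  (EX cs v. length cs = length xs & v \<in> carrier V & x = hmod.lcomb V cs xs \<oplus>\<^bsub>V\<^esub> fps_X \<odot>\<^bsub>V\<^esub> v)"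
proof (rule topologically_freeE[OF tf])
 fix V0 :: "(complex, 'a) module" and co :: "'a => nat => 'a"
 assume "tmod V0" and coc: "!!v n. v \<in> carrier V ==> co v n \<in> carrier V0"
  and coa: "!!u v n. u \<in> carrier V ==> v \<in> carrier V ==> co (u \<oplus>\<^bsub>V\<^esub> v) n = co u n \<oplus>\<^bsub>V0\<^esub> co v n"
  and cos: "!!c v n. v \<in> carrier V ==> co (c \<odot>\<^bsub>V\<^esub> v) n = finsum V0 (%k. (c $ k) \<odot>\<^bsub>V0\<^esub> co v (n - k)) {..n}"
  and coi: "!!u v. u \<in> carrier V ==> v \<in> carrier V ==> (!!n. co u n = co v n) ==> u = v"
  and cou: "!!p. (!!n. p n \<in> carrier V0) ==> EX v:carrier V. ALL n. co v n = p n"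
 interpret V: hfree V by (rule topologically_free_hfree[OF tf])
 interpret V0: tmod V0 by fact
 let ?Z = "{V.lcomb cs xs \<oplus>\<^bsub>V\<^esub> fps_X \<odot>\<^bsub>V\<^esub> v | cs v. length cs = length xs & v \<in> carrier V}"
 have Z: "V.csub ?Z" by (rule V.csub_lcomb[OF xs])
 show ?thesis
 proof (cases "x \<in> ?Z")
  case True
  then show ?thesis by blast
 next
  case False
  show ?thesis
  proof (rule V.separating_functional[OF Z x False])
  fix \<mu> :: "'a => complex"
  assume ma: "!!u v. u \<in> carrier V ==> v \<in> carrier V ==> \<mu> (u \<oplus>\<^bsub>V\<^esub> v) = \<mu> u + \<mu> v"
   and ms: "!!c u. u \<in> carrier V ==> \<mu> (fps_const c \<odot>\<^bsub>V\<^esub> u) = c * \<mu> u"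
   and mZ: "!!z. z \<in> ?Z ==> \<mu> z = 0" and mx: "\<mu> x = 1"
  \<comment> \<open>A section of the zeroth coordinate: the vector whose other coordinates
    vanish.\<close>
  define base where "base p = (SOME v. v \<in> carrier V & (ALL n. co v n = (if n = 0 then p else \<zero>\<^bsub>V0\<^esub>)))" for p
  have base: "base p \<in> carrier V & (ALL n. co (base p) n = (if n = 0 then p else \<zero>\<^bsub>V0\<^esub>))" if "p \<in> carrier V0" for p
   unfolding base_def
  proof (rule someI_ex)
   have "(if n = 0 then p else \<zero>\<^bsub>V0\<^esub>) \<in> carrier V0" for n :: nat using that by simp
   from cou[of "%n. if n = 0 then p else \<zero>\<^bsub>V0\<^esub>", OF this]
   show "EX v. v \<in> carrier V & (ALL n. co v n = (if n = 0 then p else \<zero>\<^bsub>V0\<^esub>))" by (simp only: Bex_def)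
  qed
  have co_const: "co (fps_const c \<odot>\<^bsub>V\<^esub> v) n = c \<odot>\<^bsub>V0\<^esub> co v n" if v: "v \<in> carrier V" for c v n
  proof -
   have "finsum V0 (%k. (fps_const c $ k) \<odot>\<^bsub>V0\<^esub> co v (n - k)) {..n} =
    finsum V0 (%k. if 0 = k then c \<odot>\<^bsub>V0\<^esub> co v (n - k) else \<zero>\<^bsub>V0\<^esub>) {..n}"
    using coc[OF v] by (intro V0.finsum_cong') auto
   also have "... = c \<odot>\<^bsub>V0\<^esub> co v (n - 0)"
    using coc[OF v] by (intro V0.finsum_singleton) auto
   finally show ?thesis using v by (simp add: cos)
  qed
  define \<nu> where "\<nu> p = \<mu> (base p)" for p
  have na: "\<nu> (p \<oplus>\<^bsub>V0\<^esub> q) = \<nu> p + \<nu> q" if p: "p \<in> carrier V0" and q: "q \<in> carrier V0" for p q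
  proof -
   have pq: "p \<oplus>\<^bsub>V0\<^esub> q \<in> carrier V0" using p q by simp
   have "base (p \<oplus>\<^bsub>V0\<^esub> q) = base p \<oplus>\<^bsub>V\<^esub> base q"
    by (rule coi) (use base[OF p] base[OF q] base[OF pq] in \<open>simp_all add: coa\<close>)
   then show ?thesis using base[OF p] base[OF q] by (simp add: \<nu>_def ma)
  qed
  have ns: "\<nu> (c \<odot>\<^bsub>V0\<^esub> p) = c * \<nu> p" if p: "p \<in> carrier V0" for c p
  proof -
   have cp: "c \<odot>\<^bsub>V0\<^esub> p \<in> carrier V0" using p by simp
   have "base (c \<odot>\<^bsub>V0\<^esub> p) = fps_const c \<odot>\<^bsub>V\<^esub> base p"
    by (rule coi) (use base[OF p] base[OF cp] in \<open>simp_all add: co_const\<close>)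
   then show ?thesis using base[OF p] by (simp add: \<nu>_def ms)
  qed
  have n0: "\<nu> \<zero>\<^bsub>V0\<^esub> = 0" using ns[of "\<zero>\<^bsub>V0\<^esub>" 0] by simp
  have nsum: "\<nu> (finsum V0 g F) = (\<Sum>i\<in>F. \<nu> (g i))" if "g \<in> F \<rightarrow> carrier V0" "finite F" for g and F :: "nat set"
   using that(2,1)
  proof (induction F)
   case (insert i F)
   then have "g \<in> F \<rightarrow> carrier V0" "g i \<in> carrier V0" by auto
   then show ?case using insert by (simp add: na V0.finsum_closed)
  qed (simp add: n0)
  define f where "f v = Abs_fps (%n. \<nu> (co v n))" for v
  have "flin V f"
   unfolding flin_def
  proof (intro conjI ballI allI)
   show "f (u \<oplus>\<^bsub>V\<^esub> v) = f u + f v" if "u \<in> carrier V" "v \<in> carrier V" for u v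
    using that by (intro fps_ext) (simp add: f_def coa na coc)
   show "f (c \<odot>\<^bsub>V\<^esub> u) = c * f u" if u: "u \<in> carrier V" for c u
   proof (rule fps_ext)
    fix n
    have "f (c \<odot>\<^bsub>V\<^esub> u) $ n = (\<Sum>k\<le>n. \<nu> ((c $ k) \<odot>\<^bsub>V0\<^esub> co u (n - k)))"
     using u coc[OF u] by (simp add: f_def cos nsum Pi_def)
    also have "... = (\<Sum>k\<le>n. c $ k * \<nu> (co u (n - k)))" using coc[OF u] by (simp add: ns)
    also have "... = (c * f u) $ n" by (simp add: fps_mult_nth f_def atLeast0AtMost)
    finally show "f (c \<odot>\<^bsub>V\<^esub> u) $ n = (c * f u) $ n" .
   qed
  qed
  \<comment> \<open>\<open>\<mu>\<close> vanishes on multiples of \<open>h\<close>, so it sees only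
    the zeroth coordinate.\<close>
  have f0: "f v $ 0 = \<mu> v" if v: "v \<in> carrier V" for v
  proof -
   obtain w where w: "w \<in> carrier V" "!!n. co w n = co v (Suc n)"
    using cou[of "%n. co v (Suc n)"] coc[OF v] by blast
   note b = base[OF coc[OF v], of 0]
   have coX: "co (fps_X \<odot>\<^bsub>V\<^esub> w) n = (if n = 0 then \<zero>\<^bsub>V0\<^esub> else co w (n - 1))" for n
   proof (cases n)
    case 0
    then show ?thesis using w coc[OF w(1)] by (simp add: cos)
   next
    case (Suc m)
    have "finsum V0 (%k. (fps_X $ k) \<odot>\<^bsub>V0\<^esub> co w (n - k)) {..n} =
     finsum V0 (%k. if 1 = k then co w (n - k) else \<zero>\<^bsub>V0\<^esub>) {..n}"
     using coc[OF w(1)] by (intro V0.finsum_cong') auto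
    also have "... = co w (n - 1)"
     using coc[OF w(1)] Suc by (intro V0.finsum_singleton) auto
    finally show ?thesis using w Suc by (simp add: cos)
   qed
   have "v = base (co v 0) \<oplus>\<^bsub>V\<^esub> fps_X \<odot>\<^bsub>V\<^esub> w"
   proof (rule coi)
    show "co v n = co (base (co v 0) \<oplus>\<^bsub>V\<^esub> fps_X \<odot>\<^bsub>V\<^esub> w) n" for n
     using b w coc[OF v] by (cases n) (simp_all add: coa coX)
   qed (use b w v in auto)
   moreover have "\<mu> (fps_X \<odot>\<^bsub>V\<^esub> w) = 0"
   proof (rule mZ)
    show "fps_X \<odot>\<^bsub>V\<^esub> w \<in> ?Z"
     using V.lcomb_zero[OF xs, of "length xs"] w
     by (intro CollectI exI[of _ "replicate (length xs) 0"] exI[of _ w]) auto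
   qed
   ultimately have "\<mu> v = \<mu> (base (co v 0))" using ma[of "base (co v 0)" "fps_X \<odot>\<^bsub>V\<^esub> w"] b w by simp
   then show ?thesis by (simp add: f_def \<nu>_def)
  qed
  \<comment> \<open>\<open>f x\<close> has constant term 1 but may have higher terms; dividing by
    this unit makes the value exactly 1.\<close>
  define g where "g v = inverse (f x) * f v" for v
  have "f x * inverse (f x) = 1" using f0[OF x] mx by (intro inverse_mult_eq_1') simp
  then have "g x = 1" by (simp add: g_def mult.commute)
  moreover have "flin V g" using \<open>flin V f\<close> by (auto simp: flin_def g_def algebra_simps)
  moreover have "fps_X dvd g y" if y: "y \<in> set xs" for y
  proof -
   obtain i where i: "i < length xs" "xs ! i = y" using y by (metis in_set_conv_nth)
   have yc: "y \<in> carrier V" using y xs by auto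
   have "y \<in> ?Z"
    using V.lcomb_nth[OF i(1) xs] i yc
    by (intro CollectI exI[of _ "(replicate (length xs) 0)[i := 1]"] exI[of _ "\<zero>\<^bsub>V\<^esub>"]) auto
   then have "f y $ 0 = 0" using f0[OF yc] mZ by simp
   then have "fps_X ^ 1 dvd f y" unfolding fps_X_power_dvd_iff by simp
   then show ?thesis by (simp add: g_def)
  qed
  ultimately show ?thesis by blast
  qed
 qed
qed

section \<open>Multilinear forms and tensor powers\<close>

text \<open>Finite sums of tensors are kept as lists and evaluated on forms by \<open>val\<close>.
  Tensors are compared only through forms, so no quotient has to be formed.\<close>

definition wf_comb :: "(complex fps, 'v, 'm) module_scheme => nat => (complex fps \<times> 'v list) list => bool" where
 "wf_comb V n L \<longleftrightarrow> (ALL (c, xs):set L. length xs = n & set xs \<subseteq> carrier V)"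

definition val :: "(complex fps \<times> 'v list) list => ('v list => complex fps) => complex fps" where
 "val L B = (\<Sum>(c, xs)\<leftarrow>L. c * B xs)"

lemma val_simps [simp]: "val [] B = 0" "val ((c, xs) # L) B = c * B xs + val L B" "val (L @ L') B = val L B + val L' B"
 by (simp_all add: val_def)

lemma wf_comb_simps [simp]: "wf_comb V n []" "wf_comb V n ((c, xs) # L) \<longleftrightarrow> length xs = n & set xs \<subseteq> carrier V & wf_comb V n L"
 "wf_comb V n (L @ L') \<longleftrightarrow> wf_comb V n L & wf_comb V n L'"
 unfolding wf_comb_def set_append ball_Un by auto

definition scale_comb :: "complex fps => (complex fps \<times> 'v list) list => (complex fps \<times> 'v list) list" where
 "scale_comb d = map (%(c, xs). (d * c, xs))"

lemma val_scale [simp]: "val (scale_comb d L) B = d * val L B"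
 by (induction L) (auto simp: scale_comb_def algebra_simps)

lemma wf_scale [simp]: "wf_comb V n (scale_comb d L) \<longleftrightarrow> wf_comb V n L"
 by (induction L) (auto simp: scale_comb_def)

definition cons_comb :: "'v => (complex fps \<times> 'v list) list => (complex fps \<times> 'v list) list" where
 "cons_comb x = map (%(c, xs). (c, x # xs))"

lemma val_cons [simp]: "val (cons_comb x L) B = val L (%ys. B (x # ys))"
 by (induction L) (auto simp: cons_comb_def)

lemma wf_cons [simp]: "x \<in> carrier V ==> wf_comb V (Suc n) (cons_comb x L) \<longleftrightarrow> wf_comb V n L"
 by (induction L) (auto simp: cons_comb_def)

lemma val_cong: "wf_comb V n L ==> (!!xs. length xs = n ==> set xs \<subseteq> carrier V ==> B xs = B' xs) ==> val L B = val L B'"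
 by (induction L) auto

lemma val_add: "val L (%xs. B xs + B' xs) = val L B + val L B'"
 by (induction L) (auto simp: algebra_simps)

lemma val_mult: "val L (%xs. d * B xs) = d * val L B"
 by (induction L) (auto simp: algebra_simps)

lemma mlinD:
 assumes "mlin V n B" "length xs = n" "set xs \<subseteq> carrier V" "i < n"
 shows "u \<in> carrier V ==> v \<in> carrier V ==> B (xs[i := u \<oplus>\<^bsub>V\<^esub> v]) = B (xs[i := u]) + B (xs[i := v])"
  "u \<in> carrier V ==> B (xs[i := c \<odot>\<^bsub>V\<^esub> u]) = c * B (xs[i := u])"
 using assms by (auto simp: mlin_def)

lemma mlinI:
 assumes "!!xs i u v. length xs = n ==> set xs \<subseteq> carrier V ==> i < n ==> u \<in> carrier V ==> v \<in> carrier V ==>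
   B (xs[i := u \<oplus>\<^bsub>V\<^esub> v]) = B (xs[i := u]) + B (xs[i := v])"
  and "!!xs i u c. length xs = n ==> set xs \<subseteq> carrier V ==> i < n ==> u \<in> carrier V ==>
   B (xs[i := c \<odot>\<^bsub>V\<^esub> u]) = c * B (xs[i := u])"
 shows "mlin V n B"
 using assms by (auto simp: mlin_def)

lemma mlin_Cons: "mlin V (Suc n) B ==> x \<in> carrier V ==> mlin V n (%ys. B (x # ys))"
 by (rule mlinI) (use mlinD[of V "Suc n" B "x # _" "Suc _"] in auto)

lemma mlin_head:
 assumes "mlin V (Suc n) B" "length ys = n" "set ys \<subseteq> carrier V" "u \<in> carrier V" "v \<in> carrier V"
 shows "B ((u \<oplus>\<^bsub>V\<^esub> v) # ys) = B (u # ys) + B (v # ys)" "B ((c \<odot>\<^bsub>V\<^esub> u) # ys) = c * B (u # ys)"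
 using mlinD[OF assms(1), of "u # ys" 0] assms by auto

lemma mlin_flin:
 assumes "flin V f" "mlin V n B"
 shows "mlin V (Suc n) (%ys. f (hd ys) * B (tl ys))"
proof (rule mlinI)
 fix xs i u v assume xs: "length xs = Suc n" "set xs \<subseteq> carrier V" and i: "i < Suc n" and u: "u \<in> carrier V" and v: "v \<in> carrier V"
 obtain x ys where xs': "xs = x # ys" using xs by (cases xs) auto
 show "f (hd (xs[i := u \<oplus>\<^bsub>V\<^esub> v])) * B (tl (xs[i := u \<oplus>\<^bsub>V\<^esub> v])) =
  f (hd (xs[i := u])) * B (tl (xs[i := u])) + f (hd (xs[i := v])) * B (tl (xs[i := v]))"
  using assms(1) mlinD[OF assms(2), of ys] xs xs' i u v by (cases i) (auto simp: flin_def algebra_simps)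
next
 fix xs i u c assume xs: "length xs = Suc n" "set xs \<subseteq> carrier V" and i: "i < Suc n" and u: "u \<in> carrier V"
 obtain x ys where xs': "xs = x # ys" using xs by (cases xs) auto
 show "f (hd (xs[i := c \<odot>\<^bsub>V\<^esub> u])) * B (tl (xs[i := c \<odot>\<^bsub>V\<^esub> u])) = c * (f (hd (xs[i := u])) * B (tl (xs[i := u])))"
  using assms(1) mlinD[OF assms(2), of ys] xs xs' i u by (cases i) (auto simp: flin_def algebra_simps)
qed

lemma mlin_add: "mlin V n B ==> mlin V n B' ==> mlin V n (%xs. B xs + B' xs)"
 by (auto simp: mlin_def algebra_simps)

lemma mlin_mult: "mlin V n B ==> mlin V n (%xs. d * B xs)"
 by (auto simp: mlin_def algebra_simps)

text \<open>A sum of tensors grouped by first factors, the shape in which one first factor at a time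
  can be eliminated.\<close>

definition valp :: "('v \<times> (complex fps \<times> 'v list) list) list => ('v list => complex fps) => complex fps" where
 "valp Ls B = (\<Sum>(x, M)\<leftarrow>Ls. val M (%ys. B (x # ys)))"

lemma valp_simps [simp]: "valp [] B = 0" "valp ((x, M) # Ls) B = val M (%ys. B (x # ys)) + valp Ls B"
 by (simp_all add: valp_def)

text \<open>A tensor is divisible by \<open>h\<close> if all multilinear forms take values divisible by \<open>h\<close> on it. Induction over the
 number of terms: the first factor of a term is either separated from the others by a functional, or
 a combination of them modulo \<open>h\<close>.\<close>

lemma comb_divisible:
 assumes tf: "topologically_free V" and "wf_comb V n L" and "!!B. mlin V n B ==> fps_X dvd val L B"
 shows "EX L'. wf_comb V n L' & (ALL B. mlin V n B --> val L B = fps_X * val L' B)"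
 using assms(2,3)
proof (induction n arbitrary: L)
 case 0
 have v: "val L B = val L (%_. 1) * B []" for B using 0(1) by (induction L) (auto simp: algebra_simps)
 have "mlin V 0 (%_. 1)" by (auto simp: mlin_def)
 then obtain d where d: "val L (%_. 1) = fps_X * d" using 0(2) by (meson dvdE)
 have "val L B = fps_X * val [(d, [])] B" for B by (subst v, subst d) simp
 then show ?case by (intro exI[of _ "[(d, [])]"]) simp
next
 case (Suc n)
 note IHn = Suc.IH
 interpret V: hfree V by (rule topologically_free_hfree[OF tf])
 have key: "EX L'. wf_comb V (Suc n) L' & (ALL B. mlin V (Suc n) B --> valp Ls B = fps_X * val L' B)"
  if "ALL (x, M):set Ls. x \<in> carrier V & wf_comb V n M" "!!B. mlin V (Suc n) B ==> fps_X dvd valp Ls B" for Ls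
  using that
 proof (induction "length Ls" arbitrary: Ls)
  case 0
  then show ?case by (intro exI[of _ "[]"]) simp
 next
  case (Suc m)
  obtain x M R where Ls: "Ls = (x, M) # R" and m: "length R = m" using Suc(2) by (cases Ls) auto
  have x: "x \<in> carrier V" and M: "wf_comb V n M" and R: "ALL (x, M):set R. x \<in> carrier V & wf_comb V n M"
   using Suc(3) Ls by auto
  have fR: "set (map fst R) \<subseteq> carrier V" using R by auto
  consider f where "flin V f" "f x = 1" "!!y. y \<in> fst ` set R ==> fps_X dvd f y" |
   cs v where "length cs = length R" "v \<in> carrier V" "x = V.lcomb cs (map fst R) \<oplus>\<^bsub>V\<^esub> fps_X \<odot>\<^bsub>V\<^esub> v"
   using functional_dichotomy[OF tf x fR] by auto
  then show ?case
  proof cases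
   case (1 f)
   have dM: "fps_X dvd val M B" if B: "mlin V n B" for B
   proof -
    \<comment> \<open>Tensoring with the separating functional isolates \<open>M\<close> modulo
      \<open>h\<close>: \<open>f\<close> is 1 at \<open>x\<close> and divisible by \<open>h\<close>
      at the other first factors.\<close>
    let ?B = "%ys. f (hd ys) * B (tl ys)"
    have "fps_X dvd valp Ls ?B" by (rule Suc(4)[OF mlin_flin[OF 1(1) B]])
    moreover have "valp Ls ?B = val M B + valp R ?B" by (simp add: Ls 1(2))
    moreover have "fps_X dvd valp R ?B"
     using 1(3) by (induction R) (auto simp: val_mult)
    ultimately show ?thesis by (simp add: dvd_add_left_iff)
   qed
   obtain M' where M': "wf_comb V n M'" "!!B. mlin V n B ==> val M B = fps_X * val M' B"
    using IHn[OF M dM] by blast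
   have "fps_X dvd valp R B" if B: "mlin V (Suc n) B" for B
   proof -
    have "fps_X dvd val M (%ys. B (x # ys))" using M'(2)[OF mlin_Cons[OF B x]] by simp
    then show ?thesis using Suc(4)[OF B] by (simp add: Ls dvd_add_right_iff)
   qed
   then obtain R' where R': "wf_comb V (Suc n) R'" "!!B. mlin V (Suc n) B ==> valp R B = fps_X * val R' B"
    using Suc(1)[OF m[symmetric] R] by blast
   show ?thesis
    by (intro exI[of _ "cons_comb x M' @ R'"])
     (use M'(1) R' x in \<open>auto simp: Ls M'(2)[OF mlin_Cons] algebra_simps\<close>)
  next
   case (2 cs v)
   \<comment> \<open>Replacing \<open>x\<close> by its combination distributes \<open>M\<close> over
     the remaining first factors. One group fewer is left, plus a term with an explicit factor
     \<open>h\<close>.\<close>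
   define R2 where "R2 = map2 (%(y, N) c. (y, N @ scale_comb (fps_const c) M)) R cs"
   have R2: "ALL (x, M):set R2. x \<in> carrier V & wf_comb V n M"
    using R M unfolding R2_def by (fastforce dest: set_zip_leftD)
   have e: "valp Ls B = valp R2 B + fps_X * val (cons_comb v M) B" if B: "mlin V (Suc n) B" for B
   proof -
    have lc: "val M (%ys. B (V.lcomb cs (map fst R) # ys)) + valp R B = valp R2 B"
     using 2(1) R unfolding R2_def
    proof (induction cs R rule: list_induct2)
     case Nil
     have "B (\<zero>\<^bsub>V\<^esub> # ys) = 0" if "length ys = n" "set ys \<subseteq> carrier V" for ys
      using mlin_head(2)[OF B that, of "\<zero>\<^bsub>V\<^esub>" "\<zero>\<^bsub>V\<^esub>" 0] by simp
     then have "val M (%ys. B (\<zero>\<^bsub>V\<^esub> # ys)) = val M (%ys. 0 * 0)" using M by (intro val_cong) auto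
     then show ?case using val_mult[of M 0 "%_. 0"] by simp
    next
     case (Cons c cs p R)
     obtain y N where p: "p = (y, N)" by fastforce
     have y: "y \<in> carrier V" and R': "ALL (x, M):set R. x \<in> carrier V & wf_comb V n M" using Cons(3) by (auto simp: p)
     have "set (map fst R) \<subseteq> carrier V" using R' by auto
     then have l: "V.lcomb cs (map fst R) \<in> carrier V" by (rule V.lcomb_closed)
     have "val M (%ys. B (V.lcomb (c # cs) (map fst (p # R)) # ys)) =
       val M (%ys. fps_const c * B (y # ys) + B (V.lcomb cs (map fst R) # ys))"
      using y l by (intro val_cong[OF M]) (simp add: p mlin_head[OF B])
     also have "... = fps_const c * val M (%ys. B (y # ys)) + val M (%ys. B (V.lcomb cs (map fst R) # ys))"
      by (simp add: val_add val_mult)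
     finally show ?case using Cons(2,3) by (simp add: p)
    qed
    have l: "V.lcomb cs (map fst R) \<in> carrier V" using fR by (rule V.lcomb_closed)
    have "val M (%ys. B (x # ys)) = val M (%ys. B (V.lcomb cs (map fst R) # ys) + fps_X * B (v # ys))"
     unfolding 2(3) using l 2(2) by (intro val_cong[OF M]) (simp add: mlin_head[OF B])
    then show ?thesis using lc by (simp add: Ls val_add val_mult)
   qed
   have "fps_X dvd valp R2 B" if B: "mlin V (Suc n) B" for B
    using Suc(4)[OF B] unfolding e[OF B] by (simp add: dvd_add_left_iff)
   moreover have "length R2 = m" using m 2(1) by (simp add: R2_def)
   ultimately obtain L2 where L2: "wf_comb V (Suc n) L2" "!!B. mlin V (Suc n) B ==> valp R2 B = fps_X * val L2 B"
    using Suc(1)[of R2] R2 by blast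
   show ?thesis
    by (intro exI[of _ "L2 @ cons_comb v M"]) (use L2 M 2(2) e in \<open>auto simp: algebra_simps\<close>)
  qed
 qed
 let ?Ls = "map (%(c, xs). (hd xs, [(c, tl xs)])) L"
 have "valp ?Ls B = val L B" for B
  using Suc(2)
 proof (induction L)
  case (Cons p L)
  obtain c xs where p: "p = (c, xs)" by fastforce
  then obtain y ys where "xs = y # ys" using Cons(2) by (cases xs) auto
  then show ?case using Cons p by simp
 qed simp
 moreover have "ALL (x, M):set ?Ls. x \<in> carrier V & wf_comb V n M"
 proof
  fix p assume "p \<in> set ?Ls"
  then obtain c xs where cx: "(c, xs) \<in> set L" "p = (hd xs, [(c, tl xs)])" by auto
  then have "length xs = Suc n" "set xs \<subseteq> carrier V" using Suc(2) by (auto simp: wf_comb_def)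
  then show "case p of (x, M) => x \<in> carrier V & wf_comb V n M" using cx(2) by (cases xs) auto
 qed
 ultimately show ?case using key[of ?Ls] Suc(3) by simp
qed

lemma comb_divisible_power:
 assumes tf: "topologically_free V" and "wf_comb V n L" and "!!B. mlin V n B ==> fps_X ^ N dvd val L B"
 shows "EX L'. wf_comb V n L' & (ALL B. mlin V n B --> val L B = fps_X ^ N * val L' B)"
 using assms(2,3)
proof (induction N arbitrary: L)
 case 0
 then show ?case by (intro exI[of _ L]) simp
next
 case (Suc N)
 have "fps_X dvd val L B" if "mlin V n B" for B using Suc(3)[OF that] by (simp add: dvd_mult_left)
 then obtain L1 where L1: "wf_comb V n L1" "!!B. mlin V n B ==> val L B = fps_X * val L1 B"
  using comb_divisible[OF tf Suc(2)] by blast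
 have "fps_X ^ N dvd val L1 B" if "mlin V n B" for B
  using Suc(3)[OF that] L1(2)[OF that] by simp
 then obtain L' where "wf_comb V n L'" "!!B. mlin V n B ==> val L1 B = fps_X ^ N * val L' B"
  using Suc(1)[OF L1(1)] by blast
 then show ?case using L1 by (intro exI[of _ L']) (simp add: mult.assoc)
qed

section \<open>Completed tensor powers\<close>

lemma fps_eq_dvdI: "(!!N. fps_X ^ N dvd a - b) ==> a = (b :: 'a::field fps)"
proof (rule fps_ext)
 fix n assume "!!N. fps_X ^ N dvd a - b"
 from this[of "Suc n"] show "a $ n = b $ n" unfolding fps_X_power_dvd_iff by simp
qed

lemma dvd_diff_trans: "(d :: 'a::comm_ring_1) dvd a - b ==> d dvd b - c ==> d dvd a - c"
 using dvd_add[of d "a - b" "b - c"] by simp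

lemma dvd_diff_sym: "(d :: 'a::comm_ring_1) dvd a - b ==> d dvd b - a"
 using dvd_minus_iff[of d "a - b"] by simp

lemma ctens_simps [simp]:
 "\<zero>\<^bsub>ctens V n\<^esub> = (%_. 0)" "s \<oplus>\<^bsub>ctens V n\<^esub> t = (%B. s B + t B)" "c \<odot>\<^bsub>ctens V n\<^esub> t = (%B. c * t B)"
 by (simp_all add: ctens_def)

definition wf_list :: "(complex fps, 'v, 'm) module_scheme => nat => 'v list => bool" where
 "wf_list V n xs \<longleftrightarrow> length xs = n & set xs \<subseteq> carrier V"

lemma mlin_cong: "(!!xs. wf_list V n xs ==> B xs = B' xs) ==> mlin V n B \<longleftrightarrow> mlin V n B'" if "hmod V"
proof -
 interpret hmod V by fact
 have *: "mlin V n B'" if eq: "!!xs. wf_list V n xs ==> B xs = B' xs" and B: "mlin V n B" for B B'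
 proof (rule mlinI)
  fix xs i u v assume h: "length xs = n" "set xs \<subseteq> carrier V" "i < n" "u \<in> carrier V" "v \<in> carrier V"
  then have "wf_list V n (xs[i := w])" if "w \<in> carrier V" for w
   using that set_update_subset_insert[of xs i w] by (auto simp: wf_list_def)
  then show "B' (xs[i := u \<oplus>\<^bsub>V\<^esub> v]) = B' (xs[i := u]) + B' (xs[i := v])"
   using mlinD(1)[OF B h] by (simp add: eq[symmetric] h)
 next
  fix xs i u c assume h: "length xs = n" "set xs \<subseteq> carrier V" "i < n" "u \<in> carrier V"
  then have "wf_list V n (xs[i := w])" if "w \<in> carrier V" for w
   using that set_update_subset_insert[of xs i w] by (auto simp: wf_list_def)
  then show "B' (xs[i := c \<odot>\<^bsub>V\<^esub> u]) = c * B' (xs[i := u])"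
   using mlinD(2)[OF B h] by (simp add: eq[symmetric] h)
 qed
 show "(!!xs. wf_list V n xs ==> B xs = B' xs) ==> mlin V n B \<longleftrightarrow> mlin V n B'"
  using *[of B B'] *[of B' B] by metis
qed

definition approx :: "(complex fps, 'v, 'm) module_scheme => nat => nat => 'v tens =>
  (complex fps \<times> 'v list) list => bool" where
 "approx V n N t L \<longleftrightarrow> wf_comb V n L & (ALL B. mlin V n B --> fps_X ^ N dvd t B - val L B)"

lemma approxD: "approx V n N t L ==> wf_comb V n L" "approx V n N t L ==> mlin V n B ==> fps_X ^ N dvd t B - val L B"
 by (auto simp: approx_def)

lemma pure_eq [simp]: "mlin V (length xs) B ==> pure V xs B = B xs"
 by (simp add: pure_def)

text \<open>Scalar coefficients are harmless in the approximating sums because the first factor can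
  absorb them; it exists as \<open>n\<close> is positive.\<close>

lemma ctens_iff:
 assumes "hmod V" "0 < n"
 shows "t \<in> carrier (ctens V n) \<longleftrightarrow> (ALL B. ~  mlin V n B --> t B = 0) & (ALL N. EX L. approx V n N t L)"
proof -
 interpret hmod V by fact
 have "(EX xss. (ALL xs:set xss. length xs = n & set xs \<subseteq> carrier V) &
   (ALL B. mlin V n B --> fps_X ^ N dvd t B - (\<Sum>xs\<leftarrow>xss. pure V xs B))) \<longleftrightarrow> (EX L. approx V n N t L)" for N
 proof safe
  fix xss assume wf: "ALL xs:set xss. length xs = n & set xs \<subseteq> carrier V"
   and ap: "ALL B. mlin V n B --> fps_X ^ N dvd t B - (\<Sum>xs\<leftarrow>xss. pure V xs B)"
  have "val (map (%xs. (1, xs)) xss) B = (\<Sum>xs\<leftarrow>xss. pure V xs B)" if "mlin V n B" for B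
   using wf that by (induction xss) (auto simp: pure_def)
  then have "approx V n N t (map (%xs. (1, xs)) xss)" using wf ap by (auto simp: approx_def wf_comb_def)
  then show "EX L. approx V n N t L" by blast
 next
  fix L assume L: "approx V n N t L"
  let ?xss = "map (%(c, xs). c \<odot>\<^bsub>V\<^esub> hd xs # tl xs) L"
  have "(ALL xs:set ?xss. length xs = n & set xs \<subseteq> carrier V) &
   (ALL B. mlin V n B --> (\<Sum>xs\<leftarrow>?xss. pure V xs B) = val L B)"
   using approxD(1)[OF L]
  proof (induction L)
   case (Cons p L)
   obtain c xs where p: "p = (c, xs)" by fastforce
   then obtain y ys where xs: "xs = y # ys" using Cons(2) assms(2) by (cases xs) auto
   obtain m where m: "n = Suc m" using assms(2) by (cases n) auto
   show ?case using Cons by (auto simp: p xs m pure_def mlin_head(2))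
  qed simp
  then show "EX xss. (ALL xs:set xss. length xs = n & set xs \<subseteq> carrier V) &
   (ALL B. mlin V n B --> fps_X ^ N dvd t B - (\<Sum>xs\<leftarrow>xss. pure V xs B))"
   using approxD(2)[OF L] by (intro exI[of _ ?xss]) auto
 qed
 then show ?thesis by (simp add: ctens_def)
qed

locale tfree = hfree V for V :: "(complex fps, 'v, 'm) module_scheme" (structure) +
 assumes tf: "topologically_free V"
begin

lemma wf_pure: "wf_list V n xs ==> wf_comb V n [(1, xs)]"
 by (simp add: wf_list_def)

lemmas ctens_iff' = ctens_iff[OF hmod_axioms]

lemma ctens_add_closed: "0 < n ==> s \<in> carrier (ctens V n) ==> t \<in> carrier (ctens V n) ==>
 (%B. s B + t B) \<in> carrier (ctens V n)"
 unfolding ctens_iff'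
proof (intro conjI allI impI)
 fix N assume "(ALL B. ~  mlin V n B --> s B = 0) & (ALL N. EX L. approx V n N s L)"
  "(ALL B. ~  mlin V n B --> t B = 0) & (ALL N. EX L. approx V n N t L)"
 then obtain L L' where L: "approx V n N s L" "approx V n N t L'" by blast
 have "approx V n N (%B. s B + t B) (L @ L')"
  using approxD(1)[OF L(1)] approxD(1)[OF L(2)] dvd_add[OF approxD(2)[OF L(1)] approxD(2)[OF L(2)]]
  by (auto simp: approx_def algebra_simps)
 then show "EX L. approx V n N (%B. s B + t B) L" by blast
qed auto

lemma ctens_smult_closed: "0 < n ==> t \<in> carrier (ctens V n) ==> (%B. c * t B) \<in> carrier (ctens V n)"
 unfolding ctens_iff'
proof (intro conjI allI impI)
 fix N assume "(ALL B. ~  mlin V n B --> t B = 0) & (ALL N. EX L. approx V n N t L)"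
 then obtain L where L: "approx V n N t L" by blast
 have "approx V n N (%B. c * t B) (scale_comb c L)"
  using approxD(1)[OF L] dvd_mult[OF approxD(2)[OF L], of _ c]
  by (auto simp: approx_def algebra_simps)
 then show "EX L. approx V n N (%B. c * t B) L" by blast
qed auto

lemma ctens_zero_closed: "0 < n ==> (%_. 0) \<in> carrier (ctens V n)"
 unfolding ctens_iff' by (auto simp: approx_def intro!: exI[of _ "[]"])

lemma hmod_ctens:
 assumes n: "0 < n"
 shows "hmod (ctens V n)"
 unfolding hmod_def tmod_def
proof (rule moduleI)
 show "cring (ring_of_type_algebra :: complex fps ring)" by (rule cring_from_type_algebra)
 have "EX s:carrier (ctens V n). (%B. s B + t B) = (%_. 0)" if "t \<in> carrier (ctens V n)" for t
  by (rule bexI[OF _ ctens_smult_closed[OF n that, of "- 1"]]) simp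
 then show "abelian_group (ctens V n)"
  by (intro abelian_groupI) (auto simp: ac_simps ctens_add_closed ctens_zero_closed n)
qed (auto simp: algebra_simps ctens_smult_closed n)

lemma ctens_minus [simp]:
 assumes n: "0 < n" and t: "t \<in> carrier (ctens V n)"
 shows "s \<ominus>\<^bsub>ctens V n\<^esub> t = (%B. s B - t B)"
proof -
 interpret T: hmod "ctens V n" by (rule hmod_ctens[OF n])
 show ?thesis using T.neg_as_smult[OF t] by (simp add: T.minus_eq)
qed

lemma ctens_minus_closed: "0 < n ==> s \<in> carrier (ctens V n) ==> t \<in> carrier (ctens V n) ==>
 (%B. s B - t B) \<in> carrier (ctens V n)"
 using ctens_add_closed[of n s "%B. (- 1) * t B"] ctens_smult_closed[of n t "- 1"] by simp

text \<open>After division by \<open>h ^ N\<close> the functional must again be approximable by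
  finite sums. An approximation of \<open>t\<close> to order \<open>N + M\<close> is itself
  divisible by \<open>h ^ N\<close> on forms, and \<open>comb_divisible_power\<close> carries out
  the division on the level of sums.\<close>

lemma ctens_hpow:
 assumes n: "0 < n"
 shows "t \<in> hpow (ctens V n) N \<longleftrightarrow> t \<in> carrier (ctens V n) & (ALL B. mlin V n B --> fps_X ^ N dvd t B)"
proof safe
 assume t: "t \<in> hpow (ctens V n) N"
 show "t \<in> carrier (ctens V n)" by (rule hmod.hpow_closed[OF hmod_ctens[OF n] t])
 show "fps_X ^ N dvd t B" for B using t by (auto simp: hpow_def)
next
 assume t: "t \<in> carrier (ctens V n)" and d: "ALL B. mlin V n B --> fps_X ^ N dvd t B"
 define t' where "t' B = fps_shift N (t B)" for B
 have "fps_X ^ N dvd t B" for B using d t n by (cases "mlin V n B") (auto simp: ctens_iff')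
 then have e: "t B = fps_X ^ N * t' B" for B
  unfolding t'_def fps_X_power_dvd_iff by (intro fps_ext) (auto simp: fps_X_power_mult_nth)
 have "t' \<in> carrier (ctens V n)"
  unfolding ctens_iff'[OF n]
 proof (intro conjI allI impI)
  show "t' B = 0" if "~  mlin V n B" for B using e[of B] t n that by (auto simp: ctens_iff')
  fix M
  obtain L where L: "approx V n (N + M) t L" using t n by (auto simp: ctens_iff')
  have "fps_X ^ N dvd val L B" if B: "mlin V n B" for B
  proof -
   have "fps_X ^ N dvd t B - val L B"
    by (rule dvd_trans[OF _ approxD(2)[OF L B]]) (simp add: le_imp_power_dvd)
   moreover have "fps_X ^ N dvd t B" by (simp add: e)
   ultimately show ?thesis using dvd_diff[of "fps_X ^ N" "t B" "t B - val L B"] by simp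
  qed
  then obtain L' where L': "wf_comb V n L'" "!!B. mlin V n B ==> val L B = fps_X ^ N * val L' B"
   using comb_divisible_power[OF tf approxD(1)[OF L]] by blast
  have "fps_X ^ M dvd t' B - val L' B" if B: "mlin V n B" for B
   using approxD(2)[OF L B] by (simp add: e L'(2)[OF B] power_add flip: right_diff_distrib)
  then show "EX L. approx V n M t' L" using L' by (auto simp: approx_def)
 qed
 moreover have "t = fps_X ^ N \<odot>\<^bsub>ctens V n\<^esub> t'" by (rule ext) (simp add: e)
 ultimately show "t \<in> hpow (ctens V n) N" unfolding hpow_def by blast
qed

text \<open>The products of operator series in the axioms of a quantum vertex algebra are values of
  \<open>hsum\<close> in these modules; completeness and separatedness are what make them
  computable.\<close>

lemma hfree_ctens:
 assumes n: "0 < n"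
 shows "hfree (ctens V n)"
proof -
 interpret T: hmod "ctens V n" by (rule hmod_ctens[OF n])
 show ?thesis
 proof
  fix t assume t: "t \<in> carrier (ctens V n)"
  show "t = \<zero>\<^bsub>ctens V n\<^esub>" if "!!N. t \<in> hpow (ctens V n) N"
  proof
   have "fps_X ^ N dvd t B - 0" for N B
    using that[of N] t n by (cases "mlin V n B") (auto simp: ctens_hpow ctens_iff')
   then show "t B = \<zero>\<^bsub>ctens V n\<^esub> B" for B by (simp add: fps_eq_dvdI)
  qed
  show "t = \<zero>\<^bsub>ctens V n\<^esub>" if "fps_X \<odot>\<^bsub>ctens V n\<^esub> t = \<zero>\<^bsub>ctens V n\<^esub>"
   using that by (auto simp: fun_eq_iff)
 next
  fix s assume s: "!!N. s N \<in> carrier (ctens V n)"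
   and d: "!!N. s (Suc N) \<ominus>\<^bsub>ctens V n\<^esub> s N \<in> hpow (ctens V n) N"
  have step: "s (Suc N) B $ m = s N B $ m" if "m < N" for N m B
  proof (cases "mlin V n B")
   case True
   then have "fps_X ^ N dvd s (Suc N) B - s N B" using d[of N] s n by (simp add: ctens_hpow)
   then show ?thesis using that by (simp add: fps_X_power_dvd_iff)
  next
   case False
   then show ?thesis using s n by (simp add: ctens_iff')
  qed
  have st: "s N B $ m = s (Suc m) B $ m" if "Suc m <= N" for N m B
   using that by (induction N rule: dec_induct) (auto simp: step)
  define t where "t B = Abs_fps (%m. s (Suc m) B $ m)" for B
  have td: "fps_X ^ N dvd t B - s N B" for N B
   unfolding fps_X_power_dvd_iff using st[of _ N B] by (auto simp: t_def)
  have t: "t \<in> carrier (ctens V n)"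
   unfolding ctens_iff'[OF n]
  proof (intro conjI allI impI)
   show "t B = 0" if "~  mlin V n B" for B
    using s n that by (intro fps_ext) (auto simp: t_def ctens_iff')
   fix N
   obtain L where L: "approx V n N (s N) L" using s n by (meson ctens_iff')
   have "approx V n N t L"
    using L dvd_diff_trans[OF td] by (auto simp: approx_def)
   then show "EX L. approx V n N t L" by blast
  qed
  show "EX v:carrier (ctens V n). ALL N. v \<ominus>\<^bsub>ctens V n\<^esub> s N \<in> hpow (ctens V n) N"
   by (intro bexI[OF _ t] allI) (simp add: n s ctens_hpow td ctens_minus_closed t)
 qed
qed

lemma ctens_eval: "(%t. t B) \<in> linear_maps (ctens V n) HM"
 by (rule linear_mapsI) auto

lemma ctens_finsum:
 assumes "0 < n" "!!j. g j \<in> carrier (ctens V n)"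
 shows "finsum (ctens V n) g F B = (\<Sum>j\<in>F. g j B)"
proof -
 interpret tlin "ctens V n" HM "%t. t B"
  by (rule tlinI[OF _ _ ctens_eval]) (use hmod_ctens[OF assms(1)] hmod_HM in \<open>auto simp: hmod_def\<close>)
 show ?thesis using finsum[of g F] assms by simp
qed

lemma ctens_hnullI:
 assumes "0 < n" "!!j. g j \<in> carrier (ctens V n)"
  and "!!N. EX F. finite F & (ALL j B. j \<notin> F --> mlin V n B --> fps_X ^ N dvd g j B)"
 shows "hnull (ctens V n) g"
 unfolding hnull_def
proof (intro conjI allI)
 fix N
 obtain F where F: "finite F" "!!j B. j \<notin> F ==> mlin V n B ==> fps_X ^ N dvd g j B" using assms(3) by blast
 have "{j. g j \<notin> hpow (ctens V n) N} \<subseteq> F" using F(2) assms by (auto simp: ctens_hpow)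
 then show "finite {j. g j \<notin> hpow (ctens V n) N}" using F(1) by (rule finite_subset)
qed (use assms in auto)

text \<open>The way infinite sums of tensors are used: at a given form and modulo
  \<open>h ^ N\<close> they are finite sums, provided the discarded terms are small at every
  form.\<close>

lemma ctens_hsum_dvd:
 assumes n: "0 < n" and g: "hnull (ctens V n) g" and F: "finite F"
  and d: "!!j B. j \<notin> F ==> mlin V n B ==> fps_X ^ N dvd g j B" and B: "mlin V n B"
 shows "fps_X ^ N dvd hsum (ctens V n) g B - (\<Sum>j\<in>F. g j B)"
proof -
 interpret T: hfree "ctens V n" by (rule hfree_ctens[OF n])
 have gc: "g j \<in> carrier (ctens V n)" for j using g by (auto simp: hnull_def)
 have fc: "finsum (ctens V n) g F \<in> carrier (ctens V n)" using gc by (intro T.finsum_closed) auto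
 have "hcong (ctens V n) N (finsum (ctens V n) g F) (hsum (ctens V n) g)"
  by (rule T.hsum_hcong[OF g F]) (use d gc n in \<open>auto simp: ctens_hpow\<close>)
 then have "fps_X ^ N dvd finsum (ctens V n) g F B - hsum (ctens V n) g B"
  using B n T.hsum_closed[OF g] by (simp add: hcong_def ctens_hpow)
 then show ?thesis using gc n by (simp add: ctens_finsum dvd_diff_sym)
qed

text \<open>An element of the tensor power is a mere function on forms; linearity in the form is
  inherited from the approximating sums of evaluations.\<close>

lemma ctens_add:
 assumes n: "0 < n" and t: "t \<in> carrier (ctens V n)" and B: "mlin V n B" "mlin V n B'"
 shows "t (%xs. B xs + B' xs) = t B + t B'"
proof (rule fps_eq_dvdI)
 fix N
 obtain L where L: "approx V n N t L" using t n by (meson ctens_iff')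
 have "fps_X ^ N dvd (t (%xs. B xs + B' xs) - val L (%xs. B xs + B' xs)) - ((t B - val L B) + (t B' - val L B'))"
  using B by (intro dvd_diff dvd_add approxD(2)[OF L] mlin_add)
 then show "fps_X ^ N dvd t (%xs. B xs + B' xs) - (t B + t B')" by (simp add: val_add algebra_simps)
qed

lemma ctens_mult:
 assumes n: "0 < n" and t: "t \<in> carrier (ctens V n)" and B: "mlin V n B"
 shows "t (%xs. d * B xs) = d * t B"
proof (rule fps_eq_dvdI)
 fix N
 obtain L where L: "approx V n N t L" using t n by (meson ctens_iff')
 have "fps_X ^ N dvd (t (%xs. d * B xs) - val L (%xs. d * B xs)) - d * (t B - val L B)"
  using B by (intro dvd_diff dvd_mult approxD(2)[OF L] mlin_mult)
 then show "fps_X ^ N dvd t (%xs. d * B xs) - d * t B" by (simp add: val_mult algebra_simps)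
qed

lemma ctens_cong:
 assumes n: "0 < n" and t: "t \<in> carrier (ctens V n)" and eq: "!!xs. wf_list V n xs ==> B xs = B' xs"
 shows "t B = t B'"
proof -
 have mB: "mlin V n B \<longleftrightarrow> mlin V n B'" by (rule mlin_cong[OF hmod_axioms eq])
 show ?thesis
proof (cases "mlin V n B")
 case True
 then have B': "mlin V n B'" using mB by simp
 show ?thesis
 proof (rule fps_eq_dvdI)
  fix N
  obtain L where L: "approx V n N t L" using t n by (meson ctens_iff')
  have "val L B = val L B'" using approxD(1)[OF L] eq by (intro val_cong) (auto simp: wf_list_def)
  then show "fps_X ^ N dvd t B - t B'"
   using approxD(2)[OF L True] dvd_diff_sym[OF approxD(2)[OF L B']] by (metis dvd_diff_trans)
 qed
next
 case False
 then have "~  mlin V n B'" using mB by simp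
 then show ?thesis using t n False by (simp add: ctens_iff')
qed
qed

lemma pure_ctens:
 assumes "0 < n" "wf_list V n xs"
 shows "pure V xs \<in> carrier (ctens V n)"
 unfolding ctens_iff'[OF assms(1)] using assms wf_pure[OF assms(2)]
 by (auto simp: pure_def approx_def wf_list_def intro!: exI[of _ "[(1, xs)]"])

end

lemma lift_approx:
 assumes "wf_comb U n L" "!!xs. wf_list U n xs ==> EX L. approx V m N (T xs) L"
 shows "EX L'. approx V m N (%B. val L (%xs. T xs B)) L'"
 using assms(1)
proof (induction L)
 case Nil
 then show ?case by (intro exI[of _ "[]"]) (simp add: approx_def)
next
 case (Cons p L)
 obtain c xs where p: "p = (c, xs)" by fastforce
 obtain L' where L': "approx V m N (%B. val L (%xs. T xs B)) L'" using Cons p by auto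
 obtain M where M: "approx V m N (T xs) M" using assms(2)[of xs] Cons(2) p by (auto simp: wf_list_def)
 have "fps_X ^ N dvd c * (T xs B - val M B) + (val L (%xs. T xs B) - val L' B)" if "mlin V m B" for B
  using approxD(2)[OF M that] approxD(2)[OF L' that] by (intro dvd_add dvd_mult)
 then have "approx V m N (%B. val (p # L) (%xs. T xs B)) (scale_comb c M @ L')"
  using approxD(1)[OF M] approxD(1)[OF L'] by (simp add: approx_def p algebra_simps)
 then show ?case by blast
qed

text \<open>An approximation of \<open>t\<close> combined with approximations of the finitely many
  values of \<open>T\<close> that it involves approximates the image; multilinearity of
  \<open>T\<close> against each form lets \<open>t\<close> be evaluated there.\<close>

lemma lift_tens_linear:
 assumes U: "tfree U" and V: "tfree V" and n: "0 < n" "0 < m"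
  and T: "!!xs N. wf_list U n xs ==> EX L. approx V m N (T xs) L"
  and ml: "!!B. mlin V m B ==> mlin U n (%xs. T xs B)"
 shows "lift_tens V m T \<in> linear_maps (ctens U n) (ctens V m)"
proof -
 interpret U: tfree U by fact
 interpret V: tfree V by fact
 show ?thesis
 proof (rule linear_mapsI)
  fix t assume t: "t \<in> carrier (ctens U n)"
  show "lift_tens V m T t \<in> carrier (ctens V m)"
   unfolding V.ctens_iff'[OF n(2)]
  proof (intro conjI allI impI)
   fix N
   obtain L where L: "approx U n N t L" using t n by (meson U.ctens_iff')
   obtain L' where L': "approx V m N (%B. val L (%xs. T xs B)) L'"
    using lift_approx[OF approxD(1)[OF L]] T by metis
   have "fps_X ^ N dvd lift_tens V m T t B - val L' B" if B: "mlin V m B" for B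
    using dvd_diff_trans[OF approxD(2)[OF L ml[OF B]] approxD(2)[OF L' B]] B by (simp add: lift_tens_def)
   then show "EX L. approx V m N (lift_tens V m T t) L" using approxD(1)[OF L'] by (auto simp: approx_def)
  qed (simp add: lift_tens_def)
 qed (auto simp: lift_tens_def)
qed

section \<open>Laurent families of bilinear functionals\<close>

lemma zcoef_simps [simp]:
 "zcoef 0 c = 0" "zcoef (f + g) c = zcoef f c + zcoef g c" "zcoef (f - g) c = zcoef f c - zcoef g c"
 by (auto intro: fps_ext)

lemma zcoef_dvd_iff: "fps_X ^ N dvd f \<longleftrightarrow> (ALL c. fps_X ^ N dvd zcoef f c)"
 unfolding fps_X_power_dvd_iff by (auto simp: fls_eq_iff)

lemma zcoef_hemb_mult [simp]: "zcoef (hemb c * f) d = c * zcoef f d"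
 by (rule fps_ext) (simp add: fps_mult_nth hemb_def fls_nth_sum)

lemma zcoef_hemb [simp]: "zcoef (hemb c) d = (if d = 0 then c else 0)"
 by (rule fps_ext) (simp add: hemb_def)

text \<open>The symmetric ranges may grow at will, so that several such approximations can be
  compared over one common range.\<close>

lemma zcoef_const_mult:
 "EX P0. ALL P>=P0. fps_X ^ N dvd zcoef (fps_const f * F) a - (\<Sum>d = - P..P. fps_const (f $$ (a - d)) * zcoef F d)"
proof -
 obtain A where A: "!!m. m < A ==> f $$ m = 0" by (metis fls_eq0_below_subdegree)
 obtain B where B: "!!n m. n < N ==> m < B ==> F $ n $$ m = 0" using fls_fps_lower[of N F] by blast
 show ?thesis
 proof (intro exI[of _ "max \<bar>B\<bar> \<bar>a - A\<bar>"] allI impI)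
  fix P assume P: "max \<bar>B\<bar> \<bar>a - A\<bar> <= P"
  have "(f * F $ n) $$ a = (\<Sum>d = - P..P. f $$ (a - d) * F $ n $$ d)" if n: "n < N" for n
  proof -
   have "(f * F $ n) $$ a = (F $ n * f) $$ a" by (simp add: mult.commute)
   also have "... = (\<Sum>d = B..a - A. F $ n $$ d * f $$ (a - d))" using A B n by (intro fls_times_nth_range) auto
   also have "... = (\<Sum>d = - P..P. F $ n $$ d * f $$ (a - d))"
   proof (rule sum.mono_neutral_left)
    show "{B..a - A} \<subseteq> {- P..P}" using P by auto
    show "ALL d:{- P..P} - {B..a - A}. F $ n $$ d * f $$ (a - d) = 0"
     using A[of "a - _"] B[OF n] by force
   qed simp
   finally show ?thesis by (simp add: mult.commute)
  qed
  then show "fps_X ^ N dvd zcoef (fps_const f * F) a - (\<Sum>d = - P..P. fps_const (f $$ (a - d)) * zcoef F d)"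
   unfolding fps_X_power_dvd_iff by (simp add: fps_sum_nth)
 qed
qed

text \<open>The coefficient of \<open>w^k\<close> in \<open>f(z + e w)\<close>; \<open>e\<close>
  will be \<open>1\<close> or \<open>-1\<close>. In these terms \<open>S13(z1 + z2)\<close> is a
  Taylor series in \<open>z2\<close>.\<close>

definition hasse :: "complex => nat => complex fls => complex fls" where
 "hasse e k f = fls_const (e ^ k / fact k) * (fls_deriv ^^ k) f"

lemma hasse_nth: "hasse e k f $$ c = e ^ k * (of_int (c + int k) gchoose k) * f $$ (c + int k)"
proof -
 have "(fls_deriv ^^ k) f $$ c = fact k * (of_int (c + int k) gchoose k) * f $$ (c + int k)" for c
 proof (induction k arbitrary: c)
  case (Suc k)
  let ?a = "of_int (c + 1 + int k) :: complex"
  have eq: "c + int (Suc k) = c + 1 + int k" by simp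
  have "of_nat (Suc k) * (?a gchoose Suc k) = (?a - of_nat k) * (?a gchoose k)"
   using gbinomial_mult_1[of ?a k] by (simp add: algebra_simps)
  moreover have "?a - of_nat k = of_int (c + 1)" by simp
  ultimately have g: "of_nat (Suc k) * (?a gchoose Suc k) = of_int (c + 1) * (?a gchoose k)" by simp
  have "(fls_deriv ^^ Suc k) f $$ c = of_int (c + 1) * (fls_deriv ^^ k) f $$ (c + 1)" by simp
  also have "... = fact k * (of_int (c + 1) * (?a gchoose k)) * f $$ (c + 1 + int k)"
   by (simp only: Suc.IH mult_ac)
  also have "... = fact (Suc k) * (?a gchoose Suc k) * f $$ (c + 1 + int k)"
   unfolding g[symmetric] by (simp only: fact_Suc mult_ac)
  finally show ?case unfolding eq .
 qed simp
 then show ?thesis by (simp add: hasse_def)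
qed

lemma hasse_0 [simp]: "hasse e 0 f = f"
 by (simp add: hasse_def)

lemma hasse_Suc: "of_nat (Suc k) * hasse 1 (Suc k) f = fls_deriv (hasse 1 k f)"
proof (rule fls_eqI)
 fix c
 have "of_nat (Suc k) = fls_const (of_nat (Suc k) :: complex)" by (simp only: fls_of_nat)
 then have "(of_nat (Suc k) * hasse 1 (Suc k) f) $$ c = of_nat (Suc k) * hasse 1 (Suc k) f $$ c" by (simp only: fls_mult_const_nth)
 moreover have "(1 + of_nat k :: complex) ~= 0" by (metis of_nat_Suc of_nat_neq_0)
 ultimately show "(of_nat (Suc k) * hasse 1 (Suc k) f) $$ c = fls_deriv (hasse 1 k f) $$ c"
  by (simp add: hasse_def)
qed

lemma hasse_sign: "hasse e k f = fls_const (e ^ k) * hasse 1 k f"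
 by (rule fls_eqI) (simp add: hasse_nth)

text \<open>Taylor expansion is multiplicative. The case \<open>e = 1\<close> follows from the
  Leibniz rule by induction; a general \<open>e\<close> only contributes
  \<open>e ^ n\<close>.\<close>

lemma hasse_mult: "hasse e n (f * g) = (\<Sum>j\<le>n. hasse e j f * hasse e (n - j) g)"
proof -
 have 1: "hasse 1 n (f * g) = (\<Sum>j\<le>n. hasse 1 j f * hasse 1 (n - j) g)" for n
 proof (induction n)
  case (Suc n)
  let ?h = "hasse 1" and ?T = "\<Sum>j\<le>Suc n. hasse 1 j f * hasse 1 (Suc n - j) g"
  have s1: "(\<Sum>j\<le>Suc n. of_nat j * ?h j f * ?h (Suc n - j) g) = (\<Sum>j\<le>n. fls_deriv (?h j f) * ?h (n - j) g)"
   by (subst sum.atMost_Suc_shift) (simp add: hasse_Suc[symmetric])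
  have s2: "(\<Sum>j\<le>Suc n. of_nat (Suc n - j) * ?h (Suc n - j) g * ?h j f) = (\<Sum>j\<le>n. fls_deriv (?h (n - j) g) * ?h j f)"
   by (subst sum.atMost_Suc) (auto intro!: sum.cong simp: hasse_Suc[symmetric] Suc_diff_le)
  have "of_nat (Suc n) * ?T = (\<Sum>j\<le>Suc n. of_nat j * ?h j f * ?h (Suc n - j) g) +
    (\<Sum>j\<le>Suc n. of_nat (Suc n - j) * ?h (Suc n - j) g * ?h j f)"
   unfolding sum_distrib_left sum.distrib[symmetric]
  proof (rule sum.cong[OF refl])
   fix j assume "j \<in> {..Suc n}"
   then have e: "(of_nat (Suc n) :: complex fls) = of_nat j + of_nat (Suc n - j)"
    by (simp only: of_nat_add[symmetric] atMost_iff le_add_diff_inverse)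
   show "of_nat (Suc n) * (?h j f * ?h (Suc n - j) g) =
     of_nat j * ?h j f * ?h (Suc n - j) g + of_nat (Suc n - j) * ?h (Suc n - j) g * ?h j f"
    unfolding e by (simp only: algebra_simps)
  qed
  also have "... = fls_deriv (\<Sum>j\<le>n. ?h j f * ?h (n - j) g)"
   unfolding s1 s2 by (simp add: fls_deriv_sum sum.distrib algebra_simps)
  also have "... = of_nat (Suc n) * ?h (Suc n) (f * g)"
   by (simp only: Suc.IH[symmetric] hasse_Suc)
  finally have "of_nat (Suc n) * ?T = of_nat (Suc n) * ?h (Suc n) (f * g)" .
  then show ?case by (metis mult_cancel_left of_nat_neq_0)
 qed simp
 have "hasse e j f * hasse e (n - j) g = fls_const (e ^ n) * (hasse 1 j f * hasse 1 (n - j) g)" if "j <= n" for j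
 proof -
  have "fls_const (e ^ n) = fls_const (e ^ j) * fls_const (e ^ (n - j))"
   using that by (simp flip: power_add)
  then show ?thesis by (simp add: hasse_sign[of e] ac_simps)
 qed
 then show ?thesis unfolding hasse_sign[of e n] 1 sum_distrib_left by (intro sum.cong) auto
qed

lemma hasse_flneg: "flneg (hasse 1 k f) = hasse (- 1) k (flneg f)"
proof (rule fls_eqI)
 fix c
 have "(- 1 :: complex) powi c = (- 1) ^ k * (- 1) powi (c + int k)"
  by (simp add: power_int_add)
 then show "flneg (hasse 1 k f) $$ c = hasse (- 1) k (flneg f) $$ c" by (simp add: hasse_nth)
qed

text \<open>The coefficients in \<open>z\<close> of an element of the completed
  \<open>V \<otimes> V \<otimes> C((z))[[h]]\<close>, tested on bilinear forms; \<open>'v lc\<close>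
  holds finite representatives modulo a power of \<open>h\<close>.\<close>

type_synonym 'v fam = "int => ('v => 'v => complex fps) => complex fps"
type_synonym 'v lc = "(complex fls \<times> 'v \<times> 'v) list"

definition bil :: "(complex fps, 'v, 'm) module_scheme => ('v => 'v => complex fps) => bool" where
 "bil V B \<longleftrightarrow> (ALL w:carrier V. flin V (%u. B u w) & flin V (B w))"

text \<open>Values in Laurent series are needed because the value of one operator on a form serves
  as the form for the next.\<close>

definition rbil :: "(complex fps, 'v, 'm) module_scheme => ('v => 'v => complex fls fps) => bool" where
 "rbil V C \<longleftrightarrow> (ALL d. bil V (%x y. zcoef (C x y) d))"

definition wf2 :: "(complex fps, 'v, 'm) module_scheme => 'v lc => bool" where
 "wf2 V L \<longleftrightarrow> (ALL (f, x, y):set L. x \<in> carrier V & y \<in> carrier V)"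

definition lval :: "'v lc => 'v fam" where
 "lval L c B = (\<Sum>(f, x, y)\<leftarrow>L. fps_const (f $$ c) * B x y)"

definition rval :: "'v lc => ('v => 'v => complex fls fps) => complex fls fps" where
 "rval L C = (\<Sum>(f, x, y)\<leftarrow>L. fps_const f * C x y)"

lemma lc_simps [simp]:
 "wf2 V []" "wf2 V ((f, x, y) # L) \<longleftrightarrow> x \<in> carrier V & y \<in> carrier V & wf2 V L" "wf2 V (L @ L') \<longleftrightarrow> wf2 V L & wf2 V L'"
 "lval [] c B = 0" "lval ((f, x, y) # L) c B = fps_const (f $$ c) * B x y + lval L c B"
 "lval (L @ L') c B = lval L c B + lval L' c B"
 "rval [] C = 0" "rval ((f, x, y) # L) C = fps_const f * C x y + rval L C" "rval (L @ L') C = rval L C + rval L' C"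
 unfolding wf2_def set_append ball_Un by (auto simp: lval_def rval_def)

definition rep :: "(complex fps, 'v, 'm) module_scheme => nat => 'v fam => 'v lc => bool" where
 "rep V N s L \<longleftrightarrow> wf2 V L & (ALL c B. bil V B --> fps_X ^ N dvd s c B - lval L c B)"

definition laur :: "(complex fps, 'v, 'm) module_scheme => 'v fam => bool" where
 "laur V s \<longleftrightarrow> (ALL N. EX L. rep V N s L)"

lemma repD: "rep V N s L ==> wf2 V L" "rep V N s L ==> bil V B ==> fps_X ^ N dvd s c B - lval L c B"
 by (auto simp: rep_def)

lemma rep_mono: "rep V N s L ==> M <= N ==> rep V M s L"
 unfolding rep_def by (meson dvd_trans le_imp_power_dvd)

lemma laurE: "laur V s ==> (!!L. rep V N s L ==> P) ==> P"
 unfolding laur_def by blast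

lemma bilI:
 assumes "!!u v w. u \<in> carrier V ==> v \<in> carrier V ==> w \<in> carrier V ==> B (u \<oplus>\<^bsub>V\<^esub> v) w = B u w + B v w"
  "!!u v w. u \<in> carrier V ==> v \<in> carrier V ==> w \<in> carrier V ==> B w (u \<oplus>\<^bsub>V\<^esub> v) = B w u + B w v"
  "!!c u w. u \<in> carrier V ==> w \<in> carrier V ==> B (c \<odot>\<^bsub>V\<^esub> u) w = c * B u w"
  "!!c u w. u \<in> carrier V ==> w \<in> carrier V ==> B w (c \<odot>\<^bsub>V\<^esub> u) = c * B w u"
 shows "bil V B"
 using assms by (simp add: bil_def flin_def)

lemma bilD:
 assumes "bil V B" "w \<in> carrier V"
 shows "u \<in> carrier V ==> v \<in> carrier V ==> B (u \<oplus>\<^bsub>V\<^esub> v) w = B u w + B v w"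
  "u \<in> carrier V ==> v \<in> carrier V ==> B w (u \<oplus>\<^bsub>V\<^esub> v) = B w u + B w v"
  "u \<in> carrier V ==> B (c \<odot>\<^bsub>V\<^esub> u) w = c * B u w"
  "u \<in> carrier V ==> B w (c \<odot>\<^bsub>V\<^esub> u) = c * B w u"
 using assms by (auto simp: bil_def flin_def)

lemma rbilD: "rbil V C ==> bil V (%x y. zcoef (C x y) d)"
 by (simp add: rbil_def)

lemma bil_flip: "bil V B ==> bil V (%x y. B y x)"
 by (auto simp: bil_def)

lemma rbil_flip: "rbil V C ==> rbil V (%x y. C y x)"
 unfolding rbil_def by (auto intro: bil_flip)

lemma rbil_hemb: "bil V B ==> rbil V (%x y. hemb (B x y))"
 by (auto simp: rbil_def bil_def flin_def)

lemma lval_add: "lval L c (%x y. B x y + B' x y) = lval L c B + lval L c B'"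
 by (induction L) (auto simp: algebra_simps)

lemma lval_mult: "lval L c (%x y. d * B x y) = d * lval L c B"
 by (induction L) (auto simp: algebra_simps)

lemma lval_cong: "wf2 V L ==> (!!x y. x \<in> carrier V ==> y \<in> carrier V ==> B x y = B' x y) ==> lval L c B = lval L c B'"
 by (induction L) auto

lemma rval_dvd_cong: "wf2 V L ==> (!!x y. x \<in> carrier V ==> y \<in> carrier V ==> d dvd C x y - C' x y) ==>
 d dvd rval L C - rval L C'"
proof (induction L)
 case (Cons p L)
 obtain f x y where p: "p = (f, x, y)" by (cases p) auto
 have "d dvd fps_const f * (C x y - C' x y) + (rval L C - rval L C')"
  using Cons p by (intro dvd_add dvd_mult) auto
 then show ?case by (simp add: p algebra_simps)
qed simp

lemma zcoef_rval:
 "EX P0. ALL P>=P0. fps_X ^ N dvd zcoef (rval L C) a - (\<Sum>d = - P..P. lval L (a - d) (%x y. zcoef (C x y) d))"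
proof (induction L)
 case (Cons p L)
 obtain f x y where p: "p = (f, x, y)" by (cases p) auto
 obtain P0 where P0: "!!P. P0 <= P ==> fps_X ^ N dvd zcoef (rval L C) a - (\<Sum>d = - P..P. lval L (a - d) (%x y. zcoef (C x y) d))"
  using Cons by blast
 obtain P1 where P1: "!!P. P1 <= P ==> fps_X ^ N dvd zcoef (fps_const f * C x y) a -
   (\<Sum>d = - P..P. fps_const (f $$ (a - d)) * zcoef (C x y) d)"
  using zcoef_const_mult by blast
 have "fps_X ^ N dvd zcoef (rval (p # L) C) a - (\<Sum>d = - P..P. lval (p # L) (a - d) (%x y. zcoef (C x y) d))"
  if "max P0 P1 <= P" for P
  using dvd_add[OF P1 P0, of P P] that by (simp add: p sum.distrib algebra_simps)
 then show ?case by blast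
qed simp

lemma rval_lval_cong:
 assumes "!!a d. fps_X ^ N dvd lval L a (%x y. zcoef (C x y) d) - lval L' a (%x y. zcoef (C' x y) d)"
 shows "fps_X ^ N dvd rval L C - rval L' C'"
 unfolding zcoef_dvd_iff
proof
 fix a
 obtain P0 where P0: "!!P. P0 <= P ==> fps_X ^ N dvd zcoef (rval L C) a - (\<Sum>d = - P..P. lval L (a - d) (%x y. zcoef (C x y) d))"
  using zcoef_rval by blast
 obtain P1 where P1: "!!P. P1 <= P ==> fps_X ^ N dvd zcoef (rval L' C') a - (\<Sum>d = - P..P. lval L' (a - d) (%x y. zcoef (C' x y) d))"
  using zcoef_rval by blast
 let ?P = "max P0 P1"
 have "fps_X ^ N dvd (\<Sum>d = - ?P..?P. lval L (a - d) (%x y. zcoef (C x y) d)) - (\<Sum>d = - ?P..?P. lval L' (a - d) (%x y. zcoef (C' x y) d))"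
  unfolding sum_subtractf[symmetric] by (intro dvd_sum assms)
 from dvd_diff_trans[OF dvd_diff_trans[OF P0 this] dvd_diff_sym[OF P1]]
 show "fps_X ^ N dvd zcoef (rval L C - rval L' C') a" by simp
qed

text \<open>Evaluation of a family at a Laurent-valued form. The coefficient of \<open>h ^ n\<close>
  is read off from some representative modulo \<open>h ^ (n + 1)\<close>; \<open>rep_rval_eq\<close>
  shows that the choice does not matter.\<close>

definition ext :: "(complex fps, 'v, 'm) module_scheme => 'v fam => ('v => 'v => complex fls fps) => complex fls fps" where
 "ext V s C = Abs_fps (%n. rval (SOME L. rep V (Suc n) s L) C $ n)"

text \<open>Modulo \<open>h ^ N\<close> each coefficient in \<open>z\<close> of \<open>rval\<close>
  is a finite sum of values of the family at coefficient forms, so it depends on the family alone.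
  Two different modules are allowed, for comparison across an isomorphism.\<close>

lemma rep_rval_eq:
 assumes L: "rep V N s L" and L': "rep V' N s' L'" and C: "rbil V C" and C': "rbil V' C'"
  and eq: "!!a d. s a (%x y. zcoef (C x y) d) = s' a (%x y. zcoef (C' x y) d)"
 shows "fps_X ^ N dvd rval L C - rval L' C'"
proof (rule rval_lval_cong)
 fix a d
 note 1 = dvd_diff_sym[OF repD(2)[OF L rbilD[OF C], where c = a]]
 note 2 = repD(2)[OF L' rbilD[OF C'], where c = a]
 show "fps_X ^ N dvd lval L a (%x y. zcoef (C x y) d) - lval L' a (%x y. zcoef (C' x y) d)"
  by (rule dvd_diff_trans[OF 1, unfolded eq, OF 2])
qed

lemma ext_rep:
 assumes s: "laur V s" and C: "rbil V C" and L: "rep V N s L"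
 shows "fps_X ^ N dvd ext V s C - rval L C"
 unfolding fps_X_power_dvd_iff
proof (intro allI impI)
 fix n assume n: "n < N"
 have "rep V (Suc n) s (SOME L. rep V (Suc n) s L)"
  by (rule someI_ex) (use s in \<open>simp add: laur_def\<close>)
 moreover have "rep V (Suc n) s L" using rep_mono[OF L] n by simp
 ultimately have "fps_X ^ Suc n dvd rval (SOME L. rep V (Suc n) s L) C - rval L C"
  by (rule rep_rval_eq[OF _ _ C C refl])
 then show "(ext V s C - rval L C) $ n = 0" unfolding fps_X_power_dvd_iff by (simp add: ext_def)
qed

lemma ext_eqI:
 assumes s: "laur V s" and C: "rbil V C" and r: "!!N. EX L. rep V N s L & fps_X ^ N dvd r - rval L C"
 shows "ext V s C = r"
proof (rule fps_eq_dvdI)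
 fix N
 obtain L where L: "rep V N s L" "fps_X ^ N dvd r - rval L C" using r by blast
 show "fps_X ^ N dvd ext V s C - r" by (rule dvd_diff_trans[OF ext_rep[OF s C L(1)] dvd_diff_sym[OF L(2)]])
qed

lemma ext_cong2:
 assumes s: "laur V s" and s': "laur V' s'" and C: "rbil V C" and C': "rbil V' C'"
  and eq: "!!a d. s a (%x y. zcoef (C x y) d) = s' a (%x y. zcoef (C' x y) d)"
 shows "ext V s C = ext V' s' C'"
proof (rule ext_eqI[OF s C])
 fix N
 obtain L where L: "rep V N s L" using s by (rule laurE)
 obtain L' where L': "rep V' N s' L'" using s' by (rule laurE)
 have "fps_X ^ N dvd rval L' C' - rval L C" by (rule dvd_diff_sym[OF rep_rval_eq[OF L L' C C' eq]])
 then show "EX L. rep V N s L & fps_X ^ N dvd ext V' s' C' - rval L C"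
  using L dvd_diff_trans[OF ext_rep[OF s' C' L']] by blast
qed

lemma laur_linear:
 assumes s: "laur V s" and B: "bil V B"
 shows "bil V B' ==> s c (%x y. B x y + B' x y) = s c B + s c B'"
  and "s c (%x y. d * B x y) = d * s c B"
  and "bil V B' ==> (!!x y. x \<in> carrier V ==> y \<in> carrier V ==> B x y = B' x y) ==> s c B = s c B'"
proof -
 assume B': "bil V B'"
 have BB: "bil V (%x y. B x y + B' x y)" using B B' by (auto simp: bil_def flin_def algebra_simps)
 show "s c (%x y. B x y + B' x y) = s c B + s c B'"
 proof (rule fps_eq_dvdI)
  fix N
  obtain L where L: "rep V N s L" using s by (rule laurE)
  show "fps_X ^ N dvd s c (%x y. B x y + B' x y) - (s c B + s c B')"
   using dvd_diff[OF repD(2)[OF L BB, where c = c] dvd_add[OF repD(2)[OF L B, where c = c] repD(2)[OF L B', where c = c]]]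
   by (simp add: lval_add algebra_simps)
 qed
 show "s c B = s c B'" if eq: "!!x y. x \<in> carrier V ==> y \<in> carrier V ==> B x y = B' x y"
 proof (rule fps_eq_dvdI)
  fix N
  obtain L where L: "rep V N s L" using s by (rule laurE)
  show "fps_X ^ N dvd s c B - s c B'"
   using dvd_diff[OF repD(2)[OF L B, where c = c] repD(2)[OF L B', where c = c]] lval_cong[OF repD(1)[OF L] eq, where c = c]
   by simp
 qed
next
 have BB: "bil V (%x y. d * B x y)" using B by (auto simp: bil_def flin_def algebra_simps)
 show "s c (%x y. d * B x y) = d * s c B"
 proof (rule fps_eq_dvdI)
  fix N
  obtain L where L: "rep V N s L" using s by (rule laurE)
  show "fps_X ^ N dvd s c (%x y. d * B x y) - d * s c B"
   using dvd_diff[OF repD(2)[OF L BB, where c = c] dvd_mult[OF repD(2)[OF L B, where c = c], of d]]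
   by (simp add: lval_mult algebra_simps)
 qed
qed

lemma laur_some: "laur V s ==> rep V N s (SOME L. rep V N s L)"
 unfolding laur_def by (rule someI_ex) (rule spec)

lemma zcoef_rval_hemb: "zcoef (rval L (%x y. hemb (B x y))) a = lval L a B"
proof (induction L)
 case (Cons p L)
 obtain f x y where p: "p = (f, x, y)" by (cases p) auto
 have "zcoef (fps_const f) a = fps_const (f $$ a)" by (rule fps_ext) simp
 then show ?case using Cons by (simp add: p mult.commute[of _ "hemb _"] mult.commute[of "B x y"])
qed simp

text \<open>Scalar forms, regarded as constant in \<open>z\<close>, recover the family, so that
  identities between evaluations can be read back as identities of coefficients.\<close>

lemma ext_hemb:
 assumes s: "laur V s" and B: "bil V B"
 shows "zcoef (ext V s (%x y. hemb (B x y))) a = s a B"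
proof (rule fps_eq_dvdI)
 fix N
 obtain L where L: "rep V N s L" using s by (rule laurE)
 have "fps_X ^ N dvd zcoef (ext V s (%x y. hemb (B x y)) - rval L (%x y. hemb (B x y))) a"
  using ext_rep[OF s rbil_hemb[OF B] L] unfolding zcoef_dvd_iff by (rule spec)
 then have "fps_X ^ N dvd zcoef (ext V s (%x y. hemb (B x y))) a - lval L a B"
  by (simp only: zcoef_simps zcoef_rval_hemb)
 from dvd_diff_trans[OF this dvd_diff_sym[OF repD(2)[OF L B]]]
 show "fps_X ^ N dvd zcoef (ext V s (%x y. hemb (B x y))) a - s a B" .
qed

lemma zcoef_eqI: "(!!d. zcoef f d = zcoef g d) ==> f = g"
 by (rule fps_ext, rule fls_eqI) (metis zcoef_nth)

definition rlin :: "(complex fps, 'v, 'm) module_scheme => ('v => complex fls fps) => bool" where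
 "rlin V f \<longleftrightarrow> (ALL u:carrier V. ALL v:carrier V. f (u \<oplus>\<^bsub>V\<^esub> v) = f u + f v) &
   (ALL c. ALL u:carrier V. f (c \<odot>\<^bsub>V\<^esub> u) = hemb c * f u)"

lemma rlin_iff: "rlin V f \<longleftrightarrow> (ALL d. flin V (%u. zcoef (f u) d))"
proof
 assume z: "ALL d. flin V (%u. zcoef (f u) d)"
 show "rlin V f"
  unfolding rlin_def by (intro conjI ballI allI zcoef_eqI) (use z in \<open>auto simp: flin_def simp del: zcoef_nth\<close>)
qed (auto simp: rlin_def flin_def)

lemma rbil_iff: "rbil V C \<longleftrightarrow> (ALL w:carrier V. rlin V (%u. C u w) & rlin V (C w))"
 by (auto simp: rbil_def bil_def rlin_iff)

lemma rlinD:
 assumes "rlin V f"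
 shows "u \<in> carrier V ==> v \<in> carrier V ==> f (u \<oplus>\<^bsub>V\<^esub> v) = f u + f v" "u \<in> carrier V ==> f (c \<odot>\<^bsub>V\<^esub> u) = hemb c * f u"
 using assms by (auto simp: rlin_def)

lemma rlinI:
 assumes "!!u v. u \<in> carrier V ==> v \<in> carrier V ==> f (u \<oplus>\<^bsub>V\<^esub> v) = f u + f v" "!!c u. u \<in> carrier V ==> f (c \<odot>\<^bsub>V\<^esub> u) = hemb c * f u"
 shows "rlin V f"
 using assms by (auto simp: rlin_def)

lemma rbil_add: "rbil V C ==> rbil V C' ==> rbil V (%x y. C x y + C' x y)"
 by (auto simp: rbil_iff rlin_def algebra_simps)

lemma rbil_hmult: "rbil V C ==> rbil V (%x y. hemb c * C x y)"
 by (auto simp: rbil_iff rlin_def algebra_simps)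

lemma ext_cong:
 assumes "laur V s" "rbil V C" "rbil V C'" "!!x y. x \<in> carrier V ==> y \<in> carrier V ==> C x y = C' x y"
 shows "ext V s C = ext V s C'"
proof (rule ext_cong2[OF assms(1,1-3)])
 fix a d
 show "s a (%x y. zcoef (C x y) d) = s a (%x y. zcoef (C' x y) d)"
  by (rule laur_linear(3)[OF assms(1) rbilD[OF assms(2)] rbilD[OF assms(3)]]) (simp add: assms(4))
qed

lemma ext_add:
 assumes s: "laur V s" and C: "rbil V C" "rbil V C'"
 shows "ext V s (%x y. C x y + C' x y) = ext V s C + ext V s C'"
proof (rule ext_eqI[OF s rbil_add[OF C]])
 fix N
 obtain L where L: "rep V N s L" using s by (rule laurE)
 have "rval L (%x y. C x y + C' x y) = rval L C + rval L C'" by (induction L) (auto simp: algebra_simps)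
 then show "EX L. rep V N s L & fps_X ^ N dvd ext V s C + ext V s C' - rval L (%x y. C x y + C' x y)"
  using dvd_add[OF ext_rep[OF s C(1) L] ext_rep[OF s C(2) L]] L by (intro exI[of _ L]) (simp add: algebra_simps)
qed

lemma ext_hmult:
 assumes s: "laur V s" and C: "rbil V C"
 shows "ext V s (%x y. hemb c * C x y) = hemb c * ext V s C"
proof (rule ext_eqI[OF s rbil_hmult[OF C]])
 fix N
 obtain L where L: "rep V N s L" using s by (rule laurE)
 have "rval L (%x y. hemb c * C x y) = hemb c * rval L C" by (induction L) (auto simp: algebra_simps)
 then show "EX L. rep V N s L & fps_X ^ N dvd hemb c * ext V s C - rval L (%x y. hemb c * C x y)"
  using dvd_mult[OF ext_rep[OF s C(1) L], of "hemb c"] L by (intro exI[of _ L]) (simp add: algebra_simps)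
qed

type_synonym 'v op = "'v => 'v => 'v fam"

definition sop :: "(complex fps, 'v, 'm) module_scheme => 'v op => bool" where
 "sop V s \<longleftrightarrow> (ALL x:carrier V. ALL y:carrier V. laur V (s x y)) & (ALL c B. bil V B --> bil V (%x y. s x y c B))"

lemma sopD: "sop V s ==> x \<in> carrier V ==> y \<in> carrier V ==> laur V (s x y)" "sop V s ==> bil V B ==> bil V (%x y. s x y c B)"
 by (auto simp: sop_def)

lemma ext_fam_add:
 assumes "laur V s" "laur V s'" "laur V s''" "rbil V C" "!!c B. bil V B ==> s'' c B = s c B + s' c B"
 shows "ext V s'' C = ext V s C + ext V s' C"
proof (rule ext_eqI[OF assms(3,4)])
 fix N
 obtain L where L: "rep V N s L" using assms(1) by (rule laurE)
 obtain L' where L': "rep V N s' L'" using assms(2) by (rule laurE)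
 have "rep V N s'' (L @ L')"
  unfolding rep_def
 proof (intro conjI allI impI)
  fix c B assume B: "bil V B"
  show "fps_X ^ N dvd s'' c B - lval (L @ L') c B"
   using dvd_add[OF repD(2)[OF L B, where c = c] repD(2)[OF L' B, where c = c]]
   by (simp add: assms(5)[OF B] algebra_simps)
 qed (use repD(1)[OF L] repD(1)[OF L'] in simp)
 then show "EX L. rep V N s'' L & fps_X ^ N dvd ext V s C + ext V s' C - rval L C"
  using dvd_add[OF ext_rep[OF assms(1,4) L] ext_rep[OF assms(2,4) L']]
  by (intro exI[of _ "L @ L'"]) (simp add: algebra_simps)
qed

lemma ext_fam_mult:
 assumes "laur V s" "laur V s'" "rbil V C" "!!c B. bil V B ==> s' c B = d * s c B"
 shows "ext V s' C = hemb d * ext V s C"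
proof -
 have "ext V s' C = ext V s (%x y. hemb d * C x y)"
 proof (rule ext_cong2[OF assms(2,1,3) rbil_hmult[OF assms(3)]])
  fix a e
  show "s' a (%x y. zcoef (C x y) e) = s a (%x y. zcoef (hemb d * C x y) e)"
   using assms(4)[OF rbilD[OF assms(3)], of a e] laur_linear(2)[OF assms(1) rbilD[OF assms(3)], of a d e] by simp
 qed
 then show ?thesis using ext_hmult[OF assms(1,3)] by simp
qed

text \<open>Closes the calculus under composition. Operators act on forms contravariantly: in a
  nested \<open>ext\<close> the outer family belongs to the operator that acts first.\<close>

lemma op_rbil:
 assumes V: "tmod V" and s: "sop V s" and C: "rbil V C"
 shows "rbil V (%x y. ext V (s x y) C)"
proof -
 interpret tmod V by fact
 note l = sopD(1)[OF s]
 show ?thesis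
  unfolding rbil_iff
 proof (intro ballI conjI rlinI)
  fix u v w assume h: "w \<in> carrier V" "u \<in> carrier V" "v \<in> carrier V"
  show "ext V (s (u \<oplus>\<^bsub>V\<^esub> v) w) C = ext V (s u w) C + ext V (s v w) C"
   using h bilD(1)[OF sopD(2)[OF s] h] by (intro ext_fam_add C l) auto
  show "ext V (s w (u \<oplus>\<^bsub>V\<^esub> v)) C = ext V (s w u) C + ext V (s w v) C"
   using h bilD(2)[OF sopD(2)[OF s] h] by (intro ext_fam_add C l) auto
 next
  fix u c w assume h: "w \<in> carrier V" "u \<in> carrier V"
  show "ext V (s (c \<odot>\<^bsub>V\<^esub> u) w) C = hemb c * ext V (s u w) C"
   using h bilD(3)[OF sopD(2)[OF s] h] by (intro ext_fam_mult C l) auto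
  show "ext V (s w (c \<odot>\<^bsub>V\<^esub> u)) C = hemb c * ext V (s w u) C"
   using h bilD(4)[OF sopD(2)[OF s] h] by (intro ext_fam_mult C l) auto
 qed
qed

text \<open>The form may vary with a further vector, as it does in the hexagon identity, where the
  product \<open>Y\<close> couples the factor acted on with another one.\<close>

lemma op_rbil3:
 assumes V: "tmod V" and s: "sop V s" and v: "v \<in> carrier V"
  and C: "!!x. x \<in> carrier V ==> rbil V (G x)"
  and G: "!!y z. y \<in> carrier V ==> z \<in> carrier V ==> rlin V (%x. G x y z)"
 shows "rbil V (%x z. ext V (s v z) (G x))"
proof -
 interpret tmod V by fact
 note l = sopD(1)[OF s]
 show ?thesis
  unfolding rbil_iff
 proof (intro ballI conjI)
  fix w assume w: "w \<in> carrier V"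
  show "rlin V (%z. ext V (s v z) (G w))" using op_rbil[OF V s C[OF w]] v by (simp add: rbil_iff)
  show "rlin V (%x. ext V (s v w) (G x))"
  proof (rule rlinI)
   fix x x' assume h: "x \<in> carrier V" "x' \<in> carrier V"
   have "ext V (s v w) (G (x \<oplus>\<^bsub>V\<^esub> x')) = ext V (s v w) (%y z. G x y z + G x' y z)"
    using h v w by (intro ext_cong l C rbil_add) (auto simp: rlinD[OF G])
   then show "ext V (s v w) (G (x \<oplus>\<^bsub>V\<^esub> x')) = ext V (s v w) (G x) + ext V (s v w) (G x')"
    using h v w by (simp add: ext_add l C)
  next
   fix c x assume h: "x \<in> carrier V"
   have "ext V (s v w) (G (c \<odot>\<^bsub>V\<^esub> x)) = ext V (s v w) (%y z. hemb c * G x y z)"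
    using h v w by (intro ext_cong l C rbil_hmult) (auto simp: rlinD[OF G])
   then show "ext V (s v w) (G (c \<odot>\<^bsub>V\<^esub> x)) = hemb c * ext V (s v w) (G x)"
    using h v w by (simp add: ext_hmult l C)
  qed
 qed
qed

subsection \<open>Shifted, reflected and flipped families\<close>

text \<open>In terms of operator series: \<open>hs e k\<close> is the coefficient of
  \<open>w^k\<close> in \<open>s(z + e w)\<close>, \<open>ng\<close> replaces \<open>z\<close> by
  \<open>- z\<close>, and \<open>fl\<close> conjugates by the flip of the two tensor
  factors.\<close>

definition hs :: "complex => nat => 'v fam => 'v fam" where
 "hs e k s c B = fps_const (e ^ k * (of_int (c + int k) gchoose k)) * s (c + int k) B"

definition ng :: "'v fam => 'v fam" where
 "ng s c B = fps_const ((- 1) powi c) * s c B"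

definition fl :: "'v op => 'v op" where
 "fl s x y c B = s y x c (%x y. B y x)"

definition mapf :: "(complex fls => complex fls) => 'v lc => 'v lc" where
 "mapf \<phi> = map (%(f, x, y). (\<phi> f, x, y))"

lemma mapf_simps [simp]: "mapf \<phi> [] = []" "mapf \<phi> ((f, x, y) # L) = (\<phi> f, x, y) # mapf \<phi> L" "mapf \<phi> (L @ L') = mapf \<phi> L @ mapf \<phi> L'"
 by (simp_all add: mapf_def)

lemma wf2_mapf [simp]: "wf2 V (mapf \<phi> L) \<longleftrightarrow> wf2 V L"
 by (induction L) auto

lemma rep_hs: "rep V N s L ==> rep V N (hs e k s) (mapf (hasse e k) L)"
 unfolding rep_def
proof (intro conjI allI impI)
 fix c B assume h: "wf2 V L & (ALL c B. bil V B --> fps_X ^ N dvd s c B - lval L c B)" and B: "bil V B"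
 have "lval (mapf (hasse e k) L) c B = fps_const (e ^ k * (of_int (c + int k) gchoose k)) * lval L (c + int k) B"
  by (induction L) (auto simp: hasse_nth algebra_simps simp flip: fps_const_mult)
 then show "fps_X ^ N dvd hs e k s c B - lval (mapf (hasse e k) L) c B"
  using h B by (simp add: hs_def flip: right_diff_distrib)
qed simp

lemma laur_hs: "laur V s ==> laur V (hs e k s)"
 unfolding laur_def using rep_hs by blast

lemma rep_ng: "rep V N s L ==> rep V N (ng s) (mapf flneg L)"
 unfolding rep_def
proof (intro conjI allI impI)
 fix c B assume h: "wf2 V L & (ALL c B. bil V B --> fps_X ^ N dvd s c B - lval L c B)" and B: "bil V B"
 have "lval (mapf flneg L) c B = fps_const ((- 1) powi c) * lval L c B"
  by (induction L) (auto simp: algebra_simps simp flip: fps_const_mult)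
 then show "fps_X ^ N dvd ng s c B - lval (mapf flneg L) c B"
  using h B by (simp add: ng_def flip: right_diff_distrib)
qed simp

lemma rep_fl: "rep V N (s y x) L ==> rep V N (fl s x y) (map (%(f, x, y). (f, y, x)) L)"
 unfolding rep_def
proof (intro conjI allI impI)
 fix c B assume h: "wf2 V L & (ALL c B. bil V B --> fps_X ^ N dvd s y x c B - lval L c B)" and B: "bil V B"
 have "lval (map (%(f, x, y). (f, y, x)) L) c B = lval L c (%x y. B y x)"
  by (induction L) auto
 then show "fps_X ^ N dvd fl s x y c B - lval (map (%(f, x, y). (f, y, x)) L) c B"
  using h bil_flip[OF B] by (simp add: fl_def)
qed (auto simp: wf2_def)

lemma sop_ng: "sop V s ==> sop V (%x y. ng (s x y))"
 unfolding sop_def laur_def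
proof (intro conjI ballI allI impI; elim conjE)
 fix x y N assume "ALL x:carrier V. ALL y:carrier V. ALL N. Ex (rep V N (s x y))" "x \<in> carrier V" "y \<in> carrier V"
 then show "Ex (rep V N (ng (s x y)))" using rep_ng by blast
next
 fix c B assume "ALL c B. bil V B --> bil V (%x y. s x y c B)" "bil V B"
 then have "bil V (%x y. s x y c B)" by blast
 then show "bil V (%x y. ng (s x y) c B)" by (auto simp: bil_def flin_def ng_def algebra_simps)
qed

lemma sop_hs: "sop V s ==> sop V (%x y. hs e k (s x y))"
 unfolding sop_def laur_def
proof (intro conjI ballI allI impI; elim conjE)
 fix x y N assume "ALL x:carrier V. ALL y:carrier V. ALL N. Ex (rep V N (s x y))" "x \<in> carrier V" "y \<in> carrier V"
 then show "Ex (rep V N (hs e k (s x y)))" using rep_hs by blast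
next
 fix c B assume "ALL c B. bil V B --> bil V (%x y. s x y c B)" "bil V B"
 then have "bil V (%x y. s x y (c + int k) B)" by blast
 then show "bil V (%x y. hs e k (s x y) c B)" by (auto simp: bil_def flin_def hs_def algebra_simps)
qed

lemma sop_fl: "sop V s ==> sop V (fl s)"
 unfolding sop_def laur_def
proof (intro conjI ballI allI impI; elim conjE)
 fix x y N assume "ALL x:carrier V. ALL y:carrier V. ALL N. Ex (rep V N (s x y))" "x \<in> carrier V" "y \<in> carrier V"
 then obtain L where "rep V N (s y x) L" by blast
 from rep_fl[of V N s y x, OF this] show "Ex (rep V N (fl s x y))" by (rule exI)
next
 fix c B assume "ALL c B. bil V B --> bil V (%x y. s x y c B)" and B: "bil V B"
 then have "bil V (%x y. s x y c (%x y. B y x))" using bil_flip[OF B] by blast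
 then show "bil V (%x y. fl s x y c B)" unfolding fl_def by (rule bil_flip)
qed

text \<open>The composite of two operators on representatives: each term of the first is followed by
  a representative of the second.\<close>

definition lc_bind :: "'v lc => ('v => 'v => 'v lc) => 'v lc" where
 "lc_bind L Q = concat (map (%(g, x, z). mapf (%h. g * h) (Q x z)) L)"

lemma lc_bind_simps [simp]: "lc_bind [] Q = []" "lc_bind ((g, x, z) # L) Q = mapf (%h. g * h) (Q x z) @ lc_bind L Q"
 by (simp_all add: lc_bind_def)

lemma rval_scale: "rval (mapf (%h. g * h) L) C = fps_const g * rval L C"
 by (induction L) (auto simp: algebra_simps simp flip: fps_const_mult)

lemma rval_bind: "rval (lc_bind L Q) C = rval L (%x z. rval (Q x z) C)"
 by (induction L) (auto simp: rval_scale)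

lemma wf2_bind: "wf2 V L ==> (!!x z. x \<in> carrier V ==> z \<in> carrier V ==> wf2 V (Q x z)) ==> wf2 V (lc_bind L Q)"
 by (induction L) auto

lemma fps_const_sum: "fps_const (\<Sum>i\<in>F. f i) = (\<Sum>i\<in>F. fps_const (f i))"
 by (induction F rule: infinite_finite_induct) (auto simp flip: fps_const_add)

text \<open>The Leibniz rule truncated at total order \<open>K\<close>: Taylor expanding two factors
  separately is expanding their composite. This is where the expansions of mutually inverse
  operators cancel.\<close>

lemma rval_hasse_bind:
 "(\<Sum>k\<le>K. rval (mapf (hasse e k) M) (%x z. \<Sum>l\<le>K - k. rval (mapf (hasse e l) (Q x z)) (F (k + l)))) =
  (\<Sum>n\<le>K. rval (mapf (hasse e n) (lc_bind M Q)) (F n))"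
proof (induction M)
 case (Cons p M)
 obtain g x z where p: "p = (g, x, z)" by (cases p) auto
 have "(\<Sum>k\<le>K. fps_const (hasse e k g) * (\<Sum>l\<le>K - k. rval (mapf (hasse e l) R) (F (k + l)))) =
   (\<Sum>n\<le>K. rval (mapf (hasse e n) (mapf (%h. g * h) R)) (F n))" for R
 proof (induction R)
  case (Cons q R)
  obtain h p' q' where q: "q = (h, p', q')" by (cases q) auto
  have "(\<Sum>k\<le>K. fps_const (hasse e k g) * (\<Sum>l\<le>K - k. fps_const (hasse e l h) * F (k + l) p' q')) =
    (\<Sum>k\<le>K. \<Sum>l\<le>K - k. fps_const (hasse e k g * hasse e l h) * F (k + l) p' q')"
   by (simp add: sum_distrib_left mult.assoc flip: fps_const_mult)
  also have "... = (\<Sum>(k, l)\<in>Sigma {..K} (%k. {..K - k}). fps_const (hasse e k g * hasse e l h) * F (k + l) p' q')"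
   by (simp add: sum.Sigma)
  also have "Sigma {..K} (%k. {..K - k}) = {(k, l). k + l <= K}" by auto
  also have "(\<Sum>(k, l)\<in>{(k, l). k + l <= K}. fps_const (hasse e k g * hasse e l h) * F (k + l) p' q') =
    (\<Sum>n\<le>K. \<Sum>k\<le>n. fps_const (hasse e k g * hasse e (n - k) h) * F (k + (n - k)) p' q')"
   by (rule sum.triangle_reindex_eq)
  also have "... = (\<Sum>n\<le>K. fps_const (hasse e n (g * h)) * F n p' q')"
  proof (rule sum.cong[OF refl])
   fix n
   have "(\<Sum>k\<le>n. fps_const (hasse e k g * hasse e (n - k) h) * F (k + (n - k)) p' q') =
     (\<Sum>k\<le>n. fps_const (hasse e k g * hasse e (n - k) h)) * F n p' q'"
    unfolding sum_distrib_right by (rule sum.cong) auto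
   then show "(\<Sum>k\<le>n. fps_const (hasse e k g * hasse e (n - k) h) * F (k + (n - k)) p' q') = fps_const (hasse e n (g * h)) * F n p' q'"
    by (simp add: hasse_mult fps_const_sum)
  qed
  finally show ?case using Cons by (simp add: q sum.distrib distrib_left)
 qed simp
 from this[of "Q x z"] Cons show ?case by (simp add: p sum.distrib)
qed simp

section \<open>Hexagon identities\<close>

type_synonym 'v prods = "int => 'v => 'v => 'v"

text \<open>The coefficient of \<open>z2^b\<close> in the hexagon identity modulo
  \<open>h ^ N\<close>. Order \<open>k\<close> of the Taylor expansion of
  \<open>S13(z1 + z2)\<close> leaves exponent \<open>b - k\<close> for \<open>Y\<close>, and the
  terms with exponent below \<open>M0\<close> may be dropped. Hence the sum may stop at any
  \<open>K\<close> with \<open>b - K \<le> M0\<close>, with one bound for all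
  \<open>b\<close>.\<close>

definition hexL_at :: "(complex fps, 'v, 'm) module_scheme => 'v prods => complex => 'v op => 'v => 'v => 'v =>
  nat => 'v lc => ('v => 'v lc) => int => bool" where
 "hexL_at V Y e s u v w N L M M0 \<longleftrightarrow> rep V N (s u w) L & (ALL z:carrier V. rep V N (s v z) (M z)) &
   (ALL b K. b - int K <= M0 --> rep V N (s (Y b u v) w) (concat (map (%k.
    lc_bind (mapf (hasse e k) L) (%x z. map (%(g, y, z). (g, Y (b - int k) x y, z)) (M z))) [0..<Suc K])))"

text \<open>Three forms of the identity: by representatives, where \<open>z\<close> can be replaced
  by \<open>- z\<close> term by term; by evaluations in \<open>hexA\<close>, with the factor
  \<open>s u w\<close> acting first; and in \<open>hexB\<close> with the two factors in the reversed
  order that inversion produces.\<close>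

definition hexL :: "(complex fps, 'v, 'm) module_scheme => 'v prods => complex => 'v op => bool" where
 "hexL V Y e s \<longleftrightarrow> (ALL u:carrier V. ALL v:carrier V. ALL w:carrier V. ALL N. EX L M M0. hexL_at V Y e s u v w N L M M0)"

definition hexA :: "(complex fps, 'v, 'm) module_scheme => 'v prods => complex => 'v op => bool" where
 "hexA V Y e s \<longleftrightarrow> (ALL u:carrier V. ALL v:carrier V. ALL w:carrier V. ALL N. EX M0::int. ALL b K C.
   b - int K <= M0 --> rbil V C -->
   fps_X ^ N dvd ext V (s (Y b u v) w) C -
    (\<Sum>k\<le>K. ext V (hs e k (s u w)) (%x z. ext V (s v z) (%y. C (Y (b - int k) x y)))))"

definition hexB :: "(complex fps, 'v, 'm) module_scheme => 'v prods => complex => 'v op => bool" where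
 "hexB V Y e s \<longleftrightarrow> (ALL u:carrier V. ALL v:carrier V. ALL w:carrier V. ALL N. EX M0::int. ALL b K C.
   b - int K <= M0 --> rbil V C -->
   fps_X ^ N dvd ext V (s (Y b u v) w) C -
    (\<Sum>k\<le>K. ext V (s v w) (%y z. ext V (hs e k (s u z)) (%x. C (Y (b - int k) x y)))))"

locale prods = tmod V for V :: "(complex fps, 'v, 'm) module_scheme" (structure) +
 fixes Y :: "'v prods"
 assumes Y_closed [simp]: "u \<in> carrier V ==> v \<in> carrier V ==> Y b u v \<in> carrier V"
  and Y_lin: "u \<in> carrier V ==> Y b u \<in> linear_maps V V" "v \<in> carrier V ==> (%u. Y b u v) \<in> linear_maps V V"
begin

lemma rlin_compose: "rlin V f ==> h \<in> linear_maps V V ==> rlin V (%x. f (h x))"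
 by (auto simp: rlin_def linear_maps_def Pi_def)

lemma rbilD':
 assumes "rbil V C" "w \<in> carrier V"
 shows "rlin V (%u. C u w)" "rlin V (C w)"
 using assms by (auto simp: rbil_iff)

lemma rbil_Y: assumes C: "rbil V C" and u: "u \<in> carrier V" shows "rbil V (%y. C (Y b u y))"
 unfolding rbil_iff
proof (intro ballI conjI)
 fix w assume w: "w \<in> carrier V"
 show "rlin V (%y. C (Y b u y) w)" by (rule rlin_compose[where f = "%y. C y w", OF rbilD'(1)[OF C w] Y_lin(1)[OF u]])
 show "rlin V (C (Y b u w))" by (rule rbilD'(2)[OF C Y_closed[OF u w]])
qed

lemma rbil_Y': assumes C: "rbil V C" and v: "v \<in> carrier V" shows "rbil V (%x. C (Y b x v))"
 unfolding rbil_iff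
proof (intro ballI conjI)
 fix w assume w: "w \<in> carrier V"
 show "rlin V (%x. C (Y b x v) w)"
  by (rule rlin_compose[where f = "%y. C y w" and h = "%x. Y b x v", OF rbilD'(1)[OF C w] Y_lin(2)[OF v]])
 show "rlin V (C (Y b w v))" by (rule rbilD'(2)[OF C Y_closed[OF w v]])
qed

lemma rbil_A:
 assumes "sop V s" "v \<in> carrier V" "rbil V C"
 shows "rbil V (%x z. ext V (s v z) (%y. C (Y b x y)))"
proof (rule op_rbil3[where G = "%x y. C (Y b x y)", OF tmod_axioms assms(1,2)])
 show "rbil V (%y. C (Y b x y))" if "x \<in> carrier V" for x by (rule rbil_Y[OF assms(3) that])
 show "rlin V (%x. C (Y b x y) z)" if "y \<in> carrier V" "z \<in> carrier V" for y z
  using rlin_compose[where f = "%y. C y z" and h = "%x. Y b x y"] rbilD'(1)[OF assms(3) that(2)] Y_lin(2)[OF that(1)] by blast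
qed

lemma rbil_B:
 assumes "sop V s" "u \<in> carrier V" "rbil V C"
 shows "rbil V (%y z. ext V (s u z) (%x. C (Y b x y)))"
proof (rule op_rbil3[where G = "%y x. C (Y b x y)", OF tmod_axioms assms(1,2)])
 show "rbil V (%x. C (Y b x y))" if "y \<in> carrier V" for y by (rule rbil_Y'[OF assms(3) that])
 show "rlin V (%y. C (Y b x y) z)" if "x \<in> carrier V" "z \<in> carrier V" for x z
  using rlin_compose[where f = "%y. C y z" and h = "Y b x"] rbilD'(1)[OF assms(3) that(2)] Y_lin(1)[OF that(1)] by blast
qed

lemma hexL_hexA:
 assumes s: "sop V s" and h: "hexL V Y e s"
 shows "hexA V Y e s"
 unfolding hexA_def
proof (intro ballI allI)
 fix u v w N assume c: "u \<in> carrier V" "v \<in> carrier V" "w \<in> carrier V"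
 obtain L M M0 where at: "hexL_at V Y e s u v w N L M M0" using h c unfolding hexL_def by blast
 have L: "rep V N (s u w) L" and M: "!!z. z \<in> carrier V ==> rep V N (s v z) (M z)"
  and r: "!!b K. b - int K <= M0 ==> rep V N (s (Y b u v) w) (concat (map (%k.
    lc_bind (mapf (hasse e k) L) (%x z. map (%(g, y, z). (g, Y (b - int k) x y, z)) (M z))) [0..<Suc K]))"
  using at by (simp_all add: hexL_at_def del: upt_Suc)
 have "fps_X ^ N dvd ext V (s (Y b u v) w) C -
    (\<Sum>k\<le>K. ext V (hs e k (s u w)) (%x z. ext V (s v z) (%y. C (Y (b - int k) x y))))"
  if K: "b - int K <= M0" and C: "rbil V C" for b K C
 proof -
  let ?E = "%k x z. ext V (s v z) (%y. C (Y (b - int k) x y))"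
  let ?L = "%k. lc_bind (mapf (hasse e k) L) (%x z. map (%(g, y, z). (g, Y (b - int k) x y, z)) (M z))"
  have "rval (concat (map A [0..<Suc K])) C = (\<Sum>k\<le>K. rval (A k) C)" for A
   by (induction K) auto
  from this[of ?L] have "rval (concat (map ?L [0..<Suc K])) C = (\<Sum>k\<le>K. rval (?L k) C)" .
  also have "... = (\<Sum>k\<le>K. rval (mapf (hasse e k) L) (%x z. rval (M z) (%y. C (Y (b - int k) x y))))"
  proof -
   have "rval (map (%(g, y, z). (g, Y k x y, z)) L) C = rval L (%y. C (Y k x y))" for k x L
    by (induction L) auto
   then show ?thesis by (simp add: rval_bind)
  qed
  finally have 1: "fps_X ^ N dvd ext V (s (Y b u v) w) C -
    (\<Sum>k\<le>K. rval (mapf (hasse e k) L) (%x z. rval (M z) (%y. C (Y (b - int k) x y))))"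
   using ext_rep[OF sopD(1)[OF s] C r[OF K]] c by simp
  have 2: "fps_X ^ N dvd rval (mapf (hasse e k) L) (%x z. rval (M z) (%y. C (Y (b - int k) x y))) -
    ext V (hs e k (s u w)) (?E k)" for k
  proof (rule dvd_diff_trans)
   show "fps_X ^ N dvd rval (mapf (hasse e k) L) (%x z. rval (M z) (%y. C (Y (b - int k) x y))) - rval (mapf (hasse e k) L) (?E k)"
   proof (rule rval_dvd_cong)
    show "wf2 V (mapf (hasse e k) L)" using repD(1)[OF L] by simp
    fix x z assume "x \<in> carrier V" "z \<in> carrier V"
    then show "fps_X ^ N dvd rval (M z) (%y. C (Y (b - int k) x y)) - ?E k x z"
     by (intro dvd_diff_sym[OF ext_rep] sopD(1)[OF s] rbil_Y C M c)
   qed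
   show "fps_X ^ N dvd rval (mapf (hasse e k) L) (?E k) - ext V (hs e k (s u w)) (?E k)"
    by (intro dvd_diff_sym[OF ext_rep] laur_hs sopD(1)[OF s] rbil_A s C c rep_hs L)
  qed
  show ?thesis
   by (rule dvd_diff_trans[OF 1]) (simp only: sum_subtractf[symmetric], intro dvd_sum 2)
 qed
 then show "EX M0::int. ALL b K C. b - int K <= M0 --> rbil V C -->
   fps_X ^ N dvd ext V (s (Y b u v) w) C -
    (\<Sum>k\<le>K. ext V (hs e k (s u w)) (%x z. ext V (s v z) (%y. C (Y (b - int k) x y))))" by blast
qed

text \<open>Reflection turns Taylor coefficients in \<open>w\<close> into those in
  \<open>- w\<close>, whence the sign \<open>- 1\<close>.\<close>

lemma hexL_ng:
 assumes h: "hexL V Y 1 s"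
 shows "hexL V Y (- 1) (%x y. ng (s x y))"
 unfolding hexL_def
proof (intro ballI allI)
 fix u v w N assume c: "u \<in> carrier V" "v \<in> carrier V" "w \<in> carrier V"
 obtain L M M0 where at: "hexL_at V Y 1 s u v w N L M M0" using h c unfolding hexL_def by blast
 have L: "rep V N (s u w) L" and M: "!!z. z \<in> carrier V ==> rep V N (s v z) (M z)"
  and r: "!!b K. b - int K <= M0 ==> rep V N (s (Y b u v) w) (concat (map (%k.
    lc_bind (mapf (hasse 1 k) L) (%x z. map (%(g, y, z). (g, Y (b - int k) x y, z)) (M z))) [0..<Suc K]))"
  using at by (simp_all add: hexL_at_def del: upt_Suc)
 have m1: "mapf flneg (mapf (%h. g * h) (map (%(g, y, z). (g, Y k x y, z)) R)) =
   mapf (%h. flneg g * h) (map (%(g, y, z). (g, Y k x y, z)) (mapf flneg R))" for g k x R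
  by (induction R) (auto simp: flneg_mult)
 have m: "mapf flneg (lc_bind (mapf (hasse 1 k) L) (%x z. map (%(g, y, z). (g, Y d x y, z)) (M z))) =
   lc_bind (mapf (hasse (- 1) k) (mapf flneg L)) (%x z. map (%(g, y, z). (g, Y d x y, z)) (mapf flneg (M z)))" for k d
  by (induction L) (auto simp: m1 hasse_flneg)
 have mc: "mapf flneg (concat Ls) = concat (map (mapf flneg) Ls)" for Ls :: "'v lc list"
  by (induction Ls) auto
 show "EX L M M0. hexL_at V Y (- 1) (%x y. ng (s x y)) u v w N L M M0"
  unfolding hexL_at_def
 proof (intro exI conjI ballI allI impI)
  show "rep V N (ng (s u w)) (mapf flneg L)" by (rule rep_ng[OF L])
  show "rep V N (ng (s v z)) (mapf flneg (M z))" if "z \<in> carrier V" for z by (rule rep_ng[OF M[OF that]])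
  fix b and K :: nat assume "b - int K <= M0"
  from rep_ng[OF r[OF this]]
  show "rep V N (ng (s (Y b u v) w)) (concat (map (%k.
    lc_bind (mapf (hasse (- 1) k) (mapf flneg L))
     (%x z. map (%(g, y, z). (g, Y (b - int k) x y, z)) (mapf flneg (M z)))) [0..<Suc K]))"
   by (simp only: mc map_map o_def m)
 qed
qed

lemma rval_dvd_cong_mem: "(!!f x y. (f, x, y) \<in> set L ==> d dvd C x y - C' x y) ==> d dvd rval L C - rval L C'"
proof (induction L)
 case (Cons p L)
 obtain f x y where p: "p = (f, x, y)" by (cases p) auto
 have "d dvd fps_const f * (C x y - C' x y) + (rval L C - rval L C')"
  using Cons p by (intro dvd_add dvd_mult) auto
 then show ?case by (simp add: p algebra_simps)
qed simp

text \<open>Write \<open>t\<close> for the inverse of \<open>s\<close>. Inverting both factors of \<open>s (Y b u v) w\<close> and using the Leibniz rule to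
 cancel the Taylor expansions gives the hexagon identity of \<open>t\<close>, with its factors in the opposite order.\<close>

lemma hexA_inverse:
 assumes s: "sop V s" and t: "sop V t" and h: "hexA V Y e s"
  and st: "!!x y C. x \<in> carrier V ==> y \<in> carrier V ==> rbil V C ==> ext V (s x y) (%x y. ext V (t x y) C) = C x y"
  and ts: "!!x y C. x \<in> carrier V ==> y \<in> carrier V ==> rbil V C ==> ext V (t x y) (%x y. ext V (s x y) C) = C x y"
 shows "hexB V Y e t"
 unfolding hexB_def
proof (intro ballI allI)
 fix u v w N assume c: "u \<in> carrier V" "v \<in> carrier V" "w \<in> carrier V"
 note op = op_rbil[OF tmod_axioms] and ls = sopD(1)[OF s] and lt = sopD(1)[OF t]
 obtain L where L: "rep V N (t v w) L" using lt[OF c(2,3)] by (rule laurE)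
 have wL: "y \<in> carrier V" "z \<in> carrier V" if "(f, y, z) \<in> set L" for f y z
  using repD(1)[OF L] that by (auto simp: wf2_def)
 define M where "M z = (SOME L. rep V N (t u z) L)" for z
 have M: "rep V N (t u z) (M z)" if "z \<in> carrier V" for z
  unfolding M_def by (rule laur_some[OF lt[OF c(1) that]])
 have wM: "x \<in> carrier V" "z' \<in> carrier V" if "(g, x, z') \<in> set (M z)" "z \<in> carrier V" for g x z' z
  using repD(1)[OF M[OF that(2)]] that(1) by (auto simp: wf2_def)
 define Q where "Q x z = (SOME L. rep V N (s x z) L)" for x z
 have Q: "rep V N (s x z) (Q x z)" if "x \<in> carrier V" "z \<in> carrier V" for x z
  unfolding Q_def by (rule laur_some[OF ls[OF that]])
 let ?P = "%x y z m. ALL b K C. b - int K <= m --> rbil V C -->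
   fps_X ^ N dvd ext V (s (Y b x y) z) C -
    (\<Sum>k\<le>K. ext V (hs e k (s x z)) (%x' z'. ext V (s y z') (%y'. C (Y (b - int k) x' y'))))"
 have "ALL x y z. EX m::int. x \<in> carrier V --> y \<in> carrier V --> z \<in> carrier V --> ?P x y z m"
  using h unfolding hexA_def by blast
 then have "EX m :: 'v => 'v => 'v => int. ALL x y z. x \<in> carrier V --> y \<in> carrier V --> z \<in> carrier V --> ?P x y z (m x y z)"
  by (simp only: choice_iff)
 then obtain m :: "'v => 'v => 'v => int" where m: "!!x y z. x \<in> carrier V ==> y \<in> carrier V ==> z \<in> carrier V ==> ?P x y z (m x y z)"
  by blast
 \<comment> \<open>Only finitely many triples \<open>x, y, z'\<close> occur in the chosen
   representatives, so their bounds \<open>m\<close> have a common lower bound.\<close>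
 define A where "A = (\<Union>(f, y, z)\<in>set L. (%(g, x, z'). m x y z') ` set (M z))"
 have "finite A" unfolding A_def by auto
 then obtain M0 where M0: "!!a. a \<in> A ==> M0 <= a" using bdd_below_finite[of A] by (auto simp: bdd_below_def)
 have "fps_X ^ N dvd ext V (t (Y b u v) w) C -
    (\<Sum>k\<le>K. ext V (t v w) (%y z. ext V (hs e k (t u z)) (%x. C (Y (b - int k) x y))))"
  if K: "b - int K <= M0" and C: "rbil V C" for b K C
 proof -
  \<comment> \<open>Writing \<open>C\<close> as the image of \<open>D\<close> under \<open>s\<close>
    makes the hexagon identity of \<open>s\<close> applicable to every value of
    \<open>C\<close>.\<close>
  define D where "D = (%x y. ext V (t x y) C)"
  have D: "rbil V D" unfolding D_def by (rule op[OF t C])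
  have CD: "C x y = ext V (s x y) D" if "x \<in> carrier V" "y \<in> carrier V" for x y
   using st[OF that C] by (simp add: D_def)
  define \<Phi> where "\<Phi> k y z = ext V (hs e k (t u z)) (%x. C (Y (b - int k) x y))" for k y z
  have \<Phi>: "rbil V (\<Phi> k)" for k
   unfolding \<Phi>_def by (rule rbil_B[OF sop_hs[OF t] c(1) C])
  define G where "G y z = ext V (s y z) (%y. D (Y b u y))" for y z
  have G: "rbil V G" unfolding G_def by (rule op[OF s rbil_Y[OF D c(1)]])
  have key: "fps_X ^ N dvd (\<Sum>k\<le>K. \<Phi> k y z) - G y z" if yz: "(f, y, z) \<in> set L" for f y z
  proof -
   note y = wL(1)[OF yz] and z = wL(2)[OF yz]
   define F where "F n x z' = ext V (s y z') (%y. D (Y (b - int n) x y))" for n x z'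
   have F: "rbil V (F n)" for n unfolding F_def by (rule rbil_A[OF s y D])
   define R where "R = lc_bind (M z) Q"
   have 1: "fps_X ^ N dvd \<Phi> k y z - rval (mapf (hasse e k) (M z)) (%x z'. \<Sum>l\<le>K - k. rval (mapf (hasse e l) (Q x z')) (F (k + l)))"
    if k: "k <= K" for k
   proof (rule dvd_diff_trans)
    show "fps_X ^ N dvd \<Phi> k y z - rval (mapf (hasse e k) (M z)) (%x. C (Y (b - int k) x y))"
     unfolding \<Phi>_def by (intro ext_rep laur_hs lt c z rbil_Y' C y rep_hs M)
    show "fps_X ^ N dvd rval (mapf (hasse e k) (M z)) (%x. C (Y (b - int k) x y)) -
      rval (mapf (hasse e k) (M z)) (%x z'. \<Sum>l\<le>K - k. rval (mapf (hasse e l) (Q x z')) (F (k + l)))"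
    proof (rule rval_dvd_cong_mem)
     fix g x z' assume "(g, x, z') \<in> set (mapf (hasse e k) (M z))"
     then obtain g' where g': "(g', x, z') \<in> set (M z)" by (auto simp: mapf_def)
     note x = wM(1)[OF g' z] and z' = wM(2)[OF g' z]
     have "m x y z' \<in> A" using yz g' unfolding A_def by force
     then have "b - int k - int (K - k) <= m x y z'" using M0 K k by force
     then have 2: "fps_X ^ N dvd ext V (s (Y (b - int k) x y) z') D -
       (\<Sum>l\<le>K - k. ext V (hs e l (s x z')) (%x' z'. ext V (s y z') (%y'. D (Y (b - int k - int l) x' y'))))"
      using m[OF x y z'] D by blast
     have "(%x' z'. ext V (s y z') (%y'. D (Y (b - int k - int l) x' y'))) = F (k + l)" for l
      unfolding F_def by (simp add: algebra_simps)
     with 2 have 2: "fps_X ^ N dvd C (Y (b - int k) x y) z' - (\<Sum>l\<le>K - k. ext V (hs e l (s x z')) (F (k + l)))"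
      using x y z' by (simp add: CD)
     have "fps_X ^ N dvd (\<Sum>l\<le>K - k. ext V (hs e l (s x z')) (F (k + l))) - (\<Sum>l\<le>K - k. rval (mapf (hasse e l) (Q x z')) (F (k + l)))"
      unfolding sum_subtractf[symmetric] by (intro dvd_sum ext_rep laur_hs ls x z' F rep_hs Q)
     then show "fps_X ^ N dvd C (Y (b - int k) x y) z' - (\<Sum>l\<le>K - k. rval (mapf (hasse e l) (Q x z')) (F (k + l)))"
      by (rule dvd_diff_trans[OF 2])
    qed
   qed
   have "fps_X ^ N dvd (\<Sum>k\<le>K. \<Phi> k y z) - (\<Sum>k\<le>K. rval (mapf (hasse e k) (M z)) (%x z'. \<Sum>l\<le>K - k. rval (mapf (hasse e l) (Q x z')) (F (k + l))))"
    unfolding sum_subtractf[symmetric] by (intro dvd_sum) (simp add: 1)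
   then have 3: "fps_X ^ N dvd (\<Sum>k\<le>K. \<Phi> k y z) - (\<Sum>n\<le>K. rval (mapf (hasse e n) R) (F n))"
    unfolding rval_hasse_bind R_def .
   \<comment> \<open>Applying \<open>t\<close> and then \<open>s\<close> to the pair
     \<open>u\<close>, \<open>z\<close> is the identity, a family constant in the formal variable:
     its Taylor coefficients of positive order vanish, and only \<open>n = 0\<close>
     survives.\<close>
   define \<delta> :: "'v fam" where "\<delta> c B = (if c = 0 then B u z else 0)" for c B
   have rd: "rep V N \<delta> R"
    unfolding rep_def
   proof (intro conjI allI impI)
    show "wf2 V R" unfolding R_def using repD(1)[OF M[OF z]] repD(1)[OF Q] by (intro wf2_bind) auto
    fix a B assume B: "bil V B"
    note H = rbil_hemb[OF B]
    let ?H = "%x y. hemb (B x y)"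
    have "fps_X ^ N dvd ext V (t u z) (%x z'. ext V (s x z') ?H) - rval R ?H"
     unfolding R_def rval_bind
    proof (rule dvd_diff_trans)
     show "fps_X ^ N dvd ext V (t u z) (%x z'. ext V (s x z') ?H) - rval (M z) (%x z'. ext V (s x z') ?H)"
      by (intro ext_rep lt c z op s H M)
     show "fps_X ^ N dvd rval (M z) (%x z'. ext V (s x z') ?H) - rval (M z) (%x z'. rval (Q x z') ?H)"
      by (rule rval_dvd_cong[OF repD(1)[OF M[OF z]]]) (intro ext_rep ls H Q)
    qed
    then have "fps_X ^ N dvd zcoef (hemb (B u z) - rval R ?H) a"
     unfolding ts[OF c(1) z H] zcoef_dvd_iff by (rule spec)
    then show "fps_X ^ N dvd \<delta> a B - lval R a B"
     by (simp add: \<delta>_def zcoef_rval_hemb del: zcoef_nth)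
   qed
   have n0: "fps_X ^ N dvd rval (mapf (hasse e n) R) (F n) - (if n = 0 then F 0 u z else 0)" for n
   proof (cases "n = 0")
    case True
    have "rep V N \<delta> [(1, u, z)]" using c z by (simp add: rep_def \<delta>_def)
    moreover have "mapf (hasse e 0) R = R" by (induction R) (auto simp: mapf_def)
    ultimately show ?thesis using rep_rval_eq[OF rd, of V \<delta> "[(1, u, z)]" "F 0" "F 0"] F True by simp
   next
    case False
    have "hs e n \<delta> c B = 0" for c B
     using False by (simp add: hs_def \<delta>_def gbinomial_0_left del: of_int_add)
    then have "rep V N (hs e n \<delta>) []" by (simp add: rep_def)
    then show ?thesis using rep_rval_eq[OF rep_hs[OF rd, of e n], of V "hs e n \<delta>" "[]" "F n" "F n"] F False by simp
   qed
   have "fps_X ^ N dvd (\<Sum>n\<le>K. rval (mapf (hasse e n) R) (F n)) - (\<Sum>n\<le>K. if n = 0 then F 0 u z else 0)"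
    unfolding sum_subtractf[symmetric] by (intro dvd_sum n0)
   then have "fps_X ^ N dvd (\<Sum>n\<le>K. rval (mapf (hasse e n) R) (F n)) - G y z"
    by (simp add: F_def G_def)
   then show ?thesis by (rule dvd_diff_trans[OF 3])
  qed
  have "rval L (%y z. \<Sum>k\<le>K. \<Phi> k y z) = (\<Sum>k\<le>K. rval L (\<Phi> k))"
   by (induction L) (auto simp: sum.distrib sum_distrib_left)
  moreover have "fps_X ^ N dvd rval L (%y z. \<Sum>k\<le>K. \<Phi> k y z) - rval L G" by (rule rval_dvd_cong_mem) (rule key)
  ultimately have a: "fps_X ^ N dvd (\<Sum>k\<le>K. rval L (\<Phi> k)) - rval L G" by simp
  have b: "fps_X ^ N dvd (\<Sum>k\<le>K. ext V (t v w) (\<Phi> k)) - (\<Sum>k\<le>K. rval L (\<Phi> k))"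
   unfolding sum_subtractf[symmetric] by (intro dvd_sum ext_rep lt c \<Phi> L)
  have d: "fps_X ^ N dvd rval L G - ext V (t v w) G"
   by (intro dvd_diff_sym[OF ext_rep] lt c G L)
  have "ext V (t v w) G = D (Y b u v) w"
   unfolding G_def by (rule ts[OF c(2,3) rbil_Y[OF D c(1)]])
  then have "ext V (t v w) G = ext V (t (Y b u v) w) C" by (simp add: D_def)
  then have "fps_X ^ N dvd (\<Sum>k\<le>K. ext V (t v w) (\<Phi> k)) - ext V (t (Y b u v) w) C"
   using dvd_diff_trans[OF dvd_diff_trans[OF b a] d] by simp
  then show ?thesis unfolding \<Phi>_def by (rule dvd_diff_sym)
 qed
 then show "EX M0::int. ALL b K C. b - int K <= M0 --> rbil V C --> fps_X ^ N dvd ext V (t (Y b u v) w) C -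
    (\<Sum>k\<le>K. ext V (t v w) (%y z. ext V (hs e k (t u z)) (%x. C (Y (b - int k) x y))))" by blast
qed

end

section \<open>Uniqueness of the quantum Yang-Baxter operator\<close>

text \<open>\<open>f\<close> carries \<open>\<theta>\<close> to \<open>\<theta>'\<close>, and only
  second factors from \<open>H\<close> enter: forms that match on \<open>V\<close> times
  \<open>H\<close> already give equal values. The restriction to \<open>H\<close> keeps the
  induction over the first argument within values that are known.\<close>

definition tw :: "(complex fps, 'v, 'm) module_scheme => (complex fps, 'w, 'n) module_scheme => ('v => 'w) => 'v set =>
  'v fam => 'w fam => bool" where
 "tw V V' f H \<theta> \<theta>' \<longleftrightarrow> (ALL c B B'. bil V B --> bil V' B' -->
   (ALL x:carrier V. ALL h:H. B x h = B' (f x) (f h)) --> \<theta> c B = \<theta>' c B')"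

lemma twD: "tw V V' f H \<theta> \<theta>' ==> bil V B ==> bil V' B' ==>
 (!!x h. x \<in> carrier V ==> h \<in> H ==> B x h = B' (f x) (f h)) ==> \<theta> c B = \<theta>' c B'"
 unfolding tw_def by blast

lemma tw_hs: "tw V V' f H \<theta> \<theta>' ==> tw V V' f H (hs e k \<theta>) (hs e k \<theta>')"
 unfolding tw_def hs_def by metis

lemma tw_ext:
 assumes "laur V \<theta>" "laur V' \<theta>'" "tw V V' f H \<theta> \<theta>'" "rbil V C" "rbil V' C'"
  and "!!x h. x \<in> carrier V ==> h \<in> H ==> C x h = C' (f x) (f h)"
 shows "ext V \<theta> C = ext V' \<theta>' C'"
 by (rule ext_cong2[OF assms(1,2,4,5)], rule twD[OF assms(3) rbilD[OF assms(4)] rbilD[OF assms(5)]])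
  (simp add: assms(6))

lemma tw_extI:
 assumes "laur V \<theta>" "laur V' \<theta>'"
  and "!!C C'. rbil V C ==> rbil V' C' ==> (!!x h. x \<in> carrier V ==> h \<in> H ==> C x h = C' (f x) (f h)) ==>
   ext V \<theta> C = ext V' \<theta>' C'"
 shows "tw V V' f H \<theta> \<theta>'"
 unfolding tw_def
proof (intro allI impI)
 fix c B B' assume B: "bil V B" and B': "bil V' B'" and e: "ALL x:carrier V. ALL h:H. B x h = B' (f x) (f h)"
 have "ext V \<theta> (%x y. hemb (B x y)) = ext V' \<theta>' (%x y. hemb (B' x y))"
  by (rule assms(3)[OF rbil_hemb[OF B] rbil_hemb[OF B']]) (simp add: e)
 then show "\<theta> c B = \<theta>' c B'" using ext_hemb[OF assms(1) B, of c] ext_hemb[OF assms(2) B', of c] by simp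
qed

lemma dvd_diff_join: "(d :: 'a::comm_ring_1) dvd a - b ==> d dvd c - b ==> d dvd a - c"
 using dvd_diff_trans[OF _ dvd_diff_sym] by blast

locale prods_hom = V: prods V Y + V': prods V' Y'
 for V :: "(complex fps, 'v, 'm) module_scheme" and Y and V' :: "(complex fps, 'w, 'n) module_scheme" and Y' +
 fixes f :: "'v => 'w" and H :: "'v set"
 assumes f_lin: "f \<in> linear_maps V V'"
  and f_Y: "!!b u v. u \<in> carrier V ==> v \<in> carrier V ==> f (Y b u v) = Y' b (f u) (f v)"
  and H: "H \<subseteq> carrier V"
begin

lemma f_closed [simp]: "x \<in> carrier V ==> f x \<in> carrier V'"
 using f_lin by (auto simp: linear_maps_def)

text \<open>Both identities are truncated at a common \<open>K\<close> beyond the two bounds; the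
  sums then agree term by term.\<close>

lemma tw_approx:
 assumes p: "laur V p" "laur V' p'"
  and M0: "!!N. EX M0. ALL b K C. b - int K <= M0 --> rbil V C --> fps_X ^ N dvd ext V (P b) C - (\<Sum>k\<le>K. G b k C)"
  and M1: "!!N. EX M0. ALL b K C. b - int K <= M0 --> rbil V' C --> fps_X ^ N dvd ext V' (P' b) C - (\<Sum>k\<le>K. G' b k C)"
  and b: "p = P b" "p' = P' b"
  and G: "!!k C C'. rbil V C ==> rbil V' C' ==> (!!x h. x \<in> carrier V ==> h \<in> H ==> C x h = C' (f x) (f h)) ==>
   G b k C = G' b k C'"
 shows "tw V V' f H p p'"
proof (rule tw_extI[OF p])
 fix C C' assume C: "rbil V C" "rbil V' C'" and CC: "!!x h. x \<in> carrier V ==> h \<in> H ==> C x h = C' (f x) (f h)"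
 show "ext V p C = ext V' p' C'"
 proof (rule fps_eq_dvdI)
  fix N
  obtain M0 where M0: "!!K. b - int K <= M0 ==> fps_X ^ N dvd ext V (P b) C - (\<Sum>k\<le>K. G b k C)"
   using M0[of N] C by blast
  obtain M1 where M1: "!!K. b - int K <= M1 ==> fps_X ^ N dvd ext V' (P' b) C' - (\<Sum>k\<le>K. G' b k C')"
   using M1[of N] C by blast
  define K where "K = nat (b - min M0 M1)"
  have K: "b - int K <= M0" "b - int K <= M1" unfolding K_def by auto
  have "(\<Sum>k\<le>K. G b k C) = (\<Sum>k\<le>K. G' b k C')" by (intro sum.cong refl G C CC)
  then show "fps_X ^ N dvd ext V p C - ext V' p' C'"
   using dvd_diff_join[OF M0[OF K(1)]] M1[OF K(2)] by (simp add: b)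
 qed
qed

text \<open>In the hexagon identity the third tensor factor passes through both operators and by
  hypothesis only vectors of \<open>H\<close> matter there; the product acts on the first two
  factors, where \<open>f\<close> respects it.\<close>

lemma tw_Y_A:
 assumes s: "sop V s" and s': "sop V' s'" and hx: "hexA V Y e s" and hx': "hexA V' Y' e s'"
  and u: "u \<in> carrier V" and v: "v \<in> carrier V"
  and tu: "!!h. h \<in> H ==> tw V V' f H (s u h) (s' (f u) (f h))"
  and tv: "!!h. h \<in> H ==> tw V V' f H (s v h) (s' (f v) (f h))" and h: "h \<in> H"
 shows "tw V V' f H (s (Y b u v) h) (s' (f (Y b u v)) (f h))"
proof (rule tw_approx[where P = "%b. s (Y b u v) h" and P' = "%b. s' (Y' b (f u) (f v)) (f h)" and b = b
   and G = "%b k C. ext V (hs e k (s u h)) (%x z. ext V (s v z) (%y. C (Y (b - int k) x y)))"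
   and G' = "%b k C. ext V' (hs e k (s' (f u) (f h))) (%x z. ext V' (s' (f v) z) (%y. C (Y' (b - int k) x y)))"])
 have hc: "h \<in> carrier V" using h H by auto
 show "laur V (s (Y b u v) h)" "laur V' (s' (f (Y b u v)) (f h))"
  using u v hc by (auto intro!: sopD(1)[OF s] sopD(1)[OF s'])
 show "EX M0. ALL b K C. b - int K <= M0 --> rbil V C --> fps_X ^ N dvd ext V (s (Y b u v) h) C - (\<Sum>k\<le>K. ext V (hs e k (s u h)) (%x z. ext V (s v z) (%y. C (Y (b - int k) x y))))" for N
  using hx u v hc unfolding hexA_def by blast
 show "EX M0. ALL b K C. b - int K <= M0 --> rbil V' C --> fps_X ^ N dvd ext V' (s' (Y' b (f u) (f v)) (f h)) C -
   (\<Sum>k\<le>K. ext V' (hs e k (s' (f u) (f h))) (%x z. ext V' (s' (f v) z) (%y. C (Y' (b - int k) x y))))" for N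
  using hx' f_closed[OF u] f_closed[OF v] f_closed[OF hc] unfolding hexA_def by blast
 show "s' (f (Y b u v)) (f h) = s' (Y' b (f u) (f v)) (f h)" by (simp add: f_Y u v)
 fix k C C' assume C: "rbil V C" and C': "rbil V' C'"
  and CC: "!!x h. x \<in> carrier V ==> h \<in> H ==> C x h = C' (f x) (f h)"
 show "ext V (hs e k (s u h)) (%x z. ext V (s v z) (%y. C (Y (b - int k) x y))) =
   ext V' (hs e k (s' (f u) (f h))) (%x z. ext V' (s' (f v) z) (%y. C' (Y' (b - int k) x y)))"
 proof (rule tw_ext[OF _ _ tw_hs[OF tu[OF h]]])
  show "laur V (hs e k (s u h))" "laur V' (hs e k (s' (f u) (f h)))"
   using u hc by (auto intro!: laur_hs sopD(1)[OF s] sopD(1)[OF s'])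
  show "rbil V (%x z. ext V (s v z) (%y. C (Y (b - int k) x y)))" by (rule V.rbil_A[OF s v C])
  show "rbil V' (%x z. ext V' (s' (f v) z) (%y. C' (Y' (b - int k) x y)))" by (rule V'.rbil_A[OF s' f_closed[OF v] C'])
  fix x z assume x: "x \<in> carrier V" and z: "z \<in> H"
  have zc: "z \<in> carrier V" using z H by auto
  show "ext V (s v z) (%y. C (Y (b - int k) x y)) = ext V' (s' (f v) (f z)) (%y. C' (Y' (b - int k) (f x) y))"
  proof (rule tw_ext[OF _ _ tv[OF z]])
   show "laur V (s v z)" "laur V' (s' (f v) (f z))"
    using v zc by (auto intro!: sopD(1)[OF s] sopD(1)[OF s'])
   show "rbil V (%y. C (Y (b - int k) x y))" by (rule V.rbil_Y[OF C x])
   show "rbil V' (%y. C' (Y' (b - int k) (f x) y))" by (rule V'.rbil_Y[OF C' f_closed[OF x]])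
   show "C (Y (b - int k) x y) z' = C' (Y' (b - int k) (f x) (f y)) (f z')" if "y \<in> carrier V" "z' \<in> H" for y z'
    using CC[of "Y (b - int k) x y" z'] that x by (simp add: f_Y)
  qed
 qed
qed (rule refl)

lemma tw_Y_B:
 assumes s: "sop V s" and s': "sop V' s'" and hx: "hexB V Y e s" and hx': "hexB V' Y' e s'"
  and u: "u \<in> carrier V" and v: "v \<in> carrier V"
  and tu: "!!h. h \<in> H ==> tw V V' f H (s u h) (s' (f u) (f h))"
  and tv: "!!h. h \<in> H ==> tw V V' f H (s v h) (s' (f v) (f h))" and h: "h \<in> H"
 shows "tw V V' f H (s (Y b u v) h) (s' (f (Y b u v)) (f h))"
proof (rule tw_approx[where P = "%b. s (Y b u v) h" and P' = "%b. s' (Y' b (f u) (f v)) (f h)" and b = b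
   and G = "%b k C. ext V (s v h) (%y z. ext V (hs e k (s u z)) (%x. C (Y (b - int k) x y)))"
   and G' = "%b k C. ext V' (s' (f v) (f h)) (%y z. ext V' (hs e k (s' (f u) z)) (%x. C (Y' (b - int k) x y)))"])
 have hc: "h \<in> carrier V" using h H by auto
 show "laur V (s (Y b u v) h)" "laur V' (s' (f (Y b u v)) (f h))"
  using u v hc by (auto intro!: sopD(1)[OF s] sopD(1)[OF s'])
 show "EX M0. ALL b K C. b - int K <= M0 --> rbil V C --> fps_X ^ N dvd ext V (s (Y b u v) h) C - (\<Sum>k\<le>K. ext V (s v h) (%y z. ext V (hs e k (s u z)) (%x. C (Y (b - int k) x y))))" for N
  using hx u v hc unfolding hexB_def by blast
 show "EX M0. ALL b K C. b - int K <= M0 --> rbil V' C --> fps_X ^ N dvd ext V' (s' (Y' b (f u) (f v)) (f h)) C -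
   (\<Sum>k\<le>K. ext V' (s' (f v) (f h)) (%y z. ext V' (hs e k (s' (f u) z)) (%x. C (Y' (b - int k) x y))))" for N
  using hx' f_closed[OF u] f_closed[OF v] f_closed[OF hc] unfolding hexB_def by blast
 show "s' (f (Y b u v)) (f h) = s' (Y' b (f u) (f v)) (f h)" by (simp add: f_Y u v)
 fix k C C' assume C: "rbil V C" and C': "rbil V' C'"
  and CC: "!!x h. x \<in> carrier V ==> h \<in> H ==> C x h = C' (f x) (f h)"
 show "ext V (s v h) (%y z. ext V (hs e k (s u z)) (%x. C (Y (b - int k) x y))) =
   ext V' (s' (f v) (f h)) (%y z. ext V' (hs e k (s' (f u) z)) (%x. C' (Y' (b - int k) x y)))"
 proof (rule tw_ext[OF _ _ tv[OF h]])
  show "laur V (s v h)" "laur V' (s' (f v) (f h))"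
   using v hc by (auto intro!: sopD(1)[OF s] sopD(1)[OF s'])
  show "rbil V (%y z. ext V (hs e k (s u z)) (%x. C (Y (b - int k) x y)))" by (rule V.rbil_B[OF sop_hs[OF s] u C])
  show "rbil V' (%y z. ext V' (hs e k (s' (f u) z)) (%x. C' (Y' (b - int k) x y)))"
   by (rule V'.rbil_B[OF sop_hs[OF s'] f_closed[OF u] C'])
  fix y z assume y: "y \<in> carrier V" and z: "z \<in> H"
  have zc: "z \<in> carrier V" using z H by auto
  show "ext V (hs e k (s u z)) (%x. C (Y (b - int k) x y)) = ext V' (hs e k (s' (f u) (f z))) (%x. C' (Y' (b - int k) x (f y)))"
  proof (rule tw_ext[OF _ _ tw_hs[OF tu[OF z]]])
   show "laur V (hs e k (s u z))" "laur V' (hs e k (s' (f u) (f z)))"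
    using u zc by (auto intro!: laur_hs sopD(1)[OF s] sopD(1)[OF s'])
   show "rbil V (%x. C (Y (b - int k) x y))" by (rule V.rbil_Y'[OF C y])
   show "rbil V' (%x. C' (Y' (b - int k) x (f y)))" by (rule V'.rbil_Y'[OF C' f_closed[OF y]])
   show "C (Y (b - int k) x y) z' = C' (Y' (b - int k) (f x) (f y)) (f z')" if "x \<in> carrier V" "z' \<in> H" for x z'
    using CC[of "Y (b - int k) x y" z'] that y by (simp add: f_Y)
  qed
 qed
qed (rule refl)

end

lemma (in pva) prods_nprod: "prods V (%b. nprod V (- b - 1))"
proof
 show "nprod V (- b - 1) u v \<in> carrier V" if "u \<in> carrier V" "v \<in> carrier V" for b u v using that by simp
 show "nprod V (- b - 1) u \<in> linear_maps V V" if "u \<in> carrier V" for b u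
  by (rule linear_mapsI) (use that in \<open>auto simp: nprod_add_r nprod_smult_r\<close>)
 show "(%u. nprod V (- b - 1) u v) \<in> linear_maps V V" if "v \<in> carrier V" for b v
  by (rule linear_mapsI) (use that in \<open>auto simp: nprod_add_l nprod_smult_l\<close>)
qed

text \<open>The admissible first arguments form a closed saturated subalgebra: the values depend
  linearly on them and lie in the separated, torsion-free scalars. The product case stays a
  hypothesis because it depends on which hexagon identity is available.\<close>

lemma tw_generated:
 assumes V: "pva V" and V': "pva V'" and gen: "va_generated V G" and f: "f \<in> linear_maps V V'" and H: "H \<subseteq> carrier V"
  and s: "sop V s" and s': "sop V' s'" and G: "G \<subseteq> carrier V"
  and tG: "!!g h. g \<in> insert (vac V) G ==> h \<in> H ==> tw V V' f H (s g h) (s' (f g) (f h))"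
  and tY: "!!n u v h. u \<in> carrier V ==> v \<in> carrier V ==> (!!h. h \<in> H ==> tw V V' f H (s u h) (s' (f u) (f h))) ==>
   (!!h. h \<in> H ==> tw V V' f H (s v h) (s' (f v) (f h))) ==> h \<in> H ==>
   tw V V' f H (s (nprod V n u v) h) (s' (f (nprod V n u v)) (f h))"
  and u: "u \<in> carrier V" and h: "h \<in> H"
 shows "tw V V' f H (s u h) (s' (f u) (f h))"
proof -
 interpret V: pva V by fact
 interpret V': pva V' by fact
 interpret f: tlin V V' f using f by unfold_locales
 define A where "A = {u \<in> carrier V. ALL h:H. tw V V' f H (s u h) (s' (f u) (f h))}"
 have Ac: "A \<subseteq> carrier V" by (auto simp: A_def)
 have AI: "u \<in> A" if "u \<in> carrier V"
  "!!h c B B'. h \<in> H ==> h \<in> carrier V ==> bil V B ==> bil V' B' ==> ALL x:carrier V. ALL h:H. B x h = B' (f x) (f h) ==>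
   s u h c B = s' (f u) (f h) c B'" for u
  using that H unfolding A_def tw_def by blast
 have AD: "s u h c B = s' (f u) (f h) c B'" if "u \<in> A" "h \<in> H" "bil V B" "bil V' B'"
  "ALL x:carrier V. ALL h:H. B x h = B' (f x) (f h)" for u h c B B'
  using that unfolding A_def tw_def by blast
 note b = bilD[OF sopD(2)[OF s]] and b' = bilD[OF sopD(2)[OF s']]
 have add: "u \<oplus>\<^bsub>V\<^esub> v \<in> A" if "u \<in> A" "v \<in> A" for u v
 proof (rule AI)
  have uv: "u \<in> carrier V" "v \<in> carrier V" using that Ac by auto
  then show "u \<oplus>\<^bsub>V\<^esub> v \<in> carrier V" by simp
  fix h c B B' assume h: "h \<in> H" "h \<in> carrier V" "bil V B" "bil V' B'" "ALL x:carrier V. ALL h:H. B x h = B' (f x) (f h)"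
  show "s (u \<oplus>\<^bsub>V\<^esub> v) h c B = s' (f (u \<oplus>\<^bsub>V\<^esub> v)) (f h) c B'"
   using AD[OF that(1) h(1,3-5)] AD[OF that(2) h(1,3-5)] uv h by (simp add: f.add b(1) b'(1))
 qed
 have smult: "d \<odot>\<^bsub>V\<^esub> u \<in> A" if "u \<in> A" for u d
 proof (rule AI)
  have uv: "u \<in> carrier V" using that Ac by auto
  then show "d \<odot>\<^bsub>V\<^esub> u \<in> carrier V" by simp
  fix h c B B' assume h: "h \<in> H" "h \<in> carrier V" "bil V B" "bil V' B'" "ALL x:carrier V. ALL h:H. B x h = B' (f x) (f h)"
  show "s (d \<odot>\<^bsub>V\<^esub> u) h c B = s' (f (d \<odot>\<^bsub>V\<^esub> u)) (f h) c B'"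
   using AD[OF that h(1,3-5)] uv h by (simp add: f.smult b(3) b'(3))
 qed
 have vA: "vac V \<in> A" and GA: "G \<subseteq> A" using tG G by (auto simp: A_def)
 have zA: "\<zero>\<^bsub>V\<^esub> \<in> A" using smult[OF vA, of 0] by simp
 have "va_subalgebra V A"
  unfolding va_subalgebra_def
 proof (intro conjI allI ballI)
  show "submodule A HR V"
  proof (rule V.submoduleI)
   show "\<ominus>\<^bsub>V\<^esub> u \<in> A" if "u \<in> A" for u
    using smult[OF that, of "- 1"] V.neg_as_smult[of u] that Ac by auto
  qed (use Ac zA add smult in auto)
  show "vac V \<in> A" by fact
  show "nprod V n u v \<in> A" if "u \<in> A" "v \<in> A" for n u v
   using that tY[of u v _ n] by (auto simp: A_def)
 qed
 moreover have "hclosure V A = A"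
 proof
  show "A \<subseteq> hclosure V A" unfolding hclosure_def using Ac by (auto intro!: bexI)
  show "hclosure V A \<subseteq> A"
  proof
   fix u assume u: "u \<in> hclosure V A"
   then have uc: "u \<in> carrier V" by (simp add: hclosure_def)
   show "u \<in> A"
   proof (rule AI[OF uc])
    fix h c B B' assume h: "h \<in> H" "h \<in> carrier V" "bil V B" "bil V' B'" "ALL x:carrier V. ALL h:H. B x h = B' (f x) (f h)"
    show "s u h c B = s' (f u) (f h) c B'"
    proof (rule fps_eq_dvdI)
     fix N
     obtain k where k: "k \<in> A" "u \<ominus>\<^bsub>V\<^esub> k \<in> hpow V N" using u by (auto simp: hclosure_def hcong_def)
     then obtain w where w: "w \<in> carrier V" "u \<ominus>\<^bsub>V\<^esub> k = fps_X ^ N \<odot>\<^bsub>V\<^esub> w" by (auto simp: hpow_def)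
     have kc: "k \<in> carrier V" using k Ac by auto
     have ue: "u = fps_X ^ N \<odot>\<^bsub>V\<^esub> w \<oplus>\<^bsub>V\<^esub> k" using V.add_minus_cancel[OF uc kc] w by simp
     show "fps_X ^ N dvd s u h c B - s' (f u) (f h) c B'"
      unfolding ue using w(1) kc h AD[OF k(1) h(1,3-5)] by (simp add: f.add f.smult b b')
    qed
   qed
  qed
 qed
 moreover have "saturate V A = A"
 proof
  show "A \<subseteq> saturate V A" unfolding saturate_def using Ac by (auto intro!: exI[of _ 0])
  show "saturate V A \<subseteq> A"
  proof
   fix u assume "u \<in> saturate V A"
   then obtain n where uc: "u \<in> carrier V" and n: "fps_X ^ n \<odot>\<^bsub>V\<^esub> u \<in> A" by (auto simp: saturate_def)
   show "u \<in> A"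
   proof (rule AI[OF uc])
    fix h c B B' assume h: "h \<in> H" "h \<in> carrier V" "bil V B" "bil V' B'" "ALL x:carrier V. ALL h:H. B x h = B' (f x) (f h)"
    show "s u h c B = s' (f u) (f h) c B'"
     using AD[OF n h(1,3-5), of c] uc h by (simp add: f.smult b b')
   qed
  qed
 qed
 ultimately have "A = carrier V" using gen GA unfolding va_generated_def by blast
 then show ?thesis using u h by (auto simp: A_def)
qed

section \<open>The quantum Yang-Baxter operator on bilinear forms\<close>

lemma wf_list_nth: "wf_list V n xs ==> i < n ==> xs ! i \<in> carrier V"
 by (auto simp: wf_list_def)

lemma wf_list_Cons [simp]: "wf_list V (Suc n) (x # xs) \<longleftrightarrow> x \<in> carrier V & wf_list V n xs"
 by (auto simp: wf_list_def)

lemma wf_list_0 [simp]: "wf_list V 0 []"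
 by (simp add: wf_list_def)

lemma wf_list_2 [simp]: "wf_list V 2 [x, y] \<longleftrightarrow> x \<in> carrier V & y \<in> carrier V"
 by (auto simp: wf_list_def)

lemma wf_list_update: "wf_list V n xs ==> x \<in> carrier V ==> wf_list V n (xs[i := x])"
 using set_update_subset_insert[of xs i x] by (auto simp: wf_list_def)

lemma mlinI':
 assumes "!!xs i u v. wf_list V n xs ==> i < n ==> u \<in> carrier V ==> v \<in> carrier V ==>
   B (xs[i := u \<oplus>\<^bsub>V\<^esub> v]) = B (xs[i := u]) + B (xs[i := v])"
  and "!!xs i u c. wf_list V n xs ==> i < n ==> u \<in> carrier V ==> B (xs[i := c \<odot>\<^bsub>V\<^esub> u]) = c * B (xs[i := u])"
 shows "mlin V n B"
 using assms by (auto simp: mlin_def wf_list_def)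

lemma mlinD':
 assumes "mlin V n B" "wf_list V n xs" "i < n"
 shows "u \<in> carrier V ==> v \<in> carrier V ==> B (xs[i := u \<oplus>\<^bsub>V\<^esub> v]) = B (xs[i := u]) + B (xs[i := v])"
  "u \<in> carrier V ==> B (xs[i := c \<odot>\<^bsub>V\<^esub> u]) = c * B (xs[i := u])"
 using assms by (auto simp: mlin_def wf_list_def)

lemma wf_list_2E:
 assumes "wf_list V 2 xs" obtains a b where "xs = [a, b]" "a \<in> carrier V" "b \<in> carrier V"
 using assms by (auto simp: wf_list_def numeral_2_eq_2 length_Suc_conv)

lemma mlin_bil: assumes B: "bil V B" shows "mlin V 2 (%ys. B (ys ! 0) (ys ! 1))"
proof (rule mlinI')
 fix xs i u v assume xs: "wf_list V 2 xs" and i: "i < (2::nat)" and uv: "u \<in> carrier V" "v \<in> carrier V"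
 obtain a b where "xs = [a, b]" "a \<in> carrier V" "b \<in> carrier V" using xs by (rule wf_list_2E)
 then show "B (xs[i := u \<oplus>\<^bsub>V\<^esub> v] ! 0) (xs[i := u \<oplus>\<^bsub>V\<^esub> v] ! 1) =
   B (xs[i := u] ! 0) (xs[i := u] ! 1) + B (xs[i := v] ! 0) (xs[i := v] ! 1)"
  using i uv bilD(1,2)[OF B] by (auto simp: less_2_cases_iff)
next
 fix xs i u c assume xs: "wf_list V 2 xs" and i: "i < (2::nat)" and uv: "u \<in> carrier V"
 obtain a b where "xs = [a, b]" "a \<in> carrier V" "b \<in> carrier V" using xs by (rule wf_list_2E)
 then show "B (xs[i := c \<odot>\<^bsub>V\<^esub> u] ! 0) (xs[i := c \<odot>\<^bsub>V\<^esub> u] ! 1) = c * B (xs[i := u] ! 0) (xs[i := u] ! 1)"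
  using i uv bilD(3,4)[OF B] by (auto simp: less_2_cases_iff)
qed

lemma bil_mlin: assumes "mlin V 2 B" shows "bil V (%x y. B [x, y])"
proof (rule bilI)
 fix u v w assume h: "u \<in> carrier V" "v \<in> carrier V" "w \<in> carrier V"
 show "B [u \<oplus>\<^bsub>V\<^esub> v, w] = B [u, w] + B [v, w]" using mlinD'(1)[OF assms, of "[u, w]" 0 u v] h by simp
 show "B [w, u \<oplus>\<^bsub>V\<^esub> v] = B [w, u] + B [w, v]" using mlinD'(1)[OF assms, of "[w, u]" 1 u v] h by simp
next
 fix c u w assume h: "u \<in> carrier V" "w \<in> carrier V"
 show "B [c \<odot>\<^bsub>V\<^esub> u, w] = c * B [u, w]" using mlinD'(2)[OF assms, of "[u, w]" 0 u] h by simp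
 show "B [w, c \<odot>\<^bsub>V\<^esub> u] = c * B [w, u]" using mlinD'(2)[OF assms, of "[w, u]" 1 u] h by simp
qed

lemma mlin_two_slots:
 assumes B: "mlin V n B" and xs: "wf_list V n xs" and ij: "i < n" "j < n" "i ~= j"
 shows "mlin V 2 (%ys. B (xs[i := ys ! 0, j := ys ! 1]))"
proof -
 have "bil V (%x y. B (xs[i := x, j := y]))"
 proof (rule bilI)
  fix u v w assume h: "u \<in> carrier V" "v \<in> carrier V" "w \<in> carrier V"
  show "B (xs[i := u \<oplus>\<^bsub>V\<^esub> v, j := w]) = B (xs[i := u, j := w]) + B (xs[i := v, j := w])"
   using mlinD'(1)[OF B wf_list_update[OF xs h(3)] ij(1) h(1,2), of j] ij by (simp add: list_update_swap)
  show "B (xs[i := w, j := u \<oplus>\<^bsub>V\<^esub> v]) = B (xs[i := w, j := u]) + B (xs[i := w, j := v])"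
   by (rule mlinD'(1)[OF B wf_list_update[OF xs h(3)] ij(2) h(1,2)])
 next
  fix c u w assume h: "u \<in> carrier V" "w \<in> carrier V"
  show "B (xs[i := c \<odot>\<^bsub>V\<^esub> u, j := w]) = c * B (xs[i := u, j := w])"
   using mlinD'(2)[OF B wf_list_update[OF xs h(2)] ij(1) h(1), of j] ij by (simp add: list_update_swap)
  show "B (xs[i := w, j := c \<odot>\<^bsub>V\<^esub> u]) = c * B (xs[i := w, j := u])"
   by (rule mlinD'(2)[OF B wf_list_update[OF xs h(2)] ij(2) h(1)])
 qed
 then show ?thesis by (rule mlin_bil)
qed

context tfree
begin

lemma pure_add: "wf_list V n xs ==> i < n ==> u \<in> carrier V ==> v \<in> carrier V ==>
 pure V (xs[i := u \<oplus> v]) = (%B. pure V (xs[i := u]) B + pure V (xs[i := v]) B)"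
 using mlinD'(1)[of V n _ xs i u v] by (auto simp: pure_def wf_list_def)

lemma pure_smult: "wf_list V n xs ==> i < n ==> u \<in> carrier V ==>
 pure V (xs[i := c \<odot> u]) = (%B. c * pure V (xs[i := u]) B)"
 using mlinD'(2)[of V n _ xs i u c] by (auto simp: pure_def wf_list_def)

text \<open>In a slot acted on by \<open>P\<close> linearity comes from \<open>P\<close> itself; in
  any other slot it comes from the linearity of the tensor \<open>P t\<close> as a functional on
  forms.\<close>

lemma op_at_mlin:
 assumes P: "P \<in> linear_maps (ctens V 2) (ctens V 2)" and ij: "i < n" "j < n" "i ~= j" and B: "mlin V n B"
 shows "mlin V n (%xs. P (pure V [xs ! i, xs ! j]) (%ys. B (xs[i := ys ! 0, j := ys ! 1])))"
proof -
 have Pa: "P (%B. s B + t B) = (%B. P s B + P t B)" if "s \<in> carrier (ctens V 2)" "t \<in> carrier (ctens V 2)" for s t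
  using P that by (auto simp: linear_maps_def)
 have Ps: "P (%B. c * t B) = (%B. c * P t B)" if "t \<in> carrier (ctens V 2)" for c t
  using P that by (auto simp: linear_maps_def)
 have Pc: "P t \<in> carrier (ctens V 2)" if "t \<in> carrier (ctens V 2)" for t
  using P that by (auto simp: linear_maps_def)
 have pc: "pure V [x, y] \<in> carrier (ctens V 2)" if "x \<in> carrier V" "y \<in> carrier V" for x y
  using that by (intro pure_ctens) auto
 have nth: "xs ! i \<in> carrier V" "xs ! j \<in> carrier V" if "wf_list V n xs" for xs
  using that ij wf_list_nth by auto
 have len: "length xs = n" if "wf_list V n xs" for xs using that by (simp add: wf_list_def)
 show ?thesis
 proof (rule mlinI')
  fix xs k u v assume xs: "wf_list V n xs" and k: "k < n" and u: "u \<in> carrier V" and v: "v \<in> carrier V"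
  note n = nth[OF xs] and l = len[OF xs]
  consider "k = i" | "k = j" | "k ~= i" "k ~= j" by blast
  then show "P (pure V [xs[k := u \<oplus> v] ! i, xs[k := u \<oplus> v] ! j]) (%ys. B (xs[k := u \<oplus> v, i := ys ! 0, j := ys ! 1])) =
   P (pure V [xs[k := u] ! i, xs[k := u] ! j]) (%ys. B (xs[k := u, i := ys ! 0, j := ys ! 1])) +
   P (pure V [xs[k := v] ! i, xs[k := v] ! j]) (%ys. B (xs[k := v, i := ys ! 0, j := ys ! 1]))"
  proof cases
   case 1
   have "pure V [u \<oplus> v, xs ! j] = (%B. pure V [u, xs ! j] B + pure V [v, xs ! j] B)"
    using pure_add[of 2 "[u, xs ! j]" 0 u v] n u v by simp
   then show ?thesis using 1 ij k n l u v by (simp add: Pa pc)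
  next
   case 2
   have "pure V [xs ! i, u \<oplus> v] = (%B. pure V [xs ! i, u] B + pure V [xs ! i, v] B)"
    using pure_add[of 2 "[xs ! i, u]" 1 u v] n u v by simp
   moreover have "xs[k := w, i := a, j := b] = xs[i := a, j := b]" for w a b
    using 2 ij by (simp add: list_update_swap[of j i])
   ultimately show ?thesis using 2 ij k n l u v by (simp add: Pa pc)
  next
   case 3
   have e: "xs[k := w, i := a, j := b] = xs[i := a, j := b, k := w]" for w a b
    using 3 by (simp add: list_update_swap)
   have "P (pure V [xs ! i, xs ! j]) (%ys. B (xs[i := ys ! 0, j := ys ! 1, k := u \<oplus> v])) =
    P (pure V [xs ! i, xs ! j]) (%ys. B (xs[i := ys ! 0, j := ys ! 1, k := u]) + B (xs[i := ys ! 0, j := ys ! 1, k := v]))"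
   proof (rule ctens_cong[OF _ Pc[OF pc[OF n]]])
    fix ys assume ys: "wf_list V 2 ys"
    then have "ys ! 0 \<in> carrier V" "ys ! 1 \<in> carrier V" by (auto intro: wf_list_nth)
    then show "B (xs[i := ys ! 0, j := ys ! 1, k := u \<oplus> v]) = B (xs[i := ys ! 0, j := ys ! 1, k := u]) + B (xs[i := ys ! 0, j := ys ! 1, k := v])"
     by (intro mlinD'(1)[OF B _ k u v] wf_list_update xs)
   qed simp
   also have "... = P (pure V [xs ! i, xs ! j]) (%ys. B (xs[i := ys ! 0, j := ys ! 1, k := u])) +
    P (pure V [xs ! i, xs ! j]) (%ys. B (xs[i := ys ! 0, j := ys ! 1, k := v]))"
    unfolding e[symmetric]
    by (rule ctens_add[OF _ Pc[OF pc[OF n]] mlin_two_slots[OF B wf_list_update[OF xs u] ij]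
      mlin_two_slots[OF B wf_list_update[OF xs v] ij]]) simp
   finally show ?thesis using 3 by (simp add: e)
  qed
 next
  fix xs k u c assume xs: "wf_list V n xs" and k: "k < n" and u: "u \<in> carrier V"
  note n = nth[OF xs] and l = len[OF xs]
  consider "k = i" | "k = j" | "k ~= i" "k ~= j" by blast
  then show "P (pure V [xs[k := c \<odot> u] ! i, xs[k := c \<odot> u] ! j]) (%ys. B (xs[k := c \<odot> u, i := ys ! 0, j := ys ! 1])) =
   c * P (pure V [xs[k := u] ! i, xs[k := u] ! j]) (%ys. B (xs[k := u, i := ys ! 0, j := ys ! 1]))"
  proof cases
   case 1
   have "pure V [c \<odot> u, xs ! j] = (%B. c * pure V [u, xs ! j] B)"
    using pure_smult[of 2 "[u, xs ! j]" 0 u] n u by simp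
   then show ?thesis using 1 ij k n l u by (simp add: Ps pc)
  next
   case 2
   have "pure V [xs ! i, c \<odot> u] = (%B. c * pure V [xs ! i, u] B)"
    using pure_smult[of 2 "[xs ! i, u]" 1 u] n u by simp
   moreover have "xs[k := w, i := a, j := b] = xs[i := a, j := b]" for w a b
    using 2 ij by (simp add: list_update_swap[of j i])
   ultimately show ?thesis using 2 ij k n l u by (simp add: Ps pc)
  next
   case 3
   have e: "xs[k := w, i := a, j := b] = xs[i := a, j := b, k := w]" for w a b
    using 3 by (simp add: list_update_swap)
   have "P (pure V [xs ! i, xs ! j]) (%ys. B (xs[i := ys ! 0, j := ys ! 1, k := c \<odot> u])) =
    P (pure V [xs ! i, xs ! j]) (%ys. c * B (xs[i := ys ! 0, j := ys ! 1, k := u]))"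
   proof (rule ctens_cong[OF _ Pc[OF pc[OF n]]])
    fix ys assume ys: "wf_list V 2 ys"
    then have "ys ! 0 \<in> carrier V" "ys ! 1 \<in> carrier V" by (auto intro: wf_list_nth)
    then show "B (xs[i := ys ! 0, j := ys ! 1, k := c \<odot> u]) = c * B (xs[i := ys ! 0, j := ys ! 1, k := u])"
     by (intro mlinD'(2)[OF B _ k u] wf_list_update xs)
   qed simp
   also have "... = c * P (pure V [xs ! i, xs ! j]) (%ys. B (xs[i := ys ! 0, j := ys ! 1, k := u]))"
    unfolding e[symmetric]
    by (rule ctens_mult[OF _ Pc[OF pc[OF n]] mlin_two_slots[OF B wf_list_update[OF xs u] ij]]) simp
   finally show ?thesis using 3 by (simp add: e)
  qed
 qed
qed

lemma op_at_linear:
 assumes P: "P \<in> linear_maps (ctens V 2) (ctens V 2)" and ij: "i < n" "j < n" "i ~= j"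
 shows "op_at V n P i j \<in> linear_maps (ctens V n) (ctens V n)"
 unfolding op_at_def
proof (rule lift_tens_linear)
 show "tfree V" "tfree V" by unfold_locales
 show "0 < n" "0 < n" using ij by auto
 show "mlin V n (%xs. P (pure V [xs ! i, xs ! j]) (%ys. B (xs[i := ys ! 0, j := ys ! 1])))" if "mlin V n B" for B
  by (rule op_at_mlin[OF P ij that])
 fix xs N assume xs: "wf_list V n xs"
 have "P (pure V [xs ! i, xs ! j]) \<in> carrier (ctens V 2)"
  using P pure_ctens[of 2 "[xs ! i, xs ! j]"] wf_list_nth[OF xs] ij by (auto simp: linear_maps_def)
 then obtain L where L: "approx V 2 N (P (pure V [xs ! i, xs ! j])) L" by (auto simp: ctens_iff')
 let ?L = "map (%(c, ys). (c, xs[i := ys ! 0, j := ys ! 1])) L"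
 have "val ?L B = val L (%ys. B (xs[i := ys ! 0, j := ys ! 1]))" for B by (induction L) auto
 moreover have "wf_comb V n ?L"
  using approxD(1)[OF L]
 proof (induction L)
  case (Cons p L)
  obtain c ys where p: "p = (c, ys)" by fastforce
  have "wf_list V 2 ys" using Cons(2) p by (simp add: wf_list_def)
  then have "wf_list V n (xs[i := ys ! 0, j := ys ! 1])" by (intro wf_list_update xs) (auto intro: wf_list_nth)
  then show ?case using Cons by (simp add: p wf_list_def)
 qed simp
 ultimately have "approx V n N (%B. P (pure V [xs ! i, xs ! j]) (%ys. B (xs[i := ys ! 0, j := ys ! 1]))) ?L"
  using approxD(2)[OF L mlin_two_slots[OF _ xs ij]] by (simp add: approx_def)
 then show "EX L. approx V n N (%B. P (pure V [xs ! i, xs ! j]) (%ys. B (xs[i := ys ! 0, j := ys ! 1]))) L" by blast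
qed

lemma op_at_eval: "mlin V n B ==> op_at V n P i j t B = t (%xs. P (pure V [xs ! i, xs ! j]) (%ys. B (xs[i := ys ! 0, j := ys ! 1])))"
 by (simp add: op_at_def lift_tens_def)

end

text \<open>The operator seen through bilinear forms; the lists of length two that underlie the
  tensor square are unpacked here once and for all.\<close>

definition biop :: "(complex fps, 'v, 'm) module_scheme => (int => 'v tens => 'v tens) => 'v op" where
 "biop V S x y c B = S c (pure V [x, y]) (%ys. B (ys ! 0) (ys ! 1))"

locale qyb = tfree V + va V for V :: "'v hva" (structure) +
 fixes S :: "int => 'v tens => 'v tens"
 assumes quantum: "quantum_va V S"
begin

lemma S_lin: "S c \<in> linear_maps (ctens V 2) (ctens V 2)"
 using quantum by (simp add: quantum_va_def)

lemma pure2 [simp]: "x \<in> carrier V ==> y \<in> carrier V ==> pure V [x, y] \<in> carrier (ctens V 2)"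
 by (rule pure_ctens) auto

lemma S_closed: "t \<in> carrier (ctens V 2) ==> S c t \<in> carrier (ctens V 2)"
 using S_lin[of c] by (auto simp: linear_maps_def)

lemma S_bil: "x \<in> carrier V ==> y \<in> carrier V ==> S c (pure V [x, y]) B = biop V S x y c (%x y. B [x, y])"
 unfolding biop_def
proof (rule ctens_cong[where n = 2 and t = "S c (pure V [x, y])"])
 fix xs assume "wf_list V 2 xs"
 then show "B xs = B [xs ! 0, xs ! 1]" by (rule wf_list_2E) simp
qed (auto intro: S_closed)

text \<open>Modulo \<open>h ^ N\<close> the Laurent condition on \<open>S\<close> leaves finitely
  many terms \<open>t \<otimes> f(z)\<close>, and each \<open>t\<close> is in turn replaced by a
  finite sum of pure tensors.\<close>

lemma laur_biop:
 assumes xy: "x \<in> carrier V" "y \<in> carrier V"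
 shows "laur V (biop V S x y)"
 unfolding laur_def
proof
 fix N
 obtain ts :: "('v tens \<times> complex fls) list" where ts: "fst ` set ts \<subseteq> carrier (ctens V 2)"
  "!!c B. fps_X ^ N dvd S c (pure V [x, y]) B - (\<Sum>(t, f)\<leftarrow>ts. fps_const (f $$ c) * t B)"
  using quantum pure2[OF xy] unfolding quantum_va_def laurent_tens_def by meson
 have "EX L. wf2 V L & (ALL c B. bil V B -->
   fps_X ^ N dvd (\<Sum>(t, f)\<leftarrow>ts. fps_const (f $$ c) * t (%ys. B (ys ! 0) (ys ! 1))) - lval L c B)"
  using ts(1)
 proof (induction ts)
  case Nil
  then show ?case by (intro exI[of _ "[]"]) simp
 next
  case (Cons p ts)
  obtain t f where p: "p = (t, f)" by fastforce
  obtain L where L: "wf2 V L" "!!c B. bil V B ==>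
   fps_X ^ N dvd (\<Sum>(t, f)\<leftarrow>ts. fps_const (f $$ c) * t (%ys. B (ys ! 0) (ys ! 1))) - lval L c B"
   using Cons by auto
  have "t \<in> carrier (ctens V 2)" using Cons(2) p by simp
  then obtain A where A: "approx V 2 N t A" by (meson ctens_iff' zero_less_numeral)
  let ?A = "map (%(c, ys). (f, c \<odot> (ys ! 0), ys ! 1)) A"
  have "wf2 V ?A & (ALL c B. bil V B --> lval ?A c B = fps_const (f $$ c) * val A (%ys. B (ys ! 0) (ys ! 1)))"
   using approxD(1)[OF A]
  proof (induction A)
   case (Cons q A)
   obtain c ys where q: "q = (c, ys)" by fastforce
   have "wf_list V 2 ys" using Cons(2) q by (simp add: wf_list_def)
   then have "ys ! 0 \<in> carrier V" "ys ! 1 \<in> carrier V" by (auto intro: wf_list_nth)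
   then show ?case using Cons by (auto simp: q bilD algebra_simps)
  qed simp
  then have A': "wf2 V ?A" "!!c B. bil V B ==> lval ?A c B = fps_const (f $$ c) * val A (%ys. B (ys ! 0) (ys ! 1))"
   by blast+
  have "fps_X ^ N dvd (\<Sum>(t, f)\<leftarrow>p # ts. fps_const (f $$ c) * t (%ys. B (ys ! 0) (ys ! 1))) - lval (?A @ L) c B"
   if B: "bil V B" for c B
   using dvd_add[OF dvd_mult[OF approxD(2)[OF A mlin_bil[OF B]], of "fps_const (f $$ c)"] L(2)[OF B, of c]]
   unfolding lc_simps A'(2)[OF B] by (simp add: p algebra_simps)
  then show ?case using A'(1) L(1) by (intro exI[of _ "?A @ L"]) (simp del: lc_simps add: lc_simps(3))
 qed
 then obtain L where "wf2 V L" "!!c B. bil V B ==>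
   fps_X ^ N dvd (\<Sum>(t, f)\<leftarrow>ts. fps_const (f $$ c) * t (%ys. B (ys ! 0) (ys ! 1))) - lval L c B" by blast
 then have "rep V N (biop V S x y) L"
  unfolding rep_def biop_def using dvd_diff_trans[OF ts(2)] by blast
 then show "EX L. rep V N (biop V S x y) L" by blast
qed

lemma sop_biop: "sop V (biop V S)"
 unfolding sop_def
proof (intro conjI ballI allI impI)
 show "laur V (biop V S x y)" if "x \<in> carrier V" "y \<in> carrier V" for x y using that by (rule laur_biop)
 fix c B assume "bil V B"
 have a: "S c (%B. s B + t B) = (%B. S c s B + S c t B)" if "s \<in> carrier (ctens V 2)" "t \<in> carrier (ctens V 2)" for s t
  using S_lin[of c] that by (auto simp: linear_maps_def)
 have sm: "S c (%B. d * t B) = (%B. d * S c t B)" if "t \<in> carrier (ctens V 2)" for d t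
  using S_lin[of c] that by (auto simp: linear_maps_def)
 show "bil V (%x y. biop V S x y c B)"
  unfolding biop_def
 proof (rule bilI)
  fix u v w assume h: "u \<in> carrier V" "v \<in> carrier V" "w \<in> carrier V"
  let ?B = "%ys. B (ys ! 0) (ys ! 1)"
  show "S c (pure V [u \<oplus> v, w]) ?B = S c (pure V [u, w]) ?B + S c (pure V [v, w]) ?B"
   using pure_add[of 2 "[u, w]" 0 u v] h by (simp add: a)
  show "S c (pure V [w, u \<oplus> v]) ?B = S c (pure V [w, u]) ?B + S c (pure V [w, v]) ?B"
   using pure_add[of 2 "[w, u]" 1 u v] h by (simp add: a)
 next
  fix d u w assume h: "u \<in> carrier V" "w \<in> carrier V"
  let ?B = "%ys. B (ys ! 0) (ys ! 1)"
  show "S c (pure V [d \<odot> u, w]) ?B = d * S c (pure V [u, w]) ?B"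
   using pure_smult[of 2 "[u, w]" 0 u d] h by (simp add: sm)
  show "S c (pure V [w, d \<odot> u]) ?B = d * S c (pure V [w, u]) ?B"
   using pure_smult[of 2 "[w, u]" 1 u d] h by (simp add: sm)
 qed
qed

lemma biop_vac:
 assumes "v \<in> carrier V" "bil V B"
 shows "biop V S (vac V) v c B = (if c = 0 then B (vac V) v else 0)"
proof -
 have "S c (pure V [vac V, v]) = (if c = 0 then pure V [vac V, v] else \<zero>\<^bsub>ctens V 2\<^esub>)"
  using quantum assms(1) by (simp add: quantum_va_def)
 then show ?thesis using mlin_bil[OF assms(2)] by (simp add: biop_def pure_def numeral_2_eq_2)
qed

end

section \<open>Truncation of composites and compatibility with reflection and flip\<close>

lemma lval_lower: "EX A. ALL c<A. ALL B. lval L c B = 0"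
proof (induction L)
 case (Cons p L)
 obtain f x y where p: "p = (f, x, y)" by (cases p) auto
 obtain A where A: "ALL c<A. ALL B. lval L c B = 0" using Cons by blast
 show ?case
  by (rule exI[of _ "min A (fls_subdegree f)"]) (use A in \<open>auto simp: p\<close>)
qed simp

text \<open>The second bound is uniform in the form, since truncation of a finite list depends only
  on its Laurent series. It is what shows the infinite sums in the axioms to be summable.\<close>

lemma lval_bind_sum:
 shows "EX P0. ALL P>=P0. fps_X ^ N dvd lval (lc_bind L Q) a B - (\<Sum>p = - P..P. lval L (a - p) (%x y. lval (Q x y) p B))"
  and "EX P0. ALL p B. P0 < \<bar>p\<bar> --> lval L (a - p) (%x y. lval (Q x y) p (B x y)) = 0"
proof -
 show "EX P0. ALL P>=P0. fps_X ^ N dvd lval (lc_bind L Q) a B - (\<Sum>p = - P..P. lval L (a - p) (%x y. lval (Q x y) p B))"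
  using zcoef_rval[of N L "%x y. rval (Q x y) (%x y. hemb (B x y))" a] unfolding rval_bind[symmetric] zcoef_rval_hemb .
 obtain A where A: "ALL c<A. ALL B. lval L c B = 0" using lval_lower by blast
 have "EX A'. ALL p<A'. ALL c B. lval L c (%x y. lval (Q x y) p (B x y)) = 0"
 proof (induction L)
  case (Cons q L)
  obtain f x y where q: "q = (f, x, y)" by (cases q) auto
  obtain A1 where A1: "ALL p<A1. ALL c B. lval L c (%x y. lval (Q x y) p (B x y)) = 0" using Cons by blast
  obtain A2 where A2: "ALL p<A2. ALL B. lval (Q x y) p B = 0" using lval_lower by blast
  show ?case by (rule exI[of _ "min A1 A2"]) (use A1 A2 in \<open>auto simp: q\<close>)
 qed simp
 then obtain A' where A': "ALL p<A'. ALL c B. lval L c (%x y. lval (Q x y) p (B x y)) = 0" by blast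
 have "lval L (a - p) (%x y. lval (Q x y) p (B x y)) = 0" if "max \<bar>A'\<bar> \<bar>a - A\<bar> < \<bar>p\<bar>" for p B
 proof -
  have "a - p < A | p < A'" using that by linarith
  then show ?thesis using A A' by auto
 qed
 then show "EX P0. ALL p B. P0 < \<bar>p\<bar> --> lval L (a - p) (%x y. lval (Q x y) p (B x y)) = 0" by blast
qed

lemma fneg_add: "fneg (F + G) = fneg F + fneg G"
 by (rule fps_ext) (simp add: flneg_add)

lemma fneg_const: "fneg (fps_const f) = fps_const (flneg f)"
proof (rule fps_ext)
 fix n show "fneg (fps_const f) $ n = fps_const (flneg f) $ n" using flneg_const[of 0] by (cases n) simp_all
qed

lemma fneg_dvd: "fps_X ^ N dvd F ==> fps_X ^ N dvd fneg F"
 using flneg_const[of 0] unfolding fps_X_power_dvd_iff by simp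

lemma zcoef_fneg: "zcoef (fneg F) d = fps_const ((- 1) powi d) * zcoef F d"
 by (rule fps_ext) simp

lemma rbil_fneg: "rbil V C ==> rbil V (%x y. fneg (C x y))"
 unfolding rbil_def zcoef_fneg by (auto simp: bil_def flin_def algebra_simps)

lemma ext_ng:
 assumes s: "laur V \<theta>" and s': "laur V (ng \<theta>)" and C: "rbil V C"
 shows "ext V (ng \<theta>) (%x y. fneg (C x y)) = fneg (ext V \<theta> C)"
proof (rule ext_eqI[OF s' rbil_fneg[OF C]])
 fix N
 obtain L where L: "rep V N \<theta> L" using s by (rule laurE)
 have "rval (mapf flneg L) (%x y. fneg (C x y)) = fneg (rval L C)"
 proof (induction L)
  case Nil
  have "fneg 0 = 0" using fneg_hemb[of 0] by (simp add: fneg_def hemb_def flip: fps_zero_def)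
  then show ?case by simp
 next
  case (Cons p L)
  obtain f x y where "p = (f, x, y)" by (cases p) auto
  then show ?case using Cons by (simp add: fneg_add fneg_mult fneg_const)
 qed
 then show "EX L. rep V N (ng \<theta>) L & fps_X ^ N dvd fneg (ext V \<theta> C) - rval L (%x y. fneg (C x y))"
  using rep_ng[OF L] fneg_dvd[OF ext_rep[OF s C L]] by (intro exI[of _ "mapf flneg L"]) (simp add: fneg_diff)
qed

lemma ext_fl:
 assumes "laur V (fl s x y)" "laur V (s y x)" "rbil V C"
 shows "ext V (fl s x y) C = ext V (s y x) (%x y. C y x)"
 by (rule ext_cong2[OF assms rbil_flip[OF assms(3)]]) (simp add: fl_def)

lemma lval_dvd_cong: "wf2 V L ==> (!!x y. x \<in> carrier V ==> y \<in> carrier V ==> d dvd B x y - B' x y) ==> d dvd lval L c B - lval L c B'"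
proof (induction L)
 case (Cons p L)
 obtain f x y where p: "p = (f, x, y)" by (cases p) auto
 have "d dvd fps_const (f $$ c) * (B x y - B' x y) + (lval L c B - lval L c B')"
  using Cons p by (intro dvd_add dvd_mult) auto
 then show ?case by (simp add: p algebra_simps)
qed simp

context qyb
begin

abbreviation "sY \<equiv> biop V S"

text \<open>The axiom \<open>S21(z) S(-z) = 1\<close> is a sum over all splittings
  \<open>p + (a - p)\<close> of an exponent; modulo \<open>h ^ N\<close> it reduces to the composite
  of representatives of the reflected and the flipped operator.\<close>

lemma unitary_rep:
 assumes uv: "u \<in> carrier V" "v \<in> carrier V" and L: "rep V N (ng (sY u v)) L"
  and R: "!!x y. x \<in> carrier V ==> y \<in> carrier V ==> rep V N (fl sY x y) (R x y)"
 shows "rep V N (%c B. if c = 0 then B u v else 0) (lc_bind L R)"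
 unfolding rep_def
proof (intro conjI allI impI)
 show "wf2 V (lc_bind L R)" using repD(1)[OF L] repD(1)[OF R] by (rule wf2_bind)
 fix a B assume B: "bil V B"
 define g where "g p = op_at V 2 (S p) 1 0 (fps_const ((- 1) powi (a - p)) \<odot>\<^bsub>ctens V 2\<^esub> S (a - p) (pure V [u, v]))" for p
 have gc: "g p \<in> carrier (ctens V 2)" for p
 proof -
  have "op_at V 2 (S p) 1 0 t \<in> carrier (ctens V 2)" if "t \<in> carrier (ctens V 2)" for t
   using op_at_linear[OF S_lin, of 1 2 0 p] that by (auto simp: linear_maps_def)
  then show ?thesis unfolding g_def ctens_simps by (simp add: ctens_smult_closed S_closed uv)
 qed
 have gev: "g p B = ng (sY u v) (a - p) (%x y. fl sY x y p (%x y. B [x, y]))" if B: "mlin V 2 B" for p B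
 proof -
  have "g p B = fps_const ((- 1) powi (a - p)) * S (a - p) (pure V [u, v])
    (%xs. S p (pure V [xs ! 1, xs ! 0]) (%ys. B (xs[1 := ys ! 0, 0 := ys ! 1])))"
   by (simp add: g_def op_at_eval[OF B])
  then show ?thesis unfolding S_bil[OF uv] by (simp add: ng_def fl_def biop_def)
 qed
 have ap: "fps_X ^ M dvd g p B - lval L (a - p) (%x y. lval (R x y) p (%x y. B [x, y]))"
  if L: "rep V M (ng (sY u v)) L" and R: "!!x y. x \<in> carrier V ==> y \<in> carrier V ==> rep V M (fl sY x y) (R x y)"
   and B: "mlin V 2 B" for M L R p B
 proof -
  have "bil V (%x y. fl sY x y p (%x y. B [x, y]))" by (rule sopD(2)[OF sop_fl[OF sop_biop] bil_mlin[OF B]])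
  then have 1: "fps_X ^ M dvd g p B - lval L (a - p) (%x y. fl sY x y p (%x y. B [x, y]))"
   unfolding gev[OF B] by (rule repD(2)[OF L])
  show ?thesis
   by (rule dvd_diff_trans[OF 1], rule lval_dvd_cong[OF repD(1)[OF L]]) (rule repD(2)[OF R bil_mlin[OF B]])
 qed
 \<comment> \<open>A separate choice of representatives at each precision \<open>M\<close> shows
   that the summands are small for large exponents, so the infinite sum exists.\<close>
 have bound: "EX P0. ALL p B. P0 < \<bar>p\<bar> --> mlin V 2 B --> fps_X ^ M dvd g p B" for M
 proof -
  let ?L = "SOME L. rep V M (ng (sY u v)) L" and ?R = "%x y. SOME L. rep V M (fl sY x y) L"
  have L: "rep V M (ng (sY u v)) ?L" by (rule laur_some[OF sopD(1)[OF sop_ng[OF sop_biop] uv]])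
  have R: "rep V M (fl sY x y) (?R x y)" if "x \<in> carrier V" "y \<in> carrier V" for x y
   by (rule laur_some[OF sopD(1)[OF sop_fl[OF sop_biop] that]])
  obtain P0 where P0: "ALL p B. P0 < \<bar>p\<bar> --> lval ?L (a - p) (%x y. lval (?R x y) p (B x y)) = 0"
   using lval_bind_sum(2)[of ?L a ?R] by (rule exE)
  have "fps_X ^ M dvd g p B" if h: "P0 < \<bar>p\<bar>" "mlin V 2 B" for p B
  proof -
   have "lval ?L (a - p) (%x y. lval (?R x y) p (%x y. B [x, y])) = 0"
    using P0[THEN spec, THEN spec, of p "%_ _ x y. B [x, y]"] h(1) by (rule mp)
   then show ?thesis using ap[OF L R h(2), of p] by simp
  qed
  then show ?thesis by blast
 qed
 have null: "hnull (ctens V 2) g"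
 proof (rule ctens_hnullI[OF _ gc])
  fix M
  obtain P0 where P0: "!!p B. P0 < \<bar>p\<bar> ==> mlin V 2 B ==> fps_X ^ M dvd g p B" using bound by blast
  show "EX F. finite F & (ALL p B. p \<notin> F --> mlin V 2 B --> fps_X ^ M dvd g p B)"
   by (rule exI[of _ "{- P0..P0}"]) (use P0 in auto)
 qed simp
 have "hsum (ctens V 2) g = (if a = 0 then pure V [u, v] else \<zero>\<^bsub>ctens V 2\<^esub>)"
  using quantum pure2[OF uv] unfolding quantum_va_def g_def by blast
 moreover obtain P0 where P0: "!!p B. P0 < \<bar>p\<bar> ==> mlin V 2 B ==> fps_X ^ N dvd g p B" using bound by blast
 moreover obtain P1 where P1: "!!P. P1 <= P ==> fps_X ^ N dvd lval (lc_bind L R) a B - (\<Sum>p = - P..P. lval L (a - p) (%x y. lval (R x y) p B))"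
  using lval_bind_sum(1) by blast
 moreover define P where "P = max P0 P1"
 moreover let ?B = "%ys. B (ys ! 0) (ys ! 1)"
 note mB = mlin_bil[OF B]
 have "fps_X ^ N dvd hsum (ctens V 2) g ?B - (\<Sum>p\<in>{- P..P}. g p ?B)"
  by (rule ctens_hsum_dvd[OF _ null]) (use P0 mB in \<open>auto simp: P_def\<close>)
 moreover have "fps_X ^ N dvd (\<Sum>p\<in>{- P..P}. g p ?B) - (\<Sum>p = - P..P. lval L (a - p) (%x y. lval (R x y) p B))"
  unfolding sum_subtractf[symmetric] using ap[OF L R mB] by (intro dvd_sum) simp
 ultimately have "fps_X ^ N dvd hsum (ctens V 2) g ?B - lval (lc_bind L R) a B"
  using dvd_diff_trans[OF dvd_diff_trans dvd_diff_sym[OF P1[of P]]] by (simp add: P_def)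
 moreover have "hsum (ctens V 2) g ?B = (if a = 0 then B u v else 0)"
  unfolding \<open>hsum (ctens V 2) g = _\<close> using mB by (simp add: pure_def numeral_2_eq_2)
 ultimately show "fps_X ^ N dvd (if a = 0 then B u v else 0) - lval (lc_bind L R) a B" by simp
qed

lemma unitary_1:
 assumes uv: "u \<in> carrier V" "v \<in> carrier V" and C: "rbil V C"
 shows "ext V (ng (sY u v)) (%x y. ext V (fl sY x y) C) = C u v"
proof (rule fps_eq_dvdI)
 fix N
 define L where "L = (SOME L. rep V N (ng (sY u v)) L)"
 define R where "R x y = (SOME L. rep V N (fl sY x y) L)" for x y
 note ln = sopD(1)[OF sop_ng[OF sop_biop]] and lf = sopD(1)[OF sop_fl[OF sop_biop]]
 have L: "rep V N (ng (sY u v)) L" unfolding L_def by (rule laur_some[OF ln[OF uv]])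
 have R: "rep V N (fl sY x y) (R x y)" if "x \<in> carrier V" "y \<in> carrier V" for x y
  unfolding R_def by (rule laur_some[OF lf[OF that]])
 have "rep V N (%c B. if c = 0 then B u v else 0) [(1, u, v)]" using uv by (simp add: rep_def)
 from rep_rval_eq[OF unitary_rep[OF uv L R] this C C refl]
 have 1: "fps_X ^ N dvd rval L (%x y. rval (R x y) C) - C u v" by (simp add: rval_bind)
 have 2: "fps_X ^ N dvd ext V (ng (sY u v)) (%x y. ext V (fl sY x y) C) - rval L (%x y. ext V (fl sY x y) C)"
  by (rule ext_rep[OF ln[OF uv] op_rbil[OF tmod_axioms sop_fl[OF sop_biop] C] L])
 have 3: "fps_X ^ N dvd rval L (%x y. ext V (fl sY x y) C) - rval L (%x y. rval (R x y) C)"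
  by (rule rval_dvd_cong[OF repD(1)[OF L]]) (intro ext_rep lf C R)
 show "fps_X ^ N dvd ext V (ng (sY u v)) (%x y. ext V (fl sY x y) C) - C u v"
  by (rule dvd_diff_trans[OF dvd_diff_trans[OF 2 3] 1])
qed

text \<open>The axiom gives an inverse on one side. Exchanging the tensor factors and replacing
  \<open>z\<close> by \<open>- z\<close> interchanges the two operators and yields the other
  side.\<close>

lemma unitary_2:
 assumes uv: "u \<in> carrier V" "v \<in> carrier V" and C: "rbil V C"
 shows "ext V (fl sY u v) (%x y. ext V (ng (sY x y)) C) = C u v"
proof -
 note ln = sopD(1)[OF sop_ng[OF sop_biop]] and lf = sopD(1)[OF sop_fl[OF sop_biop]] and l = sopD(1)[OF sop_biop]
 note op = op_rbil[OF tmod_axioms]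
 define C' where "C' x y = fneg (C y x)" for x y
 have C': "rbil V C'" unfolding C'_def by (rule rbil_fneg[OF rbil_flip[OF C]])
 have CC: "C x y = fneg (C' y x)" for x y by (simp add: C'_def)
 have 1: "ext V (ng (sY x y)) C = fneg (ext V (fl sY y x) C')" if "x \<in> carrier V" "y \<in> carrier V" for x y
 proof -
  have "ext V (ng (sY x y)) C = ext V (ng (sY x y)) (%x y. fneg (C' y x))" by (simp add: C'_def)
  also have "... = fneg (ext V (sY x y) (%x y. C' y x))"
   by (rule ext_ng[OF l[OF that] ln[OF that] rbil_flip[OF C']])
  also have "... = fneg (ext V (fl sY y x) C')" using that by (subst ext_fl[OF lf l C']) auto
  finally show ?thesis .
 qed
 have fC: "rbil V (%x y. ext V (fl sY x y) C')" by (rule op[OF sop_fl[OF sop_biop] C'])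
 have "ext V (fl sY u v) (%x y. ext V (ng (sY x y)) C) = ext V (sY v u) (%x y. ext V (ng (sY y x)) C)"
  by (rule ext_fl[OF lf[OF uv] l[OF uv(2,1)] op[OF sop_ng[OF sop_biop] C]])
 also have "... = ext V (sY v u) (%x y. fneg (ext V (fl sY x y) C'))"
  by (rule ext_cong[OF l[OF uv(2,1)] rbil_flip[OF op[OF sop_ng[OF sop_biop] C]] rbil_fneg[OF fC]]) (rule 1)
 also have "... = fneg (fneg (ext V (sY v u) (%x y. fneg (ext V (fl sY x y) C'))))" by simp
 also have "fneg (ext V (sY v u) (%x y. fneg (ext V (fl sY x y) C'))) =
   ext V (ng (sY v u)) (%x y. fneg (fneg (ext V (fl sY x y) C')))"
  by (rule ext_ng[OF l[OF uv(2,1)] ln[OF uv(2,1)] rbil_fneg[OF fC], symmetric])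
 also have "... = C' v u" unfolding fneg_fneg by (rule unitary_1[OF uv(2,1) C'])
 finally show ?thesis by (simp add: C'_def)
qed

end

lemma sum_times_singleton: "(\<Sum>j\<in>A \<times> {c}. f j) = (\<Sum>p\<in>A. f (p, c))" "(\<Sum>j\<in>{c} \<times> A. f j) = (\<Sum>p\<in>A. f (c, p))"
proof -
 have "A \<times> {c} = (%p. (p, c)) ` A" "{c} \<times> A = (%p. (c, p)) ` A" by auto
 then show "(\<Sum>j\<in>A \<times> {c}. f j) = (\<Sum>p\<in>A. f (p, c))" by (simp add: sum.reindex inj_on_def)
next
 have "{c} \<times> A = (%p. (c, p)) ` A" by auto
 then show "(\<Sum>j\<in>{c} \<times> A. f j) = (\<Sum>p\<in>A. f (c, p))" by (simp add: sum.reindex inj_on_def)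
qed

lemma wf_list_3E:
 assumes "wf_list V 3 xs" obtains a b c where "xs = [a, b, c]" "a \<in> carrier V" "b \<in> carrier V" "c \<in> carrier V"
 using assms by (auto simp: wf_list_def numeral_3_eq_3 length_Suc_conv)

lemma wf_list_3 [simp]: "wf_list V 3 [x, y, z] \<longleftrightarrow> x \<in> carrier V & y \<in> carrier V & z \<in> carrier V"
 by (auto simp: wf_list_def)

context qyb
begin

text \<open>Indexed by the exponent of \<open>z\<close>, as the hexagon identity compares
  coefficients of \<open>z2^b\<close>.\<close>

definition yop :: "int => 'v => 'v => 'v" where "yop b = nprod V (- b - 1)"

lemma yop_closed [simp]: "x \<in> carrier V ==> y \<in> carrier V ==> yop b x y \<in> carrier V"
 by (simp add: yop_def)

lemma yop_simps: "x \<in> carrier V ==> x' \<in> carrier V ==> y \<in> carrier V ==> yop b (x \<oplus> x') y = yop b x y \<oplus> yop b x' y"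
 "x \<in> carrier V ==> x' \<in> carrier V ==> y \<in> carrier V ==> yop b y (x \<oplus> x') = yop b y x \<oplus> yop b y x'"
 "x \<in> carrier V ==> y \<in> carrier V ==> yop b (c \<odot> x) y = c \<odot> yop b x y"
 "x \<in> carrier V ==> y \<in> carrier V ==> yop b y (c \<odot> x) = c \<odot> yop b y x"
 by (simp_all add: yop_def nprod_add_l nprod_add_r nprod_smult_l nprod_smult_r)

lemma yop_trunc: "x \<in> carrier V ==> y \<in> carrier V ==> EX M0. ALL b<M0. yop b x y \<in> hpow V N"
proof -
 assume xy: "x \<in> carrier V" "y \<in> carrier V"
 have "nonlocal_va V" using quantum by (simp add: quantum_va_def)
 then have "is_field V (Yc V x)" using xy by (simp add: nonlocal_va_def)
 then show ?thesis using xy unfolding is_field_def Yc_def yop_def by blast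
qed

text \<open>The trilinear form by which the coefficient of \<open>z^q\<close> in \<open>Y(z) \<otimes> 1\<close> acts.\<close>

definition yform :: "int => ('v list => complex fps) => 'v list => complex fps" where
 "yform q B = (%xs. pure V (take 0 xs @ Yc V (xs ! 0) q (xs ! Suc 0) # drop (0 + 2) xs) B)"

lemma yform_3 [simp]: "mlin V 2 B ==> yform q B [x, y, z] = B [yop q x y, z]"
 by (simp add: yform_def yop_def Yc_def pure_def numeral_2_eq_2)

lemma mlin_yform: assumes B: "mlin V 2 B" shows "mlin V 3 (yform q B)"
proof (rule mlinI')
 note b = bilD[OF bil_mlin[OF B]]
 fix xs i u v assume xs: "wf_list V 3 xs" and i: "i < (3::nat)" and uv: "u \<in> carrier V" "v \<in> carrier V"
 obtain x y z where "xs = [x, y, z]" "x \<in> carrier V" "y \<in> carrier V" "z \<in> carrier V" using xs by (rule wf_list_3E)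
 then show "yform q B (xs[i := u \<oplus> v]) = yform q B (xs[i := u]) + yform q B (xs[i := v])"
  using i uv B by (auto simp: numeral_3_eq_3 less_Suc_eq yop_simps b(1,2))
next
 note b = bilD[OF bil_mlin[OF B]]
 fix xs i u c assume xs: "wf_list V 3 xs" and i: "i < (3::nat)" and uv: "u \<in> carrier V"
 obtain x y z where "xs = [x, y, z]" "x \<in> carrier V" "y \<in> carrier V" "z \<in> carrier V" using xs by (rule wf_list_3E)
 then show "yform q B (xs[i := c \<odot> u]) = c * yform q B (xs[i := u])"
  using i uv B by (auto simp: numeral_3_eq_3 less_Suc_eq yop_simps b(3,4))
qed

lemma Y_at_eval: "Y_at V 2 0 q t B = (if mlin V 2 B then t (yform q B) else 0)"
 by (simp add: Y_at_def lift_tens_def yform_def)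

lemma Y_at_linear: "Y_at V 2 0 q \<in> linear_maps (ctens V 3) (ctens V 2)"
 unfolding Y_at_def
proof (rule lift_tens_linear)
 show "tfree V" "tfree V" by unfold_locales
 show "mlin V 3 (%xs. pure V (take 0 xs @ Yc V (xs ! 0) q (xs ! Suc 0) # drop (0 + 2) xs) B)" if "mlin V 2 B" for B
  using mlin_yform[OF that] unfolding yform_def .
 fix xs N assume "wf_list V 3 xs"
 then obtain x y z where "xs = [x, y, z]" "x \<in> carrier V" "y \<in> carrier V" "z \<in> carrier V" by (rule wf_list_3E)
 then show "EX L. approx V 2 N (pure V (take 0 xs @ Yc V (xs ! 0) q (xs ! Suc 0) # drop (0 + 2) xs)) L"
  using pure2[of "yop q x y" z] by (simp add: yop_def Yc_def ctens_iff')
qed auto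

section \<open>The hexagon identity at a fixed triple of vectors\<close>

context
 fixes u v w assumes c: "u \<in> carrier V" "v \<in> carrier V" "w \<in> carrier V"
begin

definition Tp :: "'v tens" where "Tp = pure V [u, v, w]"

definition inner :: "int => int => 'v tens" where
 "inner a b = comp2 (ctens V 3) (in_z1 (%c. op_at V 3 (S c) 1 2)) (in_sum (%c. op_at V 3 (S c) 0 2)) a b Tp"

text \<open>The summands of the inner convolution \<open>S23(z1) S13(z1 + z2)\<close>; those of the
  outer one, with \<open>Y(z2)\<close> applied to the result, are \<open>oterm\<close>.\<close>

definition iterm :: "int => int => int \<times> int => 'v tens" where
 "iterm a b = (%(p, q). in_z1 (%c. op_at V 3 (S c) 1 2) p q (in_sum (%c. op_at V 3 (S c) 0 2) (a - p) (b - q) Tp))"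

lemma Tp_closed: "Tp \<in> carrier (ctens V 3)"
 unfolding Tp_def by (rule pure_ctens) (use c in auto)

lemma op3_closed: "i < 3 ==> j < 3 ==> i ~= j ==> t \<in> carrier (ctens V 3) ==> op_at V 3 (S p) i j t \<in> carrier (ctens V 3)"
 using op_at_linear[OF S_lin, of i 3 j p] by (auto simp: linear_maps_def)

lemma iterm_closed: "iterm a b j \<in> carrier (ctens V 3)"
proof -
 have z: "(%_. 0) \<in> carrier (ctens V 3)" by (rule ctens_zero_closed) simp
 have "in_sum (%c. op_at V 3 (S c) 0 2) a b Tp \<in> carrier (ctens V 3)" for a b
  unfolding in_sum_def using z by (auto intro!: ctens_smult_closed op3_closed Tp_closed)
 then show ?thesis unfolding iterm_def in_z1_def using z by (auto split: prod.split intro!: op3_closed)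
qed

lemma iterm_zero: "q ~= 0 | b < 0 ==> iterm a b (p, q) G = 0"
 by (auto simp: iterm_def in_z1_def in_sum_def op_at_def lift_tens_def)

lemma bil_inner: "mlin V 3 G ==> bil V (%x z. sY v z p (%y z'. G [x, y, z']))"
 using bil_mlin[OF mlin_two_slots[OF op_at_mlin[OF S_lin, of 1 3 2 G p], of "[u, v, w]" 0 2]] c
 by (simp add: biop_def)

text \<open>\<open>S13(z1 + z2)\<close> acts first, and its expansion in \<open>z2\<close>
  contributes the Taylor coefficient of order \<open>b\<close>. \<open>S23(z1)\<close> acts
  afterwards and therefore appears as the inner evaluation.\<close>

lemma iterm_eval:
 assumes G: "mlin V 3 G" and b: "0 <= b"
 shows "iterm a b (p, 0) G = hs 1 (nat b) (sY u w) (a - p) (%x z. sY v z p (%y z'. G [x, y, z']))"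
proof -
 define G1 where "G1 = (%xs. S p (pure V [xs ! 1, xs ! 2]) (%ys. G (xs[1 := ys ! 0, 2 := ys ! 1])))"
 have G1: "mlin V 3 G1" unfolding G1_def by (rule op_at_mlin[OF S_lin _ _ _ G]) simp_all
 define G2 where "G2 d = (%xs. S d (pure V [xs ! 0, xs ! 2]) (%ys. G1 (xs[0 := ys ! 0, 2 := ys ! 1])))" for d
 have G2: "mlin V 3 (G2 d)" for d unfolding G2_def by (rule op_at_mlin[OF S_lin _ _ _ G1]) simp_all
 have "iterm a b (p, 0) G = in_sum (%c. op_at V 3 (S c) 0 2) (a - p) b Tp G1"
  by (simp add: iterm_def in_z1_def op_at_eval[OF G] G1_def)
 also have "... = fps_const (of_int (a - p + b) gchoose nat b) * op_at V 3 (S (a - p + b)) 0 2 Tp G1"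
  using b by (simp add: in_sum_def)
 also have "op_at V 3 (S (a - p + b)) 0 2 Tp G1 = Tp (G2 (a - p + b))"
  by (simp add: op_at_eval[OF G1] G2_def)
 also have "... = G2 (a - p + b) [u, v, w]" using G2 by (simp add: Tp_def pure_def numeral_3_eq_3)
 finally show ?thesis using b by (simp add: hs_def biop_def G2_def G1_def)
qed

lemma iterm_approx:
 assumes G: "mlin V 3 G" and b: "0 <= b" and L: "rep V N (sY u w) L"
  and M: "!!z. z \<in> carrier V ==> rep V N (sY v z) (M z)"
 shows "fps_X ^ N dvd iterm a b (p, 0) G - lval (mapf (hasse 1 (nat b)) L) (a - p) (%x z. lval (M z) p (%y z'. G [x, y, z']))"
proof -
 have L': "rep V N (hs 1 (nat b) (sY u w)) (mapf (hasse 1 (nat b)) L)" by (rule rep_hs[OF L])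
 have G1: "bil V (%y z'. G [x, y, z'])" if x: "x \<in> carrier V" for x
  using bil_mlin[OF mlin_two_slots[OF G, of "[x, v, w]" 1 2]] x c by simp
 show ?thesis
  unfolding iterm_eval[OF G b]
 proof (rule dvd_diff_trans[OF repD(2)[OF L' bil_inner[OF G]] lval_dvd_cong[OF repD(1)[OF L']]])
  fix x z assume "x \<in> carrier V" "z \<in> carrier V"
  then show "fps_X ^ N dvd sY v z p (%y z'. G [x, y, z']) - lval (M z) p (%y z'. G [x, y, z'])"
   by (intro repD(2)[OF M G1])
 qed
qed

definition SL :: "nat => 'v lc" where "SL N = (SOME L. rep V N (sY u w) L)"
definition SM :: "nat => 'v => 'v lc" where "SM N z = (SOME L. rep V N (sY v z) L)"

lemma SL: "rep V N (sY u w) (SL N)"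
 unfolding SL_def by (rule laur_some[OF laur_biop[OF c(1,3)]])

lemma SM: "z \<in> carrier V ==> rep V N (sY v z) (SM N z)"
 unfolding SM_def by (rule laur_some[OF laur_biop[OF c(2)]])

lemma iterm_bound: "EX P0. ALL p G. P0 < \<bar>p\<bar> --> mlin V 3 G --> fps_X ^ N dvd iterm a b (p, 0) G"
proof (cases "0 <= b")
 case True
 let ?L = "mapf (hasse 1 (nat b)) (SL N)" and ?R = "%x z. SM N z"
 obtain P0 where P0: "ALL p B. P0 < \<bar>p\<bar> --> lval ?L (a - p) (%x y. lval (?R x y) p (B x y)) = 0"
  using lval_bind_sum(2)[of ?L a ?R] by (rule exE)
 have "fps_X ^ N dvd iterm a b (p, 0) G" if h: "P0 < \<bar>p\<bar>" "mlin V 3 G" for p G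
 proof -
  have "lval ?L (a - p) (%x z. lval (?R x z) p (%y z'. G [x, y, z'])) = 0"
   using P0[THEN spec, THEN spec, of p "%x _ y z'. G [x, y, z']"] h(1) by (rule mp)
  then show ?thesis using iterm_approx[OF h(2) True SL SM, of N a p] by simp
 qed
 then show ?thesis by blast
qed (auto simp: iterm_zero)

lemma iterm_null: "hnull (ctens V 3) (iterm a b)"
proof (rule ctens_hnullI[OF _ iterm_closed])
 fix N
 obtain P0 where P0: "!!p G. P0 < \<bar>p\<bar> ==> mlin V 3 G ==> fps_X ^ N dvd iterm a b (p, 0) G" using iterm_bound by blast
 have "fps_X ^ N dvd iterm a b j G" if "j \<notin> {- P0..P0} \<times> {0}" "mlin V 3 G" for j G
 proof -
  obtain p q where pq: "j = (p, q)" by fastforce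
  show ?thesis using that P0[of p G] by (cases "q = 0") (auto simp: pq iterm_zero)
 qed
 then show "EX F. finite F & (ALL j G. j \<notin> F --> mlin V 3 G --> fps_X ^ N dvd iterm a b j G)"
  by (intro exI[of _ "{- P0..P0} \<times> {0}"]) auto
qed simp

lemma inner_eq: "inner a b = hsum (ctens V 3) (iterm a b)"
 by (simp add: inner_def comp2_def iterm_def)

lemma inner_closed: "inner a b \<in> carrier (ctens V 3)"
 unfolding inner_eq by (rule hfree.hsum_closed[OF hfree_ctens iterm_null]) simp

lemma inner_neg: "b < 0 ==> mlin V 3 G ==> inner a b G = 0"
proof (rule fps_eq_dvdI)
 fix N assume b: "b < 0" and G: "mlin V 3 G"
 have z: "iterm a b j G = 0" for j G using iterm_zero[of "snd j" b a "fst j"] b by simp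
 show "fps_X ^ N dvd inner a b G - 0"
  using ctens_hsum_dvd[OF _ iterm_null[of a b], of "{}" N G] z G unfolding inner_eq by simp
qed

lemma inner_approx:
 assumes G: "mlin V 3 G" and b: "0 <= b" and L: "rep V N (sY u w) L"
  and M: "!!z. z \<in> carrier V ==> rep V N (sY v z) (M z)"
 shows "fps_X ^ N dvd inner a b G - zcoef (rval (mapf (hasse 1 (nat b)) L) (%x z. rval (M z) (%y z'. hemb (G [x, y, z'])))) a"
proof -
 let ?L = "mapf (hasse 1 (nat b)) L" and ?l = "%p. lval (mapf (hasse 1 (nat b)) L) (a - p) (%x z. lval (M z) p (%y z'. G [x, y, z']))"
 obtain P0 where P0: "!!p G. P0 < \<bar>p\<bar> ==> mlin V 3 G ==> fps_X ^ N dvd iterm a b (p, 0) G" using iterm_bound by blast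
 obtain P1 where P1: "!!P. P1 <= P ==> fps_X ^ N dvd zcoef (rval ?L (%x z. rval (M z) (%y z'. hemb (G [x, y, z'])))) a - (\<Sum>p = - P..P. ?l p)"
  using zcoef_rval[of N ?L "%x z. rval (M z) (%y z'. hemb (G [x, y, z']))" a] unfolding zcoef_rval_hemb by blast
 define P where "P = max P0 P1"
 have "fps_X ^ N dvd hsum (ctens V 3) (iterm a b) G - (\<Sum>j\<in>{- P..P} \<times> {0}. iterm a b j G)"
 proof (rule ctens_hsum_dvd[OF _ iterm_null _ _ G])
  fix j G assume h: "j \<notin> {- P..P} \<times> {0::int}" "mlin V 3 G"
  obtain p q where pq: "j = (p, q)" by fastforce
  show "fps_X ^ N dvd iterm a b j G" using h P0[of p G] by (cases "q = 0") (auto simp: pq iterm_zero P_def)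
 qed auto
 also have "(\<Sum>j\<in>{- P..P} \<times> {0}. iterm a b j G) = (\<Sum>p = - P..P. iterm a b (p, 0) G)"
  by (rule sum_times_singleton)
 finally have 1: "fps_X ^ N dvd inner a b G - (\<Sum>p = - P..P. iterm a b (p, 0) G)" unfolding inner_eq .
 have 2: "fps_X ^ N dvd (\<Sum>p = - P..P. iterm a b (p, 0) G) - (\<Sum>p = - P..P. ?l p)"
  unfolding sum_subtractf[symmetric] by (intro dvd_sum iterm_approx[OF G b L M])
 show ?thesis by (rule dvd_diff_trans[OF dvd_diff_trans[OF 1 2] dvd_diff_sym[OF P1]]) (simp add: P_def)
qed

definition oterm :: "int => int => int \<times> int => 'v tens" where
 "oterm a b = (%(p, q). in_z2 (Y_at V 2 0) p q (inner (a - p) (b - q)))"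

lemma oterm_closed: "oterm a b j \<in> carrier (ctens V 2)"
proof -
 have "Y_at V 2 0 q t \<in> carrier (ctens V 2)" if "t \<in> carrier (ctens V 3)" for q t
  using Y_at_linear[of q] that by (auto simp: linear_maps_def)
 then show ?thesis using inner_closed ctens_zero_closed[of 2] by (auto simp: oterm_def in_z2_def split: prod.split)
qed

lemma oterm_zero: "p ~= 0 | b < q ==> oterm a b (p, q) B = 0"
 by (auto simp: oterm_def in_z2_def Y_at_eval inner_neg mlin_yform)

abbreviation hexl :: "'v lc => ('v => 'v lc) => nat => int => 'v lc" where
 "hexl L M k q \<equiv> lc_bind (mapf (hasse 1 k) L) (%x z. map (%(g, y, z). (g, yop q x y, z)) (M z))"

lemma oterm_approx:
 assumes B: "mlin V 2 B" and q: "q <= b" and L: "rep V N (sY u w) L"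
  and M: "!!z. z \<in> carrier V ==> rep V N (sY v z) (M z)"
 shows "fps_X ^ N dvd oterm a b (0, q) B - lval (hexl L M (nat (b - q)) q) a (%x y. B [x, y])"
proof -
 have r: "rval (map (%(g, y, z). (g, yop q x y, z)) L) C = rval L (%y. C (yop q x y))" for x L and C :: "'v => 'v => complex fls fps"
  by (induction L) auto
 have "lval (hexl L M (nat (b - q)) q) a (%x y. B [x, y]) =
   zcoef (rval (mapf (hasse 1 (nat (b - q))) L) (%x z. rval (M z) (%y z'. hemb (yform q B [x, y, z'])))) a"
  unfolding zcoef_rval_hemb[symmetric] rval_bind r yform_3[OF B] ..
 moreover have "oterm a b (0, q) B = inner a (b - q) (yform q B)" using B by (simp add: oterm_def in_z2_def Y_at_eval)
 ultimately show ?thesis using inner_approx[OF mlin_yform[OF B] _ L M, of "b - q" a q] q by simp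
qed

text \<open>Truncation of \<open>Y\<close> depends on both vectors, but only the finitely many pairs
  occurring in \<open>L\<close> and \<open>M\<close> are involved, so one bound serves all.\<close>

lemma hexl_bound:
 assumes L: "rep V N (sY u w) L" and M: "!!z. z \<in> carrier V ==> rep V N (sY v z) (M z)"
 shows "EX M0. ALL q k a B. q < M0 --> bil V B --> fps_X ^ N dvd lval (hexl L M k q) a B"
proof -
 have "ALL x y. EX m. x \<in> carrier V --> y \<in> carrier V --> (ALL b<m. yop b x y \<in> hpow V N)" using yop_trunc by blast
 then obtain m where m: "!!x y b. x \<in> carrier V ==> y \<in> carrier V ==> b < m x y ==> yop b x y \<in> hpow V N" by metis
 define A where "A = (\<Union>(f, x, z)\<in>set L. (%(g, y, z'). m x y) ` set (M z))"
 have "finite A" unfolding A_def by auto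
 then obtain M0 where M0: "!!a. a \<in> A ==> M0 <= a" using bdd_below_finite[of A] by (auto simp: bdd_below_def)
 have "fps_X ^ N dvd lval (hexl L M k q) a B" if q: "q < M0" and B: "bil V B" for q k a B
 proof -
  have d: "fps_X ^ N dvd lval K a B" if "!!f x y. (f, x, y) \<in> set K ==> fps_X ^ N dvd B x y" for K
   using that
  proof (induction K)
   case (Cons p K)
   obtain f x y where "p = (f, x, y)" by (cases p) auto
   then show ?case using Cons by (auto intro!: dvd_add dvd_mult)
  qed simp
  show ?thesis
  proof (rule d)
   fix f x z assume "(f, x, z) \<in> set (hexl L M k q)"
   then obtain f0 x0 z0 g y where h: "(f0, x0, z0) \<in> set L" "(g, y, z) \<in> set (M z0)" "x = yop q x0 y"
    by (auto simp: lc_bind_def mapf_def)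
   have c0: "x0 \<in> carrier V" "z0 \<in> carrier V" using repD(1)[OF L] h(1) by (auto simp: wf2_def)
   have c1: "y \<in> carrier V" "z \<in> carrier V" using repD(1)[OF M[OF c0(2)]] h(2) by (auto simp: wf2_def)
   have "m x0 y \<in> A" using h unfolding A_def by force
   then have "q < m x0 y" using M0 q by fastforce
   then have "x \<in> hpow V N" using m[OF c0(1) c1(1)] h(3) by simp
   then obtain x' where "x' \<in> carrier V" "x = fps_X ^ N \<odot> x'" by (auto simp: hpow_def)
   then show "fps_X ^ N dvd B x z" using c1 by (simp add: bilD(3)[OF B])
  qed
 qed
 then show ?thesis by blast
qed

lemma oterm_null: "hnull (ctens V 2) (oterm a b)"
proof (rule ctens_hnullI[OF _ oterm_closed])
 fix N
 obtain M0 where M0: "!!q k a B. q < M0 ==> bil V B ==> fps_X ^ N dvd lval (hexl (SL N) (SM N) k q) a B"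
  using hexl_bound[OF SL SM, of N] by blast
 have "fps_X ^ N dvd oterm a b j B" if j: "j \<notin> {0} \<times> {M0..b}" and B: "mlin V 2 B" for j B
 proof -
  obtain p q where pq: "j = (p, q)" by fastforce
  show ?thesis
  proof (cases "p ~= 0 | b < q")
   case False
   then have "q < M0" "p = 0" "q <= b" using j pq by auto
   then have "fps_X ^ N dvd oterm a b (0, q) B - 0"
    using dvd_diff_trans[OF oterm_approx[OF B _ SL SM]] M0[OF _ bil_mlin[OF B]] by (metis diff_zero)
   then show ?thesis using pq \<open>p = 0\<close> by simp
  qed (simp add: pq oterm_zero)
 qed
 then show "EX F. finite F & (ALL j B. j \<notin> F --> mlin V 2 B --> fps_X ^ N dvd oterm a b j B)"
  by (intro exI[of _ "{0} \<times> {M0..b}"]) auto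
qed simp

lemma hexagon_hsum: "S a (pure V [yop b u v, w]) = hsum (ctens V 2) (oterm a b)"
proof -
 have "S a (Y_at V 2 0 b Tp) = hsum (ctens V 2) (oterm a b)"
  using quantum Tp_closed unfolding quantum_va_def oterm_def comp2_def[of "ctens V 2"] inner_def by blast
 moreover have "Y_at V 2 0 b Tp = pure V [yop b u v, w]"
  unfolding Tp_def
 proof
  fix B
  show "Y_at V 2 0 b (pure V [u, v, w]) B = pure V [yop b u v, w] B"
  proof (cases "mlin V 2 B")
   case True
   have "pure V [u, v, w] (yform b B) = yform b B [u, v, w]"
    using mlin_yform[OF True] by (simp add: pure_def numeral_3_eq_3)
   moreover have "pure V [yop b u v, w] B = B [yop b u v, w]" using True by (simp add: pure_def numeral_2_eq_2)
   ultimately show ?thesis using True by (simp only: Y_at_eval if_True yform_3)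
  next
   case False
   then show ?thesis by (simp add: Y_at_eval) (simp add: pure_def numeral_2_eq_2)
  qed
 qed
 ultimately show ?thesis by simp
qed

text \<open>Two cut-offs meet: exponents \<open>q\<close> of \<open>Y\<close> above \<open>b\<close>
  do not occur because \<open>S13(z1 + z2)\<close> has no negative powers of \<open>z2\<close>, and
  those below \<open>M0\<close> vanish modulo \<open>h ^ N\<close>. What remains is among the
  \<open>b - k\<close> with \<open>k \<le> K\<close>.\<close>

lemma hexagon_at: "EX M0. hexL_at V yop 1 sY u v w N (SL N) (SM N) M0"
proof -
 obtain M0 where M0: "!!q k a B. q < M0 ==> bil V B ==> fps_X ^ N dvd lval (hexl (SL N) (SM N) k q) a B"
  using hexl_bound[OF SL SM, of N] by blast
 have "rep V N (sY (yop b u v) w) (concat (map (%k. hexl (SL N) (SM N) k (b - int k)) [0..<Suc K]))"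
  if K: "b - int K <= M0" for b K
  unfolding rep_def
 proof (intro conjI allI impI)
  have w: "wf2 V (hexl (SL N) (SM N) k q)" for k q
  proof (rule wf2_bind)
   fix x z assume "x \<in> carrier V" "z \<in> carrier V"
   then show "wf2 V (map (%(g, y, z). (g, yop q x y, z)) (SM N z))"
    using repD(1)[OF SM, of z N] by (auto simp: wf2_def)
  qed (use repD(1)[OF SL, of N] in simp)
  have wc: "wf2 V (concat (map A [0..<n]))" if "!!k. wf2 V (A k)" for A :: "nat => 'v lc" and n
   using that by (induction n) auto
  show "wf2 V (concat (map (%k. hexl (SL N) (SM N) k (b - int k)) [0..<Suc K]))"
   by (rule wc) (rule w)
  fix a B assume B: "bil V B"
  let ?B = "%ys. B (ys ! 0) (ys ! 1)" and ?F = "{0::int} \<times> (%k. b - int k) ` {..K}"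
  note mB = mlin_bil[OF B]
  have "fps_X ^ N dvd hsum (ctens V 2) (oterm a b) ?B - (\<Sum>j\<in>?F. oterm a b j ?B)"
  proof (rule ctens_hsum_dvd[OF _ oterm_null _ _ mB])
   fix j B assume j: "j \<notin> ?F" and B: "mlin V 2 B"
   obtain p q where pq: "j = (p, q)" by fastforce
   show "fps_X ^ N dvd oterm a b j B"
   proof (cases "p ~= 0 | b < q")
    case False
    have "q < b - int K"
    proof (rule ccontr)
     assume "~  q < b - int K"
     then have "q = b - int (nat (b - q))" "nat (b - q) <= K" using False by auto
     then have "q \<in> (%k. b - int k) ` {..K}" by blast
     then show False using j pq False by auto
    qed
    then have "q < M0" "p = 0" "q <= b" using K False by auto
    then have "fps_X ^ N dvd oterm a b (0, q) B - 0"
     using dvd_diff_trans[OF oterm_approx[OF B _ SL SM]] M0[OF _ bil_mlin[OF B]] by (metis diff_zero)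
    then show ?thesis using pq \<open>p = 0\<close> by simp
   qed (simp add: pq oterm_zero)
  qed auto
  also have "(\<Sum>j\<in>?F. oterm a b j ?B) = (\<Sum>q\<in>(%k. b - int k) ` {..K}. oterm a b (0, q) ?B)"
   by (rule sum_times_singleton)
  also have "... = (\<Sum>k\<le>K. oterm a b (0, b - int k) ?B)"
   by (subst sum.reindex) (auto simp: inj_on_def)
  finally have 1: "fps_X ^ N dvd sY (yop b u v) w a B - (\<Sum>k\<le>K. oterm a b (0, b - int k) ?B)"
   by (simp add: biop_def hexagon_hsum)
  have 2: "fps_X ^ N dvd oterm a b (0, b - int k) ?B - lval (hexl (SL N) (SM N) k (b - int k)) a B" for k
   using oterm_approx[OF mB _ SL SM, of "b - int k" b N a] by simp
  have 3: "fps_X ^ N dvd (\<Sum>k\<le>K. oterm a b (0, b - int k) ?B) - (\<Sum>k\<le>K. lval (hexl (SL N) (SM N) k (b - int k)) a B)"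
   unfolding sum_subtractf[symmetric] by (intro dvd_sum 2)
  have "lval (concat (map A [0..<Suc K])) a B = (\<Sum>k\<le>K. lval (A k) a B)" for A
   by (induction K) auto
  then show "fps_X ^ N dvd sY (yop b u v) w a B - lval (concat (map (%k. hexl (SL N) (SM N) k (b - int k)) [0..<Suc K])) a B"
   using dvd_diff_trans[OF 1 3] by metis
 qed
 then show ?thesis unfolding hexL_at_def using SL SM by blast
qed

end

lemma hexagon: "hexL V yop 1 sY"
 unfolding hexL_def using hexagon_at by blast

end

section \<open>Consequences of the hexagon identity and unitarity\<close>

lemma quantum_va_qyb: "quantum_va V S ==> qyb V S"
 unfolding qyb_def qyb_axioms_def tfree_def tfree_axioms_def
 using nonlocal_va_va topologically_free_hfree by (auto simp: quantum_va_def nonlocal_va_def)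

lemma ext_delta:
 assumes s: "laur V \<theta>" and C: "rbil V C" and xy: "x \<in> carrier V" "y \<in> carrier V"
  and e: "!!c B. bil V B ==> \<theta> c B = (if c = 0 then B x y else 0)"
 shows "ext V \<theta> C = C x y"
 by (rule ext_eqI[OF s C], rule exI[of _ "[(1, x, y)]"]) (use xy e in \<open>auto simp: rep_def\<close>)

context qyb
begin

text \<open>The axioms prescribe only \<open>S(z)\<close> on tensors with the vacuum on the left.
  There the flipped operator is trivial on \<open>v\<close>, vacuum, and unitarity then makes its
  inverse trivial as well.\<close>

lemma biop_vac_right:
 assumes v: "v \<in> carrier V" and B: "bil V B"
 shows "biop V S v (vac V) c B = (if c = 0 then B v (vac V) else 0)"
proof -
 note ln = sopD(1)[OF sop_ng[OF sop_biop]] and lf = sopD(1)[OF sop_fl[OF sop_biop]]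
 note H = rbil_hemb[OF B] and vc = vac_closed
 have "fl sY v (vac V) c B = (if c = 0 then B v (vac V) else 0)" if "bil V B" for c B
  using biop_vac[OF v bil_flip[OF that], of c] by (simp add: fl_def)
 then have "ext V (fl sY v (vac V)) (%x y. ext V (ng (sY x y)) (%x y. hemb (B x y))) = ext V (ng (sY v (vac V))) (%x y. hemb (B x y))"
  by (rule ext_delta[OF lf[OF v vc] op_rbil[OF tmod_axioms sop_ng[OF sop_biop] H] v vc])
 then have "ext V (ng (sY v (vac V))) (%x y. hemb (B x y)) = hemb (B v (vac V))"
  using unitary_2[OF v vc H] by simp
 then have "ng (sY v (vac V)) c B = (if c = 0 then B v (vac V) else 0)"
  using ext_hemb[OF ln[OF v vc] B, of c] by simp
 then have "fps_const ((- 1) powi c) * (fps_const ((- 1) powi c) * sY v (vac V) c B) =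
   fps_const ((- 1) powi c) * (if c = 0 then B v (vac V) else 0)"
  by (simp add: ng_def)
 moreover have "(- 1 :: complex) powi c * (- 1) powi c = 1"
  by (simp flip: power_int_mult_distrib)
 ultimately show ?thesis by (simp add: mult.assoc[symmetric] split: if_splits)
qed

lemma prods_yop: "prods V yop"
 unfolding yop_def by (rule prods_nprod)

lemma hexA_biop: "hexA V yop 1 sY"
 by (rule prods.hexL_hexA[OF prods_yop sop_biop hexagon])

text \<open>Unitarity makes the flipped operator the inverse of the reflected one; the latter
  satisfies the hexagon identity with sign \<open>- 1\<close>, so the former satisfies the reversed
  identity.\<close>

lemma hexB_biop: "hexB V yop (- 1) (fl sY)"
 by (rule prods.hexA_inverse[OF prods_yop sop_ng[OF sop_biop] sop_fl[OF sop_biop]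
   prods.hexL_hexA[OF prods_yop sop_ng[OF sop_biop] prods.hexL_ng[OF prods_yop hexagon]] unitary_1 unitary_2])

end

section \<open>Maps between tensor powers\<close>

lemma map_tens_linear:
 assumes V: "tfree V" and V': "tfree V'" and f: "f \<in> linear_maps V V'" and n: "0 < n"
 shows "map_tens V' n f \<in> linear_maps (ctens V n) (ctens V' n)"
  and "wf_list V n xs ==> map_tens V' n f (pure V xs) = pure V' (map f xs)"
proof -
 interpret V: tfree V by fact
 interpret V': tfree V' by fact
 interpret f: tlin V V' f using f by unfold_locales
 have len: "length xs = n" if "wf_list V n xs" for xs using that by (simp add: wf_list_def)
 have wf: "wf_list V' n (map f xs)" if "wf_list V n xs" for xs
  using that by (auto simp: wf_list_def)
 have ml: "mlin V n (%xs. pure V' (map f xs) B)" if B: "mlin V' n B" for B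
 proof (rule mlinI')
  fix xs i u v assume h: "wf_list V n xs" "i < n" "u \<in> carrier V" "v \<in> carrier V"
  show "pure V' (map f (xs[i := u \<oplus>\<^bsub>V\<^esub> v])) B = pure V' (map f (xs[i := u])) B + pure V' (map f (xs[i := v])) B"
   using V'.pure_add[OF wf[OF h(1)] h(2), of "f u" "f v"] h by (simp add: map_update f.add)
 next
  fix xs i u c assume h: "wf_list V n xs" "i < n" "u \<in> carrier V"
  show "pure V' (map f (xs[i := c \<odot>\<^bsub>V\<^esub> u])) B = c * pure V' (map f (xs[i := u])) B"
   using V'.pure_smult[OF wf[OF h(1)] h(2), of "f u"] h by (simp add: map_update f.smult)
 qed
 show "map_tens V' n f \<in> linear_maps (ctens V n) (ctens V' n)"
  unfolding map_tens_def
 proof (rule lift_tens_linear[OF V V' n n _ ml])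
  fix xs N assume "wf_list V n xs"
  then show "EX L. approx V' n N (pure V' (map f xs)) L"
   using V'.pure_ctens[OF n wf] V'.ctens_iff'[OF n] by blast
 qed
 assume xs: "wf_list V n xs"
 show "map_tens V' n f (pure V xs) = pure V' (map f xs)"
 proof
  fix B
  show "map_tens V' n f (pure V xs) B = pure V' (map f xs) B"
  proof (cases "mlin V' n B")
   case True
   then show ?thesis using ml[OF True] len[OF xs] by (simp add: map_tens_def lift_tens_def)
  next
   case False
   then show ?thesis using len[OF xs] by (simp add: map_tens_def lift_tens_def pure_def)
  qed
 qed
qed

text \<open>Finite sums of pure tensors are dense and linear maps are continuous. Density in the
  module topology, and not merely on the values at forms, is supplied by
  \<open>ctens_hpow\<close>.\<close>

lemma ctens_linear_eq:
 assumes V: "tfree V" and V': "tfree V'" and n: "0 < n" "0 < m"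
  and D: "D \<in> linear_maps (ctens V n) (ctens V' m)" and E: "E \<in> linear_maps (ctens V n) (ctens V' m)"
  and eq: "!!xs. wf_list V n xs ==> D (pure V xs) = E (pure V xs)" and t: "t \<in> carrier (ctens V n)"
 shows "D t = E t"
proof
 interpret V: tfree V by fact
 interpret V': tfree V' by fact
 fix B
 show "D t B = E t B"
 proof (rule fps_eq_dvdI)
  fix N
  obtain L where L: "approx V n N t L" using t n by (meson V.ctens_iff')
  \<comment> \<open>The list \<open>L\<close> as an element of the tensor power; \<open>pure\<close>
    rather than bare evaluation makes it vanish on functions that are not multilinear.\<close>
  define l where "l L = (%B. \<Sum>(c, xs)\<leftarrow>L. c * pure V xs B)" for L
  have "l L \<in> carrier (ctens V n) & D (l L) = E (l L) & (ALL B. mlin V n B --> l L B = val L B)"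
   using approxD(1)[OF L]
  proof (induction L)
   case Nil
   have z: "(%_. 0) \<in> carrier (ctens V n)" by (rule V.ctens_zero_closed[OF n(1)])
   have "F (%_. 0) = (%_. 0)" if "F \<in> linear_maps (ctens V n) (ctens V' m)" for F
   proof -
    have "F (0 \<odot>\<^bsub>ctens V n\<^esub> (%_. 0)) = 0 \<odot>\<^bsub>ctens V' m\<^esub> F (%_. 0)" using that z unfolding linear_maps_def by blast
    then show ?thesis by simp
   qed
   then show ?case using z D E by (simp add: l_def)
  next
   case (Cons p L)
   obtain c xs where p: "p = (c, xs)" by fastforce
   have xs: "wf_list V n xs" using Cons(2) p by (simp add: wf_list_def)
   note pc = V.pure_ctens[OF n(1) xs]
   note sc = V.ctens_smult_closed[OF n(1) pc, of c]
   have lp: "l ((c, xs) # L) = (%B. c * pure V xs B + l L B)" by (simp add: l_def)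
   have IH: "l L \<in> carrier (ctens V n)" "D (l L) = E (l L)" "!!B. mlin V n B ==> l L B = val L B"
    using Cons p by auto
   have F: "F (l ((c, xs) # L)) = (%B. c * F (pure V xs) B + F (l L) B)" if "F \<in> linear_maps (ctens V n) (ctens V' m)" for F
    unfolding lp using that pc sc IH(1) by (simp add: linear_maps_def)
   have 1: "D (l ((c, xs) # L)) = E (l ((c, xs) # L))" unfolding F[OF D] F[OF E] IH(2) eq[OF xs] ..
   have 2: "l ((c, xs) # L) \<in> carrier (ctens V n)" unfolding lp by (rule V.ctens_add_closed[OF n(1) sc IH(1)])
   have 3: "l ((c, xs) # L) B = val ((c, xs) # L) B" if "mlin V n B" for B
    unfolding lp using IH(3)[OF that] xs that by (simp add: wf_list_def)
   show ?case unfolding p using 1 2 3 by blast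
  qed
  then have l: "l L \<in> carrier (ctens V n)" "D (l L) = E (l L)" "!!B. mlin V n B ==> l L B = val L B" by blast+
  have "t \<ominus>\<^bsub>ctens V n\<^esub> l L \<in> hpow (ctens V n) N"
   using approxD(2)[OF L] l t n by (simp add: V.ctens_hpow V.ctens_minus_closed)
  then have d: "fps_X ^ N dvd F t B - F (l L) B" if F: "F \<in> linear_maps (ctens V n) (ctens V' m)" for F
  proof -
   assume h: "t \<ominus>\<^bsub>ctens V n\<^esub> l L \<in> hpow (ctens V n) N"
   interpret F: tlin "ctens V n" "ctens V' m" F
    using F V.hmod_ctens[OF n(1)] V'.hmod_ctens[OF n(2)] by (intro tlinI) (auto simp: hmod_def)
   have "F (t \<ominus>\<^bsub>ctens V n\<^esub> l L) \<in> hpow (ctens V' m) N"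
    by (rule linear_maps_hpow[OF V.hmod_ctens[OF n(1)] V'.hmod_ctens[OF n(2)] F h])
   then have h': "(%B. F t B - F (l L) B) \<in> hpow (ctens V' m) N"
    using F.minus[OF t l(1)] V'.ctens_minus[OF n(2) F.closed[OF l(1)]] by simp
   then show ?thesis by (auto simp: hpow_def fun_eq_iff)
  qed
  show "fps_X ^ N dvd D t B - E t B" using dvd_diff_join[OF d[OF D] d[OF E, folded l(2)]] .
 qed
qed

text \<open>The flipped operator is determined for an arbitrary first argument against generators by
  means of \<open>hexB\<close>. Read backwards, this is a generator against an arbitrary second
  factor, the base case of the induction over the first argument of \<open>S\<close> by means of
  \<open>hexA\<close>.\<close>

theorem quantum_va_isoI:
 assumes Q: "quantum_va V S" and Q': "quantum_va V' S'" and f: "f \<in> va_iso V V'"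
  and gen: "va_generated V G" and G: "G \<subseteq> carrier V"
  and gg: "!!x y c B B'. x \<in> G ==> y \<in> G ==> bil V B ==> bil V' B' ==>
   ALL x:insert (vac V) G. ALL y:insert (vac V) G. B x y = B' (f x) (f y) ==>
   biop V S x y c B = biop V' S' (f x) (f y) c B'"
 shows "f \<in> quantum_va_iso V S V' S'"
proof -
 interpret V: qyb V S by (rule quantum_va_qyb[OF Q])
 interpret V': qyb V' S' by (rule quantum_va_qyb[OF Q'])
 have fh: "f \<in> va_hom V V'" using f by (simp add: va_iso_def)
 then have fl: "f \<in> linear_maps V V'" and fv: "f (vac V) = vac V'"
  and fn: "!!n u v. u \<in> carrier V ==> v \<in> carrier V ==> f (nprod V n u v) = nprod V' n (f u) (f v)"
  by (auto simp: va_hom_def)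
 interpret f: tlin V V' f using fl by unfold_locales
 \<comment> \<open>The vacuum is added because values of the operator on generators may involve
   it.\<close>
 define H where "H = insert (vac V) G"
 have H: "H \<subseteq> carrier V" using G by (auto simp: H_def)
 have ph: "prods_hom V V.yop V' V'.yop f H" if "H \<subseteq> carrier V" for H
  unfolding prods_hom_def prods_hom_axioms_def using V.prods_yop V'.prods_yop fl fn that
  by (auto simp: V.yop_def V'.yop_def)
 have gH: "biop V S x y c B = biop V' S' (f x) (f y) c B'"
  if "x \<in> H" "y \<in> H" "bil V B" "bil V' B'" "ALL x:H. ALL y:H. B x y = B' (f x) (f y)" for x y c B B'
 proof (cases "x = vac V | y = vac V")
  case True
  then show ?thesis
   using that H by (auto simp: fv V.biop_vac V'.biop_vac V.biop_vac_right V'.biop_vac_right)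
 next
  case False
  then show ?thesis using that gg[of x y B B' c] by (auto simp: H_def)
 qed
 have nY: "nprod V n u v = V.yop (- n - 1) u v" for n u v by (simp add: V.yop_def)
 have 1: "tw V V' f H (V.sY u h) (V'.sY (f u) (f h))" if "u \<in> carrier V" "h \<in> H" for u h
 proof (rule tw_generated[OF V.pva_axioms V'.pva_axioms gen fl H V.sop_biop V'.sop_biop G _ _ that])
  fix g h assume "g \<in> insert (vac V) G" "h \<in> H"
  then have gh: "g \<in> H" "h \<in> H" by (simp_all add: H_def)
  show "tw V V' f H (V.sY g h) (V'.sY (f g) (f h))"
   unfolding tw_def
  proof (intro allI impI)
   fix c B B' assume B: "bil V B" "bil V' B'" "ALL x:carrier V. ALL h:H. B x h = B' (f x) (f h)"
   show "V.sY g h c B = V'.sY (f g) (f h) c B'" by (rule gH[OF gh B(1,2)]) (use B(3) H in auto)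
  qed
 next
  fix n u v h
  show "u \<in> carrier V ==> v \<in> carrier V ==> (!!h. h \<in> H ==> tw V V' f H (V.sY u h) (V'.sY (f u) (f h))) ==>
   (!!h. h \<in> H ==> tw V V' f H (V.sY v h) (V'.sY (f v) (f h))) ==> h \<in> H ==>
   tw V V' f H (V.sY (nprod V n u v) h) (V'.sY (f (nprod V n u v)) (f h))"
   unfolding nY by (rule prods_hom.tw_Y_A[OF ph[OF H] V.sop_biop V'.sop_biop V.hexA_biop V'.hexA_biop])
 qed
 have 2: "tw V V' f H (fl V.sY u h) (fl V'.sY (f u) (f h))" if "u \<in> carrier V" "h \<in> H" for u h
 proof (rule tw_generated[OF V.pva_axioms V'.pva_axioms gen fl H sop_fl[OF V.sop_biop] sop_fl[OF V'.sop_biop] G _ _ that])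
  fix g h assume "g \<in> insert (vac V) G" "h \<in> H"
  then have gh: "g \<in> H" "h \<in> H" by (simp_all add: H_def)
  show "tw V V' f H (fl V.sY g h) (fl V'.sY (f g) (f h))"
   unfolding tw_def fl_def
  proof (intro allI impI)
   fix c B B' assume B: "bil V B" "bil V' B'" "ALL x:carrier V. ALL h:H. B x h = B' (f x) (f h)"
   show "V.sY h g c (%x y. B y x) = V'.sY (f h) (f g) c (%x y. B' y x)"
    by (rule gH[OF gh(2,1) bil_flip[OF B(1)] bil_flip[OF B(2)]]) (use B(3) H in auto)
  qed
 next
  fix n u v h
  show "u \<in> carrier V ==> v \<in> carrier V ==> (!!h. h \<in> H ==> tw V V' f H (fl V.sY u h) (fl V'.sY (f u) (f h))) ==>
   (!!h. h \<in> H ==> tw V V' f H (fl V.sY v h) (fl V'.sY (f v) (f h))) ==> h \<in> H ==>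
   tw V V' f H (fl V.sY (nprod V n u v) h) (fl V'.sY (f (nprod V n u v)) (f h))"
   unfolding nY
   by (rule prods_hom.tw_Y_B[OF ph[OF H] sop_fl[OF V.sop_biop] sop_fl[OF V'.sop_biop] V.hexB_biop V'.hexB_biop])
 qed
 have 3: "tw V V' f (carrier V) (V.sY u w) (V'.sY (f u) (f w))" if "u \<in> carrier V" "w \<in> carrier V" for u w
 proof (rule tw_generated[OF V.pva_axioms V'.pva_axioms gen fl subset_refl V.sop_biop V'.sop_biop G _ _ that])
  fix g w assume gw: "g \<in> insert (vac V) G" "w \<in> carrier V"
  show "tw V V' f (carrier V) (V.sY g w) (V'.sY (f g) (f w))"
   unfolding tw_def
  proof (intro allI impI)
   fix c B B' assume B: "bil V B" "bil V' B'" "ALL x:carrier V. ALL h:carrier V. B x h = B' (f x) (f h)"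
   have "fl V.sY w g c (%x y. B y x) = fl V'.sY (f w) (f g) c (%x y. B' y x)"
    by (rule twD[OF 2 bil_flip[OF B(1)] bil_flip[OF B(2)]]) (use B(3) gw H in \<open>auto simp: H_def\<close>)
   then show "V.sY g w c B = V'.sY (f g) (f w) c B'" by (simp add: fl_def)
  qed
 next
  fix n u v h
  show "u \<in> carrier V ==> v \<in> carrier V ==> (!!h. h \<in> carrier V ==> tw V V' f (carrier V) (V.sY u h) (V'.sY (f u) (f h))) ==>
   (!!h. h \<in> carrier V ==> tw V V' f (carrier V) (V.sY v h) (V'.sY (f v) (f h))) ==> h \<in> carrier V ==>
   tw V V' f (carrier V) (V.sY (nprod V n u v) h) (V'.sY (f (nprod V n u v)) (f h))"
   unfolding nY
   by (rule prods_hom.tw_Y_A[OF ph[OF subset_refl] V.sop_biop V'.sop_biop V.hexA_biop V'.hexA_biop])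
 qed
 note m = map_tens_linear[OF V.tfree_axioms V'.tfree_axioms fl, of 2]
 have "map_tens V' 2 f (S c t) = S' c (map_tens V' 2 f t)" if t: "t \<in> carrier (ctens V 2)" for c t
 proof (rule ctens_linear_eq[OF V.tfree_axioms V'.tfree_axioms _ _ _ _ _ t, of 2 "%t. map_tens V' 2 f (S c t)" "%t. S' c (map_tens V' 2 f t)"])
  show "(%t. map_tens V' 2 f (S c t)) \<in> linear_maps (ctens V 2) (ctens V' 2)"
   "(%t. S' c (map_tens V' 2 f t)) \<in> linear_maps (ctens V 2) (ctens V' 2)"
   using m(1) V.S_lin[of c] V'.S_lin[of c] by (auto simp: linear_maps_def Pi_def)
  fix xs assume "wf_list V 2 xs"
  then obtain x y where xs: "xs = [x, y]" and xy: "x \<in> carrier V" "y \<in> carrier V" by (rule wf_list_2E)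
  show "map_tens V' 2 f (S c (pure V xs)) = S' c (map_tens V' 2 f (pure V xs))"
  proof
   fix B
   have r: "map_tens V' 2 f (pure V xs) = pure V' [f x, f y]" using m(2)[of xs] xy by (simp add: xs)
   show "map_tens V' 2 f (S c (pure V xs)) B = S' c (map_tens V' 2 f (pure V xs)) B"
   proof (cases "mlin V' 2 B")
    case True
    have "map_tens V' 2 f (S c (pure V xs)) B = S c (pure V [x, y]) (%zs. pure V' (map f zs) B)"
     using True by (simp add: map_tens_def lift_tens_def xs)
    also have "... = V.sY x y c (%x y. B [f x, f y])"
     unfolding V.S_bil[OF xy] using True by (simp add: pure_def numeral_2_eq_2)
    also have "... = V'.sY (f x) (f y) c (%x y. B [x, y])"
    proof (rule twD[OF 3[OF xy] _ bil_mlin[OF True]])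
     show "bil V (%x y. B [f x, f y])"
      by (rule bilI) (use bilD[OF bil_mlin[OF True]] in \<open>auto simp: f.add f.smult\<close>)
    qed simp
    also have "... = S' c (pure V' [f x, f y]) B" using V'.S_bil[of "f x" "f y" c B] xy by simp
    finally show ?thesis by (simp add: r)
   next
    case False
    have "S' c (pure V' [f x, f y]) \<in> carrier (ctens V' 2)" using xy by (intro V'.S_closed V'.pure2) auto
    then have "S' c (pure V' [f x, f y]) B = 0" using False by (simp add: V'.ctens_iff')
    then show ?thesis using False unfolding r by (simp add: map_tens_def lift_tens_def)
   qed
  qed
 qed simp_all
 then show ?thesis using f by (simp add: quantum_va_iso_def)
qed

section \<open>Values on the generators\<close>

definition gbase :: "'v hva => ('i gen => 'v) => 'i gen => 'v" where
 "gbase V g s = (case s of Hg i => vac V | Xg e i => g s)"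

text \<open>All four values have the form \<open>S(z)(x \<otimes> y) = x \<otimes> y \<otimes> p(z) + x' \<otimes> y' \<otimes> p'(z)\<close>, where \<open>x'\<close>, \<open>y'\<close>
 arise by replacing each \<open>h_i\<close> by the vacuum.\<close>

lemma S_on_gens_eval:
 "EX p p'. ALL (V :: 'v hva) g S B. S_on_gens a r l t V g S --> bil V B -->
  biop V S (g s1) (g s2) c B = p * B (g s1) (g s2) + p' * B (gbase V g s1) (gbase V g s2)"
proof -
 have pe: "pure V [x, y] (%ys. B (ys ! 0) (ys ! 1)) = B x y" if "bil V B" for V :: "'v hva" and x y B
  using mlin_bil[OF that] by (simp add: pure_def numeral_2_eq_2)
 show ?thesis
 proof (cases s1)
  case s1: (Hg j)
  show ?thesis
  proof (cases s2)
   case s2: (Hg i)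
   have "biop V S (g s1) (g s2) c B = (if c = 0 then 1 else 0) * B (g s1) (g s2) + (zcoef (hD_fls (qnum (ra a r i j)) (qdiff_fls (rl r l) (- rl r l) (inverse zv ^ 2)) + temb (reflect (t Nought Nought i j)) - temb (t Nought Nought j i)) c) * B (gbase V g s1) (gbase V g s2)"
    if S: "S_on_gens a r l t V g S" and B: "bil V B" for V :: "'v hva" and g S B
   proof -
    have e: "S c (pure V [g (Hg j), g (Hg i)]) = (%B. (if c = 0 then 1 else 0) * pure V [g (Hg j), g (Hg i)] B + (zcoef (hD_fls (qnum (ra a r i j)) (qdiff_fls (rl r l) (- rl r l) (inverse zv ^ 2)) + temb (reflect (t Nought Nought i j)) - temb (t Nought Nought j i)) c) * pure V [vac V, vac V] B)"
     using S unfolding S_on_gens_def Let_def ctens_simps by blast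
    show ?thesis unfolding biop_def s1 s2 gbase_def e pe[OF B] by simp
   qed
   then show ?thesis by blast
  next
   case s2: (Xg e i)
   have "biop V S (g s1) (g s2) c B = (if c = 0 then 1 else 0) * B (g s1) (g s2) + (- of_int (sg e) * zcoef (qdiff_fls (ra a r j i) (rl r l) (inverse zv) + temb (reflect (t Bullet Nought i j)) + temb (t Nought Bullet j i)) c) * B (gbase V g s1) (gbase V g s2)"
    if S: "S_on_gens a r l t V g S" and B: "bil V B" for V :: "'v hva" and g S B
   proof -
    have e: "S c (pure V [g (Hg j), g (Xg e i)]) = (%B. (if c = 0 then 1 else 0) * pure V [g (Hg j), g (Xg e i)] B + (- of_int (sg e) * zcoef (qdiff_fls (ra a r j i) (rl r l) (inverse zv) + temb (reflect (t Bullet Nought i j)) + temb (t Nought Bullet j i)) c) * pure V [vac V, g (Xg e i)] B)"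
     using S unfolding S_on_gens_def Let_def ctens_simps by blast
    show ?thesis unfolding biop_def s1 s2 gbase_def e pe[OF B] by simp
   qed
   then show ?thesis by blast
  qed
 next
  case s1: (Xg e1 j)
  show ?thesis
  proof (cases s2)
   case s2: (Hg i)
   have "biop V S (g s1) (g s2) c B = (if c = 0 then 1 else 0) * B (g s1) (g s2) + (of_int (sg e1) * zcoef (qdiff_fls (ra a r i j) (rl r l) (inverse zv) + temb (reflect (t Nought Bullet i j)) + temb (t Bullet Nought j i)) c) * B (gbase V g s1) (gbase V g s2)"
    if S: "S_on_gens a r l t V g S" and B: "bil V B" for V :: "'v hva" and g S B
   proof -
    have e: "S c (pure V [g (Xg e1 j), g (Hg i)]) = (%B. (if c = 0 then 1 else 0) * pure V [g (Xg e1 j), g (Hg i)] B + (of_int (sg e1) * zcoef (qdiff_fls (ra a r i j) (rl r l) (inverse zv) + temb (reflect (t Nought Bullet i j)) + temb (t Bullet Nought j i)) c) * pure V [g (Xg e1 j), vac V] B)"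
     using S unfolding S_on_gens_def Let_def ctens_simps by blast
    show ?thesis unfolding biop_def s1 s2 gbase_def e pe[OF B] by simp
   qed
   then show ?thesis by blast
  next
   case s2: (Xg e2 i)
   have "biop V S (g s1) (g s2) c B = (zcoef ((temb (t Bullet Bullet j i) / temb (reflect (t Bullet Bullet i j))) powi (sg e1 * sg e2) *
     ((zv - of_int (sg e1 * sg e2) * hmon (ra a r i j)) / (zv + of_int (sg e1 * sg e2) * hmon (ra a r i j)))) c) * B (g s1) (g s2) + (0) * B (gbase V g s1) (gbase V g s2)"
    if S: "S_on_gens a r l t V g S" and B: "bil V B" for V :: "'v hva" and g S B
   proof -
    have e: "S c (pure V [g (Xg e1 j), g (Xg e2 i)]) = (%B. (zcoef ((temb (t Bullet Bullet j i) / temb (reflect (t Bullet Bullet i j))) powi (sg e1 * sg e2) *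
     ((zv - of_int (sg e1 * sg e2) * hmon (ra a r i j)) / (zv + of_int (sg e1 * sg e2) * hmon (ra a r i j)))) c) * pure V [g (Xg e1 j), g (Xg e2 i)] B)"
     using S unfolding S_on_gens_def Let_def ctens_simps by blast
    show ?thesis unfolding biop_def s1 s2 gbase_def e pe[OF B] by simp
   qed
   then show ?thesis by blast
  qed
 qed
qed

text \<open>Every term of a value on two generators contains the same vectors \<open>x\<close> as
  the pair itself, so both sides scale by \<open>u s1 * u s2\<close>. A generator \<open>h_i\<close>
  may turn into the vacuum, whence its scale 1.\<close>

lemma quantum_va_iso_gens:
 fixes V V' :: "'v hva"
 assumes Q: "quantum_va V S" and Q': "quantum_va V' S'" and S: "S_on_gens a r l t V g S" and S': "S_on_gens a r l t V' g' S'"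
  and f: "f \<in> va_iso V V'" and gen: "va_generated V (range g)" and g: "range g \<subseteq> carrier V" and g': "range g' \<subseteq> carrier V'"
  and fg: "!!s. f (g s) = u s \<odot>\<^bsub>V'\<^esub> g' s" and u: "!!i. u (Hg i) = 1"
 shows "f \<in> quantum_va_iso V S V' S'"
proof (rule quantum_va_isoI[OF Q Q' f gen g])
 interpret V: qyb V S by (rule quantum_va_qyb[OF Q])
 interpret V': qyb V' S' by (rule quantum_va_qyb[OF Q'])
 fix x y c B B' assume x: "x \<in> range g" and y: "y \<in> range g" and B: "bil V B" and B': "bil V' B'"
  and BB: "ALL x:insert (vac V) (range g). ALL y:insert (vac V) (range g). B x y = B' (f x) (f y)"
 obtain s1 s2 where s: "x = g s1" "y = g s2" using x y by blast
 have fv: "f (vac V) = vac V'" using f by (auto simp: va_iso_def va_hom_def)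
 have gc: "g' s \<in> carrier V'" for s using g' by auto
 have bc: "gbase V' g' s \<in> carrier V'" for s using gc by (simp add: gbase_def split: gen.split)
 have fb: "f (gbase V g s) = u s \<odot>\<^bsub>V'\<^esub> gbase V' g' s" for s
  by (simp add: gbase_def fv fg u split: gen.split)
 obtain p p' where e: "!!(V :: 'v hva) g S B. S_on_gens a r l t V g S ==> bil V B ==>
  biop V S (g s1) (g s2) c B = p * B (g s1) (g s2) + p' * B (gbase V g s1) (gbase V g s2)"
  using S_on_gens_eval[of a r l t s1 s2 c] by blast
 have "biop V S x y c B = p * B (g s1) (g s2) + p' * B (gbase V g s1) (gbase V g s2)" unfolding s by (rule e[OF S B])
 also have "B (g s1) (g s2) = B' (f (g s1)) (f (g s2))" using BB by blast
 also have "B (gbase V g s1) (gbase V g s2) = B' (f (gbase V g s1)) (f (gbase V g s2))"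
  using BB by (auto simp: gbase_def split: gen.split)
 also have "p * B' (f (g s1)) (f (g s2)) + p' * B' (f (gbase V g s1)) (f (gbase V g s2)) =
   u s1 * u s2 * (p * B' (g' s1) (g' s2) + p' * B' (gbase V' g' s1) (gbase V' g' s2))"
  using bilD(3,4)[OF B'] gc bc by (simp add: fg fb algebra_simps)
 also have "... = u s1 * u s2 * biop V' S' (g' s1) (g' s2) c B'" unfolding e[OF S' B'] ..
 also have "... = biop V' S' (f x) (f y) c B'"
  using bilD(3,4)[OF sopD(2)[OF V'.sop_biop B']] gc by (simp add: s fg)
 finally show "biop V S x y c B = biop V' S' (f x) (f y) c B'" .
qed

section \<open>The isomorphism of the quotients\<close>

definition unique_iso where
 "unique_iso a r l t A g B g' \<longleftrightarrow> (EX! f. f \<in> va_iso A B \<inter> extensional (carrier A) & maps_gens r g B g' f &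
  (ALL S S'. quantum_va A S & S_on_gens a r l t A g S & quantum_va B S' & S_on_gens a r l t B g' S' -->
   f \<in> quantum_va_iso A S B S'))"

lemma (in pva) nprod_iter_scale:
 assumes "x \<in> carrier V" "y \<in> carrier V"
 shows "(nprod V m x ^^ n) y \<in> carrier V &
  (nprod V m (c \<odot> x) ^^ n) (d \<odot> y) = (c ^ n * d) \<odot> (nprod V m x ^^ n) y"
 using assms by (induction n) (auto simp: nprod_smult_l nprod_smult_r sm_assoc mult_ac)

lemma (in pva_hom) nprod_iter_image:
 assumes "x \<in> carrier A" "y \<in> carrier A"
 shows "(nprod A m x ^^ n) y \<in> carrier A & f ((nprod A m x ^^ n) y) = (nprod B m (f x) ^^ n) (f y)"
 using assms by (induction n) (auto simp: nprod)

text \<open>Relators need to match only up to a unit, which leaves the ideals they generate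
  unchanged.\<close>

definition corr :: "'v hva => ('u => 'v) => 'u => 'v => bool" where
 "corr B f x y \<longleftrightarrow> (EX c c'. c * c' = 1 & f x = c \<odot>\<^bsub>B\<^esub> y)"

lemma corrD:
 assumes "pva B" "corr B f x y" "y \<in> carrier B"
 shows "EX c. f x = c \<odot>\<^bsub>B\<^esub> y" "EX c. y = c \<odot>\<^bsub>B\<^esub> f x"
proof -
 interpret pva B by fact
 obtain c c' where c: "c * c' = 1" "f x = c \<odot>\<^bsub>B\<^esub> y" using assms by (auto simp: corr_def)
 then have "c' \<odot>\<^bsub>B\<^esub> f x = y" using assms(3) by (simp add: sm_assoc mult.commute)
 then show "EX c. f x = c \<odot>\<^bsub>B\<^esub> y" "EX c. y = c \<odot>\<^bsub>B\<^esub> f x" using c by metis+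
qed

text \<open>A situation that reproduces itself on quotients: the passage from the universal algebras
  to \<open>V\<close> and the one from \<open>V\<close> to \<open>L\<close> become two instances of
  the same lemma.\<close>

locale gens_iso = A: pva A + B: pva B for A B :: "'v hva" +
 fixes f :: "'v => 'v" and g g' :: "'i gen => 'v" and u :: "'i gen => complex fps"
 assumes iso: "f \<in> va_iso A B" and fg: "!!s. f (g s) = u s \<odot>\<^bsub>B\<^esub> g' s"
  and g: "range g \<subseteq> carrier A" and g': "range g' \<subseteq> carrier B"
  and u: "!!s. u s * inverse (u s) = 1" and gen: "va_generated A (range g)"
begin

lemma gc [simp]: "g s \<in> carrier A" "g' s \<in> carrier B"
 using g g' by auto

lemma hom: "f \<in> va_hom A B"
 using iso by (simp add: va_iso_def)

sublocale h: pva_hom A B f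
 by (rule pva_homI[OF A.pva_axioms B.pva_axioms hom])

lemma iter_corr: "corr B f ((nprod A m (g s) ^^ n) (g s')) ((nprod B m (g' s) ^^ n) (g' s'))"
 unfolding corr_def
proof (intro exI conjI)
 show "(u s ^ n * u s') * (inverse (u s) ^ n * inverse (u s')) = 1"
  using u[of s] u[of s'] by (simp add: algebra_simps flip: power_mult_distrib)
 show "f ((nprod A m (g s) ^^ n) (g s')) = (u s ^ n * u s') \<odot>\<^bsub>B\<^esub> (nprod B m (g' s) ^^ n) (g' s')"
  using h.nprod_iter_image[of "g s" "g s'" n m] B.nprod_iter_scale[of "g' s" "g' s'" n m "u s" "u s'"] by (simp add: fg)
qed

lemma quotient:
 assumes R: "R \<subseteq> carrier A" and R': "R' \<subseteq> carrier B"
  and 1: "!!x. x \<in> R ==> EX y:R'. corr B f x y" and 2: "!!y. y \<in> R' ==> EX x:R. corr B f x y"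
 defines "K \<equiv> closed_ideal_gen A R" and "K' \<equiv> closed_ideal_gen B R'"
 obtains F where "F \<in> extensional (carrier (va_quot A K))"
  "gens_iso (va_quot A K) (va_quot B K') F (%s. K +>\<^bsub>A\<^esub> g s) (%s. K' +>\<^bsub>B\<^esub> g' s) u" "hsep (va_quot B K')"
proof -
 have cs: "A.cs_ideal K" "B.cs_ideal K'"
  unfolding K_def K'_def by (rule A.closed_ideal_gen_cs[OF R], rule B.closed_ideal_gen_cs[OF R'])
 then have K: "va_ideal A K" and K': "va_ideal B K'" and c': "hclosure B K' = K'" "saturate B K' = K'"
  by (auto simp: A.cs_ideal_def B.cs_ideal_def)
 have KK: "x \<in> K \<longleftrightarrow> f x \<in> K'" if "x \<in> carrier A" for x
  unfolding K_def K'_def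
 proof (rule closed_ideal_gen_iso[OF A.pva_axioms B.pva_axioms iso R R' _ _ that])
  fix x assume "x \<in> R"
  from 1[OF this] obtain y where y: "y \<in> R'" "corr B f x y" by (rule bexE)
  obtain c where "f x = c \<odot>\<^bsub>B\<^esub> y" using corrD(1)[OF B.pva_axioms y(2) subsetD[OF R' y(1)]] by (rule exE)
  then show "EX c. EX y:R'. f x = c \<odot>\<^bsub>B\<^esub> y" using y(1) by (intro exI bexI)
 next
  fix y assume y: "y \<in> R'"
  from 2[OF this] obtain x where x: "x \<in> R" "corr B f x y" by (rule bexE)
  obtain c where "y = c \<odot>\<^bsub>B\<^esub> f x" using corrD(2)[OF B.pva_axioms x(2) subsetD[OF R' y]] by (rule exE)
  then show "EX c. EX x:R. y = c \<odot>\<^bsub>B\<^esub> f x" using x(1) by (intro exI bexI)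
 qed
 obtain F where F: "F \<in> va_iso (va_quot A K) (va_quot B K') \<inter> extensional (carrier (va_quot A K))"
  "!!x. x \<in> carrier A ==> F (K +>\<^bsub>A\<^esub> x) = K' +>\<^bsub>B\<^esub> f x"
  using quot_iso[OF A.pva_axioms B.pva_axioms iso K K' KK] by blast
 show ?thesis
 proof (rule that[of F])
  show "F \<in> extensional (carrier (va_quot A K))" using F by simp
  show "hsep (va_quot B K')" by (rule B.quot_hsep[OF K' c'])
  show "gens_iso (va_quot A K) (va_quot B K') F (%s. K +>\<^bsub>A\<^esub> g s) (%s. K' +>\<^bsub>B\<^esub> g' s) u"
   unfolding gens_iso_def gens_iso_axioms_def
  proof (intro conjI allI)
   show "pva (va_quot A K)" "pva (va_quot B K')" by (rule A.quot_pva[OF K], rule B.quot_pva[OF K'])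
   show "F \<in> va_iso (va_quot A K) (va_quot B K')" using F by simp
   show "F (K +>\<^bsub>A\<^esub> g s) = u s \<odot>\<^bsub>va_quot B K'\<^esub> (K' +>\<^bsub>B\<^esub> g' s)" for s
    by (simp add: F(2) fg B.quot_smult[OF K'])
   show "range (%s. K +>\<^bsub>A\<^esub> g s) \<subseteq> carrier (va_quot A K)" "range (%s. K' +>\<^bsub>B\<^esub> g' s) \<subseteq> carrier (va_quot B K')"
    by (auto simp: A.quot_carrier[OF K] B.quot_carrier[OF K'])
   show "va_generated (va_quot A K) (range (%s. K +>\<^bsub>A\<^esub> g s))" by (rule A.quot_generated[OF K gen g])
  qed (rule u)
 qed
qed

text \<open>Uniqueness comes from generation of the source and separatedness of the target.
  Compatibility with Yang-Baxter operators holds for any two operators with the prescribed values,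
  so none has to be constructed.\<close>

lemma unique_iso_gens:
 assumes ue: "u = gen_unit r" and ext: "f \<in> extensional (carrier A)" and sep: "hsep B"
 shows "unique_iso a r l t A g B g'"
proof -
 have mg: "maps_gens r g B g' h \<longleftrightarrow> (ALL s. h (g s) = u s \<odot>\<^bsub>B\<^esub> g' s)" for h
 proof
  assume m: "maps_gens r g B g' h"
  show "ALL s. h (g s) = u s \<odot>\<^bsub>B\<^esub> g' s"
  proof
   \<comment> \<open>The inner case split ranges over the sign of a generator \<open>x\<close>; for
     a generator \<open>h\<close> the value \<open>Neg\<close> is a placeholder.\<close>
   fix s show "h (g s) = u s \<odot>\<^bsub>B\<^esub> g' s"
    using m by (cases s; cases "case s of Xg e i => e | _ => Neg") (auto simp: maps_gens_def ue gen_unit_def)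
  qed
 next
  assume m: "ALL s. h (g s) = u s \<odot>\<^bsub>B\<^esub> g' s"
  then show "maps_gens r g B g' h" by (simp add: maps_gens_def ue gen_unit_def)
 qed
 have uH: "u (Hg i) = 1" for i by (simp add: ue)
 show ?thesis
  unfolding unique_iso_def
 proof (rule ex1I[of _ f])
  show "f \<in> va_iso A B \<inter> extensional (carrier A) & maps_gens r g B g' f &
   (ALL S S'. quantum_va A S & S_on_gens a r l t A g S & quantum_va B S' & S_on_gens a r l t B g' S' -->
    f \<in> quantum_va_iso A S B S')"
   using iso ext fg mg quantum_va_iso_gens[where f = f and g = g and g' = g' and u = u, OF _ _ _ _ iso gen g g' fg uH] by blast
  fix h assume h: "h \<in> va_iso A B \<inter> extensional (carrier A) & maps_gens r g B g' h &
   (ALL S S'. quantum_va A S & S_on_gens a r l t A g S & quantum_va B S' & S_on_gens a r l t B g' S' -->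
    h \<in> quantum_va_iso A S B S')"
  then have hh: "h \<in> va_hom A B" and he: "h \<in> extensional (carrier A)" and hg: "!!s. h (g s) = u s \<odot>\<^bsub>B\<^esub> g' s"
   using mg by (auto simp: va_iso_def)
  show "h = f"
  proof (rule extensionalityI[OF he ext])
   show "h x = f x" if "x \<in> carrier A" for x
    by (rule va_hom_eq[OF A.pva_axioms B.pva_axioms gen sep hh hom _ g that]) (auto simp: hg fg)
  qed
 qed
qed

lemma R2_corr:
 shows "R2 r k A g \<subseteq> carrier A" "R2 r k B g' \<subseteq> carrier B"
  "x \<in> R2 r k A g ==> EX y:R2 r k B g'. corr B f x y" "y \<in> R2 r k B g' ==> EX x:R2 r k A g. corr B f x y"
 using A.nprod_iter_scale[of "g _" "g _"] B.nprod_iter_scale[of "g' _" "g' _"] iter_corr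
 unfolding R2_def by fastforce+

lemma serre_corr:
 shows "serre a A g \<subseteq> carrier A" "serre a B g' \<subseteq> carrier B"
  "x \<in> serre a A g ==> EX y:serre a B g'. corr B f x y" "y \<in> serre a B g' ==> EX x:serre a A g. corr B f x y"
 using A.nprod_iter_scale[of "g _" "g _"] B.nprod_iter_scale[of "g' _" "g' _"] iter_corr
 unfolding serre_def by fastforce+

end

text \<open>The universal algebras themselves, where topological freeness provides the infinite sums
  in the vectors \<open>E\<close> and the division in the relators.\<close>

locale level_iso = gens_iso A B f g g' "gen_unit r" + A: va A + B: va B
 for A B :: "'v hva" and f g g' and r :: "'i::finite => nat" +
 fixes a :: "'i => 'i => int" and l :: complex
 assumes gcm: "symmetrizable_gcm a r"
begin

lemma r_pos: "0 < r i"
 using gcm by (simp add: symmetrizable_gcm_def)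

sublocale v: va_hom_loc A B f
 by (rule va_hom_locI[OF A.va_axioms B.va_axioms hom])

lemma E_tau_eq: "E_tau r l (tau_trig a r l) V w i = E_hat r l V w i"
 and E_scalar_0: "fps_sqrt (Fval (of_nat (r i) + rl r l) / Fval (of_nat (r i) - rl r l)) $ 0 = 1"
proof -
 have "a i i = 2" using gcm by (simp add: symmetrizable_gcm_def)
 then have "tau_trig a r l Bullet Bullet i i = tau_shift (2 * of_nat (r i))"
  unfolding tau_trig_bullet by (simp add: ra_def mult.commute)
 from E_scalar[OF this, of "rl r l"]
 show "E_tau r l (tau_trig a r l) V w i = E_hat r l V w i"
  "fps_sqrt (Fval (of_nat (r i) + rl r l) / Fval (of_nat (r i) - rl r l)) $ 0 = 1"
  by (simp_all add: E_tau_def E_hat_def del: tau_trig.simps)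
qed

lemma E_hat_image: "f (E_hat r l A g i) = E_hat r l B g' i"
 by (simp add: E_hat_def h.smult v.exp_vec fg)

lemma E_hat_closed: "E_hat r l A g i \<in> carrier A" "E_hat r l B g' i \<in> carrier B"
 by (simp_all add: E_hat_def)

lemma vac_minus_E: "vac A \<ominus>\<^bsub>A\<^esub> E_hat r l A g i \<in> hpow A 1" "vac B \<ominus>\<^bsub>B\<^esub> E_hat r l B g' i \<in> hpow B 1"
 unfolding E_hat_def by (rule A.vac_minus_exp_vec[OF gc(1) E_scalar_0], rule B.vac_minus_exp_vec[OF gc(2) E_scalar_0])

abbreviation "uP i \<equiv> gen_unit r (Xg Pos i)"
abbreviation "dA i \<equiv> hdiv A (of_nat (2 * r i) * fps_X) (vac A \<ominus>\<^bsub>A\<^esub> E_hat r l A g i)"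
abbreviation "dB i \<equiv> hdiv B (qdiff r i) (vac B \<ominus>\<^bsub>B\<^esub> E_hat r l B g' i)"

lemma two_r: "of_nat (2 * r i) * fps_const (1 / of_nat (2 * r i)) = (1 :: complex fps)"
proof -
 have "(of_nat (2 * r i) :: complex fps) = fps_const (of_nat (2 * r i))" by (simp only: fps_of_nat)
 then show ?thesis using r_pos[of i] by simp
qed

lemma dA: "dA i \<in> carrier A" "(of_nat (2 * r i) * fps_X) \<odot>\<^bsub>A\<^esub> dA i = vac A \<ominus>\<^bsub>A\<^esub> E_hat r l A g i"
 using A.hdiv_closed[OF vac_minus_E(1) mult.commute two_r] by blast+

lemma dB: "dB i \<in> carrier B" "qdiff r i \<odot>\<^bsub>B\<^esub> dB i = vac B \<ominus>\<^bsub>B\<^esub> E_hat r l B g' i"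
proof -
 have e: "qdiff r i = fps_X * (uP i * of_nat (2 * r i))" using qdiff_eq(1)[of r i] r_pos by (simp add: mult_ac)
 have "(uP i * of_nat (2 * r i)) * (inverse (uP i) * fps_const (1 / of_nat (2 * r i))) =
   (uP i * inverse (uP i)) * (of_nat (2 * r i) * fps_const (1 / of_nat (2 * r i)))" by (simp only: mult_ac)
 also have "... = 1" unfolding two_r u by simp
 finally show "dB i \<in> carrier B" "qdiff r i \<odot>\<^bsub>B\<^esub> dB i = vac B \<ominus>\<^bsub>B\<^esub> E_hat r l B g' i"
  using B.hdiv_closed[OF vac_minus_E(2) e] by blast+
qed

text \<open>The two divisors differ by the unit \<open>uP i\<close>, which is also the factor by
  which \<open>x_i^+\<close> is rescaled; hence both summands of the relator scale alike. The
  equation is checked after multiplication by a divisor, as there is no torsion.\<close>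

lemma dA_image: "f (dA i) = uP i \<odot>\<^bsub>B\<^esub> dB i"
proof (rule B.smult_cancel)
 let ?d = "of_nat (2 * r i) * fps_X :: complex fps"
 show "f (dA i) \<in> carrier B" "uP i \<odot>\<^bsub>B\<^esub> dB i \<in> carrier B" using dA dB by auto
 have "?d \<odot>\<^bsub>B\<^esub> f (dA i) = vac B \<ominus>\<^bsub>B\<^esub> E_hat r l B g' i"
  using arg_cong[OF dA(2), of f i] dA(1) E_hat_closed(1) by (simp add: h.smult h.minus h.vac E_hat_image)
 also have "... = qdiff r i \<odot>\<^bsub>B\<^esub> dB i" by (rule dB(2)[symmetric])
 also have "... = ?d \<odot>\<^bsub>B\<^esub> (uP i \<odot>\<^bsub>B\<^esub> dB i)"
 proof -
  have "qdiff r i \<odot>\<^bsub>B\<^esub> x = ?d \<odot>\<^bsub>B\<^esub> (uP i \<odot>\<^bsub>B\<^esub> x)" if "x \<in> carrier B" for x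
   using that qdiff_eq(1)[of r i, OF r_pos] by (simp add: B.sm_assoc mult_ac)
  then show ?thesis using dB(1) .
 qed
 finally show "?d \<odot>\<^bsub>B\<^esub> f (dA i) = ?d \<odot>\<^bsub>B\<^esub> (uP i \<odot>\<^bsub>B\<^esub> dB i)" .
 show "?d ~= 0" using r_pos[of i] by simp
qed

lemma unit_coeff: "uP i * (fps_const (2 * rl r l) * fps_X / qdiff r i) = fps_const (rl r l / of_nat (r i))"
proof -
 have q0: "qdiff r i ~= 0" using qdiff_eq[of r i] r_pos[of i] by auto
 have n: "(of_nat (2 * r i) :: complex fps) = fps_const (of_nat (2 * r i))" by (simp only: fps_of_nat)
 have 1: "(fps_const (rl r l / of_nat (r i)) * inverse (uP i)) * qdiff r i =
   (uP i * inverse (uP i)) * (fps_const (rl r l / of_nat (r i)) * of_nat (2 * r i)) * fps_X"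
  using qdiff_eq(1)[of r i] r_pos by (simp only: mult_ac)
 have 2: "fps_const (rl r l / of_nat (r i)) * of_nat (2 * r i) = fps_const (2 * rl r l)"
  unfolding n using r_pos[of i] by simp
 have "fps_const (2 * rl r l) * fps_X = (fps_const (rl r l / of_nat (r i)) * inverse (uP i)) * qdiff r i"
  unfolding 1 2 u by simp
 then have "fps_const (2 * rl r l) * fps_X / qdiff r i = fps_const (rl r l / of_nat (r i)) * inverse (uP i)"
  using q0 by simp
 then show ?thesis using u[of "Xg Pos i"] by (simp add: mult.left_commute)
qed

lemma R1_corr:
 shows "R1_tau a r l (tau_trig a r l) A g \<subseteq> carrier A" "R1_hat a r l B g' \<subseteq> carrier B"
  "x \<in> R1_tau a r l (tau_trig a r l) A g ==> EX y:R1_hat a r l B g'. corr B f x y"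
  "y \<in> R1_hat a r l B g' ==> EX x:R1_tau a r l (tau_trig a r l) A g. corr B f x y"
proof -
 let ?x0 = "%i. nprod A 0 (g (Xg Pos i)) (g (Xg Neg i)) \<ominus>\<^bsub>A\<^esub> dA i"
 let ?y0 = "%i. nprod B 0 (g' (Xg Pos i)) (g' (Xg Neg i)) \<ominus>\<^bsub>B\<^esub> dB i"
 let ?x1 = "%i. nprod A 1 (g (Xg Pos i)) (g (Xg Neg i)) \<ominus>\<^bsub>A\<^esub> fps_const (rl r l / of_nat (r i)) \<odot>\<^bsub>A\<^esub> E_hat r l A g i"
 let ?y1 = "%i. nprod B 1 (g' (Xg Pos i)) (g' (Xg Neg i)) \<ominus>\<^bsub>B\<^esub> (fps_const (2 * rl r l) * fps_X / qdiff r i) \<odot>\<^bsub>B\<^esub> E_hat r l B g' i"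
 have RA: "R1_tau a r l (tau_trig a r l) A g = range ?x0 \<union> range ?x1 \<union> serre a A g"
  unfolding R1_tau_def E_tau_eq by auto
 have RB: "R1_hat a r l B g' = range ?y0 \<union> range ?y1 \<union> serre a B g'"
  unfolding R1_hat_def by auto
 have 0: "corr B f (?x0 i) (?y0 i)" for i
  unfolding corr_def
 proof (intro exI conjI)
  show "uP i * inverse (uP i) = 1" by (rule u)
  show "f (?x0 i) = uP i \<odot>\<^bsub>B\<^esub> ?y0 i"
   using dA dB by (simp add: h.minus h.nprod fg dA_image B.sm_minus_r B.nprod_smult_l del: of_nat_mult)
 qed
 have 1: "corr B f (?x1 i) (?y1 i)" for i
  unfolding corr_def
 proof (intro exI conjI)
  show "uP i * inverse (uP i) = 1" by (rule u)
  show "f (?x1 i) = uP i \<odot>\<^bsub>B\<^esub> ?y1 i"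
   using E_hat_closed
   by (simp add: h.minus h.smult h.nprod fg E_hat_image B.sm_minus_r B.nprod_smult_l B.sm_assoc unit_coeff)
 qed
 show "R1_tau a r l (tau_trig a r l) A g \<subseteq> carrier A" "R1_hat a r l B g' \<subseteq> carrier B"
  unfolding RA RB using dA dB E_hat_closed serre_corr(1,2) by auto
 show "EX y:R1_hat a r l B g'. corr B f x y" if "x \<in> R1_tau a r l (tau_trig a r l) A g"
  using that 0 1 serre_corr(3)[of x a] unfolding RA RB by blast
 show "EX x:R1_tau a r l (tau_trig a r l) A g. corr B f x y" if "y \<in> R1_hat a r l B g'"
  using that 0 1 serre_corr(4)[of y a] unfolding RA RB by blast
qed

end

theorem propositionB1:
  fixes a :: "'i::finite \<Rightarrow> 'i \<Rightarrow> int" and r :: "'i \<Rightarrow> nat" and l :: complex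
    and U U' :: "'v hva" and g g' :: "'i gen \<Rightarrow> 'v"
  assumes "symmetrizable_gcm a r"
    and "universal_va (M_tau a r l (tau_trig a r l)) U g"
    and "universal_va (M_hat a r l) U' g'"
  shows "tau_trig a r l \<in> tau_set r l \<and>
    (let t = tau_trig a r l;
         V = V_tau a r l t U g; gV = gV_tau a r l t U g;
         V' = V_hat a r l U' g'; gV' = gV_hat a r l U' g'
     in \<exists>!f. f \<in> va_iso V V' \<inter> extensional (carrier V) \<and> maps_gens r gV V' gV' f \<and>
          (\<forall>S S'. quantum_va V S \<and> S_on_gens a r l t V gV S \<and>
                  quantum_va V' S' \<and> S_on_gens a r l t V' gV' S' \<longrightarrow>
             f \<in> quantum_va_iso V S V' S')) \<and>
    (\<forall>k>0. l = of_nat k \<longrightarrow>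
      (let t = tau_trig a r l;
           L = L_tau a r k t U g; gL = gL_tau a r k t U g;
           L' = L_hat a r k U' g'; gL' = gL_hat a r k U' g'
       in \<exists>!f. f \<in> va_iso L L' \<inter> extensional (carrier L) \<and> maps_gens r gL L' gL' f \<and>
            (\<forall>S S'. quantum_va L S \<and> S_on_gens a r l t L gL S \<and>
                    quantum_va L' S' \<and> S_on_gens a r l t L' gL' S' \<longrightarrow>
               f \<in> quantum_va_iso L S L' S')))"
proof -
 let ?t = "tau_trig a r l"
 have r: "0 < r i" for i using assms(1) by (simp add: symmetrizable_gcm_def)
 have sym: "ra a r i j = ra a r j i" for i j
 proof -
  have "int (r i) * a i j = int (r j) * a j i" using assms(1) by (simp add: symmetrizable_gcm_def)
  then have "(of_int (int (r i) * a i j) :: complex) = of_int (int (r j) * a j i)" by simp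
  then show ?thesis by (simp add: ra_def)
 qed
 obtain \<phi> where \<phi>: "\<phi> \<in> va_iso U U'" "!!s. \<phi> (g s) = gen_unit r s \<odot>\<^bsub>U'\<^esub> g' s"
  using universal_iso[OF sym r assms(2,3)] by blast
 have U: "va U" "range g \<subseteq> carrier U" "va_generated U (range g)" and U': "va U'" "range g' \<subseteq> carrier U'"
  using assms(2,3) nonlocal_va_va by (auto simp: universal_va_def)
 interpret I: level_iso U U' \<phi> g g' r a l
  unfolding level_iso_def level_iso_axioms_def gens_iso_def gens_iso_axioms_def
  using U U' \<phi> gen_unit_inverse[OF r] assms(1) by (auto simp: va_def)
 have K1: "K1_tau a r l ?t U g = closed_ideal_gen U (R1_tau a r l ?t U g)"
  unfolding K1_tau_def by (rule I.A.hclosure_saturate_ideal_gen[OF I.R1_corr(1)])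
 obtain F where F: "F \<in> extensional (carrier (V_tau a r l ?t U g))" "hsep (V_hat a r l U' g')"
  and Fg: "gens_iso (V_tau a r l ?t U g) (V_hat a r l U' g') F (gV_tau a r l ?t U g) (gV_hat a r l U' g') (gen_unit r)"
 proof (rule I.quotient[OF I.R1_corr], assumption, assumption)
  fix F
  assume "F \<in> extensional (carrier (va_quot U (closed_ideal_gen U (R1_tau a r l ?t U g))))"
   "gens_iso (va_quot U (closed_ideal_gen U (R1_tau a r l ?t U g))) (va_quot U' (closed_ideal_gen U' (R1_hat a r l U' g'))) F
    (%s. closed_ideal_gen U (R1_tau a r l ?t U g) +>\<^bsub>U\<^esub> g s)
    (%s. closed_ideal_gen U' (R1_hat a r l U' g') +>\<^bsub>U'\<^esub> g' s) (gen_unit r)"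
   "hsep (va_quot U' (closed_ideal_gen U' (R1_hat a r l U' g')))"
  then show thesis
   by (intro that[of F]) (simp_all add: V_tau_def V_hat_def K1 K1_hat_def gV_tau_def[abs_def] gV_hat_def[abs_def])
 qed
 interpret J: gens_iso "V_tau a r l ?t U g" "V_hat a r l U' g'" F "gV_tau a r l ?t U g" "gV_hat a r l U' g'" "gen_unit r"
  by (fact Fg)
 \<comment> \<open>Since \<open>l\<close> is \<open>of_nat k\<close>, the algebras \<open>V\<close>
   inside \<open>L_tau\<close> and \<open>L_hat\<close> are the ones already compared, and the
   quotient argument applies a second time.\<close>
 have 2: "unique_iso a r l ?t (L_tau a r k ?t U g) (gL_tau a r k ?t U g) (L_hat a r k U' g') (gL_hat a r k U' g')"
  if l: "l = of_nat k" for k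
 proof -
  let ?V = "V_tau a r l ?t U g" and ?V' = "V_hat a r l U' g'"
  let ?g = "gV_tau a r l ?t U g" and ?g' = "gV_hat a r l U' g'"
  let ?K = "closed_ideal_gen ?V (R2 r k ?V ?g)" and ?K' = "closed_ideal_gen ?V' (R2 r k ?V' ?g')"
  have K2: "K2_tau a r k ?t U g = ?K"
   unfolding K2_tau_def Let_def l[symmetric] by (rule J.A.hclosure_saturate_ideal_gen[OF J.R2_corr(1)])
  have K2': "K2_hat a r k U' g' = ?K'"
   unfolding K2_hat_def Let_def l[symmetric] ..
  have L: "L_tau a r k ?t U g = va_quot ?V ?K" "L_hat a r k U' g' = va_quot ?V' ?K'"
   "gL_tau a r k ?t U g = (%s. ?K +>\<^bsub>?V\<^esub> ?g s)" "gL_hat a r k U' g' = (%s. ?K' +>\<^bsub>?V'\<^esub> ?g' s)"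
   unfolding L_tau_def L_hat_def gL_tau_def[abs_def] gL_hat_def[abs_def] l[symmetric] K2 K2' by (rule refl)+
  show ?thesis
   unfolding L
  proof (rule J.quotient[OF J.R2_corr], assumption, assumption)
   fix H
   assume "H \<in> extensional (carrier (va_quot ?V ?K))"
    "gens_iso (va_quot ?V ?K) (va_quot ?V' ?K') H (%s. ?K +>\<^bsub>?V\<^esub> ?g s) (%s. ?K' +>\<^bsub>?V'\<^esub> ?g' s) (gen_unit r)"
    "hsep (va_quot ?V' ?K')"
   note H = this
   show "unique_iso a r l ?t (va_quot ?V ?K) (%s. ?K +>\<^bsub>?V\<^esub> ?g s) (va_quot ?V' ?K') (%s. ?K' +>\<^bsub>?V'\<^esub> ?g' s)"
    by (rule gens_iso.unique_iso_gens[OF H(2) refl H(1,3)])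
  qed
 qed
 show ?thesis
  unfolding Let_def
  by (intro conjI allI impI tau_trig_in_tau_set J.unique_iso_gens[OF refl F, unfolded unique_iso_def] 2[unfolded unique_iso_def])
qed

end
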